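(* Let $R$ be a commutative Noetherian ring with $1$, $I$ a proper ideal of $R$, $M$ a finitely generated $R$-module and $N$ a weakly Laskerian $R$-module. Suppose the pair $M,N$ is $I$-cohomologically injective. Then the following assertions hold: (i) If $\mathrm{cd}_I(M,N)=1$, then $H^1_I(M,N)$ is $I$-weakly cofinite. (ii) If $\mathrm{cd}_I(M,N)=2$, then $H^1_I(M,N)$ is $I$-weakly cofinite if and only if $H^2_I(M,N)$ is $I$-weakly cofinite. (iii) Suppose that $\mathrm{cd}_I(M,N)=3$ and that $i,j,k$ are three different indices in $\{1,2,3\}$. If $H^i_I(M,N)$ is $I$-weakly cofinite, then $H^j_I(M,N)$ is $I$-weakly cofinite if and only if $H^k_I(M,N)$ is $I$-weakly cofinite.
   Context: An $R$-module $W$ is weakly Laskerian if $\mathrm{Ass}_R(W/U)$ is finite for every $R$-submodule $U$ of $W$. An $R$-module $W$ is $I$-weakly cofinite if $\mathrm{Supp}_R W\subset V(I)=\{P\in\mathrm{Spec}\,R\mid I\subset P\}$ and $\mathrm{Ext}^i_R(R/I,W)$ is weakly Laskerian for all $i\ge 0$. The generalized local cohomology modules are $H^i_I(M,N)=\varinjlim_n \mathrm{Ext}^i_R(M/I^nM,N)$, where the direct system is induced by the natural surjections $M/I^{n+1}M\to M/I^nM$; $H^i_I(N)=H^i_I(R,N)$ is ordinary local cohomology. For $M$ finitely generated, the pair $M,N$ is $I$-cohomologically injective if there is some injective resolution $E^\bullet$ of $N$ such that the module $H^0_I(\mathrm{Hom}_R(M,E^i))$ is injective for every $E^i$ appearing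 in $E^\bullet$. The (generalized) cohomological dimension is $\mathrm{cd}_I(M,N)=\sup\{i\ge 0\mid H^i_I(M,N)\neq 0\}$. *)

theory Defs
  imports
    "HOL-Algebra.Ring_Divisibility"
    "HOL-Algebra.Ideal_Product"
    "HOL-Algebra.Module"
    "HOL-Library.Extended_Real"
begin

text \<open>
  Modules are those of \<^theory>\<open>HOL-Algebra.Module\<close>: records with an explicit carrier. The record
  extends the ring record, so it has fields \<open>mult\<close> and \<open>one\<close>, which play no role for a module and
  are left \<^const>\<open>undefined\<close> below. Homomorphisms are extensional, i.e. \<^const>\<open>undefined\<close>
  outside the carrier of the source, so that equality of functions is equality of homomorphisms.
\<close>

definition reg_module :: "('a, 'r) ring_scheme \<Rightarrow> ('a, 'a) module" where
  "reg_module R = \<lparr>carrier = carrier R, mult = mult R, one = one R, zero = zero R, add = add R,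
     smult = mult R\<rparr>"

definition mod_span :: "('a, 'r) ring_scheme \<Rightarrow> ('a, 'b) module \<Rightarrow> 'b set \<Rightarrow> 'b set" where
  "mod_span R M S = \<Inter>{U. submodule U R M \<and> S \<subseteq> U}"

definition fin_gen :: "('a, 'r) ring_scheme \<Rightarrow> ('a, 'b) module \<Rightarrow> bool" where
  "fin_gen R M \<longleftrightarrow> (\<exists>S. finite S \<and> S \<subseteq> carrier M \<and> mod_span R M S = carrier M)"

definition quot_module :: "('a, 'b) module \<Rightarrow> 'b set \<Rightarrow> ('a, 'b set) module" where
  "quot_module M U = \<lparr>carrier = a_rcosets\<^bsub>M\<^esub> U, mult = undefined, one = undefined, zero = U,
     add = set_add M, smult = (\<lambda>a X. \<Union>x\<in>X. U +>\<^bsub>M\<^esub> (a \<odot>\<^bsub>M\<^esub> x))\<rparr>"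

text \<open>The map into \<open>quot_module M U\<close> induced on cosets by a map \<open>h\<close> into \<open>M\<close>.\<close>

definition coset_map :: "('a, 'b) module \<Rightarrow> 'b set \<Rightarrow> ('c \<Rightarrow> 'b) \<Rightarrow> 'c set \<Rightarrow> 'b set" where
  "coset_map M U h X = (\<Union>x\<in>X. U +>\<^bsub>M\<^esub> h x)"

definition mod_hom :: "('a, 'r) ring_scheme \<Rightarrow> ('a, 'b) module \<Rightarrow> ('a, 'c) module \<Rightarrow> ('b \<Rightarrow> 'c) set"
  where
  "mod_hom R A B = {f \<in> carrier A \<rightarrow>\<^sub>E carrier B.
     (\<forall>x\<in>carrier A. \<forall>y\<in>carrier A. f (x \<oplus>\<^bsub>A\<^esub> y) = f x \<oplus>\<^bsub>B\<^esub> f y) \<and>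
     (\<forall>a\<in>carrier R. \<forall>x\<in>carrier A. f (a \<odot>\<^bsub>A\<^esub> x) = a \<odot>\<^bsub>B\<^esub> f x)}"

definition hom_module ::
  "('a, 'r) ring_scheme \<Rightarrow> ('a, 'b) module \<Rightarrow> ('a, 'c) module \<Rightarrow> ('a, 'b \<Rightarrow> 'c) module" where
  "hom_module R A B = \<lparr>carrier = mod_hom R A B, mult = undefined, one = undefined,
     zero = (\<lambda>x\<in>carrier A. \<zero>\<^bsub>B\<^esub>),
     add = (\<lambda>f g. \<lambda>x\<in>carrier A. f x \<oplus>\<^bsub>B\<^esub> g x),
     smult = (\<lambda>a f. \<lambda>x\<in>carrier A. a \<odot>\<^bsub>B\<^esub> f x)\<rparr>"

section \<open>Associated primes, support, weakly Laskerian modules\<close>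

definition mod_ann :: "('a, 'r) ring_scheme \<Rightarrow> ('a, 'b) module \<Rightarrow> 'b \<Rightarrow> 'a set" where
  "mod_ann R M x = {a \<in> carrier R. a \<odot>\<^bsub>M\<^esub> x = \<zero>\<^bsub>M\<^esub>}"

definition Ass :: "('a, 'r) ring_scheme \<Rightarrow> ('a, 'b) module \<Rightarrow> 'a set set" where
  "Ass R M = {P. primeideal P R \<and> (\<exists>x\<in>carrier M. P = mod_ann R M x)}"

definition weakly_Laskerian :: "('a, 'r) ring_scheme \<Rightarrow> ('a, 'b) module \<Rightarrow> bool" where
  "weakly_Laskerian R W \<longleftrightarrow>
     Module.module R W \<and> (\<forall>U. submodule U R W \<longrightarrow> finite (Ass R (quot_module W U)))"

definition loc_rel :: "('a, 'r) ring_scheme \<Rightarrow> ('a, 'b) module \<Rightarrow> 'a set \<Rightarrow> (('b \<times> 'a) \<times> 'b \<times> 'a) set"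
  where
  "loc_rel R M P = {((x, s), (y, t)). x \<in> carrier M \<and> y \<in> carrier M \<and>
     s \<in> carrier R - P \<and> t \<in> carrier R - P \<and>
     (\<exists>u\<in>carrier R - P. u \<odot>\<^bsub>M\<^esub> (t \<odot>\<^bsub>M\<^esub> x) = u \<odot>\<^bsub>M\<^esub> (s \<odot>\<^bsub>M\<^esub> y))}"

text \<open>The localization at \<open>P\<close>, as a module over the original ring; the class of \<open>(x, s)\<close> is \<open>x/s\<close>.\<close>

definition loc_module ::
  "('a, 'r) ring_scheme \<Rightarrow> ('a, 'b) module \<Rightarrow> 'a set \<Rightarrow> ('a, ('b \<times> 'a) set) module" where
  "loc_module R M P = \<lparr>carrier = (carrier M \<times> (carrier R - P)) // loc_rel R M P,
     mult = undefined, one = undefined,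
     zero = loc_rel R M P `` {(\<zero>\<^bsub>M\<^esub>, \<one>\<^bsub>R\<^esub>)},
     add = (\<lambda>X Y. \<Union>(x, s)\<in>X. \<Union>(y, t)\<in>Y.
       loc_rel R M P `` {(t \<odot>\<^bsub>M\<^esub> x \<oplus>\<^bsub>M\<^esub> s \<odot>\<^bsub>M\<^esub> y, s \<otimes>\<^bsub>R\<^esub> t)}),
     smult = (\<lambda>a X. \<Union>(x, s)\<in>X. loc_rel R M P `` {(a \<odot>\<^bsub>M\<^esub> x, s)})\<rparr>"

definition Supp :: "('a, 'r) ring_scheme \<Rightarrow> ('a, 'b) module \<Rightarrow> 'a set set" where
  "Supp R M = {P. primeideal P R \<and> carrier (loc_module R M P) \<noteq> {\<zero>\<^bsub>loc_module R M P\<^esub>}}"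

definition Vset :: "('a, 'r) ring_scheme \<Rightarrow> 'a set \<Rightarrow> 'a set set" where
  "Vset R I = {P. primeideal P R \<and> I \<subseteq> P}"

section \<open>Free modules and the standard free resolution\<close>

definition free_module :: "('a, 'r) ring_scheme \<Rightarrow> 'b set \<Rightarrow> ('a, 'b \<Rightarrow> 'a) module" where
  "free_module R B = \<lparr>carrier = {c. (\<forall>b. c b \<in> carrier R) \<and> (\<forall>b. b \<notin> B \<longrightarrow> c b = \<zero>\<^bsub>R\<^esub>) \<and>
       finite {b. c b \<noteq> \<zero>\<^bsub>R\<^esub>}},
     mult = undefined, one = undefined, zero = (\<lambda>b. \<zero>\<^bsub>R\<^esub>),
     add = (\<lambda>c d b. c b \<oplus>\<^bsub>R\<^esub> d b), smult = (\<lambda>a c b. a \<otimes>\<^bsub>R\<^esub> c b)\<rparr>"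

definition free_unit :: "('a, 'r) ring_scheme \<Rightarrow> 'b \<Rightarrow> 'b \<Rightarrow> 'a" where
  "free_unit R b = (\<lambda>v. if v = b then \<one>\<^bsub>R\<^esub> else \<zero>\<^bsub>R\<^esub>)"

text \<open>The linear map from a free module to \<open>Y\<close> that sends each basis element \<open>b\<close> to \<open>g b\<close>.\<close>

definition lin_ext ::
  "('a, 'r) ring_scheme \<Rightarrow> 'b set \<Rightarrow> ('a, 'c) module \<Rightarrow> ('b \<Rightarrow> 'c) \<Rightarrow> ('b \<Rightarrow> 'a) \<Rightarrow> 'c" where
  "lin_ext R B Y g = (\<lambda>c\<in>carrier (free_module R B).
     (\<Oplus>\<^bsub>Y\<^esub>b\<in>{b. c b \<noteq> \<zero>\<^bsub>R\<^esub>}. c b \<odot>\<^bsub>Y\<^esub> g b))"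

text \<open>
  The standard free resolution \<open>\<dots> \<rightarrow> F 1 \<rightarrow> F 0 \<rightarrow> X\<close>: \<open>F 0\<close> is free on the elements of \<open>X\<close>, and
  \<open>F (n + 1)\<close> is free on the formal linear combinations \<open>\<Sum> a\<^sub>i u\<^sub>i\<close> of basis elements of \<open>F n\<close>
  whose value lies in the kernel of the map leaving \<open>F n\<close>; such a combination is sent to its value.
  The type below contains the basis elements of all degrees: \<open>Gen x\<close> for \<open>x \<in> X\<close>, and
  \<open>Rel [(a\<^sub>1, u\<^sub>1), \<dots>]\<close> for the combinations. In this form the resolution is strictly functorial in \<open>X\<close>:
  a map \<open>f\<close> acts on basis elements by \<open>map_syz id f\<close>.
\<close>

datatype ('a, 'x) syz = Gen (gen_of: 'x) | Rel (rel_of: "('a \<times> ('a, 'x) syz) list")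

definition comb_value :: "('a, 'r) ring_scheme \<Rightarrow> ('a \<times> 'b) list \<Rightarrow> 'b \<Rightarrow> 'a" where
  "comb_value R l = (\<lambda>v. foldr (\<lambda>(a, u) s. (if u = v then a \<oplus>\<^bsub>R\<^esub> s else s)) l \<zero>\<^bsub>R\<^esub>)"

fun res_basis :: "('a, 'r) ring_scheme \<Rightarrow> ('a, 'x) module \<Rightarrow> nat \<Rightarrow> ('a, 'x) syz set" where
  "res_basis R X 0 = Gen ` carrier X"
| "res_basis R X (Suc 0) = {Rel l | l. set l \<subseteq> carrier R \<times> res_basis R X 0 \<and>
     lin_ext R (res_basis R X 0) X gen_of (comb_value R l) = \<zero>\<^bsub>X\<^esub>}"
| "res_basis R X (Suc (Suc n)) = {Rel l | l. set l \<subseteq> carrier R \<times> res_basis R X (Suc n) \<and>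
     lin_ext R (res_basis R X (Suc n)) (free_module R (res_basis R X n))
       (\<lambda>b. comb_value R (rel_of b)) (comb_value R l) = \<zero>\<^bsub>free_module R (res_basis R X n)\<^esub>}"

definition res_module ::
  "('a, 'r) ring_scheme \<Rightarrow> ('a, 'x) module \<Rightarrow> nat \<Rightarrow> ('a, ('a, 'x) syz \<Rightarrow> 'a) module" where
  "res_module R X n = free_module R (res_basis R X n)"

definition res_aug :: "('a, 'r) ring_scheme \<Rightarrow> ('a, 'x) module \<Rightarrow> (('a, 'x) syz \<Rightarrow> 'a) \<Rightarrow> 'x" where
  "res_aug R X = lin_ext R (res_basis R X 0) X gen_of"

text \<open>\<open>res_diff R X n\<close> is the differential from degree \<open>n + 1\<close> to degree \<open>n\<close>.\<close>

definition res_diff ::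
  "('a, 'r) ring_scheme \<Rightarrow> ('a, 'x) module \<Rightarrow> nat \<Rightarrow> (('a, 'x) syz \<Rightarrow> 'a) \<Rightarrow> ('a, 'x) syz \<Rightarrow> 'a" where
  "res_diff R X n =
     lin_ext R (res_basis R X (Suc n)) (res_module R X n) (\<lambda>b. comb_value R (rel_of b))"

definition res_map ::
  "('a, 'r) ring_scheme \<Rightarrow> ('a, 'x) module \<Rightarrow> ('a, 'y) module \<Rightarrow> ('x \<Rightarrow> 'y) \<Rightarrow> nat \<Rightarrow>
   (('a, 'x) syz \<Rightarrow> 'a) \<Rightarrow> ('a, 'y) syz \<Rightarrow> 'a" where
  "res_map R X Y f n =
     lin_ext R (res_basis R X n) (res_module R Y n) (\<lambda>b. free_unit R (map_syz id f b))"

section \<open>Ext\<close>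

definition cocycles ::
  "(nat \<Rightarrow> ('a, 'b) module) \<Rightarrow> (nat \<Rightarrow> 'b \<Rightarrow> 'b) \<Rightarrow> nat \<Rightarrow> ('a, 'b) module" where
  "cocycles C d n = (C n)\<lparr>carrier := {x \<in> carrier (C n). d n x = \<zero>\<^bsub>C (Suc n)\<^esub>}\<rparr>"

definition coboundaries ::
  "(nat \<Rightarrow> ('a, 'b) module) \<Rightarrow> (nat \<Rightarrow> 'b \<Rightarrow> 'b) \<Rightarrow> nat \<Rightarrow> 'b set" where
  "coboundaries C d n = (case n of 0 \<Rightarrow> {\<zero>\<^bsub>C 0\<^esub>} | Suc m \<Rightarrow> d m ` carrier (C m))"

definition cohomology ::
  "(nat \<Rightarrow> ('a, 'b) module) \<Rightarrow> (nat \<Rightarrow> 'b \<Rightarrow> 'b) \<Rightarrow> nat \<Rightarrow> ('a, 'b set) module" where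
  "cohomology C d n = quot_module (cocycles C d n) (coboundaries C d n)"

definition ext_complex ::
  "('a, 'r) ring_scheme \<Rightarrow> ('a, 'x) module \<Rightarrow> ('a, 'y) module \<Rightarrow> nat \<Rightarrow>
   ('a, (('a, 'x) syz \<Rightarrow> 'a) \<Rightarrow> 'y) module" where
  "ext_complex R X Y n = hom_module R (res_module R X n) Y"

definition ext_diff ::
  "('a, 'r) ring_scheme \<Rightarrow> ('a, 'x) module \<Rightarrow> nat \<Rightarrow>
   ((('a, 'x) syz \<Rightarrow> 'a) \<Rightarrow> 'y) \<Rightarrow> (('a, 'x) syz \<Rightarrow> 'a) \<Rightarrow> 'y" where
  "ext_diff R X n \<phi> = compose (carrier (res_module R X (Suc n))) \<phi> (res_diff R X n)"

definition Ext ::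
  "('a, 'r) ring_scheme \<Rightarrow> nat \<Rightarrow> ('a, 'x) module \<Rightarrow> ('a, 'y) module \<Rightarrow>
   ('a, ((('a, 'x) syz \<Rightarrow> 'a) \<Rightarrow> 'y) set) module" where
  "Ext R i X Y = cohomology (ext_complex R X Y) (ext_diff R X) i"

text \<open>The map from \<open>Ext R i X' Y\<close> to \<open>Ext R i X Y\<close> induced by a homomorphism \<open>f\<close> from \<open>X\<close> to \<open>X'\<close>.\<close>

definition Ext_map ::
  "('a, 'r) ring_scheme \<Rightarrow> nat \<Rightarrow> ('a, 'x) module \<Rightarrow> ('a, 'z) module \<Rightarrow> ('a, 'y) module \<Rightarrow> ('x \<Rightarrow> 'z) \<Rightarrow>
   ((('a, 'z) syz \<Rightarrow> 'a) \<Rightarrow> 'y) set \<Rightarrow> ((('a, 'x) syz \<Rightarrow> 'a) \<Rightarrow> 'y) set" where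
  "Ext_map R i X X' Y f =
     coset_map (cocycles (ext_complex R X Y) (ext_diff R X) i)
       (coboundaries (ext_complex R X Y) (ext_diff R X) i)
       (\<lambda>\<phi>. compose (carrier (res_module R X i)) \<phi> (res_map R X X' f i))"

section \<open>Sequential direct limits and generalized local cohomology\<close>

primrec dl_trans :: "(nat \<Rightarrow> 'b \<Rightarrow> 'b) \<Rightarrow> nat \<Rightarrow> nat \<Rightarrow> 'b \<Rightarrow> 'b" where
  "dl_trans \<phi> n 0 x = x"
| "dl_trans \<phi> n (Suc j) x = \<phi> (n + j) (dl_trans \<phi> n j x)"

definition dl_rel ::
  "(nat \<Rightarrow> ('a, 'b) module) \<Rightarrow> (nat \<Rightarrow> 'b \<Rightarrow> 'b) \<Rightarrow> ((nat \<times> 'b) \<times> nat \<times> 'b) set" where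
  "dl_rel G \<phi> = {((n, x), (m, y)). x \<in> carrier (G n) \<and> y \<in> carrier (G m) \<and>
     (\<exists>i j. n + i = m + j \<and> dl_trans \<phi> n i x = dl_trans \<phi> m j y)}"

text \<open>
  The colimit of \<open>G 0 \<rightarrow> G 1 \<rightarrow> G 2 \<rightarrow> \<dots>\<close> with transition maps \<open>\<phi> n\<close> from \<open>G n\<close> to \<open>G (n + 1)\<close>.
  For the sum, any two classes have representatives in a common degree.
\<close>

definition dir_lim ::
  "(nat \<Rightarrow> ('a, 'b) module) \<Rightarrow> (nat \<Rightarrow> 'b \<Rightarrow> 'b) \<Rightarrow> ('a, (nat \<times> 'b) set) module" where
  "dir_lim G \<phi> = \<lparr>carrier = (SIGMA n:UNIV. carrier (G n)) // dl_rel G \<phi>,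
     mult = undefined, one = undefined,
     zero = dl_rel G \<phi> `` {(0, \<zero>\<^bsub>G 0\<^esub>)},
     add = (\<lambda>X Y. \<Union>{dl_rel G \<phi> `` {(n, x \<oplus>\<^bsub>G n\<^esub> y)} | n x y. (n, x) \<in> X \<and> (n, y) \<in> Y}),
     smult = (\<lambda>a X. \<Union>(n, x)\<in>X. dl_rel G \<phi> `` {(n, a \<odot>\<^bsub>G n\<^esub> x)})\<rparr>"

primrec ideal_pow :: "('a, 'r) ring_scheme \<Rightarrow> 'a set \<Rightarrow> nat \<Rightarrow> 'a set" where
  "ideal_pow R I 0 = carrier R"
| "ideal_pow R I (Suc n) = ideal_prod R (ideal_pow R I n) I"

definition ideal_smult :: "('a, 'r) ring_scheme \<Rightarrow> 'a set \<Rightarrow> ('a, 'b) module \<Rightarrow> 'b set" where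
  "ideal_smult R J M = mod_span R M {a \<odot>\<^bsub>M\<^esub> x | a x. a \<in> J \<and> x \<in> carrier M}"

definition adic_quot ::
  "('a, 'r) ring_scheme \<Rightarrow> 'a set \<Rightarrow> ('a, 'b) module \<Rightarrow> nat \<Rightarrow> ('a, 'b set) module" where
  "adic_quot R I M n = quot_module M (ideal_smult R (ideal_pow R I n) M)"

text \<open>The natural surjection \<open>M/I\<^sup>n\<^sup>+\<^sup>1M \<rightarrow> M/I\<^sup>nM\<close>.\<close>

definition adic_proj ::
  "('a, 'r) ring_scheme \<Rightarrow> 'a set \<Rightarrow> ('a, 'b) module \<Rightarrow> nat \<Rightarrow> 'b set \<Rightarrow> 'b set" where
  "adic_proj R I M n = coset_map M (ideal_smult R (ideal_pow R I n) M) id"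

definition gen_loc_coh ::
  "('a, 'r) ring_scheme \<Rightarrow> 'a set \<Rightarrow> nat \<Rightarrow> ('a, 'm) module \<Rightarrow> ('a, 'n) module \<Rightarrow>
   ('a, (nat \<times> ((('a, 'm set) syz \<Rightarrow> 'a) \<Rightarrow> 'n) set) set) module" where
  "gen_loc_coh R I i M N =
     dir_lim (\<lambda>n. Ext R i (adic_quot R I M n) N)
       (\<lambda>n. Ext_map R i (adic_quot R I M (Suc n)) (adic_quot R I M n) N (adic_proj R I M n))"

abbreviation loc_coh ::
  "('a, 'r) ring_scheme \<Rightarrow> 'a set \<Rightarrow> nat \<Rightarrow> ('a, 'n) module \<Rightarrow>
   ('a, (nat \<times> ((('a, 'a set) syz \<Rightarrow> 'a) \<Rightarrow> 'n) set) set) module" where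
  "loc_coh R I i N \<equiv> gen_loc_coh R I i (reg_module R) N"

text \<open>A supremum in the extended reals; it is \<open>-\<infinity>\<close> if all the modules vanish.\<close>

definition gen_cd ::
  "('a, 'r) ring_scheme \<Rightarrow> 'a set \<Rightarrow> ('a, 'm) module \<Rightarrow> ('a, 'n) module \<Rightarrow> ereal" where
  "gen_cd R I M N =
     (SUP i\<in>{i. carrier (gen_loc_coh R I i M N) \<noteq> {\<zero>\<^bsub>gen_loc_coh R I i M N\<^esub>}}. ereal (real i))"

definition weakly_cofinite :: "('a, 'r) ring_scheme \<Rightarrow> 'a set \<Rightarrow> ('a, 'b) module \<Rightarrow> bool" where
  "weakly_cofinite R I W \<longleftrightarrow> Module.module R W \<and> Supp R W \<subseteq> Vset R I \<and>
     (\<forall>i. weakly_Laskerian R (Ext R i (quot_module (reg_module R) I) W))"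

section \<open>Injective resolutions\<close>

text \<open>
  A definition cannot quantify over modules on all types. The extension property is therefore
  demanded for all pairs of modules carried by subsets of \<open>('a + 'e) list\<close>, an infinite type that
  contains copies of the ring and of the module under consideration. No generality is lost:
  the inclusions of the ideals into the ring are, up to isomorphism, among these pairs, so Baer's
  criterion gives the extension property for modules on every type.
\<close>

definition injective_module :: "('a, 'r) ring_scheme \<Rightarrow> ('a, 'e) module \<Rightarrow> bool" where
  "injective_module R E \<longleftrightarrow> Module.module R E \<and>
     (\<forall>(A :: ('a, ('a + 'e) list) module) (B :: ('a, ('a + 'e) list) module) f g.
        Module.module R A \<and> Module.module R B \<and> f \<in> mod_hom R A B \<and> inj_on f (carrier A) \<and>
        g \<in> mod_hom R A E \<longrightarrow>
        (\<exists>h\<in>mod_hom R B E. \<forall>x\<in>carrier A. h (f x) = g x))"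

definition injective_resolution ::
  "('a, 'r) ring_scheme \<Rightarrow> ('a, 'n) module \<Rightarrow> (nat \<Rightarrow> ('a, 'e) module) \<Rightarrow> (nat \<Rightarrow> 'e \<Rightarrow> 'e) \<Rightarrow>
   ('n \<Rightarrow> 'e) \<Rightarrow> bool" where
  "injective_resolution R N E d \<epsilon> \<longleftrightarrow>
     (\<forall>i. injective_module R (E i)) \<and>
     \<epsilon> \<in> mod_hom R N (E 0) \<and> (\<forall>i. d i \<in> mod_hom R (E i) (E (Suc i))) \<and>
     inj_on \<epsilon> (carrier N) \<and>
     \<epsilon> ` carrier N = {x \<in> carrier (E 0). d 0 x = \<zero>\<^bsub>E 1\<^esub>} \<and>
     (\<forall>i. d i ` carrier (E i) = {x \<in> carrier (E (Suc i)). d (Suc i) x = \<zero>\<^bsub>E (Suc (Suc i))\<^esub>})"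

text \<open>
  The first argument is the type that carries the terms of the resolution; it cannot be bound by
  the existential quantifier.
\<close>

definition coh_injective_pair ::
  "'e itself \<Rightarrow> ('a, 'r) ring_scheme \<Rightarrow> 'a set \<Rightarrow> ('a, 'm) module \<Rightarrow> ('a, 'n) module \<Rightarrow> bool" where
  "coh_injective_pair _ R I M N \<longleftrightarrow>
     (\<exists>(E :: nat \<Rightarrow> ('a, 'e) module) d \<epsilon>. injective_resolution R N E d \<epsilon> \<and>
        (\<forall>i. injective_module R (loc_coh R I 0 (hom_module R M (E i)))))"

end

theory Submission
  imports Defs
begin

text \<open>
  Let \<open>E\<close> be the injective resolution of \<open>N\<close>, and let \<open>T i\<close> consist of the homomorphisms from \<open>M\<close>
  to \<open>E i\<close> that vanish on some \<open>I^n M\<close>; this is the \<open>I\<close>-power torsion of \<open>Hom (M, E i)\<close>, i.e.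
  \<open>H^0_I (Hom (M, E i))\<close> (\<open>loc_coh_zero_iso\<close>). Since \<open>Ext i (M/I^n M, N)\<close> is also the cohomology
  of \<open>Hom (M/I^n M, E)\<close> (\<open>balance\<close> and the lemmas on it) and \<open>T\<close> is the direct limit of these
  complexes, \<open>H^i_I (M, N)\<close> is the cohomology \<open>H i\<close> of \<open>T\<close> (\<open>gen_loc_coh_iso\<close>). The hypothesis on
  the pair says that \<open>T\<close> is a complex of injective modules, and Baer's criterion (\<open>baer_extend\<close>)
  makes this injectivity available for modules on all types.

  Let \<open>Z i\<close> and \<open>B i\<close> be the cocycles and coboundaries of \<open>T\<close>. Because \<open>Ext p (R/I, T i)\<close> is zero
  for \<open>p > 0\<close>, \<open>Ext p (R/I, B (i + 1))\<close> and \<open>Ext (p + 1) (R/I, Z i)\<close> are isomorphic for \<open>p > 0\<close>;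
  for \<open>p = 0\<close> the first maps onto the second, and the kernel comes from the \<open>I\<close>-torsion of \<open>T\<close>.
  This torsion is the complex \<open>Hom (M/IM, E)\<close>, and its cohomology is weakly Laskerian, since
  \<open>M/IM\<close> is finitely generated and \<open>N\<close> is weakly Laskerian (\<open>wl_Hom_cohomology\<close>). The sequences
  \<open>0 \<rightarrow> B i \<rightarrow> Z i \<rightarrow> H i \<rightarrow> 0\<close> then give: if \<open>Ext p (R/I, H i)\<close> is weakly Laskerian for all \<open>p\<close> and all
  \<open>i \<noteq> k\<close>, it is so for \<open>i = k\<close>. To the right of \<open>k\<close> one treats the modules \<open>Z i\<close> by induction on
  \<open>p\<close>, to the left of \<open>k\<close> the modules \<open>B i\<close> by induction on \<open>i\<close> (\<open>good_Z_right\<close>, \<open>good_B_left\<close>,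
  \<open>good_H_last\<close>). The support of \<open>H i\<close> lies in \<open>V(I)\<close>, because every element of \<open>H i\<close> is killed by
  a power of \<open>I\<close> (\<open>Supp_pow_torsion\<close>).

  The module \<open>H 0\<close> is always weakly cofinite: it is isomorphic to a submodule of \<open>Hom (M, N)\<close>,
  which is contained in a finite power of \<open>N\<close>, so \<open>H 0\<close> is weakly Laskerian, and Ext of a finitely
  generated module into a weakly Laskerian one is weakly Laskerian (\<open>Ext_weakly_Laskerian\<close>). The
  modules above the cohomological dimension are zero. Thus among the modules of degrees \<open>1, \<dots>, cd\<close>
  all but one weakly cofinite implies all weakly cofinite (\<open>weakly_cofinite_last\<close>); the three
  assertions are the cases of dimension \<open>1\<close>, \<open>2\<close> and \<open>3\<close>.

  Weakly Laskerian modules form a Serre class. This is proved as \<open>wl_exact\<close> for subquotients \<open>Z/B\<close>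
  that are given by pairs of submodules, and for linear relations in place of maps. Connecting
  homomorphisms, dimension shifts and the comparison of resolutions are then statements about
  cochains, and no map between cohomology modules has to be defined for them.
\<close>

section \<open>Submodules, homomorphisms and quotients\<close>

lemma submodule_intro:
  assumes "Module.module R M" "H \<subseteq> carrier M" "\<zero>\<^bsub>M\<^esub> \<in> H"
    and "\<And>a b. a \<in> H \<Longrightarrow> b \<in> H \<Longrightarrow> a \<oplus>\<^bsub>M\<^esub> b \<in> H"
    and "\<And>a x. a \<in> carrier R \<Longrightarrow> x \<in> H \<Longrightarrow> a \<odot>\<^bsub>M\<^esub> x \<in> H"
  shows "submodule H R M"
proof -
  interpret M: Module.module R M by fact
  show ?thesis
  proof (rule M.submoduleI)
    fix a assume "a \<in> H"
    then have "\<ominus>\<^bsub>M\<^esub> a = (\<ominus>\<^bsub>R\<^esub> \<one>\<^bsub>R\<^esub>) \<odot>\<^bsub>M\<^esub> a"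
      using assms(2) by (simp add: M.smult_l_minus subset_iff)
    then show "\<ominus>\<^bsub>M\<^esub> a \<in> H" using assms(5)[of "\<ominus>\<^bsub>R\<^esub> \<one>\<^bsub>R\<^esub>" a] \<open>a \<in> H\<close> by simp
  qed (use assms in auto)
qed

lemma submodule_subset: "submodule H R M \<Longrightarrow> H \<subseteq> carrier M"
  using subgroup.subset[OF submodule.axioms(1), of H R M] by simp

lemma submodule_mem: "submodule H R M \<Longrightarrow> x \<in> H \<Longrightarrow> x \<in> carrier M"
  using submodule_subset by blast

lemma submodule_zero: "submodule H R M \<Longrightarrow> \<zero>\<^bsub>M\<^esub> \<in> H"
  using subgroup.one_closed[OF submodule.axioms(1), of H R M] by simp

lemma submodule_add: "submodule H R M \<Longrightarrow> x \<in> H \<Longrightarrow> y \<in> H \<Longrightarrow> x \<oplus>\<^bsub>M\<^esub> y \<in> H"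
  using subgroup.m_closed[OF submodule.axioms(1), of H R M] by simp

lemma submodule_smult: "submodule H R M \<Longrightarrow> a \<in> carrier R \<Longrightarrow> x \<in> H \<Longrightarrow> a \<odot>\<^bsub>M\<^esub> x \<in> H"
  by (rule submodule.smult_closed)

lemma submodule_module: "submodule H R M \<Longrightarrow> Module.module R M \<Longrightarrow> Module.module R (M\<lparr>carrier := H\<rparr>)"
  by (rule submodule.submodule_is_module)

lemma submodule_self: "Module.module R M \<Longrightarrow> submodule (carrier M) R M"
  by (rule Module.module.carrier_is_submodule)

lemma submodule_zero_set: assumes "Module.module R M" shows "submodule {\<zero>\<^bsub>M\<^esub>} R M"
proof -
  interpret M: Module.module R M by fact
  show ?thesis by (rule submodule_intro) (auto intro: assms)
qed

lemma submodule_restrict: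
  assumes "submodule H R M" "submodule K R M" "H \<subseteq> K" "Module.module R M"
  shows "submodule H R (M\<lparr>carrier := K\<rparr>)"
  by (rule submodule_intro)
    (use assms in \<open>auto simp: submodule_zero submodule_add submodule_smult intro: submodule_module\<close>)

lemma submodule_unrestrict:
  assumes "submodule H R (M\<lparr>carrier := K\<rparr>)" "submodule K R M" "Module.module R M"
  shows "submodule H R M"
  by (rule submodule_intro)
    (use assms submodule_subset[OF assms(1)] submodule_subset[OF assms(2)] submodule_zero[OF assms(1)]
      submodule_add[OF assms(1)] submodule_smult[OF assms(1)] in auto)

text \<open>
  A difference built from the addition and the scalar multiplication alone: unlike the additive
  inverse of the library it does not change when the carrier is shrunk to a submodule.
\<close>

definition mdiff :: "('a, 'r) ring_scheme \<Rightarrow> ('a, 'b) module \<Rightarrow> 'b \<Rightarrow> 'b \<Rightarrow> 'b" where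
  "mdiff R M x y = x \<oplus>\<^bsub>M\<^esub> (\<ominus>\<^bsub>R\<^esub> \<one>\<^bsub>R\<^esub>) \<odot>\<^bsub>M\<^esub> y"

lemma mdiff_carrier_update [simp]: "mdiff R (M\<lparr>carrier := H\<rparr>) = mdiff R M"
  by (simp add: mdiff_def fun_eq_iff)

lemma mdiff_eq:
  assumes "Module.module R M" "x \<in> carrier M" "y \<in> carrier M"
  shows "mdiff R M x y = x \<ominus>\<^bsub>M\<^esub> y"
proof -
  interpret M: Module.module R M by fact
  show ?thesis using assms by (simp add: mdiff_def a_minus_def M.smult_l_minus)
qed

lemma mdiff_closed:
  assumes "Module.module R M" "x \<in> carrier M" "y \<in> carrier M"
  shows "mdiff R M x y \<in> carrier M"
proof -
  interpret M: Module.module R M by fact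
  show ?thesis using assms by (simp add: mdiff_def)
qed

lemma mdiff_self:
  assumes "Module.module R M" "x \<in> carrier M"
  shows "mdiff R M x x = \<zero>\<^bsub>M\<^esub>"
proof -
  interpret M: Module.module R M by fact
  show ?thesis using assms by (simp add: mdiff_eq[OF assms(1)] a_minus_def M.r_neg)
qed

lemma mdiff_zero:
  assumes "Module.module R M" "x \<in> carrier M"
  shows "mdiff R M x \<zero>\<^bsub>M\<^esub> = x"
proof -
  interpret M: Module.module R M by fact
  show ?thesis using assms by (simp add: mdiff_def)
qed

lemma mdiff_add:
  assumes "Module.module R M" "x \<in> carrier M" "y \<in> carrier M"
  shows "mdiff R M x y \<oplus>\<^bsub>M\<^esub> y = x" "y \<oplus>\<^bsub>M\<^esub> mdiff R M x y = x" "mdiff R M (x \<oplus>\<^bsub>M\<^esub> y) y = x"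
    "mdiff R M (x \<oplus>\<^bsub>M\<^esub> y) x = y"
proof -
  interpret M: Module.module R M by fact
  show "mdiff R M x y \<oplus>\<^bsub>M\<^esub> y = x"
    using assms by (simp add: mdiff_eq[OF assms(1)] a_minus_def M.a_assoc M.l_neg)
  then show "y \<oplus>\<^bsub>M\<^esub> mdiff R M x y = x"
    using assms by (simp add: M.a_comm mdiff_closed[OF assms(1)])
  have *: "mdiff R M (x \<oplus>\<^bsub>M\<^esub> y) y = x" if "x \<in> carrier M" "y \<in> carrier M" for x y
    using that by (simp add: mdiff_eq[OF assms(1)] a_minus_def M.a_assoc M.r_neg)
  show "mdiff R M (x \<oplus>\<^bsub>M\<^esub> y) y = x" by (rule *) fact+
  show "mdiff R M (x \<oplus>\<^bsub>M\<^esub> y) x = y"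
    using *[of y x] assms by (simp add: M.a_comm)
qed

lemma mdiff_eq_zero:
  assumes "Module.module R M" "x \<in> carrier M" "y \<in> carrier M"
  shows "mdiff R M x y = \<zero>\<^bsub>M\<^esub> \<longleftrightarrow> x = y"
proof -
  interpret M: Module.module R M by fact
  show ?thesis using mdiff_add(1)[OF assms] mdiff_self[OF assms(1,2)] assms by auto
qed

lemma submodule_mdiff:
  assumes "submodule H R M" "Module.module R M" "x \<in> H" "y \<in> H"
  shows "mdiff R M x y \<in> H"
proof -
  interpret M: Module.module R M by fact
  show ?thesis using assms by (simp add: mdiff_def submodule_add submodule_smult)
qed

lemma submodule_add_cancel:
  assumes "submodule H R M" "Module.module R M" "x \<in> carrier M" "mdiff R M x y \<in> H" "y \<in> H"
  shows "x \<in> H"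
  using submodule_add[OF assms(1,4,5)] mdiff_add(1)[OF assms(2,3) submodule_mem[OF assms(1,5)]] by simp

lemma mod_homI:
  assumes "f \<in> extensional (carrier A)" "\<And>x. x \<in> carrier A \<Longrightarrow> f x \<in> carrier B"
    "\<And>x y. x \<in> carrier A \<Longrightarrow> y \<in> carrier A \<Longrightarrow> f (x \<oplus>\<^bsub>A\<^esub> y) = f x \<oplus>\<^bsub>B\<^esub> f y"
    "\<And>a x. a \<in> carrier R \<Longrightarrow> x \<in> carrier A \<Longrightarrow> f (a \<odot>\<^bsub>A\<^esub> x) = a \<odot>\<^bsub>B\<^esub> f x"
  shows "f \<in> mod_hom R A B"
  using assms by (auto simp: mod_hom_def PiE_def)

lemma mod_hom_ext: "f \<in> mod_hom R A B \<Longrightarrow> f \<in> extensional (carrier A)"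
  by (auto simp: mod_hom_def PiE_def)

lemma mod_hom_closed: "f \<in> mod_hom R A B \<Longrightarrow> x \<in> carrier A \<Longrightarrow> f x \<in> carrier B"
  by (auto simp: mod_hom_def)

lemma mod_hom_add:
  "f \<in> mod_hom R A B \<Longrightarrow> x \<in> carrier A \<Longrightarrow> y \<in> carrier A \<Longrightarrow> f (x \<oplus>\<^bsub>A\<^esub> y) = f x \<oplus>\<^bsub>B\<^esub> f y"
  by (auto simp: mod_hom_def)

lemma mod_hom_smult:
  "f \<in> mod_hom R A B \<Longrightarrow> a \<in> carrier R \<Longrightarrow> x \<in> carrier A \<Longrightarrow> f (a \<odot>\<^bsub>A\<^esub> x) = a \<odot>\<^bsub>B\<^esub> f x"
  by (auto simp: mod_hom_def)

lemma mod_hom_zero: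
  assumes "f \<in> mod_hom R A B" "Module.module R A" "Module.module R B"
  shows "f \<zero>\<^bsub>A\<^esub> = \<zero>\<^bsub>B\<^esub>"
proof -
  interpret A: Module.module R A by fact
  interpret B: Module.module R B by fact
  have "f (\<zero>\<^bsub>R\<^esub> \<odot>\<^bsub>A\<^esub> \<zero>\<^bsub>A\<^esub>) = \<zero>\<^bsub>R\<^esub> \<odot>\<^bsub>B\<^esub> f \<zero>\<^bsub>A\<^esub>" using assms by (intro mod_hom_smult) auto
  then show ?thesis using mod_hom_closed[OF assms(1), of "\<zero>\<^bsub>A\<^esub>"] by simp
qed

lemma mod_hom_mdiff:
  assumes "f \<in> mod_hom R A B" "Module.module R A" "x \<in> carrier A" "y \<in> carrier A"
  shows "f (mdiff R A x y) = mdiff R B (f x) (f y)"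
proof -
  interpret A: Module.module R A by fact
  show ?thesis using assms by (simp add: mdiff_def mod_hom_add mod_hom_smult)
qed

lemma mod_hom_compose:
  assumes "f \<in> mod_hom R A B" "g \<in> mod_hom R B C" "Module.module R A"
  shows "compose (carrier A) g f \<in> mod_hom R A C"
proof -
  interpret A: Module.module R A by fact
  show ?thesis
    by (rule mod_homI) (use assms in \<open>auto simp: compose_def mod_hom_closed mod_hom_add mod_hom_smult\<close>)
qed

lemma mod_hom_corestrict:
  assumes "S \<subseteq> carrier B"
  shows "f \<in> mod_hom R A (B\<lparr>carrier := S\<rparr>) \<longleftrightarrow> f \<in> mod_hom R A B \<and> (\<forall>x\<in>carrier A. f x \<in> S)"
  using assms by (auto simp: mod_hom_def PiE_def)

lemma mod_hom_restrict:
  assumes "f \<in> mod_hom R A B" "S \<subseteq> carrier A" "submodule S R A"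
  shows "restrict f S \<in> mod_hom R (A\<lparr>carrier := S\<rparr>) B"
  by (rule mod_homI) (use assms in \<open>auto simp: mod_hom_closed mod_hom_add mod_hom_smult submodule_add
    submodule_smult subset_iff\<close>)

lemma mod_hom_id:
  assumes "Module.module R A"
  shows "restrict id (carrier A) \<in> mod_hom R A A"
proof -
  interpret A: Module.module R A by fact
  show ?thesis by (rule mod_homI) auto
qed

lemma mod_hom_zero_map:
  assumes "Module.module R A" "Module.module R B"
  shows "(\<lambda>x\<in>carrier A. \<zero>\<^bsub>B\<^esub>) \<in> mod_hom R A B"
proof -
  interpret A: Module.module R A by fact
  interpret B: Module.module R B by fact
  show ?thesis by (rule mod_homI) auto
qed

lemma mod_hom_image_submodule:
  assumes "f \<in> mod_hom R A B" "Module.module R A" "Module.module R B" "submodule S R A"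
  shows "submodule (f ` S) R B"
proof (rule submodule_intro)
  have S: "\<And>x. x \<in> S \<Longrightarrow> x \<in> carrier A" by (rule submodule_mem[OF assms(4)])
  show "f ` S \<subseteq> carrier B" using S assms(1) by (auto intro: mod_hom_closed)
  show "\<zero>\<^bsub>B\<^esub> \<in> f ` S" using mod_hom_zero[OF assms(1-3)] submodule_zero[OF assms(4)] by force
  show "a \<oplus>\<^bsub>B\<^esub> b \<in> f ` S" if "a \<in> f ` S" "b \<in> f ` S" for a b
  proof -
    from that obtain x y where "x \<in> S" "y \<in> S" "a = f x" "b = f y" by auto
    then have "a \<oplus>\<^bsub>B\<^esub> b = f (x \<oplus>\<^bsub>A\<^esub> y)" using S assms(1) by (simp add: mod_hom_add)
    then show ?thesis using \<open>x \<in> S\<close> \<open>y \<in> S\<close> submodule_add[OF assms(4)] by blast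
  qed
  show "a \<odot>\<^bsub>B\<^esub> b \<in> f ` S" if "a \<in> carrier R" "b \<in> f ` S" for a b
  proof -
    from that obtain x where "x \<in> S" "b = f x" by auto
    then have "a \<odot>\<^bsub>B\<^esub> b = f (a \<odot>\<^bsub>A\<^esub> x)" using S assms(1) that by (simp add: mod_hom_smult)
    then show ?thesis using \<open>x \<in> S\<close> that submodule_smult[OF assms(4)] by blast
  qed
qed (use assms in auto)

lemma mod_hom_kernel_submodule:
  assumes "f \<in> mod_hom R A B" "Module.module R A" "Module.module R B" "submodule S R A"
  shows "submodule {x \<in> S. f x = \<zero>\<^bsub>B\<^esub>} R A"
proof (rule submodule_intro)
  interpret A: Module.module R A by fact
  interpret B: Module.module R B by fact
  have S: "\<And>x. x \<in> S \<Longrightarrow> x \<in> carrier A" by (rule submodule_mem[OF assms(4)])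
  show "{x \<in> S. f x = \<zero>\<^bsub>B\<^esub>} \<subseteq> carrier A" using S by auto
  show "\<zero>\<^bsub>A\<^esub> \<in> {x \<in> S. f x = \<zero>\<^bsub>B\<^esub>}" using mod_hom_zero[OF assms(1-3)] submodule_zero[OF assms(4)] by auto
  show "a \<oplus>\<^bsub>A\<^esub> b \<in> {x \<in> S. f x = \<zero>\<^bsub>B\<^esub>}" if "a \<in> {x \<in> S. f x = \<zero>\<^bsub>B\<^esub>}" "b \<in> {x \<in> S. f x = \<zero>\<^bsub>B\<^esub>}" for a b
    using that S assms submodule_add[OF assms(4)] by (auto simp: mod_hom_add)
  show "a \<odot>\<^bsub>A\<^esub> b \<in> {x \<in> S. f x = \<zero>\<^bsub>B\<^esub>}" if "a \<in> carrier R" "b \<in> {x \<in> S. f x = \<zero>\<^bsub>B\<^esub>}" for a b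
    using that S assms submodule_smult[OF assms(4)] by (auto simp: mod_hom_smult)
qed (use assms in auto)

subsection \<open>Modules of homomorphisms\<close>

lemma hom_module_simps [simp]:
  "carrier (hom_module R A B) = mod_hom R A B"
  "\<zero>\<^bsub>hom_module R A B\<^esub> = (\<lambda>x\<in>carrier A. \<zero>\<^bsub>B\<^esub>)"
  "f \<oplus>\<^bsub>hom_module R A B\<^esub> g = (\<lambda>x\<in>carrier A. f x \<oplus>\<^bsub>B\<^esub> g x)"
  "a \<odot>\<^bsub>hom_module R A B\<^esub> f = (\<lambda>x\<in>carrier A. a \<odot>\<^bsub>B\<^esub> f x)"
  by (simp_all add: hom_module_def)

lemma mod_hom_minus_closed:
  assumes "Module.module R A" "Module.module R B" "f \<in> mod_hom R A B"
  shows "(\<lambda>x\<in>carrier A. \<ominus>\<^bsub>B\<^esub> f x) \<in> mod_hom R A B"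
proof -
  interpret A: Module.module R A by fact
  interpret B: Module.module R B by fact
  show ?thesis
    by (rule mod_homI) (use assms in \<open>auto simp: mod_hom_add mod_hom_smult mod_hom_closed
      B.minus_add B.smult_r_minus\<close>)
qed

lemma hom_module_module:
  assumes "Module.module R A" "Module.module R B"
  shows "Module.module R (hom_module R A B)"
proof -
  interpret A: Module.module R A by fact
  interpret B: Module.module R B by fact
  have e: "restrict (restrict f S) S = restrict f S" for f :: "'c \<Rightarrow> 'd" and S by auto
  have r: "restrict f S = f" if "f \<in> extensional S" for f :: "'c \<Rightarrow> 'd" and S
    using that by (rule extensional_restrict)
  show ?thesis
  proof (rule moduleI)
    show "cring R" by (rule A.is_cring)
    show "abelian_group (hom_module R A B)"
    proof (rule abelian_groupI)
      fix f g assume f: "f \<in> carrier (hom_module R A B)" and g: "g \<in> carrier (hom_module R A B)"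
      show "f \<oplus>\<^bsub>hom_module R A B\<^esub> g \<in> carrier (hom_module R A B)"
        unfolding hom_module_simps
        by (rule mod_homI) (use f g in \<open>auto simp: mod_hom_add mod_hom_smult mod_hom_closed B.a_ac
          B.smult_r_distr\<close>)
      show "f \<oplus>\<^bsub>hom_module R A B\<^esub> g = g \<oplus>\<^bsub>hom_module R A B\<^esub> f"
        using f g by (auto simp: mod_hom_closed B.a_ac intro!: restrict_ext)
    next
      fix f g h assume "f \<in> carrier (hom_module R A B)" "g \<in> carrier (hom_module R A B)"
        "h \<in> carrier (hom_module R A B)"
      then show "(f \<oplus>\<^bsub>hom_module R A B\<^esub> g) \<oplus>\<^bsub>hom_module R A B\<^esub> h =
          f \<oplus>\<^bsub>hom_module R A B\<^esub> (g \<oplus>\<^bsub>hom_module R A B\<^esub> h)"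
        by (auto simp: mod_hom_closed B.a_assoc intro!: restrict_ext)
    next
      show "\<zero>\<^bsub>hom_module R A B\<^esub> \<in> carrier (hom_module R A B)"
        using mod_hom_zero_map[OF assms] by simp
    next
      fix f assume f: "f \<in> carrier (hom_module R A B)"
      then show "\<zero>\<^bsub>hom_module R A B\<^esub> \<oplus>\<^bsub>hom_module R A B\<^esub> f = f"
        by (intro extensionalityI[of _ "carrier A"]) (auto simp: mod_hom_closed dest: mod_hom_ext)
      show "\<exists>g\<in>carrier (hom_module R A B). g \<oplus>\<^bsub>hom_module R A B\<^esub> f = \<zero>\<^bsub>hom_module R A B\<^esub>"
        using f by (intro bexI[of _ "\<lambda>x\<in>carrier A. \<ominus>\<^bsub>B\<^esub> f x"])
          (auto simp: mod_hom_closed B.l_neg intro!: restrict_ext mod_hom_minus_closed[OF assms])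
    qed
  next
    fix a f assume f: "a \<in> carrier R" "f \<in> carrier (hom_module R A B)"
    show "a \<odot>\<^bsub>hom_module R A B\<^esub> f \<in> carrier (hom_module R A B)"
      unfolding hom_module_simps
      by (rule mod_homI) (use f in \<open>auto simp: mod_hom_add mod_hom_smult mod_hom_closed
          B.smult_r_distr B.smult_assoc1[symmetric] A.m_comm\<close>)
  next
    fix f assume f: "f \<in> carrier (hom_module R A B)"
    then show "\<one>\<^bsub>R\<^esub> \<odot>\<^bsub>hom_module R A B\<^esub> f = f"
      by (intro extensionalityI[of _ "carrier A"]) (auto simp: mod_hom_closed dest: mod_hom_ext)
  qed (auto simp: mod_hom_closed B.smult_l_distr B.smult_r_distr B.smult_assoc1 intro!: restrict_ext)
qed

lemma hom_module_mdiff: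
  assumes "Module.module R A"
  shows "mdiff R (hom_module R A B) f g = (\<lambda>x\<in>carrier A. mdiff R B (f x) (g x))"
  by (auto simp: mdiff_def intro!: restrict_ext)

lemma mdiff_mdiff:
  assumes "Module.module R M" "x \<in> carrier M" "y \<in> carrier M"
  shows "mdiff R M x (mdiff R M x y) = y"
  using mdiff_add(3)[OF assms(1,3) mdiff_closed[OF assms]] by (simp only: mdiff_add(2)[OF assms])

subsection \<open>Quotient modules\<close>

text \<open>
  A map that respects the submodules is constant modulo \<open>V\<close> on each coset of \<open>B\<close>, so the union in
  \<open>coset_map\<close> is a union of equal cosets.
\<close>

lemma coset_map_coset:
  assumes "Module.module R C" "Module.module R D" "submodule B R C" "submodule V R D"
    and "x \<in> carrier C" "\<And>x. x \<in> carrier C \<Longrightarrow> h x \<in> carrier D"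
    and "\<And>x y. x \<in> carrier C \<Longrightarrow> y \<in> carrier C \<Longrightarrow> h (x \<oplus>\<^bsub>C\<^esub> y) = h x \<oplus>\<^bsub>D\<^esub> h y"
    and "\<And>x. x \<in> B \<Longrightarrow> h x \<in> V"
  shows "coset_map D V h (B +>\<^bsub>C\<^esub> x) = V +>\<^bsub>D\<^esub> h x"
proof -
  interpret C: Module.module R C by fact
  interpret D: Module.module R D by fact
  interpret V: abelian_subgroup V D
    by (intro abelian_subgroupI3 additive_subgroupI submodule.axioms(1)[OF assms(4)] D.abelian_group_axioms)
  have B: "\<And>x. x \<in> B \<Longrightarrow> x \<in> carrier C" by (rule submodule_mem[OF assms(3)])
  have V: "\<And>x. x \<in> V \<Longrightarrow> x \<in> carrier D" by (rule submodule_mem[OF assms(4)])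
  have *: "V +>\<^bsub>D\<^esub> h y = V +>\<^bsub>D\<^esub> h x" if "y \<in> B +>\<^bsub>C\<^esub> x" for y
  proof -
    from that obtain b where b: "b \<in> B" "y = b \<oplus>\<^bsub>C\<^esub> x" by (auto simp: a_r_coset_def')
    then have "h y = h b \<oplus>\<^bsub>D\<^esub> h x" using assms(7)[OF B[OF b(1)] assms(5)] b(2) by simp
    then have "h y \<in> V +>\<^bsub>D\<^esub> h x" using assms(8)[OF b(1)] by (auto simp: a_r_coset_def')
    then show ?thesis
      by (rule D.a_repr_independence[symmetric, OF _ assms(6)[OF assms(5)] submodule.axioms(1)[OF assms(4)]])
  qed
  have "x \<in> B +>\<^bsub>C\<^esub> x"
    using submodule_zero[OF assms(3)] assms(5) by (force simp: a_r_coset_def')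
  then show ?thesis unfolding coset_map_def by (rule UN_constant_eq) (use * in blast)
qed

context
  fixes R :: "('a, 'r) ring_scheme" and C :: "('a, 'b) module" and B :: "'b set"
  assumes C: "Module.module R C" and B: "submodule B R C"
begin

interpretation C: Module.module R C by (rule C)
interpretation B: abelian_subgroup B C
  by (intro abelian_subgroupI3 additive_subgroupI submodule.axioms(1)[OF B] C.abelian_group_axioms)

lemma quot_carrier: "carrier (quot_module C B) = (\<lambda>x. B +>\<^bsub>C\<^esub> x) ` carrier C"
  by (auto simp: quot_module_def A_RCOSETS_def')

lemma quot_zero [simp]: "\<zero>\<^bsub>quot_module C B\<^esub> = B"
  by (simp add: quot_module_def)

lemma quot_add:
  "x \<in> carrier C \<Longrightarrow> y \<in> carrier C \<Longrightarrow>
    (B +>\<^bsub>C\<^esub> x) \<oplus>\<^bsub>quot_module C B\<^esub> (B +>\<^bsub>C\<^esub> y) = B +>\<^bsub>C\<^esub> (x \<oplus>\<^bsub>C\<^esub> y)"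
  by (simp add: quot_module_def B.a_rcos_sum)

lemma quot_smult:
  assumes "a \<in> carrier R" "x \<in> carrier C"
  shows "a \<odot>\<^bsub>quot_module C B\<^esub> (B +>\<^bsub>C\<^esub> x) = B +>\<^bsub>C\<^esub> (a \<odot>\<^bsub>C\<^esub> x)"
  using coset_map_coset[OF C C B B assms(2), of "\<lambda>x. a \<odot>\<^bsub>C\<^esub> x"] assms(1)
  by (simp add: quot_module_def coset_map_def C.smult_r_distr submodule_smult[OF B])

lemma coset_eq_iff:
  assumes "x \<in> carrier C" "y \<in> carrier C"
  shows "B +>\<^bsub>C\<^esub> x = B +>\<^bsub>C\<^esub> y \<longleftrightarrow> mdiff R C x y \<in> B"
proof -
  have "B +>\<^bsub>C\<^esub> x = B +>\<^bsub>C\<^esub> y \<longleftrightarrow> x \<in> B +>\<^bsub>C\<^esub> y"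
    using B.a_rcos_self[OF assms(1)] C.a_repr_independence[OF _ assms(2) submodule.axioms(1)[OF B], of x]
    by metis
  also have "\<dots> \<longleftrightarrow> (\<exists>b\<in>B. x = b \<oplus>\<^bsub>C\<^esub> y)" by (auto simp: a_r_coset_def')
  also have "\<dots> \<longleftrightarrow> mdiff R C x y \<in> B"
  proof
    assume "\<exists>b\<in>B. x = b \<oplus>\<^bsub>C\<^esub> y"
    then obtain b where "b \<in> B" "x = b \<oplus>\<^bsub>C\<^esub> y" by blast
    then show "mdiff R C x y \<in> B" using mdiff_add(3)[OF C _ assms(2)] submodule_mem[OF B] by simp
  next
    assume "mdiff R C x y \<in> B"
    then show "\<exists>b\<in>B. x = b \<oplus>\<^bsub>C\<^esub> y" using mdiff_add(1)[OF C assms] by force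
  qed
  finally show ?thesis .
qed

lemma coset_eq_zero_iff:
  assumes "x \<in> carrier C"
  shows "B +>\<^bsub>C\<^esub> x = B \<longleftrightarrow> x \<in> B"
  using coset_eq_iff[OF assms C.zero_closed] assms
  by (simp add: mdiff_zero[OF C] C.a_coset_add_zero[OF submodule_subset[OF B]])

lemma quot_module: "Module.module R (quot_module C B)"
proof -
  have *: "\<exists>g\<in>carrier C. B +>\<^bsub>C\<^esub> (g \<oplus>\<^bsub>C\<^esub> x) = B" if "x \<in> carrier C" for x
    using that by (intro bexI[of _ "\<ominus>\<^bsub>C\<^esub> x"]) (auto simp: C.l_neg C.a_coset_add_zero[OF submodule_subset[OF B]])
  have z: "B +>\<^bsub>C\<^esub> \<zero>\<^bsub>C\<^esub> = B" by (rule C.a_coset_add_zero[OF submodule_subset[OF B]])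
  show ?thesis
  proof (rule moduleI)
    show "abelian_group (quot_module C B)"
    proof (rule abelian_groupI)
      show "\<zero>\<^bsub>quot_module C B\<^esub> \<in> carrier (quot_module C B)"
        unfolding quot_carrier quot_zero using z by force
      show "\<zero>\<^bsub>quot_module C B\<^esub> \<oplus>\<^bsub>quot_module C B\<^esub> x = x" if "x \<in> carrier (quot_module C B)" for x
        using that quot_add[OF C.zero_closed] by (auto simp: quot_carrier z)
      show "\<exists>y\<in>carrier (quot_module C B). y \<oplus>\<^bsub>quot_module C B\<^esub> x = \<zero>\<^bsub>quot_module C B\<^esub>"
        if "x \<in> carrier (quot_module C B)" for x
        using that * by (auto simp: quot_carrier quot_add)
    qed (auto simp: quot_carrier quot_add C.a_ac)
  qed (auto simp: quot_carrier quot_add quot_smult C.is_cring C.smult_l_distr C.smult_r_distr C.smult_assoc1)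
qed

lemma quot_proj_hom: "(\<lambda>x\<in>carrier C. B +>\<^bsub>C\<^esub> x) \<in> mod_hom R C (quot_module C B)"
  by (rule mod_homI) (auto simp: quot_carrier quot_add quot_smult)

end

lemma coset_carrier_update [simp]: "B +>\<^bsub>C\<lparr>carrier := Z\<rparr>\<^esub> x = B +>\<^bsub>C\<^esub> x"
  by (simp add: a_r_coset_def')

section \<open>Weakly Laskerian subquotients\<close>

text \<open>
  The quotient \<open>Z/B\<close> of two submodules of \<open>X\<close> is weakly Laskerian. The primes associated to
  \<open>Z/U\<close> are the prime colon ideals \<open>(U : x)\<close>, so that neither \<open>Z/B\<close> nor its quotients have to be
  formed; this is what makes it possible to argue with linear relations instead of homomorphisms
  between quotients.
\<close>

definition wl :: "('a, 'r) ring_scheme \<Rightarrow> ('a, 'b) module \<Rightarrow> 'b set \<Rightarrow> 'b set \<Rightarrow> bool" where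
  "wl R X Z B \<longleftrightarrow> (\<forall>U. submodule U R X \<and> B \<subseteq> U \<and> U \<subseteq> Z \<longrightarrow>
     finite {P. primeideal P R \<and> (\<exists>x\<in>Z. P = {a \<in> carrier R. a \<odot>\<^bsub>X\<^esub> x \<in> U})})"

lemma wl_mono:
  assumes "wl R X Z B" "Z' \<subseteq> Z" "B \<subseteq> B'"
  shows "wl R X Z' B'"
  unfolding wl_def
proof (intro allI impI, elim conjE)
  fix U assume U: "submodule U R X" "B' \<subseteq> U" "U \<subseteq> Z'"
  have "finite {P. primeideal P R \<and> (\<exists>x\<in>Z. P = {a \<in> carrier R. a \<odot>\<^bsub>X\<^esub> x \<in> U})}"
    using assms U unfolding wl_def by blast
  then show "finite {P. primeideal P R \<and> (\<exists>x\<in>Z'. P = {a \<in> carrier R. a \<odot>\<^bsub>X\<^esub> x \<in> U})}"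
    by (rule rev_finite_subset) (use assms(2) in blast)
qed

lemma wl_trivial:
  assumes "Z \<subseteq> B"
  shows "wl R X Z B"
  unfolding wl_def
proof (intro allI impI, elim conjE)
  fix U assume U: "submodule U R X" "B \<subseteq> U" "U \<subseteq> Z"
  have "\<not> primeideal P R" if "x \<in> Z" "P = {a \<in> carrier R. a \<odot>\<^bsub>X\<^esub> x \<in> U}" for x P
  proof
    assume P: "primeideal P R"
    have "P = carrier R" using that assms U submodule_smult[OF U(1)] by auto
    then show False using primeideal.I_notcarr[OF P] by simp
  qed
  then have "{P. primeideal P R \<and> (\<exists>x\<in>Z. P = {a \<in> carrier R. a \<odot>\<^bsub>X\<^esub> x \<in> U})} = {}" by blast
  then show "finite {P. primeideal P R \<and> (\<exists>x\<in>Z. P = {a \<in> carrier R. a \<odot>\<^bsub>X\<^esub> x \<in> U})}"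
    by (simp only: finite.emptyI)
qed

text \<open>
  Maps between cohomology modules are usually defined by choosing representatives and lifts. A
  linear relation records all possible choices at once, and lives on the modules of cochains.
\<close>

definition linrel :: "('a, 'r) ring_scheme \<Rightarrow> ('a, 'b) module \<Rightarrow> ('a, 'c) module \<Rightarrow> ('b \<times> 'c) set \<Rightarrow> bool"
  where
  "linrel R X Y \<rho> \<longleftrightarrow> \<rho> \<subseteq> carrier X \<times> carrier Y \<and> (\<zero>\<^bsub>X\<^esub>, \<zero>\<^bsub>Y\<^esub>) \<in> \<rho> \<and>
     (\<forall>x y x' y'. (x, y) \<in> \<rho> \<longrightarrow> (x', y') \<in> \<rho> \<longrightarrow> (x \<oplus>\<^bsub>X\<^esub> x', y \<oplus>\<^bsub>Y\<^esub> y') \<in> \<rho>) \<and>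
     (\<forall>a\<in>carrier R. \<forall>x y. (x, y) \<in> \<rho> \<longrightarrow> (a \<odot>\<^bsub>X\<^esub> x, a \<odot>\<^bsub>Y\<^esub> y) \<in> \<rho>)"

lemma linrelI:
  assumes "\<And>x y. (x, y) \<in> \<rho> \<Longrightarrow> x \<in> carrier X \<and> y \<in> carrier Y" "(\<zero>\<^bsub>X\<^esub>, \<zero>\<^bsub>Y\<^esub>) \<in> \<rho>"
    "\<And>x y x' y'. (x, y) \<in> \<rho> \<Longrightarrow> (x', y') \<in> \<rho> \<Longrightarrow> (x \<oplus>\<^bsub>X\<^esub> x', y \<oplus>\<^bsub>Y\<^esub> y') \<in> \<rho>"
    "\<And>a x y. a \<in> carrier R \<Longrightarrow> (x, y) \<in> \<rho> \<Longrightarrow> (a \<odot>\<^bsub>X\<^esub> x, a \<odot>\<^bsub>Y\<^esub> y) \<in> \<rho>"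
  shows "linrel R X Y \<rho>"
  unfolding linrel_def
proof (intro conjI allI impI ballI subsetI)
  show "p \<in> carrier X \<times> carrier Y" if "p \<in> \<rho>" for p
    using assms(1)[of "fst p" "snd p"] that by (simp add: mem_Times_iff)
qed (rule assms; assumption)+

lemma linrelD:
  assumes "linrel R X Y \<rho>"
  shows "(x, y) \<in> \<rho> \<Longrightarrow> x \<in> carrier X" "(x, y) \<in> \<rho> \<Longrightarrow> y \<in> carrier Y" "(\<zero>\<^bsub>X\<^esub>, \<zero>\<^bsub>Y\<^esub>) \<in> \<rho>"
    "(x, y) \<in> \<rho> \<Longrightarrow> (x', y') \<in> \<rho> \<Longrightarrow> (x \<oplus>\<^bsub>X\<^esub> x', y \<oplus>\<^bsub>Y\<^esub> y') \<in> \<rho>"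
    "a \<in> carrier R \<Longrightarrow> (x, y) \<in> \<rho> \<Longrightarrow> (a \<odot>\<^bsub>X\<^esub> x, a \<odot>\<^bsub>Y\<^esub> y) \<in> \<rho>"
  using assms unfolding linrel_def by blast+

lemma linrel_mdiff:
  assumes "linrel R X Y \<rho>" "cring R" "(x, y) \<in> \<rho>" "(x', y') \<in> \<rho>"
  shows "(mdiff R X x x', mdiff R Y y y') \<in> \<rho>"
proof -
  interpret R: cring R by fact
  show ?thesis unfolding mdiff_def by (intro linrelD(4,5)[OF assms(1)] assms) auto
qed

lemma linrel_Id_on: "Module.module R X \<Longrightarrow> linrel R X X (Id_on (carrier X))"
proof -
  assume "Module.module R X"
  then interpret X: Module.module R X .
  show ?thesis by (rule linrelI) auto
qed

lemma linrel_graph: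
  assumes "f \<in> mod_hom R A B" "Module.module R A" "Module.module R B" "submodule S R A"
  shows "linrel R A B {(x, f x) | x. x \<in> S}"
proof (rule linrelI)
  have S: "\<And>x. x \<in> S \<Longrightarrow> x \<in> carrier A" by (rule submodule_mem[OF assms(4)])
  show "(x \<oplus>\<^bsub>A\<^esub> x', y \<oplus>\<^bsub>B\<^esub> y') \<in> {(x, f x) | x. x \<in> S}"
    if "(x, y) \<in> {(x, f x) | x. x \<in> S}" "(x', y') \<in> {(x, f x) | x. x \<in> S}" for x y x' y'
    using that S assms(1) submodule_add[OF assms(4)] by (auto simp: mod_hom_add)
  show "(a \<odot>\<^bsub>A\<^esub> x, a \<odot>\<^bsub>B\<^esub> y) \<in> {(x, f x) | x. x \<in> S}"
    if "a \<in> carrier R" "(x, y) \<in> {(x, f x) | x. x \<in> S}" for a x y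
    using that S assms(1) submodule_smult[OF assms(4)] by (auto simp: mod_hom_smult)
qed (use assms in \<open>auto simp: mod_hom_closed submodule_mem mod_hom_zero submodule_zero\<close>)

text \<open>
  Weakly Laskerian modules form a Serre class, in the form in which it is used below: exactness of
  \<open>Z1/B1 \<rightarrow> Z2/B2 \<rightarrow> Z3/B3\<close> in the middle. For \<open>P = (V : y)\<close> prime there are two cases, as in the
  inclusion \<open>Ass Y \<subseteq> Ass U \<union> Ass (Y/U)\<close>. If some multiple \<open>a y\<close> with \<open>a \<notin> P\<close> lies in
  \<open>U + V\<close> for the kernel \<open>U\<close> of the second map, then \<open>P\<close> is also the colon ideal of an element of
  \<open>U\<close>, which comes from \<open>Z1\<close>; otherwise \<open>P = (U + V : y)\<close> is seen in \<open>Z3\<close>.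
\<close>

lemma wl_exact:
  assumes mods: "Module.module R X1" "Module.module R X2" "Module.module R X3"
    and sub1: "submodule Z1 R X1" "B1 \<subseteq> Z1"
    and sub2: "submodule Z2 R X2" "submodule B2 R X2" "B2 \<subseteq> Z2"
    and sub3: "submodule Z3 R X3" "submodule B3 R X3" "B3 \<subseteq> Z3"
    and rho: "linrel R X1 X2 \<rho>" "\<And>x. x \<in> Z1 \<Longrightarrow> \<exists>y\<in>Z2. (x, y) \<in> \<rho>"
      "\<And>x y. (x, y) \<in> \<rho> \<Longrightarrow> x \<in> B1 \<Longrightarrow> y \<in> B2"
    and sub1': "submodule B1 R X1"
    and sig: "linrel R X2 X3 \<sigma>" "\<And>y. y \<in> Z2 \<Longrightarrow> \<exists>z\<in>Z3. (y, z) \<in> \<sigma>"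
      "\<And>y z. (y, z) \<in> \<sigma> \<Longrightarrow> y \<in> B2 \<Longrightarrow> z \<in> B3"
    and exact: "\<And>y z. y \<in> Z2 \<Longrightarrow> (y, z) \<in> \<sigma> \<Longrightarrow> z \<in> B3 \<Longrightarrow> \<exists>x\<in>Z1. \<exists>y'. (x, y') \<in> \<rho> \<and> mdiff R X2 y y' \<in> B2"
    and wl: "wl R X1 Z1 B1" "wl R X3 Z3 B3"
  shows "wl R X2 Z2 B2"
  unfolding wl_def
proof (intro allI impI, elim conjE)
  interpret X1: Module.module R X1 by fact
  interpret X2: Module.module R X2 by fact
  interpret X3: Module.module R X3 by fact
  fix V assume V: "submodule V R X2" "B2 \<subseteq> V" "V \<subseteq> Z2"
  have Vc: "\<And>v. v \<in> V \<Longrightarrow> v \<in> carrier X2" by (rule submodule_mem[OF V(1)])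
  \<comment> \<open>The preimage of \<open>V\<close> in \<open>Z1\<close>, the image of \<open>V\<close> in \<open>Z3\<close>, and the kernel of the second map.\<close>
  define V1 where "V1 = {x \<in> Z1. \<exists>v\<in>V. (x, v) \<in> \<rho>}"
  define V3 where "V3 = {z \<in> Z3. \<exists>v\<in>V. \<exists>z'. (v, z') \<in> \<sigma> \<and> mdiff R X3 z z' \<in> B3}"
  define U where "U = {y \<in> Z2. \<exists>z\<in>B3. (y, z) \<in> \<sigma>}"
  define S1 where "S1 = {P. primeideal P R \<and> (\<exists>x\<in>Z1. P = {a \<in> carrier R. a \<odot>\<^bsub>X1\<^esub> x \<in> V1})}"
  define S3 where "S3 = {P. primeideal P R \<and> (\<exists>x\<in>Z3. P = {a \<in> carrier R. a \<odot>\<^bsub>X3\<^esub> x \<in> V3})}"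
  have "submodule V1 R X1"
  proof (rule submodule_intro)
    show "a \<oplus>\<^bsub>X1\<^esub> b \<in> V1" if "a \<in> V1" "b \<in> V1" for a b
      using that submodule_add[OF sub1(1)] submodule_add[OF V(1)] linrelD(4)[OF rho(1)]
      unfolding V1_def by blast
    show "a \<odot>\<^bsub>X1\<^esub> b \<in> V1" if "a \<in> carrier R" "b \<in> V1" for a b
      using that submodule_smult[OF sub1(1)] submodule_smult[OF V(1)] linrelD(5)[OF rho(1)]
      unfolding V1_def by blast
    show "\<zero>\<^bsub>X1\<^esub> \<in> V1"
      using submodule_zero[OF sub1(1)] submodule_zero[OF V(1)] linrelD(3)[OF rho(1)]
      unfolding V1_def by blast
  qed (use mods sub1 submodule_mem in \<open>auto simp: V1_def\<close>)
  moreover have "B1 \<subseteq> V1" unfolding V1_def using sub1 rho(2,3) V(2) by blast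
  ultimately have f1: "finite S1" using wl(1) unfolding wl_def S1_def V1_def by blast
  have "submodule V3 R X3"
  proof (rule submodule_intro)
    show "a \<oplus>\<^bsub>X3\<^esub> b \<in> V3" if "a \<in> V3" "b \<in> V3" for a b
    proof -
      from that obtain v z v' z' where *: "v \<in> V" "(v, z) \<in> \<sigma>" "mdiff R X3 a z \<in> B3"
        "v' \<in> V" "(v', z') \<in> \<sigma>" "mdiff R X3 b z' \<in> B3" "a \<in> Z3" "b \<in> Z3" unfolding V3_def by blast
      have c: "a \<in> carrier X3" "b \<in> carrier X3" "z \<in> carrier X3" "z' \<in> carrier X3"
        using * linrelD(2)[OF sig(1)] submodule_mem[OF sub3(1)] by auto
      have "mdiff R X3 (a \<oplus>\<^bsub>X3\<^esub> b) (z \<oplus>\<^bsub>X3\<^esub> z') = mdiff R X3 a z \<oplus>\<^bsub>X3\<^esub> mdiff R X3 b z'"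
        using c by (simp add: mdiff_def X3.smult_r_distr X3.a_ac)
      also have "\<dots> \<in> B3" using * submodule_add[OF sub3(2)] by blast
      finally show ?thesis using * submodule_add[OF sub3(1)] submodule_add[OF V(1)] linrelD(4)[OF sig(1)]
        unfolding V3_def by blast
    qed
    show "a \<odot>\<^bsub>X3\<^esub> b \<in> V3" if a: "a \<in> carrier R" "b \<in> V3" for a b
    proof -
      from that obtain v z where *: "v \<in> V" "(v, z) \<in> \<sigma>" "mdiff R X3 b z \<in> B3" "b \<in> Z3"
        unfolding V3_def by blast
      have c: "b \<in> carrier X3" "z \<in> carrier X3"
        using * linrelD(2)[OF sig(1)] submodule_mem[OF sub3(1)] by auto
      have "mdiff R X3 (a \<odot>\<^bsub>X3\<^esub> b) (a \<odot>\<^bsub>X3\<^esub> z) = a \<odot>\<^bsub>X3\<^esub> mdiff R X3 b z"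
        using c a by (simp add: mdiff_def X3.smult_r_distr X3.smult_assoc1[symmetric] X1.m_comm)
      also have "\<dots> \<in> B3" using * a submodule_smult[OF sub3(2)] by blast
      finally show ?thesis using * a submodule_smult[OF sub3(1)] submodule_smult[OF V(1)] linrelD(5)[OF sig(1)]
        unfolding V3_def by blast
    qed
    show "\<zero>\<^bsub>X3\<^esub> \<in> V3"
      using submodule_zero[OF sub3(1)] submodule_zero[OF sub3(2)] submodule_zero[OF V(1)]
        linrelD(3)[OF sig(1)] mdiff_self[OF mods(3) X3.zero_closed]
      unfolding V3_def by force
  qed (use mods sub3 submodule_mem in \<open>auto simp: V3_def\<close>)
  moreover have "B3 \<subseteq> V3"
  proof
    fix b assume b: "b \<in> B3"
    then have "mdiff R X3 b \<zero>\<^bsub>X3\<^esub> \<in> B3" using mdiff_zero[OF mods(3)] submodule_mem[OF sub3(2)] by simp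
    then show "b \<in> V3" using b sub3(3) submodule_zero[OF V(1)] linrelD(3)[OF sig(1)]
      unfolding V3_def by blast
  qed
  ultimately have f3: "finite S3" using wl(2) unfolding wl_def S3_def V3_def by blast
  have "{P. primeideal P R \<and> (\<exists>x\<in>Z2. P = {a \<in> carrier R. a \<odot>\<^bsub>X2\<^esub> x \<in> V})} \<subseteq> S1 \<union> S3"
  proof (clarify)
    fix P y
    let ?P = "{a \<in> carrier R. a \<odot>\<^bsub>X2\<^esub> y \<in> V}"
    assume P: "primeideal ?P R"
      and y: "y \<in> Z2" and n: "?P \<notin> S3"
    have yc: "y \<in> carrier X2" by (rule submodule_mem[OF sub2(1) y])
    show "?P \<in> S1"
    proof (cases "\<exists>a\<in>carrier R - ?P. \<exists>u\<in>U. \<exists>v\<in>V. a \<odot>\<^bsub>X2\<^esub> y = u \<oplus>\<^bsub>X2\<^esub> v")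
      case True
      then obtain a u v where a: "a \<in> carrier R" "a \<odot>\<^bsub>X2\<^esub> y \<notin> V" and u: "u \<in> U" and v: "v \<in> V"
        and ay: "a \<odot>\<^bsub>X2\<^esub> y = u \<oplus>\<^bsub>X2\<^esub> v" by blast
      have uc: "u \<in> carrier X2" using u submodule_mem[OF sub2(1)] unfolding U_def by blast
      obtain x u' where x: "x \<in> Z1" "(x, u') \<in> \<rho>" "mdiff R X2 u u' \<in> B2"
        using exact u unfolding U_def by blast
      have u'c: "u' \<in> carrier X2" using linrelD(2)[OF rho(1) x(2)] .
      have 1: "c \<in> ?P \<longleftrightarrow> c \<odot>\<^bsub>X2\<^esub> u \<in> V" if c: "c \<in> carrier R" for c
      proof -
        have "c \<in> ?P \<longleftrightarrow> c \<otimes>\<^bsub>R\<^esub> a \<in> ?P"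
          using primeideal.I_prime[OF P c a(1)] a c
            ideal.I_r_closed[OF primeideal.axioms(1)[OF P], of c a] by auto
        also have "\<dots> \<longleftrightarrow> c \<odot>\<^bsub>X2\<^esub> (u \<oplus>\<^bsub>X2\<^esub> v) \<in> V"
          using a(1) c yc by (simp add: X2.smult_assoc1 ay[symmetric])
        also have "c \<odot>\<^bsub>X2\<^esub> (u \<oplus>\<^bsub>X2\<^esub> v) = c \<odot>\<^bsub>X2\<^esub> u \<oplus>\<^bsub>X2\<^esub> c \<odot>\<^bsub>X2\<^esub> v"
          using c uc v Vc by (simp add: X2.smult_r_distr)
        also have "\<dots> \<in> V \<longleftrightarrow> c \<odot>\<^bsub>X2\<^esub> u \<in> V"
        proof -
          have "c \<odot>\<^bsub>X2\<^esub> u \<in> carrier X2" "c \<odot>\<^bsub>X2\<^esub> v \<in> carrier X2" using c uc Vc v by auto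
          note * = mdiff_add(3)[OF mods(2) this]
          show ?thesis
            using submodule_add[OF V(1) _ submodule_smult[OF V(1) c v]]
              submodule_mdiff[OF V(1) mods(2) _ submodule_smult[OF V(1) c v]] * by metis
        qed
        finally show ?thesis .
      qed
      have 2: "c \<odot>\<^bsub>X2\<^esub> u \<in> V \<longleftrightarrow> c \<odot>\<^bsub>X1\<^esub> x \<in> V1" if c: "c \<in> carrier R" for c
      proof -
        have "c \<odot>\<^bsub>X2\<^esub> mdiff R X2 u u' \<in> V" using submodule_smult[OF V(1) c] x(3) V(2) by blast
        then have d: "mdiff R X2 (c \<odot>\<^bsub>X2\<^esub> u) (c \<odot>\<^bsub>X2\<^esub> u') \<in> V"
          using c uc u'c by (simp add: mdiff_def X2.smult_r_distr X2.smult_assoc1[symmetric] X1.m_comm)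
        have r: "(c \<odot>\<^bsub>X1\<^esub> x, c \<odot>\<^bsub>X2\<^esub> u') \<in> \<rho>" by (rule linrelD(5)[OF rho(1) c x(2)])
        have "c \<odot>\<^bsub>X2\<^esub> u \<in> V \<longleftrightarrow> c \<odot>\<^bsub>X2\<^esub> u' \<in> V"
        proof
          assume "c \<odot>\<^bsub>X2\<^esub> u' \<in> V"
          then show "c \<odot>\<^bsub>X2\<^esub> u \<in> V" using submodule_add_cancel[OF V(1) mods(2) _ d] c uc by simp
        next
          assume "c \<odot>\<^bsub>X2\<^esub> u \<in> V"
          then have "mdiff R X2 (c \<odot>\<^bsub>X2\<^esub> u) (mdiff R X2 (c \<odot>\<^bsub>X2\<^esub> u) (c \<odot>\<^bsub>X2\<^esub> u')) \<in> V"
            using submodule_mdiff[OF V(1) mods(2)] d by blast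
          then show "c \<odot>\<^bsub>X2\<^esub> u' \<in> V"
            using mdiff_mdiff[OF mods(2), of "c \<odot>\<^bsub>X2\<^esub> u" "c \<odot>\<^bsub>X2\<^esub> u'"] c uc u'c by simp
        qed
        also have "\<dots> \<longleftrightarrow> c \<odot>\<^bsub>X1\<^esub> x \<in> V1"
        proof
          assume "c \<odot>\<^bsub>X2\<^esub> u' \<in> V"
          then show "c \<odot>\<^bsub>X1\<^esub> x \<in> V1" using r submodule_smult[OF sub1(1) c x(1)] unfolding V1_def by blast
        next
          assume "c \<odot>\<^bsub>X1\<^esub> x \<in> V1"
          then obtain v where v: "v \<in> V" "(c \<odot>\<^bsub>X1\<^esub> x, v) \<in> \<rho>" unfolding V1_def by blast
          have "(mdiff R X1 (c \<odot>\<^bsub>X1\<^esub> x) (c \<odot>\<^bsub>X1\<^esub> x), mdiff R X2 (c \<odot>\<^bsub>X2\<^esub> u') v) \<in> \<rho>"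
            by (rule linrel_mdiff[OF rho(1) X1.is_cring r v(2)])
          moreover have "mdiff R X1 (c \<odot>\<^bsub>X1\<^esub> x) (c \<odot>\<^bsub>X1\<^esub> x) \<in> B1"
            using mdiff_self[OF mods(1)] c submodule_mem[OF sub1(1) x(1)] submodule_zero[OF sub1'] by simp
          ultimately have "mdiff R X2 (c \<odot>\<^bsub>X2\<^esub> u') v \<in> V" using rho(3) V(2) by blast
          then show "c \<odot>\<^bsub>X2\<^esub> u' \<in> V" using submodule_add_cancel[OF V(1) mods(2) _ _ v(1)] c u'c by simp
        qed
        finally show ?thesis .
      qed
      have "?P = {c \<in> carrier R. c \<odot>\<^bsub>X1\<^esub> x \<in> V1}" using 1 2 by blast
      then show ?thesis using P x(1) unfolding S1_def by auto
    next
      case False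
      obtain z where z: "z \<in> Z3" "(y, z) \<in> \<sigma>" using sig(2) y by blast
      have zc: "z \<in> carrier X3" by (rule submodule_mem[OF sub3(1) z(1)])
      have "a \<in> ?P \<longleftrightarrow> a \<odot>\<^bsub>X3\<^esub> z \<in> V3" if a: "a \<in> carrier R" for a
      proof
        have r: "(a \<odot>\<^bsub>X2\<^esub> y, a \<odot>\<^bsub>X3\<^esub> z) \<in> \<sigma>" by (rule linrelD(5)[OF sig(1) a z(2)])
        {
          assume "a \<in> ?P"
          moreover have "mdiff R X3 (a \<odot>\<^bsub>X3\<^esub> z) (a \<odot>\<^bsub>X3\<^esub> z) \<in> B3"
            using mdiff_self[OF mods(3)] a zc submodule_zero[OF sub3(2)] by simp
          ultimately show "a \<odot>\<^bsub>X3\<^esub> z \<in> V3" using r submodule_smult[OF sub3(1) a z(1)] unfolding V3_def by blast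
        next
          assume "a \<odot>\<^bsub>X3\<^esub> z \<in> V3"
          then obtain v z' where v: "v \<in> V" "(v, z') \<in> \<sigma>" "mdiff R X3 (a \<odot>\<^bsub>X3\<^esub> z) z' \<in> B3"
            unfolding V3_def by blast
          have "(mdiff R X2 (a \<odot>\<^bsub>X2\<^esub> y) v, mdiff R X3 (a \<odot>\<^bsub>X3\<^esub> z) z') \<in> \<sigma>"
            by (rule linrel_mdiff[OF sig(1) X1.is_cring r v(2)])
          moreover have "mdiff R X2 (a \<odot>\<^bsub>X2\<^esub> y) v \<in> Z2"
            using submodule_mdiff[OF sub2(1) mods(2)] submodule_smult[OF sub2(1) a y] v(1) V(3) by blast
          ultimately have "mdiff R X2 (a \<odot>\<^bsub>X2\<^esub> y) v \<in> U" using v(3) unfolding U_def by blast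
          moreover have "a \<odot>\<^bsub>X2\<^esub> y = mdiff R X2 (a \<odot>\<^bsub>X2\<^esub> y) v \<oplus>\<^bsub>X2\<^esub> v"
            using mdiff_add(1)[OF mods(2)] a yc Vc v(1) by simp
          ultimately show "a \<in> ?P" using False a v(1) by blast
        }
      qed
      then have "?P = {c \<in> carrier R. c \<odot>\<^bsub>X3\<^esub> z \<in> V3}" by blast
      then have "?P \<in> S3" using P z(1) unfolding S3_def by auto
      then show ?thesis using n by blast
    qed
  qed
  then show "finite {P. primeideal P R \<and> (\<exists>x\<in>Z2. P = {a \<in> carrier R. a \<odot>\<^bsub>X2\<^esub> x \<in> V})}"
    using f1 f3 by (rule finite_subset[OF _ finite_UnI])
qed

text \<open>
  The case of \<open>wl_exact\<close> in which the third subquotient is zero: quotients of weakly Laskerian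
  modules.
\<close>

lemma wl_surj:
  assumes "Module.module R X1" "Module.module R X2"
    and "submodule Z1 R X1" "submodule B1 R X1" "B1 \<subseteq> Z1"
    and "submodule Z2 R X2" "submodule B2 R X2" "B2 \<subseteq> Z2"
    and "linrel R X1 X2 \<rho>" "\<And>x. x \<in> Z1 \<Longrightarrow> \<exists>y\<in>Z2. (x, y) \<in> \<rho>"
      "\<And>x y. (x, y) \<in> \<rho> \<Longrightarrow> x \<in> B1 \<Longrightarrow> y \<in> B2"
    and "\<And>y. y \<in> Z2 \<Longrightarrow> \<exists>x\<in>Z1. \<exists>y'. (x, y') \<in> \<rho> \<and> mdiff R X2 y y' \<in> B2"
    and "wl R X1 Z1 B1"
  shows "wl R X2 Z2 B2"
proof -
  have id: "\<And>y. y \<in> Z2 \<Longrightarrow> \<exists>z\<in>Z2. (y, z) \<in> Id_on (carrier X2)"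
    using submodule_mem[OF assms(6)] by blast
  show ?thesis
  by (rule wl_exact[where \<sigma> = "Id_on (carrier X2)" and ?Z3.0 = Z2 and ?B3.0 = Z2 and ?Z1.0 = Z1
        and \<rho> = \<rho> and ?B1.0 = B1 and ?X3.0 = X2 and ?X1.0 = X1])
    (use assms submodule_mem[OF assms(6)] id in \<open>auto simp: linrel_Id_on wl_trivial\<close>)
qed

text \<open>
  The case of \<open>wl_exact\<close> in which the first subquotient is zero: submodules of weakly Laskerian
  modules.
\<close>

lemma wl_inj:
  assumes "Module.module R X2" "Module.module R X3"
    and "submodule Z2 R X2" "submodule B2 R X2" "B2 \<subseteq> Z2"
    and "submodule Z3 R X3" "submodule B3 R X3" "B3 \<subseteq> Z3"
    and "linrel R X2 X3 \<sigma>" "\<And>y. y \<in> Z2 \<Longrightarrow> \<exists>z\<in>Z3. (y, z) \<in> \<sigma>"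
      "\<And>y z. (y, z) \<in> \<sigma> \<Longrightarrow> y \<in> B2 \<Longrightarrow> z \<in> B3"
    and refl: "\<And>y z. y \<in> Z2 \<Longrightarrow> (y, z) \<in> \<sigma> \<Longrightarrow> z \<in> B3 \<Longrightarrow> y \<in> B2"
    and "wl R X3 Z3 B3"
  shows "wl R X2 Z2 B2"
proof (rule wl_exact[where \<rho> = "Id_on (carrier X2)" and ?Z3.0 = Z3 and ?B3.0 = B3 and ?Z1.0 = B2
      and \<sigma> = \<sigma> and ?B1.0 = B2 and ?X3.0 = X3 and ?X1.0 = X2])
  fix y z assume y: "y \<in> Z2" "(y, z) \<in> \<sigma>" "z \<in> B3"
  have "y \<in> B2" by (rule refl[OF y])
  moreover have c: "y \<in> carrier X2" using y submodule_mem[OF assms(3)] by blast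
  ultimately show "\<exists>x\<in>B2. \<exists>y'. (x, y') \<in> Id_on (carrier X2) \<and> mdiff R X2 y y' \<in> B2"
    using mdiff_self[OF assms(1) c] submodule_zero[OF assms(4)] by force
next
  show "\<exists>y\<in>Z2. (x, y) \<in> Id_on (carrier X2)" if "x \<in> B2" for x
    using that assms(5) submodule_mem[OF assms(4)] by blast
qed (use assms submodule_mem[OF assms(4)] in \<open>auto simp: linrel_Id_on wl_trivial\<close>)

lemma weakly_Laskerian_iff:
  "weakly_Laskerian R W \<longleftrightarrow> Module.module R W \<and> wl R W (carrier W) {\<zero>\<^bsub>W\<^esub>}"
proof (cases "Module.module R W")
  case True
  interpret W: Module.module R W by fact
  have *: "Ass R (quot_module W U) =
      {P. primeideal P R \<and> (\<exists>x\<in>carrier W. P = {a \<in> carrier R. a \<odot>\<^bsub>W\<^esub> x \<in> U})}" if U: "submodule U R W" for U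
  proof -
    have "mod_ann R (quot_module W U) (U +>\<^bsub>W\<^esub> x) = {a \<in> carrier R. a \<odot>\<^bsub>W\<^esub> x \<in> U}"
      if "x \<in> carrier W" for x
      unfolding mod_ann_def quot_zero[OF True U]
    proof (rule Collect_cong, rule conj_cong[OF refl])
      fix a assume a: "a \<in> carrier R"
      show "a \<odot>\<^bsub>quot_module W U\<^esub> (U +>\<^bsub>W\<^esub> x) = U \<longleftrightarrow> a \<odot>\<^bsub>W\<^esub> x \<in> U"
        unfolding quot_smult[OF True U a that]
        by (rule coset_eq_zero_iff[OF True U W.smult_closed[OF a that]])
    qed
    then show ?thesis unfolding Ass_def quot_carrier[OF True U] by auto
  qed
  have "wl R W (carrier W) {\<zero>\<^bsub>W\<^esub>} \<longleftrightarrow> (\<forall>U. submodule U R W \<longrightarrow> finite (Ass R (quot_module W U)))"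
  proof -
    have "submodule U R W \<and> {\<zero>\<^bsub>W\<^esub>} \<subseteq> U \<and> U \<subseteq> carrier W \<longleftrightarrow> submodule U R W" for U
      using submodule_subset[of U R W] submodule_zero[of U R W] by blast
    then show ?thesis unfolding wl_def using * by simp
  qed
  then show ?thesis unfolding weakly_Laskerian_def using True by simp
qed (simp add: weakly_Laskerian_def)

text \<open>
  Submodules of \<open>Z/B\<close> correspond to the submodules between \<open>B\<close> and \<open>Z\<close>, and colon ideals agree
  under this correspondence. Through this lemma cohomology modules are replaced by pairs of
  submodules.
\<close>

lemma weakly_Laskerian_quot_iff:
  assumes "Module.module R C" "submodule Z R C" "submodule B R C" "B \<subseteq> Z"
  shows "weakly_Laskerian R (quot_module (C\<lparr>carrier := Z\<rparr>) B) \<longleftrightarrow> wl R C Z B"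
proof -
  let ?C = "C\<lparr>carrier := Z\<rparr>" and ?Q = "quot_module (C\<lparr>carrier := Z\<rparr>) B"
  interpret C: Module.module R C by fact
  have mC: "Module.module R ?C" by (rule submodule_module[OF assms(2,1)])
  have sB: "submodule B R ?C" by (rule submodule_restrict[OF assms(3,2,4,1)])
  have mQ: "Module.module R ?Q" by (rule quot_module[OF mC sB])
  interpret Q: Module.module R ?Q by fact
  have Zc: "\<And>x. x \<in> Z \<Longrightarrow> x \<in> carrier C" by (rule submodule_mem[OF assms(2)])
  have carr: "carrier ?Q = (\<lambda>x. B +>\<^bsub>C\<^esub> x) ` Z" using quot_carrier[OF mC sB] by simp
  have zero: "\<zero>\<^bsub>?Q\<^esub> = B" by (rule quot_zero[OF mC sB])
  have z: "B +>\<^bsub>C\<^esub> x = B \<longleftrightarrow> x \<in> B" if "x \<in> Z" for x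
    using coset_eq_zero_iff[OF mC sB, of x] that by simp
  define \<rho> where "\<rho> = {(x, B +>\<^bsub>C\<^esub> x) | x. x \<in> Z}"
  have add: "(B +>\<^bsub>C\<^esub> x) \<oplus>\<^bsub>?Q\<^esub> (B +>\<^bsub>C\<^esub> y) = B +>\<^bsub>C\<^esub> (x \<oplus>\<^bsub>C\<^esub> y)" if "x \<in> Z" "y \<in> Z" for x y
    using quot_add[OF mC sB, of x y] that by simp
  have smult: "a \<odot>\<^bsub>?Q\<^esub> (B +>\<^bsub>C\<^esub> y) = B +>\<^bsub>C\<^esub> (a \<odot>\<^bsub>C\<^esub> y)" if "a \<in> carrier R" "y \<in> Z" for a y
    using quot_smult[OF mC sB, of a y] that by simp
  have zz: "B +>\<^bsub>C\<^esub> \<zero>\<^bsub>C\<^esub> = B" using z[OF submodule_zero[OF assms(2)]] submodule_zero[OF assms(3)] by simp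
  have r: "linrel R C ?Q \<rho>"
    by (rule linrelI) (auto simp: \<rho>_def carr zero add smult Zc submodule_add[OF assms(2)]
        submodule_smult[OF assms(2)] zz intro!: exI[of _ "\<zero>\<^bsub>C\<^esub>"] submodule_zero[OF assms(2)])
  have s: "submodule {\<zero>\<^bsub>?Q\<^esub>} R ?Q" "submodule (carrier ?Q) R ?Q"
    by (rule submodule_zero_set[OF mQ], rule submodule_self[OF mQ])
  have "wl R C Z B" if w: "wl R ?Q (carrier ?Q) {\<zero>\<^bsub>?Q\<^esub>}"
  proof (rule wl_inj[OF assms(1) mQ assms(2-4) s(2,1) _ r _ _ _ w])
    show "\<exists>q\<in>carrier ?Q. (y, q) \<in> \<rho>" if "y \<in> Z" for y using that by (auto simp: \<rho>_def carr)
    show "q \<in> {\<zero>\<^bsub>?Q\<^esub>}" if "(y, q) \<in> \<rho>" "y \<in> B" for y q using that z by (auto simp: \<rho>_def zero)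
    show "y \<in> B" if "(y, q) \<in> \<rho>" "q \<in> {\<zero>\<^bsub>?Q\<^esub>}" for y q using that z by (auto simp: \<rho>_def zero)
  qed simp
  moreover have "wl R ?Q (carrier ?Q) {\<zero>\<^bsub>?Q\<^esub>}" if w: "wl R C Z B"
  proof (rule wl_surj[OF assms(1) mQ assms(2,3,4) s(2,1) _ r _ _ _ w])
    show "\<exists>q\<in>carrier ?Q. (y, q) \<in> \<rho>" if "y \<in> Z" for y using that by (auto simp: \<rho>_def carr)
    show "q \<in> {\<zero>\<^bsub>?Q\<^esub>}" if "(y, q) \<in> \<rho>" "y \<in> B" for y q using that z by (auto simp: \<rho>_def zero)
    show "\<exists>x\<in>Z. \<exists>q'. (x, q') \<in> \<rho> \<and> mdiff R ?Q q q' \<in> {\<zero>\<^bsub>?Q\<^esub>}" if q: "q \<in> carrier ?Q" for q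
    proof -
      obtain x where "x \<in> Z" "q = B +>\<^bsub>C\<^esub> x" using q by (auto simp: carr)
      then have "(x, q) \<in> \<rho>" by (auto simp: \<rho>_def)
      then show ?thesis using mdiff_self[OF mQ q] \<open>x \<in> Z\<close> by blast
    qed
  qed simp
  ultimately show ?thesis using mQ weakly_Laskerian_iff by blast
qed

section \<open>Free modules and the standard resolution\<close>

lemma free_carrier:
  "c \<in> carrier (free_module R B) \<longleftrightarrow> (\<forall>b. c b \<in> carrier R) \<and> (\<forall>b. b \<notin> B \<longrightarrow> c b = \<zero>\<^bsub>R\<^esub>) \<and>
     finite {b. c b \<noteq> \<zero>\<^bsub>R\<^esub>}"
  by (simp add: free_module_def)

lemma free_simps [simp]:
  "\<zero>\<^bsub>free_module R B\<^esub> = (\<lambda>b. \<zero>\<^bsub>R\<^esub>)"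
  "c \<oplus>\<^bsub>free_module R B\<^esub> d = (\<lambda>b. c b \<oplus>\<^bsub>R\<^esub> d b)"
  "a \<odot>\<^bsub>free_module R B\<^esub> c = (\<lambda>b. a \<otimes>\<^bsub>R\<^esub> c b)"
  by (simp_all add: free_module_def)

lemma free_module_module:
  fixes R :: "('a, 'r) ring_scheme" and B :: "'b set"
  assumes "cring R"
  shows "Module.module R (free_module R B)"
proof -
  interpret R: cring R by fact
  have fin: "finite {b. c b \<oplus>\<^bsub>R\<^esub> d b \<noteq> \<zero>\<^bsub>R\<^esub>}"
    if "finite {b. c b \<noteq> \<zero>\<^bsub>R\<^esub>}" "finite {b. d b \<noteq> \<zero>\<^bsub>R\<^esub>}" for c d :: "'b \<Rightarrow> 'a"
    by (rule finite_subset[OF _ finite_UnI[OF that]]) auto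
  have fin': "finite {b. a \<otimes>\<^bsub>R\<^esub> c b \<noteq> \<zero>\<^bsub>R\<^esub>}"
    if "finite {b. c b \<noteq> \<zero>\<^bsub>R\<^esub>}" "a \<in> carrier R" for a and c :: "'b \<Rightarrow> 'a"
    by (rule finite_subset[OF _ that(1)]) (use that in auto)
  have fin'': "finite {b. \<ominus>\<^bsub>R\<^esub> c b \<noteq> \<zero>\<^bsub>R\<^esub>}" if "finite {b. c b \<noteq> \<zero>\<^bsub>R\<^esub>}" for c :: "'b \<Rightarrow> 'a"
    by (rule finite_subset[OF _ that]) auto
  show ?thesis
  proof (rule moduleI)
    show "abelian_group (free_module R B)"
    proof (rule abelian_groupI)
      show "\<exists>d\<in>carrier (free_module R B). d \<oplus>\<^bsub>free_module R B\<^esub> c = \<zero>\<^bsub>free_module R B\<^esub>"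
        if "c \<in> carrier (free_module R B)" for c
        using that by (intro bexI[of _ "\<lambda>b. \<ominus>\<^bsub>R\<^esub> c b"]) (auto simp: free_carrier R.l_neg fin'')
    qed (auto simp: free_carrier R.a_ac fin)
  qed (auto simp: free_carrier R.is_cring fin' R.l_distr R.r_distr R.m_assoc)
qed

lemma free_unit_closed: "cring R \<Longrightarrow> b \<in> B \<Longrightarrow> free_unit R b \<in> carrier (free_module R B)"
proof -
  assume R: "cring R" and b: "b \<in> B"
  interpret R: cring R by fact
  have "finite {v. free_unit R b v \<noteq> \<zero>\<^bsub>R\<^esub>}"
    by (rule finite_subset[of _ "{b}"]) (auto simp: free_unit_def)
  then show ?thesis using b by (auto simp: free_carrier free_unit_def)
qed

lemma free_gen_finite:
  assumes "cring R" "submodule V R (free_module R B)" "\<And>b. b \<in> S \<Longrightarrow> free_unit R b \<in> V" "finite S"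
    "S \<subseteq> B" "c \<in> carrier (free_module R B)" "\<And>b. b \<notin> S \<Longrightarrow> c b = \<zero>\<^bsub>R\<^esub>"
  shows "c \<in> V"
  using assms(4,3,5-7)
proof (induction S arbitrary: c rule: finite_induct)
  case empty
  then have "c = \<zero>\<^bsub>free_module R B\<^esub>" by auto
  then show ?case using submodule_zero[OF assms(2)] by simp
next
  case (insert b S)
  interpret R: cring R by fact
  define d where "d = c(b := \<zero>\<^bsub>R\<^esub>)"
  have c: "\<And>b. c b \<in> carrier R" "\<And>b. b \<notin> B \<Longrightarrow> c b = \<zero>\<^bsub>R\<^esub>" "finite {b. c b \<noteq> \<zero>\<^bsub>R\<^esub>}"
    using insert.prems(3) by (auto simp: free_carrier)
  have "finite {b. d b \<noteq> \<zero>\<^bsub>R\<^esub>}" by (rule finite_subset[OF _ c(3)]) (auto simp: d_def)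
  then have d: "d \<in> carrier (free_module R B)" using c by (auto simp: free_carrier d_def)
  have "d \<in> V"
  proof (rule insert.IH[OF _ _ d])
    show "d v = \<zero>\<^bsub>R\<^esub>" if "v \<notin> S" for v using insert.prems(4)[of v] that by (simp add: d_def)
  qed (use insert.prems in auto)
  moreover have "c b \<odot>\<^bsub>free_module R B\<^esub> free_unit R b \<in> V"
    using c insert.prems by (intro submodule_smult[OF assms(2)]) auto
  ultimately have "d \<oplus>\<^bsub>free_module R B\<^esub> c b \<odot>\<^bsub>free_module R B\<^esub> free_unit R b \<in> V"
    by (rule submodule_add[OF assms(2)])
  moreover have "d \<oplus>\<^bsub>free_module R B\<^esub> c b \<odot>\<^bsub>free_module R B\<^esub> free_unit R b = c"
    using c by (auto simp: d_def free_unit_def)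
  ultimately show ?case by simp
qed

lemma free_gen:
  assumes "cring R" "submodule V R (free_module R B)" "\<And>b. b \<in> B \<Longrightarrow> free_unit R b \<in> V"
    "c \<in> carrier (free_module R B)"
  shows "c \<in> V"
  by (rule free_gen_finite[OF assms(1,2), where S = "{b. c b \<noteq> \<zero>\<^bsub>R\<^esub>}"])
    (use assms in \<open>auto simp: free_carrier\<close>)

lemma free_hom_eq:
  assumes "cring R" "Module.module R Y" "f \<in> mod_hom R (free_module R B) Y" "g \<in> mod_hom R (free_module R B) Y"
    "\<And>b. b \<in> B \<Longrightarrow> f (free_unit R b) = g (free_unit R b)" "c \<in> carrier (free_module R B)"
  shows "f c = g c"
proof -
  interpret R: cring R by fact
  note F = free_module_module[OF assms(1), of B]
  interpret F: Module.module R "free_module R B" by (rule F)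
  have "submodule {c \<in> carrier (free_module R B). f c = g c} R (free_module R B)"
  proof (rule submodule_intro[OF F])
    show "\<zero>\<^bsub>free_module R B\<^esub> \<in> {c \<in> carrier (free_module R B). f c = g c}"
      using mod_hom_zero[OF assms(3) F assms(2)] mod_hom_zero[OF assms(4) F assms(2)] F.zero_closed by simp
  qed (use F.add.m_closed F.smult_closed in \<open>auto simp del: free_simps simp: mod_hom_add[OF assms(3)] mod_hom_add[OF assms(4)]
      mod_hom_smult[OF assms(3)] mod_hom_smult[OF assms(4)]\<close>)
  then have "c \<in> {c \<in> carrier (free_module R B). f c = g c}"
    by (rule free_gen[OF assms(1) _ _ assms(6)]) (simp add: assms(5) free_unit_closed[OF assms(1)])
  then show ?thesis by simp
qed

context
  fixes R :: "('a, 'r) ring_scheme" and Y :: "('a, 'c) module" and B :: "'b set" and g :: "'b \<Rightarrow> 'c"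
  assumes Y: "Module.module R Y" and g: "\<And>b. b \<in> B \<Longrightarrow> g b \<in> carrier Y"
begin

interpretation Y: Module.module R Y by (rule Y)

lemma lin_ext_eq:
  assumes "c \<in> carrier (free_module R B)" "finite T" "{b. c b \<noteq> \<zero>\<^bsub>R\<^esub>} \<subseteq> T" "T \<subseteq> B"
  shows "lin_ext R B Y g c = (\<Oplus>\<^bsub>Y\<^esub>b\<in>T. c b \<odot>\<^bsub>Y\<^esub> g b)"
proof -
  have "(\<Oplus>\<^bsub>Y\<^esub>b\<in>{b. c b \<noteq> \<zero>\<^bsub>R\<^esub>}. c b \<odot>\<^bsub>Y\<^esub> g b) = (\<Oplus>\<^bsub>Y\<^esub>b\<in>T. c b \<odot>\<^bsub>Y\<^esub> g b)"
    by (rule Y.add.finprod_mono_neutral_cong_left) (use assms g in \<open>auto simp: free_carrier\<close>)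
  then show ?thesis using assms(1) by (simp add: lin_ext_def)
qed

lemma lin_ext_hom: "lin_ext R B Y g \<in> mod_hom R (free_module R B) Y"
proof (rule mod_homI)
  show "lin_ext R B Y g \<in> extensional (carrier (free_module R B))" by (simp add: lin_ext_def)
  have fs: "finite {b. c b \<noteq> \<zero>\<^bsub>R\<^esub>}" "{b. c b \<noteq> \<zero>\<^bsub>R\<^esub>} \<subseteq> B" if "c \<in> carrier (free_module R B)" for c
    using that by (auto simp: free_carrier)
  interpret F: Module.module R "free_module R B" by (rule free_module_module[OF Y.is_cring])
  show "lin_ext R B Y g c \<in> carrier Y" if c: "c \<in> carrier (free_module R B)" for c
    unfolding lin_ext_eq[OF c fs(1)[OF c] order_refl fs(2)[OF c]]
    using c g by (intro Y.finsum_closed) (auto simp: free_carrier)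
  show "lin_ext R B Y g (c \<oplus>\<^bsub>free_module R B\<^esub> d) = lin_ext R B Y g c \<oplus>\<^bsub>Y\<^esub> lin_ext R B Y g d"
    if c: "c \<in> carrier (free_module R B)" and d: "d \<in> carrier (free_module R B)" for c d
  proof -
    let ?T = "{b. c b \<noteq> \<zero>\<^bsub>R\<^esub>} \<union> {b. d b \<noteq> \<zero>\<^bsub>R\<^esub>}"
    have T: "finite ?T" "?T \<subseteq> B" using fs[OF c] fs[OF d] by auto
    have cR: "\<And>b. c b \<in> carrier R" "\<And>b. d b \<in> carrier R" using c d by (auto simp: free_carrier)
    have gT: "\<And>b. b \<in> ?T \<Longrightarrow> g b \<in> carrier Y" using g T(2) by blast
    have sT: "{b. (c \<oplus>\<^bsub>free_module R B\<^esub> d) b \<noteq> \<zero>\<^bsub>R\<^esub>} \<subseteq> ?T" by auto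
    have cd: "c \<oplus>\<^bsub>free_module R B\<^esub> d \<in> carrier (free_module R B)" using c d by (rule F.add.m_closed)
    have "lin_ext R B Y g (c \<oplus>\<^bsub>free_module R B\<^esub> d) = (\<Oplus>\<^bsub>Y\<^esub>b\<in>?T. (c b \<oplus>\<^bsub>R\<^esub> d b) \<odot>\<^bsub>Y\<^esub> g b)"
      using lin_ext_eq[OF cd T(1) sT T(2)] by simp
    also have "\<dots> = (\<Oplus>\<^bsub>Y\<^esub>b\<in>?T. c b \<odot>\<^bsub>Y\<^esub> g b \<oplus>\<^bsub>Y\<^esub> d b \<odot>\<^bsub>Y\<^esub> g b)"
      using cR gT by (intro Y.finsum_cong'[OF refl] Pi_I Y.smult_l_distr Y.add.m_closed Y.smult_closed) simp_all
    also have "\<dots> = (\<Oplus>\<^bsub>Y\<^esub>b\<in>?T. c b \<odot>\<^bsub>Y\<^esub> g b) \<oplus>\<^bsub>Y\<^esub> (\<Oplus>\<^bsub>Y\<^esub>b\<in>?T. d b \<odot>\<^bsub>Y\<^esub> g b)"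
      by (rule Y.finsum_addf) (use c d g T(2) in \<open>auto simp: free_carrier\<close>)
    also have "\<dots> = lin_ext R B Y g c \<oplus>\<^bsub>Y\<^esub> lin_ext R B Y g d"
      using lin_ext_eq[OF c T(1) _ T(2)] lin_ext_eq[OF d T(1) _ T(2)] by simp
    finally show ?thesis .
  qed
  show "lin_ext R B Y g (a \<odot>\<^bsub>free_module R B\<^esub> c) = a \<odot>\<^bsub>Y\<^esub> lin_ext R B Y g c"
    if a: "a \<in> carrier R" and c: "c \<in> carrier (free_module R B)" for a c
  proof -
    let ?T = "{b. c b \<noteq> \<zero>\<^bsub>R\<^esub>}"
    have cR: "\<And>b. c b \<in> carrier R" using c by (auto simp: free_carrier)
    have gT: "\<And>b. b \<in> ?T \<Longrightarrow> g b \<in> carrier Y" using g fs(2)[OF c] by blast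
    have sT: "{b. (a \<odot>\<^bsub>free_module R B\<^esub> c) b \<noteq> \<zero>\<^bsub>R\<^esub>} \<subseteq> ?T" using a by auto
    have ac: "a \<odot>\<^bsub>free_module R B\<^esub> c \<in> carrier (free_module R B)" using a c by (rule F.smult_closed)
    have "lin_ext R B Y g (a \<odot>\<^bsub>free_module R B\<^esub> c) = (\<Oplus>\<^bsub>Y\<^esub>b\<in>?T. (a \<otimes>\<^bsub>R\<^esub> c b) \<odot>\<^bsub>Y\<^esub> g b)"
      using lin_ext_eq[OF ac fs(1)[OF c] sT fs(2)[OF c]] by simp
    also have "\<dots> = (\<Oplus>\<^bsub>Y\<^esub>b\<in>?T. a \<odot>\<^bsub>Y\<^esub> (c b \<odot>\<^bsub>Y\<^esub> g b))"
      using a cR gT by (intro Y.finsum_cong'[OF refl] Pi_I Y.smult_assoc1 Y.smult_closed) simp_all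
    also have "\<dots> = a \<odot>\<^bsub>Y\<^esub> (\<Oplus>\<^bsub>Y\<^esub>b\<in>?T. c b \<odot>\<^bsub>Y\<^esub> g b)"
      by (rule Y.finsum_smult_ldistr[symmetric]) (use a c g fs(2)[OF c] in \<open>auto simp: free_carrier\<close>)
    also have "\<dots> = a \<odot>\<^bsub>Y\<^esub> lin_ext R B Y g c"
      using lin_ext_eq[OF c fs(1)[OF c] order_refl fs(2)[OF c]] by simp
    finally show ?thesis .
  qed
qed

lemma lin_ext_unit:
  assumes "b \<in> B"
  shows "lin_ext R B Y g (free_unit R b) = g b"
proof -
  have "lin_ext R B Y g (free_unit R b) = (\<Oplus>\<^bsub>Y\<^esub>v\<in>{b}. free_unit R b v \<odot>\<^bsub>Y\<^esub> g v)"
    using assms by (intro lin_ext_eq free_unit_closed) (auto simp: Y.is_cring free_unit_def)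
  also have "\<dots> = g b" using g[OF assms] by (simp add: free_unit_def)
  finally show ?thesis .
qed

end

text \<open>Free modules are projective, because the values of the lift on the basis can be chosen.\<close>

lemma free_lift:
  assumes "Module.module R V" "Module.module R W" "g \<in> mod_hom R V W"
    "\<chi> \<in> mod_hom R (free_module R B) W" "\<And>c. c \<in> carrier (free_module R B) \<Longrightarrow> \<chi> c \<in> g ` carrier V"
  shows "\<exists>v\<in>mod_hom R (free_module R B) V. \<forall>c\<in>carrier (free_module R B). g (v c) = \<chi> c"
proof -
  interpret V: Module.module R V by fact
  have "\<forall>b\<in>B. \<exists>y\<in>carrier V. g y = \<chi> (free_unit R b)"
    using assms(5) free_unit_closed[OF V.is_cring] by (metis imageE)
  then obtain h where h: "\<And>b. b \<in> B \<Longrightarrow> h b \<in> carrier V" "\<And>b. b \<in> B \<Longrightarrow> g (h b) = \<chi> (free_unit R b)"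
    by metis
  let ?v = "lin_ext R B V h"
  have v: "?v \<in> mod_hom R (free_module R B) V" by (rule lin_ext_hom[OF assms(1) h(1)])
  have "g (?v c) = \<chi> c" if c: "c \<in> carrier (free_module R B)" for c
  proof -
    have "compose (carrier (free_module R B)) g ?v c = \<chi> c"
    proof (rule free_hom_eq[OF V.is_cring assms(2) mod_hom_compose[OF v assms(3)] assms(4) _ c])
      show "Module.module R (free_module R B)" by (rule free_module_module[OF V.is_cring])
      show "compose (carrier (free_module R B)) g ?v (free_unit R b) = \<chi> (free_unit R b)" if "b \<in> B" for b
        using that h lin_ext_unit[OF assms(1) h(1) that] free_unit_closed[OF V.is_cring that]
        by (simp add: compose_eq)
    qed
    then show ?thesis using c by (simp add: compose_eq)
  qed
  then show ?thesis using v by blast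
qed

subsection \<open>Formal linear combinations\<close>

lemma comb_value_Nil [simp]: "comb_value R [] = (\<lambda>b. \<zero>\<^bsub>R\<^esub>)"
  by (simp add: comb_value_def)

context
  fixes R :: "('a, 'r) ring_scheme" and B :: "'b set"
  assumes R: "cring R"
begin

interpretation R: cring R by (rule R)
interpretation F: Module.module R "free_module R B" by (rule free_module_module[OF R])

lemma comb_value_in: "set l \<subseteq> carrier R \<times> B \<Longrightarrow> comb_value R l v \<in> carrier R"
  by (induction l) (auto simp: comb_value_def)

lemma comb_value_Cons:
  assumes "a \<in> carrier R" "set l \<subseteq> carrier R \<times> B"
  shows "comb_value R ((a, u) # l) =
    a \<odot>\<^bsub>free_module R B\<^esub> free_unit R u \<oplus>\<^bsub>free_module R B\<^esub> comb_value R l"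
proof
  fix v
  show "comb_value R ((a, u) # l) v =
    (a \<odot>\<^bsub>free_module R B\<^esub> free_unit R u \<oplus>\<^bsub>free_module R B\<^esub> comb_value R l) v"
    using assms comb_value_in[OF assms(2), of v]
    by (simp add: comb_value_def free_unit_def)
qed

lemma comb_value_closed: "set l \<subseteq> carrier R \<times> B \<Longrightarrow> comb_value R l \<in> carrier (free_module R B)"
proof (induction l)
  case Nil
  then show ?case using F.zero_closed by simp
next
  case (Cons p l)
  then show ?case
    using free_unit_closed[OF R, of "snd p" B] F.add.m_closed F.smult_closed
    by (cases p) (auto simp: comb_value_Cons simp del: free_simps)
qed

lemma comb_value_append:
  assumes "set l \<subseteq> carrier R \<times> B" "set k \<subseteq> carrier R \<times> B"
  shows "comb_value R (l @ k) = comb_value R l \<oplus>\<^bsub>free_module R B\<^esub> comb_value R k"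
  using assms(1)
proof (induction l)
  case Nil
  then show ?case using F.l_zero[OF comb_value_closed[OF assms(2)]] by simp
next
  case (Cons p l)
  obtain a u where p: "p = (a, u)" by (cases p)
  have "a \<in> carrier R" "u \<in> B" "set l \<subseteq> carrier R \<times> B" "set (l @ k) \<subseteq> carrier R \<times> B"
    using Cons.prems assms p by auto
  then show ?case
    using Cons.IH F.a_assoc[OF F.smult_closed[OF _ free_unit_closed[OF R]] comb_value_closed comb_value_closed[OF assms(2)]]
    by (simp add: p comb_value_Cons del: free_simps)
qed

lemma comb_value_smult:
  assumes "set l \<subseteq> carrier R \<times> B" "a \<in> carrier R"
  shows "comb_value R (map (\<lambda>(r, u). (a \<otimes>\<^bsub>R\<^esub> r, u)) l) = a \<odot>\<^bsub>free_module R B\<^esub> comb_value R l"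
  using assms(1)
proof (induction l)
  case Nil
  then show ?case using assms by simp
next
  case (Cons p l)
  obtain r u where p: "p = (r, u)" by (cases p)
  have *: "r \<in> carrier R" "u \<in> B" "set l \<subseteq> carrier R \<times> B"
    "set (map (\<lambda>(r, u). (a \<otimes>\<^bsub>R\<^esub> r, u)) l) \<subseteq> carrier R \<times> B"
    using Cons.prems assms p by auto
  have "comb_value R (map (\<lambda>(r, u). (a \<otimes>\<^bsub>R\<^esub> r, u)) (p # l)) =
      (a \<otimes>\<^bsub>R\<^esub> r) \<odot>\<^bsub>free_module R B\<^esub> free_unit R u \<oplus>\<^bsub>free_module R B\<^esub> a \<odot>\<^bsub>free_module R B\<^esub> comb_value R l"
    using * assms Cons.IH by (simp add: p comb_value_Cons del: free_simps)
  also have "\<dots> = a \<odot>\<^bsub>free_module R B\<^esub> comb_value R (p # l)"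
    using * assms free_unit_closed[OF R *(2)] comb_value_closed[OF *(3)]
    by (simp add: p comb_value_Cons F.smult_r_distr F.smult_assoc1 del: free_simps)
  finally show ?case .
qed

lemma comb_value_surj:
  assumes "c \<in> carrier (free_module R B)"
  shows "\<exists>l. set l \<subseteq> carrier R \<times> B \<and> comb_value R l = c"
proof -
  have "submodule (comb_value R ` {l. set l \<subseteq> carrier R \<times> B}) R (free_module R B)"
  proof (rule submodule_intro[OF free_module_module[OF R]])
    show "\<zero>\<^bsub>free_module R B\<^esub> \<in> comb_value R ` {l. set l \<subseteq> carrier R \<times> B}"
      by (rule image_eqI[of _ _ "[]"]) auto
  next
    fix c d assume "c \<in> comb_value R ` {l. set l \<subseteq> carrier R \<times> B}" "d \<in> comb_value R ` {l. set l \<subseteq> carrier R \<times> B}"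
    then obtain l k where "set l \<subseteq> carrier R \<times> B" "set k \<subseteq> carrier R \<times> B" "c = comb_value R l" "d = comb_value R k"
      by auto
    then show "c \<oplus>\<^bsub>free_module R B\<^esub> d \<in> comb_value R ` {l. set l \<subseteq> carrier R \<times> B}"
      using comb_value_append by (intro image_eqI[of _ _ "l @ k"]) auto
  next
    fix a c assume a: "a \<in> carrier R" and "c \<in> comb_value R ` {l. set l \<subseteq> carrier R \<times> B}"
    then obtain l where "set l \<subseteq> carrier R \<times> B" "c = comb_value R l" by auto
    then show "a \<odot>\<^bsub>free_module R B\<^esub> c \<in> comb_value R ` {l. set l \<subseteq> carrier R \<times> B}"
      using comb_value_smult a
      by (intro image_eqI[of _ _ "map (\<lambda>(r, u). (a \<otimes>\<^bsub>R\<^esub> r, u)) l"]) auto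
  qed (use comb_value_closed in auto)
  moreover have "free_unit R b \<in> comb_value R ` {l. set l \<subseteq> carrier R \<times> B}" if "b \<in> B" for b
    using that by (intro image_eqI[of _ _ "[(\<one>\<^bsub>R\<^esub>, b)]"]) (auto simp: comb_value_def free_unit_def)
  ultimately have "c \<in> comb_value R ` {l. set l \<subseteq> carrier R \<times> B}" by (rule free_gen[OF R _ _ assms])
  then show ?thesis by auto
qed

end

subsection \<open>Exactness and functoriality of the standard resolution\<close>

lemma res_module_module: "cring R \<Longrightarrow> Module.module R (res_module R X n)"
  unfolding res_module_def by (rule free_module_module)

lemma res_basis_Suc:
  "res_basis R X (Suc n) = {Rel l | l. set l \<subseteq> carrier R \<times> res_basis R X n \<and>
     (case n of 0 \<Rightarrow> res_aug R X (comb_value R l) = \<zero>\<^bsub>X\<^esub>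
      | Suc m \<Rightarrow> res_diff R X m (comb_value R l) = \<zero>\<^bsub>res_module R X m\<^esub>)}"
  by (cases n) (simp_all add: res_aug_def res_diff_def res_module_def)

context
  fixes R :: "('a, 'r) ring_scheme" and X :: "('a, 'x) module"
  assumes X: "Module.module R X"
begin

interpretation X: Module.module R X by (rule X)

lemma rel_value_closed:
  assumes "b \<in> res_basis R X (Suc n)"
  shows "comb_value R (rel_of b) \<in> carrier (res_module R X n)"
  using assms comb_value_closed[OF X.is_cring]
  by (auto simp: res_basis_Suc res_module_def simp del: res_basis.simps)

lemma res_aug_hom: "res_aug R X \<in> mod_hom R (res_module R X 0) X"
  unfolding res_aug_def res_module_def by (rule lin_ext_hom[OF X]) auto

lemma res_diff_hom: "res_diff R X n \<in> mod_hom R (res_module R X (Suc n)) (res_module R X n)"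
proof -
  have "res_diff R X n \<in> mod_hom R (free_module R (res_basis R X (Suc n))) (res_module R X n)"
    unfolding res_diff_def
    by (rule lin_ext_hom[OF res_module_module[OF X.is_cring] rel_value_closed])
  then show ?thesis by (simp only: res_module_def[of R X "Suc n"])
qed

lemma res_diff_unit:
  "b \<in> res_basis R X (Suc n) \<Longrightarrow> res_diff R X n (free_unit R b) = comb_value R (rel_of b)"
  unfolding res_diff_def by (rule lin_ext_unit[OF res_module_module[OF X.is_cring] rel_value_closed])

lemma res_aug_unit: "x \<in> carrier X \<Longrightarrow> res_aug R X (free_unit R (Gen x)) = x"
  unfolding res_aug_def by (subst lin_ext_unit[OF X]) auto

lemma gen_unit_closed: "x \<in> carrier X \<Longrightarrow> free_unit R (Gen x) \<in> carrier (res_module R X 0)"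
  unfolding res_module_def by (intro free_unit_closed[OF X.is_cring]) auto

text \<open>
  The basis in each degree consists of all formal combinations whose value is a cycle. A cycle is
  therefore the image of a single basis element, which is more than exactness.
\<close>

lemma rel_unit_exists:
  assumes "c \<in> carrier (res_module R X n)"
    "case n of 0 \<Rightarrow> res_aug R X c = \<zero>\<^bsub>X\<^esub> | Suc m \<Rightarrow> res_diff R X m c = \<zero>\<^bsub>res_module R X m\<^esub>"
  shows "\<exists>b\<in>res_basis R X (Suc n). res_diff R X n (free_unit R b) = c"
proof -
  obtain l where l: "set l \<subseteq> carrier R \<times> res_basis R X n" "comb_value R l = c"
    using comb_value_surj[OF X.is_cring assms(1)[unfolded res_module_def]] by blast
  have "Rel l \<in> res_basis R X (Suc n)"
    using l assms(2) by (simp add: res_basis_Suc del: res_basis.simps split: nat.splits)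
  then show ?thesis using res_diff_unit[of "Rel l" n] l by auto
qed

lemma res_exact_aug:
  assumes "c \<in> carrier (res_module R X 0)"
  shows "res_aug R X c = \<zero>\<^bsub>X\<^esub> \<longleftrightarrow> (\<exists>d\<in>carrier (res_module R X 1). res_diff R X 0 d = c)"
proof
  assume "res_aug R X c = \<zero>\<^bsub>X\<^esub>"
  then obtain b where b: "b \<in> res_basis R X (Suc 0)" "res_diff R X 0 (free_unit R b) = c"
    using rel_unit_exists[OF assms] by auto
  have "free_unit R b \<in> carrier (res_module R X 1)"
    using free_unit_closed[OF X.is_cring b(1)] by (simp only: res_module_def One_nat_def)
  then show "\<exists>d\<in>carrier (res_module R X 1). res_diff R X 0 d = c" using b(2) by blast
next
  let ?B = "res_basis R X (Suc 0)"
  assume "\<exists>d\<in>carrier (res_module R X 1). res_diff R X 0 d = c"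
  then obtain d where d: "d \<in> carrier (free_module R ?B)" "res_diff R X 0 d = c"
    unfolding res_module_def by auto
  have F: "Module.module R (free_module R ?B)" by (rule free_module_module[OF X.is_cring])
  have "compose (carrier (free_module R ?B)) (res_aug R X) (res_diff R X 0) d =
      (\<lambda>x\<in>carrier (free_module R ?B). \<zero>\<^bsub>X\<^esub>) d"
  proof (rule free_hom_eq[OF X.is_cring X _ _ _ d(1)])
    show "compose (carrier (free_module R ?B)) (res_aug R X) (res_diff R X 0) \<in> mod_hom R (free_module R ?B) X"
      by (rule mod_hom_compose[OF _ res_aug_hom F])
        (use res_diff_hom[of 0] in \<open>simp add: res_module_def[of R X "Suc 0"]\<close>)
    show "(\<lambda>x\<in>carrier (free_module R ?B). \<zero>\<^bsub>X\<^esub>) \<in> mod_hom R (free_module R ?B) X"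
      by (rule mod_hom_zero_map[OF F X])
    show "compose (carrier (free_module R ?B)) (res_aug R X) (res_diff R X 0) (free_unit R b) =
        (\<lambda>x\<in>carrier (free_module R ?B). \<zero>\<^bsub>X\<^esub>) (free_unit R b)" if b: "b \<in> ?B" for b
      using b res_diff_unit[OF b] free_unit_closed[OF X.is_cring b]
      by (auto simp: compose_eq res_basis_Suc[of R X 0] simp del: res_basis.simps)
  qed
  then show "res_aug R X c = \<zero>\<^bsub>X\<^esub>" using d by (simp add: compose_eq)
qed

lemma res_exact:
  assumes "c \<in> carrier (res_module R X (Suc n))"
  shows "res_diff R X n c = \<zero>\<^bsub>res_module R X n\<^esub> \<longleftrightarrow>
    (\<exists>d\<in>carrier (res_module R X (Suc (Suc n))). res_diff R X (Suc n) d = c)"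
proof
  assume "res_diff R X n c = \<zero>\<^bsub>res_module R X n\<^esub>"
  then show "\<exists>d\<in>carrier (res_module R X (Suc (Suc n))). res_diff R X (Suc n) d = c"
    using rel_unit_exists[OF assms] free_unit_closed[OF X.is_cring, of _ "res_basis R X (Suc (Suc n))"]
    by (fastforce simp: res_module_def[of R X "Suc (Suc n)"] simp del: res_basis.simps)
next
  let ?B = "res_basis R X (Suc (Suc n))"
  assume "\<exists>d\<in>carrier (res_module R X (Suc (Suc n))). res_diff R X (Suc n) d = c"
  then obtain d where d: "d \<in> carrier (free_module R ?B)" "res_diff R X (Suc n) d = c"
    unfolding res_module_def by blast
  have F: "Module.module R (free_module R ?B)" by (rule free_module_module[OF X.is_cring])
  have "compose (carrier (free_module R ?B)) (res_diff R X n) (res_diff R X (Suc n)) d =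
      (\<lambda>x\<in>carrier (free_module R ?B). \<zero>\<^bsub>res_module R X n\<^esub>) d"
  proof (rule free_hom_eq[OF X.is_cring res_module_module[OF X.is_cring] _ _ _ d(1)])
    show "compose (carrier (free_module R ?B)) (res_diff R X n) (res_diff R X (Suc n)) \<in>
        mod_hom R (free_module R ?B) (res_module R X n)"
      by (rule mod_hom_compose[OF _ res_diff_hom F])
        (use res_diff_hom[of "Suc n"] in \<open>simp add: res_module_def[of R X "Suc (Suc n)"]\<close>)
    show "(\<lambda>x\<in>carrier (free_module R ?B). \<zero>\<^bsub>res_module R X n\<^esub>) \<in> mod_hom R (free_module R ?B) (res_module R X n)"
      by (rule mod_hom_zero_map[OF F res_module_module[OF X.is_cring]])
    show "compose (carrier (free_module R ?B)) (res_diff R X n) (res_diff R X (Suc n)) (free_unit R b) =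
        (\<lambda>x\<in>carrier (free_module R ?B). \<zero>\<^bsub>res_module R X n\<^esub>) (free_unit R b)" if b: "b \<in> ?B" for b
      using b res_diff_unit[OF b] free_unit_closed[OF X.is_cring b]
      by (auto simp: compose_eq res_basis_Suc[of R X "Suc n"] simp del: res_basis.simps)
  qed
  then show "res_diff R X n c = \<zero>\<^bsub>res_module R X n\<^esub>" using d by (simp add: compose_eq)
qed

end

context
  fixes R :: "('a, 'r) ring_scheme" and X :: "('a, 'x) module" and Y :: "('a, 'y) module" and f :: "'x \<Rightarrow> 'y"
  assumes X: "Module.module R X" and Y: "Module.module R Y"
    and f: "restrict f (carrier X) \<in> mod_hom R X Y"
begin

interpretation X: Module.module R X by (rule X)

private lemma f_closed: "x \<in> carrier X \<Longrightarrow> f x \<in> carrier Y"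
  using mod_hom_closed[OF f, of x] by simp

text \<open>
  That \<open>map_syz id f\<close> maps basis elements to basis elements and that \<open>res_map\<close> commutes with the
  differentials depend on each other across degrees: a combination is a basis element only if its
  value is a cycle. The following lemmas on \<open>res_map\<close> thus assume the former in the degrees that
  they concern, and \<open>map_syz_res_basis\<close> then proves it by induction on the degree.
\<close>

lemma res_map_hom_aux:
  assumes "\<And>b. b \<in> res_basis R X n \<Longrightarrow> map_syz id f b \<in> res_basis R Y n"
  shows "res_map R X Y f n \<in> mod_hom R (res_module R X n) (res_module R Y n)"
    and "b \<in> res_basis R X n \<Longrightarrow> res_map R X Y f n (free_unit R b) = free_unit R (map_syz id f b)"
proof -
  have *: "\<And>b. b \<in> res_basis R X n \<Longrightarrow> free_unit R (map_syz id f b) \<in> carrier (res_module R Y n)"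
    unfolding res_module_def by (rule free_unit_closed[OF X.is_cring assms])
  show "res_map R X Y f n \<in> mod_hom R (res_module R X n) (res_module R Y n)"
    unfolding res_map_def res_module_def[of R X]
    by (rule lin_ext_hom[OF res_module_module[OF X.is_cring] *])
  show "b \<in> res_basis R X n \<Longrightarrow> res_map R X Y f n (free_unit R b) = free_unit R (map_syz id f b)"
    unfolding res_map_def by (rule lin_ext_unit[OF res_module_module[OF X.is_cring] *])
qed

lemma res_map_comb_aux:
  assumes "\<And>b. b \<in> res_basis R X n \<Longrightarrow> map_syz id f b \<in> res_basis R Y n"
    "set l \<subseteq> carrier R \<times> res_basis R X n"
  shows "res_map R X Y f n (comb_value R l) = comb_value R (map (map_prod id (map_syz id f)) l)"
  using assms(2)
proof (induction l)
  case Nil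
  show ?case using mod_hom_zero[OF res_map_hom_aux(1)[OF assms(1)] res_module_module[OF X.is_cring] res_module_module[OF X.is_cring]]
    by (simp add: res_module_def)
next
  case (Cons p l)
  obtain a u where p: "p = (a, u)" by (cases p)
  have *: "a \<in> carrier R" "u \<in> res_basis R X n" "set l \<subseteq> carrier R \<times> res_basis R X n"
    "set (map (map_prod id (map_syz id f)) l) \<subseteq> carrier R \<times> res_basis R Y n"
    using Cons.prems assms p by auto
  interpret P: Module.module R "res_module R X n" by (rule res_module_module[OF X.is_cring])
  have c: "free_unit R u \<in> carrier (res_module R X n)" "comb_value R l \<in> carrier (res_module R X n)"
    using free_unit_closed[OF X.is_cring *(2)] comb_value_closed[OF X.is_cring *(3)] by (simp_all add: res_module_def)
  note h = res_map_hom_aux(1)[OF assms(1)]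
  have "res_map R X Y f n (comb_value R (p # l)) =
      res_map R X Y f n (a \<odot>\<^bsub>res_module R X n\<^esub> free_unit R u \<oplus>\<^bsub>res_module R X n\<^esub> comb_value R l)"
    unfolding p comb_value_Cons[OF X.is_cring *(1,3)] res_module_def ..
  also have "\<dots> = a \<odot>\<^bsub>res_module R Y n\<^esub> res_map R X Y f n (free_unit R u)
      \<oplus>\<^bsub>res_module R Y n\<^esub> res_map R X Y f n (comb_value R l)"
    using * c by (simp only: mod_hom_add[OF h] mod_hom_smult[OF h] P.smult_closed)
  also have "\<dots> = comb_value R ((a, map_syz id f u) # map (map_prod id (map_syz id f)) l)"
    by (simp only: comb_value_Cons[OF X.is_cring *(1,4)] Cons.IH[OF *(3)] res_map_hom_aux(2)[OF assms(1) *(2)]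
      res_module_def)
  also have "\<dots> = comb_value R (map (map_prod id (map_syz id f)) (p # l))" by (simp add: p)
  finally show ?case .
qed

lemma res_map_aug_aux:
  assumes "\<And>b. b \<in> res_basis R X 0 \<Longrightarrow> map_syz id f b \<in> res_basis R Y 0" "c \<in> carrier (res_module R X 0)"
  shows "res_aug R Y (res_map R X Y f 0 c) = f (res_aug R X c)"
proof -
  let ?P = "res_module R X 0"
  note P = res_module_module[OF X.is_cring, of X 0]
  have "compose (carrier ?P) (res_aug R Y) (res_map R X Y f 0) c =
      compose (carrier ?P) (restrict f (carrier X)) (res_aug R X) c"
  proof (rule free_hom_eq[OF X.is_cring Y _ _ _ assms(2)[unfolded res_module_def]])
    show "compose (carrier ?P) (res_aug R Y) (res_map R X Y f 0) \<in> mod_hom R (free_module R (res_basis R X 0)) Y"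
      using mod_hom_compose[OF res_map_hom_aux(1)[OF assms(1)] res_aug_hom[OF Y] P] by (simp add: res_module_def)
    show "compose (carrier ?P) (restrict f (carrier X)) (res_aug R X) \<in> mod_hom R (free_module R (res_basis R X 0)) Y"
      using mod_hom_compose[OF res_aug_hom[OF X] f P] by (simp add: res_module_def)
    show "compose (carrier ?P) (res_aug R Y) (res_map R X Y f 0) (free_unit R b) =
        compose (carrier ?P) (restrict f (carrier X)) (res_aug R X) (free_unit R b)" if b: "b \<in> res_basis R X 0" for b
    proof -
      obtain x where x: "b = Gen x" "x \<in> carrier X" using b by auto
      then show ?thesis
        using res_map_hom_aux(2)[OF assms(1) b] gen_unit_closed[OF X x(2)] res_aug_unit[OF X x(2)]
          res_aug_unit[OF Y f_closed[OF x(2)]] by (simp add: compose_eq)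
    qed
  qed
  then show ?thesis using assms(2) mod_hom_closed[OF res_aug_hom[OF X] assms(2)] by (simp add: compose_eq)
qed

lemma res_map_diff_aux:
  assumes "\<And>b. b \<in> res_basis R X n \<Longrightarrow> map_syz id f b \<in> res_basis R Y n"
    "\<And>b. b \<in> res_basis R X (Suc n) \<Longrightarrow> map_syz id f b \<in> res_basis R Y (Suc n)"
    "c \<in> carrier (res_module R X (Suc n))"
  shows "res_diff R Y n (res_map R X Y f (Suc n) c) = res_map R X Y f n (res_diff R X n c)"
proof -
  let ?P = "res_module R X (Suc n)"
  note P = res_module_module[OF X.is_cring, of X "Suc n"]
  have e: "free_module R (res_basis R X (Suc n)) = ?P" by (simp only: res_module_def)
  have "compose (carrier ?P) (res_diff R Y n) (res_map R X Y f (Suc n)) c =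
      compose (carrier ?P) (res_map R X Y f n) (res_diff R X n) c"
  proof (rule free_hom_eq[OF X.is_cring res_module_module[OF X.is_cring], of _ "res_basis R X (Suc n)", unfolded e])
    show "compose (carrier ?P) (res_diff R Y n) (res_map R X Y f (Suc n)) \<in> mod_hom R ?P (res_module R Y n)"
      by (rule mod_hom_compose[OF res_map_hom_aux(1)[OF assms(2)] res_diff_hom[OF Y] P])
    show "compose (carrier ?P) (res_map R X Y f n) (res_diff R X n) \<in> mod_hom R ?P (res_module R Y n)"
      by (rule mod_hom_compose[OF res_diff_hom[OF X] res_map_hom_aux(1)[OF assms(1)] P])
    show "c \<in> carrier ?P" by fact
    show "compose (carrier ?P) (res_diff R Y n) (res_map R X Y f (Suc n)) (free_unit R b) =
        compose (carrier ?P) (res_map R X Y f n) (res_diff R X n) (free_unit R b)"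
      if b: "b \<in> res_basis R X (Suc n)" for b
    proof -
      obtain l where l: "b = Rel l" "set l \<subseteq> carrier R \<times> res_basis R X n"
        using b unfolding res_basis_Suc by blast
      have u: "free_unit R b \<in> carrier ?P" unfolding res_module_def by (rule free_unit_closed[OF X.is_cring b])
      show ?thesis
        using l u res_map_hom_aux(2)[OF assms(2) b] res_diff_unit[OF X b] res_diff_unit[OF Y assms(2)[OF b]]
          res_map_comb_aux[OF assms(1) l(2)]
        by (simp add: compose_eq)
    qed
  qed
  then show ?thesis using assms(3) by (simp add: compose_eq)
qed

lemma map_syz_res_basis:
  "b \<in> res_basis R X n \<Longrightarrow> map_syz id f b \<in> res_basis R Y n"
proof -
  let ?bp = "\<lambda>n. \<forall>b. b \<in> res_basis R X n \<longrightarrow> map_syz id f b \<in> res_basis R Y n"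
  have step: "?bp (Suc n)" if bp: "?bp n" and
    c: "\<And>c. c \<in> carrier (res_module R X n) \<Longrightarrow>
      (case n of 0 \<Rightarrow> res_aug R X c = \<zero>\<^bsub>X\<^esub> | Suc m \<Rightarrow> res_diff R X m c = \<zero>\<^bsub>res_module R X m\<^esub>) \<Longrightarrow>
      (case n of 0 \<Rightarrow> res_aug R Y (res_map R X Y f n c) = \<zero>\<^bsub>Y\<^esub>
        | Suc m \<Rightarrow> res_diff R Y m (res_map R X Y f n c) = \<zero>\<^bsub>res_module R Y m\<^esub>)" for n
  proof (intro allI impI)
    fix b assume "b \<in> res_basis R X (Suc n)"
    then obtain l where l: "b = Rel l" "set l \<subseteq> carrier R \<times> res_basis R X n"
      "case n of 0 \<Rightarrow> res_aug R X (comb_value R l) = \<zero>\<^bsub>X\<^esub>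
        | Suc m \<Rightarrow> res_diff R X m (comb_value R l) = \<zero>\<^bsub>res_module R X m\<^esub>" unfolding res_basis_Suc by blast
    have "comb_value R l \<in> carrier (res_module R X n)"
      unfolding res_module_def by (rule comb_value_closed[OF X.is_cring l(2)])
    have e: "res_map R X Y f n (comb_value R l) = comb_value R (map (map_prod id (map_syz id f)) l)"
      using res_map_comb_aux[OF _ l(2)] bp by blast
    from c[OF \<open>comb_value R l \<in> _\<close> l(3)] e have "case n of 0 \<Rightarrow> res_aug R Y (comb_value R (map (map_prod id (map_syz id f)) l)) = \<zero>\<^bsub>Y\<^esub>
        | Suc m \<Rightarrow> res_diff R Y m (comb_value R (map (map_prod id (map_syz id f)) l)) = \<zero>\<^bsub>res_module R Y m\<^esub>"
      by (cases n) (simp_all only: nat.case)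
    moreover have "set (map (map_prod id (map_syz id f)) l) \<subseteq> carrier R \<times> res_basis R Y n"
      using l(2) bp by auto
    ultimately show "map_syz id f b \<in> res_basis R Y (Suc n)"
      using l(1) unfolding res_basis_Suc by auto
  qed
  have "?bp n \<and> ?bp (Suc n)" for n
  proof (induction n)
    case 0
    have 0: "?bp 0" using f_closed by auto
    moreover have "?bp (Suc 0)"
    proof (rule step[OF 0])
      fix c assume c: "c \<in> carrier (res_module R X 0)"
        "case 0 of 0 \<Rightarrow> res_aug R X c = \<zero>\<^bsub>X\<^esub> | Suc m \<Rightarrow> res_diff R X m c = \<zero>\<^bsub>res_module R X m\<^esub>"
      then show "case 0 of 0 \<Rightarrow> res_aug R Y (res_map R X Y f 0 c) = \<zero>\<^bsub>Y\<^esub>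
        | Suc m \<Rightarrow> res_diff R Y m (res_map R X Y f 0 c) = \<zero>\<^bsub>res_module R Y m\<^esub>"
        using res_map_aug_aux[OF _ c(1)] 0 mod_hom_zero[OF f X Y] by simp
    qed
    ultimately show ?case by blast
  next
    case (Suc n)
    have "?bp (Suc (Suc n))"
    proof (rule step)
      fix c assume c: "c \<in> carrier (res_module R X (Suc n))"
        "case Suc n of 0 \<Rightarrow> res_aug R X c = \<zero>\<^bsub>X\<^esub> | Suc m \<Rightarrow> res_diff R X m c = \<zero>\<^bsub>res_module R X m\<^esub>"
      then show "case Suc n of 0 \<Rightarrow> res_aug R Y (res_map R X Y f (Suc n) c) = \<zero>\<^bsub>Y\<^esub>
        | Suc m \<Rightarrow> res_diff R Y m (res_map R X Y f (Suc n) c) = \<zero>\<^bsub>res_module R Y m\<^esub>"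
        using res_map_diff_aux[OF _ _ c(1)] Suc
          mod_hom_zero[OF res_map_hom_aux(1) res_module_module[OF X.is_cring] res_module_module[OF X.is_cring], of n]
        by simp
    qed (use Suc in blast)
    then show ?case using Suc by blast
  qed
  then show "b \<in> res_basis R X n \<Longrightarrow> map_syz id f b \<in> res_basis R Y n" by blast
qed

lemma res_map_hom: "res_map R X Y f n \<in> mod_hom R (res_module R X n) (res_module R Y n)"
  by (rule res_map_hom_aux(1)[OF map_syz_res_basis])

lemma res_map_unit:
  "b \<in> res_basis R X n \<Longrightarrow> res_map R X Y f n (free_unit R b) = free_unit R (map_syz id f b)"
  by (rule res_map_hom_aux(2)[OF map_syz_res_basis])

lemma res_map_aug:
  "c \<in> carrier (res_module R X 0) \<Longrightarrow> res_aug R Y (res_map R X Y f 0 c) = f (res_aug R X c)"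
  by (rule res_map_aug_aux[OF map_syz_res_basis])

lemma res_map_diff:
  "c \<in> carrier (res_module R X (Suc n)) \<Longrightarrow>
    res_diff R Y n (res_map R X Y f (Suc n) c) = res_map R X Y f n (res_diff R X n c)"
  by (rule res_map_diff_aux[OF map_syz_res_basis map_syz_res_basis])

end

section \<open>Injective modules\<close>

text \<open>
  For structures whose operations are given on representatives, such as direct limits, the axioms
  are checked in a known module rather than on the representatives.
\<close>

lemma module_transport:
  assumes K: "Module.module R K" and inj: "inj_on \<Theta> (carrier W)"
    and cl: "\<And>x. x \<in> carrier W \<Longrightarrow> \<Theta> x \<in> carrier K" "\<zero>\<^bsub>W\<^esub> \<in> carrier W"
      "\<And>x y. x \<in> carrier W \<Longrightarrow> y \<in> carrier W \<Longrightarrow> x \<oplus>\<^bsub>W\<^esub> y \<in> carrier W"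
      "\<And>a x. a \<in> carrier R \<Longrightarrow> x \<in> carrier W \<Longrightarrow> a \<odot>\<^bsub>W\<^esub> x \<in> carrier W"
    and hom: "\<Theta> \<zero>\<^bsub>W\<^esub> = \<zero>\<^bsub>K\<^esub>"
      "\<And>x y. x \<in> carrier W \<Longrightarrow> y \<in> carrier W \<Longrightarrow> \<Theta> (x \<oplus>\<^bsub>W\<^esub> y) = \<Theta> x \<oplus>\<^bsub>K\<^esub> \<Theta> y"
      "\<And>a x. a \<in> carrier R \<Longrightarrow> x \<in> carrier W \<Longrightarrow> \<Theta> (a \<odot>\<^bsub>W\<^esub> x) = a \<odot>\<^bsub>K\<^esub> \<Theta> x"
  shows "Module.module R W"
proof -
  interpret K: Module.module R K by fact
  note eqI = inj_onD[OF inj]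
  have neg: "(\<ominus>\<^bsub>R\<^esub> \<one>\<^bsub>R\<^esub>) \<odot>\<^bsub>W\<^esub> x \<oplus>\<^bsub>W\<^esub> x = \<zero>\<^bsub>W\<^esub>" if "x \<in> carrier W" for x
    by (rule eqI) (use that in \<open>simp_all add: cl hom K.smult_l_minus K.l_neg\<close>)
  show ?thesis
  proof (rule moduleI)
    show "abelian_group W"
    proof (rule abelian_groupI)
      show "\<exists>y\<in>carrier W. y \<oplus>\<^bsub>W\<^esub> x = \<zero>\<^bsub>W\<^esub>" if "x \<in> carrier W" for x
        using neg[OF that] cl(4)[OF _ that, of "\<ominus>\<^bsub>R\<^esub> \<one>\<^bsub>R\<^esub>"] by auto
    next
      fix x y z assume "x \<in> carrier W" "y \<in> carrier W" "z \<in> carrier W"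
      then show "(x \<oplus>\<^bsub>W\<^esub> y) \<oplus>\<^bsub>W\<^esub> z = x \<oplus>\<^bsub>W\<^esub> (y \<oplus>\<^bsub>W\<^esub> z)"
        by (intro eqI) (simp_all add: cl hom K.a_assoc)
    next
      fix x y assume "x \<in> carrier W" "y \<in> carrier W"
      then show "x \<oplus>\<^bsub>W\<^esub> y = y \<oplus>\<^bsub>W\<^esub> x" by (intro eqI) (simp_all add: cl hom K.a_comm)
    next
      fix x assume "x \<in> carrier W"
      then show "\<zero>\<^bsub>W\<^esub> \<oplus>\<^bsub>W\<^esub> x = x" by (intro eqI) (simp_all add: cl hom)
    qed (use cl in auto)
  qed (auto intro!: eqI simp: cl hom K.is_cring K.smult_l_distr K.smult_r_distr K.smult_assoc1)
qed

lemma reg_module_simps [simp]: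
  "carrier (reg_module R) = carrier R" "\<zero>\<^bsub>reg_module R\<^esub> = \<zero>\<^bsub>R\<^esub>" "x \<oplus>\<^bsub>reg_module R\<^esub> y = x \<oplus>\<^bsub>R\<^esub> y"
  "a \<odot>\<^bsub>reg_module R\<^esub> x = a \<otimes>\<^bsub>R\<^esub> x"
  by (simp_all add: reg_module_def)

lemma reg_module_module: assumes "cring R" shows "Module.module R (reg_module R)"
proof -
  interpret R: cring R by fact
  show ?thesis
  proof (rule moduleI)
    show "abelian_group (reg_module R)"
      by (rule abelian_groupI) (auto simp: R.a_ac intro: R.l_neg)
  qed (auto simp: R.is_cring R.l_distr R.r_distr R.m_assoc)
qed

lemma submodule_reg_iff:
  assumes "cring R"
  shows "submodule J R (reg_module R) \<longleftrightarrow> ideal J R"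
proof
  interpret R: cring R by fact
  {
    assume J: "submodule J R (reg_module R)"
    show "ideal J R"
    proof (rule idealI)
      have "\<ominus>\<^bsub>R\<^esub> a \<in> J" if "a \<in> J" for a
        using submodule_smult[OF J, of "\<ominus>\<^bsub>R\<^esub> \<one>\<^bsub>R\<^esub>" a] submodule_mem[OF J that] that by (simp add: R.l_minus)
      then show "subgroup J (add_monoid R)"
        using submodule_subset[OF J] submodule_zero[OF J] submodule_add[OF J]
        by (intro R.add.subgroupI) auto
      show "a \<otimes>\<^bsub>R\<^esub> x \<in> J" "x \<otimes>\<^bsub>R\<^esub> a \<in> J" if "a \<in> J" "x \<in> carrier R" for a x
        using submodule_smult[OF J that(2,1)] submodule_mem[OF J that(1)] that
        by (simp_all add: R.m_comm)
    qed (rule R.ring_axioms)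
  next
    assume J: "ideal J R"
    interpret J: ideal J R by fact
    show "submodule J R (reg_module R)"
      by (rule submodule_intro[OF reg_module_module[OF assms]])
        (use J.I_l_closed J.a_subset in auto)
  }
qed

text \<open>
  By linearity a relation is single-valued as soon as it is so at zero.
\<close>

lemma linrel_function:
  assumes "linrel R X Y \<rho>" "Module.module R X" "Module.module R Y" "submodule Z R X"
    "\<And>x. x \<in> Z \<Longrightarrow> \<exists>y. (x, y) \<in> \<rho>" "\<And>y. (\<zero>\<^bsub>X\<^esub>, y) \<in> \<rho> \<Longrightarrow> y = \<zero>\<^bsub>Y\<^esub>"
  shows "\<exists>f\<in>mod_hom R (X\<lparr>carrier := Z\<rparr>) Y. \<forall>x\<in>Z. \<forall>y. (x, y) \<in> \<rho> \<longleftrightarrow> y = f x"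
proof -
  interpret X: Module.module R X by fact
  have uniq: "y = y'" if "(x, y) \<in> \<rho>" "(x, y') \<in> \<rho>" for x y y'
  proof -
    have "(mdiff R X x x, mdiff R Y y y') \<in> \<rho>" by (rule linrel_mdiff[OF assms(1) X.is_cring that])
    then have "mdiff R Y y y' = \<zero>\<^bsub>Y\<^esub>"
      using assms(6) mdiff_self[OF assms(2) linrelD(1)[OF assms(1) that(1)]] by simp
    then show ?thesis using mdiff_eq_zero[OF assms(3)] linrelD(2)[OF assms(1)] that by blast
  qed
  define f where "f = (\<lambda>x\<in>Z. THE y. (x, y) \<in> \<rho>)"
  have f: "(x, y) \<in> \<rho> \<longleftrightarrow> y = f x" if x: "x \<in> Z" for x y
  proof -
    obtain y' where y': "(x, y') \<in> \<rho>" using assms(5)[OF x] by blast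
    then have "f x = y'" unfolding f_def using x uniq by (auto intro!: the_equality)
    then show ?thesis using \<open>(x, y') \<in> \<rho>\<close> uniq by blast
  qed
  have "f \<in> mod_hom R (X\<lparr>carrier := Z\<rparr>) Y"
  proof (rule mod_homI)
    show "f \<in> extensional (carrier (X\<lparr>carrier := Z\<rparr>))" by (simp add: f_def)
    show "f x \<in> carrier Y" if "x \<in> carrier (X\<lparr>carrier := Z\<rparr>)" for x
      using that f linrelD(2)[OF assms(1)] by auto
    show "f (x \<oplus>\<^bsub>X\<lparr>carrier := Z\<rparr>\<^esub> y) = f x \<oplus>\<^bsub>Y\<^esub> f y"
      if "x \<in> carrier (X\<lparr>carrier := Z\<rparr>)" "y \<in> carrier (X\<lparr>carrier := Z\<rparr>)" for x y
      using that linrelD(4)[OF assms(1), of x "f x" y "f y"] f submodule_add[OF assms(4)] by simp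
    show "f (a \<odot>\<^bsub>X\<lparr>carrier := Z\<rparr>\<^esub> x) = a \<odot>\<^bsub>Y\<^esub> f x"
      if "a \<in> carrier R" "x \<in> carrier (X\<lparr>carrier := Z\<rparr>)" for a x
      using that linrelD(5)[OF assms(1), of a x "f x"] f submodule_smult[OF assms(4)] by simp
  qed
  then show ?thesis using f by blast
qed

text \<open>
  Injectivity as the extension property for ideals. By Baer's criterion, proved below, it gives
  the extension property for modules on arbitrary types.
\<close>

definition baer :: "('a, 'r) ring_scheme \<Rightarrow> ('a, 'e) module \<Rightarrow> bool" where
  "baer R E \<longleftrightarrow> Module.module R E \<and> (\<forall>J \<phi>. ideal J R \<longrightarrow>
     \<phi> \<in> mod_hom R ((reg_module R)\<lparr>carrier := J\<rparr>) E \<longrightarrow> (\<exists>e\<in>carrier E. \<forall>a\<in>J. \<phi> a = a \<odot>\<^bsub>E\<^esub> e))"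

lemma baer_module: "baer R E \<Longrightarrow> Module.module R E"
  by (simp add: baer_def)

lemma baerD:
  "baer R E \<Longrightarrow> ideal J R \<Longrightarrow> \<phi> \<in> mod_hom R ((reg_module R)\<lparr>carrier := J\<rparr>) E \<Longrightarrow>
    \<exists>e\<in>carrier E. \<forall>a\<in>J. \<phi> a = a \<odot>\<^bsub>E\<^esub> e"
  by (simp add: baer_def)

text \<open>A copy of an ideal inside the lists over which \<^const>\<open>injective_module\<close> quantifies.\<close>

definition list_ideal :: "('a, 'r) ring_scheme \<Rightarrow> 'a set \<Rightarrow> ('a, ('a + 'e) list) module" where
  "list_ideal R J = \<lparr>carrier = (\<lambda>a. [Inl a]) ` J, mult = undefined, one = undefined, zero = [Inl \<zero>\<^bsub>R\<^esub>],
     add = (\<lambda>x y. [Inl (projl (hd x) \<oplus>\<^bsub>R\<^esub> projl (hd y))]),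
     smult = (\<lambda>a x. [Inl (a \<otimes>\<^bsub>R\<^esub> projl (hd x))])\<rparr>"

lemma list_ideal_module:
  assumes "cring R" "ideal J R"
  shows "Module.module R (list_ideal R J)"
proof -
  interpret R: cring R by fact
  interpret J: ideal J R by fact
  show ?thesis
    by (rule module_transport[OF reg_module_module[OF assms(1)], where \<Theta> = "\<lambda>x. projl (hd x)"])
      (auto simp: list_ideal_def J.I_l_closed inj_on_def)
qed

text \<open>
  The extension property is applied to the inclusion of the copy of the ideal into the copy of the
  ring; the value of the extension at the copy of \<open>\<one>\<close> is the multiplier.
\<close>

lemma injective_imp_baer:
  fixes R :: "('a, 'r) ring_scheme" and E :: "('a, 'e) module"
  assumes "injective_module R E"
  shows "baer R E"
  unfolding baer_def
proof (intro conjI allI impI)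
  have E: "Module.module R E" using assms by (simp add: injective_module_def)
  then show "Module.module R E" .
  interpret E: Module.module R E by (rule E)
  fix J \<phi> assume J: "ideal J R" and \<phi>: "\<phi> \<in> mod_hom R ((reg_module R)\<lparr>carrier := J\<rparr>) E"
  interpret J: ideal J R by (rule J)
  let ?A = "list_ideal R J :: ('a, ('a + 'e) list) module"
  let ?B = "list_ideal R (carrier R) :: ('a, ('a + 'e) list) module"
  let ?f = "\<lambda>x\<in>carrier ?A. x" and ?g = "\<lambda>x\<in>carrier ?A. \<phi> (projl (hd x))"
  have J_in: "a \<in> carrier R" if "a \<in> J" for a using that by simp
  have "?f \<in> mod_hom R ?A ?B"
    by (rule mod_homI) (auto simp: list_ideal_def J.I_l_closed)
  moreover
  have \<phi>': "\<And>x. x \<in> J \<Longrightarrow> \<phi> x \<in> carrier E" "\<And>x y. x \<in> J \<Longrightarrow> y \<in> J \<Longrightarrow> \<phi> (x \<oplus>\<^bsub>R\<^esub> y) = \<phi> x \<oplus>\<^bsub>E\<^esub> \<phi> y"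
    "\<And>a x. a \<in> carrier R \<Longrightarrow> x \<in> J \<Longrightarrow> \<phi> (a \<otimes>\<^bsub>R\<^esub> x) = a \<odot>\<^bsub>E\<^esub> \<phi> x"
    using \<phi> by (auto simp: mod_hom_def)
  have "?g \<in> mod_hom R ?A E"
    by (rule mod_homI) (auto simp: list_ideal_def J.I_l_closed \<phi>')
  moreover have "inj_on ?f (carrier ?A)" by (auto simp: inj_on_def)
  moreover have "Module.module R ?A" "Module.module R ?B"
    using list_ideal_module[OF E.is_cring] J E.R.oneideal by auto
  ultimately obtain h where h: "h \<in> mod_hom R ?B E" "\<forall>x\<in>carrier ?A. h (?f x) = ?g x"
    using assms unfolding injective_module_def by blast
  let ?e = "h [Inl \<one>\<^bsub>R\<^esub>]"
  have one: "[Inl \<one>\<^bsub>R\<^esub>] \<in> carrier ?B" by (simp add: list_ideal_def)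
  have "\<phi> a = a \<odot>\<^bsub>E\<^esub> ?e" if a: "a \<in> J" for a
  proof -
    have "\<phi> a = h [Inl a]" using h(2) a by (auto simp: list_ideal_def)
    also have "[Inl a] = a \<odot>\<^bsub>?B\<^esub> [Inl \<one>\<^bsub>R\<^esub>]" using J_in[OF a] by (simp add: list_ideal_def)
    also have "h \<dots> = a \<odot>\<^bsub>E\<^esub> ?e" by (rule mod_hom_smult[OF h(1) J_in[OF a] one])
    finally show ?thesis .
  qed
  then show "\<exists>e\<in>carrier E. \<forall>a\<in>J. \<phi> a = a \<odot>\<^bsub>E\<^esub> e" using mod_hom_closed[OF h(1) one] by blast
qed

lemma baer_transport:
  assumes "baer R E" "Module.module R G" "f \<in> mod_hom R G E" "inj_on f (carrier G)" "f ` carrier G = carrier E"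
  shows "baer R G"
  unfolding baer_def
proof (intro conjI allI impI assms(2))
  fix J \<phi> assume J: "ideal J R" and \<phi>: "\<phi> \<in> mod_hom R ((reg_module R)\<lparr>carrier := J\<rparr>) G"
  interpret J: ideal J R by (rule J)
  interpret G: Module.module R G by fact
  let ?J = "(reg_module R)\<lparr>carrier := J\<rparr>"
  have mJ: "Module.module R ?J"
    using submodule_module[OF _ reg_module_module] submodule_reg_iff J G.is_cring by blast
  obtain e where e: "e \<in> carrier E" "\<forall>a\<in>J. compose J f \<phi> a = a \<odot>\<^bsub>E\<^esub> e"
    using baerD[OF assms(1) J] mod_hom_compose[OF \<phi> assms(3) mJ] by auto
  have "e \<in> f ` carrier G" using e(1) assms(5) by simp
  then obtain g where g: "g \<in> carrier G" "f g = e" by blast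
  have "\<phi> a = a \<odot>\<^bsub>G\<^esub> g" if a: "a \<in> J" for a
  proof (rule inj_onD[OF assms(4)])
    have "a \<in> carrier R" using a by simp
    then show "f (\<phi> a) = f (a \<odot>\<^bsub>G\<^esub> g)" using e(2) a g mod_hom_smult[OF assms(3)] by (simp add: compose_eq)
    show "\<phi> a \<in> carrier G" using mod_hom_closed[OF \<phi>] a by simp
    show "a \<odot>\<^bsub>G\<^esub> g \<in> carrier G" using \<open>a \<in> carrier R\<close> g by simp
  qed
  then show "\<exists>g\<in>carrier G. \<forall>a\<in>J. \<phi> a = a \<odot>\<^bsub>G\<^esub> g" using g by blast
qed

text \<open>
  Baer's criterion. A maximal single-valued linear relation that contains the graph of \<open>\<chi>\<close> is
  defined everywhere: if it is not defined at \<open>b\<close>, then \<open>a \<mapsto> \<rho> (a b)\<close> is a homomorphism on an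
  ideal, hence multiplication by some \<open>e\<close>, and sending \<open>b\<close> to \<open>e\<close> enlarges the relation.
\<close>

lemma baer_extend:
  assumes E: "baer R E" and B: "Module.module R B" and A: "submodule A R B"
    and \<chi>: "\<chi> \<in> mod_hom R (B\<lparr>carrier := A\<rparr>) E"
  shows "\<exists>h\<in>mod_hom R B E. \<forall>x\<in>A. h x = \<chi> x"
proof -
  have mE: "Module.module R E" by (rule baer_module[OF E])
  interpret B: Module.module R B by (rule B)
  interpret E: Module.module R E by (rule mE)
  have mA: "Module.module R (B\<lparr>carrier := A\<rparr>)" by (rule submodule_module[OF A B])
  define \<gamma> where "\<gamma> = {(x, \<chi> x) | x. x \<in> A}"
  define \<A> where "\<A> = {\<rho>. linrel R B E \<rho> \<and> (\<forall>e. (\<zero>\<^bsub>B\<^esub>, e) \<in> \<rho> \<longrightarrow> e = \<zero>\<^bsub>E\<^esub>) \<and> \<gamma> \<subseteq> \<rho>}"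
  have Ac: "\<And>x. x \<in> A \<Longrightarrow> x \<in> carrier B" by (rule submodule_mem[OF A])
  have "linrel R B E \<gamma>"
  proof (rule linrelI)
    show "(\<zero>\<^bsub>B\<^esub>, \<zero>\<^bsub>E\<^esub>) \<in> \<gamma>" using mod_hom_zero[OF \<chi> mA mE] submodule_zero[OF A] by (auto simp: \<gamma>_def)
  qed (use Ac mod_hom_closed[OF \<chi>] mod_hom_add[OF \<chi>] mod_hom_smult[OF \<chi>] submodule_add[OF A] submodule_smult[OF A]
       in \<open>auto simp: \<gamma>_def\<close>)
  moreover have "e = \<zero>\<^bsub>E\<^esub>" if "(\<zero>\<^bsub>B\<^esub>, e) \<in> \<gamma>" for e
    using that mod_hom_zero[OF \<chi> mA mE] by (auto simp: \<gamma>_def)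
  ultimately have "\<gamma> \<in> \<A>" by (auto simp: \<A>_def)
  then have ne: "\<A> \<noteq> {}" by blast
  have ch: "\<Union>\<C> \<in> \<A>" if C: "\<C> \<noteq> {}" "subset.chain \<A> \<C>" for \<C>
  proof -
    have C1: "\<And>\<rho>. \<rho> \<in> \<C> \<Longrightarrow> linrel R B E \<rho>" "\<And>\<rho> e. \<rho> \<in> \<C> \<Longrightarrow> (\<zero>\<^bsub>B\<^esub>, e) \<in> \<rho> \<Longrightarrow> e = \<zero>\<^bsub>E\<^esub>" "\<And>\<rho>. \<rho> \<in> \<C> \<Longrightarrow> \<gamma> \<subseteq> \<rho>"
      using C(2) unfolding subset.chain_def \<A>_def by blast+
    have C2: "\<rho> \<subseteq> \<sigma> \<or> \<sigma> \<subseteq> \<rho>" if "\<rho> \<in> \<C>" "\<sigma> \<in> \<C>" for \<rho> \<sigma>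
      using C(2) that unfolding subset.chain_def by blast
    have "linrel R B E (\<Union>\<C>)"
    proof (rule linrelI)
      show "x \<in> carrier B \<and> y \<in> carrier E" if "(x, y) \<in> \<Union>\<C>" for x y
        using that linrelD(1,2)[OF C1(1)] by blast
      show "(\<zero>\<^bsub>B\<^esub>, \<zero>\<^bsub>E\<^esub>) \<in> \<Union>\<C>" using C(1) linrelD(3)[OF C1(1)] by blast
      show "(a \<odot>\<^bsub>B\<^esub> x, a \<odot>\<^bsub>E\<^esub> y) \<in> \<Union>\<C>" if "a \<in> carrier R" "(x, y) \<in> \<Union>\<C>" for a x y
        using that linrelD(5)[OF C1(1)] by blast
      show "(x \<oplus>\<^bsub>B\<^esub> x', y \<oplus>\<^bsub>E\<^esub> y') \<in> \<Union>\<C>" if xy: "(x, y) \<in> \<Union>\<C>" "(x', y') \<in> \<Union>\<C>" for x y x' y'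
      proof -
        obtain \<rho> \<sigma> where "\<rho> \<in> \<C>" "\<sigma> \<in> \<C>" "(x, y) \<in> \<rho>" "(x', y') \<in> \<sigma>" using xy by blast
        then show ?thesis using C2[of \<rho> \<sigma>] linrelD(4)[OF C1(1)] by (metis UnionI subsetD)
      qed
    qed
    then show ?thesis using C1 C(1) unfolding \<A>_def by blast
  qed
  obtain \<rho> where \<rho>: "\<rho> \<in> \<A>" and max: "\<And>\<sigma>. \<sigma> \<in> \<A> \<Longrightarrow> \<rho> \<subseteq> \<sigma> \<Longrightarrow> \<sigma> = \<rho>"
    using subset_Zorn_nonempty[OF ne ch] by blast
  have lin: "linrel R B E \<rho>" and sv: "\<And>e. (\<zero>\<^bsub>B\<^esub>, e) \<in> \<rho> \<Longrightarrow> e = \<zero>\<^bsub>E\<^esub>" and ext: "\<gamma> \<subseteq> \<rho>"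
    using \<rho> by (auto simp: \<A>_def)
  have total: "\<exists>e. (b, e) \<in> \<rho>" if b: "b \<in> carrier B" for b
  proof -
    define J where "J = {a \<in> carrier R. \<exists>e. (a \<odot>\<^bsub>B\<^esub> b, e) \<in> \<rho>}"
    define \<tau> where "\<tau> = {(a, e). a \<in> carrier R \<and> (a \<odot>\<^bsub>B\<^esub> b, e) \<in> \<rho>}"
    note reg = reg_module_module[OF B.is_cring]
    have \<tau>: "linrel R (reg_module R) E \<tau>"
    proof (rule linrelI)
      show "(\<zero>\<^bsub>reg_module R\<^esub>, \<zero>\<^bsub>E\<^esub>) \<in> \<tau>" using linrelD(3)[OF lin] b by (simp add: \<tau>_def)
      show "(a \<oplus>\<^bsub>reg_module R\<^esub> a', e \<oplus>\<^bsub>E\<^esub> e') \<in> \<tau>" if "(a, e) \<in> \<tau>" "(a', e') \<in> \<tau>" for a e a' e'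
        using that linrelD(4)[OF lin] b by (auto simp: \<tau>_def B.smult_l_distr)
      show "(c \<odot>\<^bsub>reg_module R\<^esub> a, c \<odot>\<^bsub>E\<^esub> e) \<in> \<tau>" if "c \<in> carrier R" "(a, e) \<in> \<tau>" for c a e
        using that linrelD(5)[OF lin] b by (auto simp: \<tau>_def B.smult_assoc1)
    qed (use linrelD(2)[OF lin] in \<open>auto simp: \<tau>_def\<close>)
    have J: "submodule J R (reg_module R)"
    proof (rule submodule_intro[OF reg])
      show "\<zero>\<^bsub>reg_module R\<^esub> \<in> J" using linrelD(3)[OF lin] b by (auto simp: J_def)
      show "a \<oplus>\<^bsub>reg_module R\<^esub> a' \<in> J" if "a \<in> J" "a' \<in> J" for a a'
      proof -
        from that obtain e e' where *: "a \<in> carrier R" "a' \<in> carrier R" "(a \<odot>\<^bsub>B\<^esub> b, e) \<in> \<rho>" "(a' \<odot>\<^bsub>B\<^esub> b, e') \<in> \<rho>"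
          unfolding J_def by blast
        from linrelD(4)[OF lin *(3,4)] show ?thesis using * b by (auto simp: J_def B.smult_l_distr)
      qed
      show "c \<odot>\<^bsub>reg_module R\<^esub> a \<in> J" if c: "c \<in> carrier R" "a \<in> J" for c a
      proof -
        from that obtain e where *: "a \<in> carrier R" "(a \<odot>\<^bsub>B\<^esub> b, e) \<in> \<rho>" unfolding J_def by blast
        from linrelD(5)[OF lin c(1) *(2)] show ?thesis using * c b by (auto simp: J_def B.smult_assoc1)
      qed
    qed (auto simp: J_def)
    obtain \<phi> where \<phi>: "\<phi> \<in> mod_hom R ((reg_module R)\<lparr>carrier := J\<rparr>) E" "\<forall>a\<in>J. \<forall>e. (a, e) \<in> \<tau> \<longleftrightarrow> e = \<phi> a"
      using linrel_function[OF \<tau> reg mE J] sv b by (auto simp: \<tau>_def J_def)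
    obtain e0 where e0: "e0 \<in> carrier E" "\<forall>a\<in>J. \<phi> a = a \<odot>\<^bsub>E\<^esub> e0"
      using baerD[OF E _ \<phi>(1)] J submodule_reg_iff[OF B.is_cring] by blast
    define \<sigma> where "\<sigma> = {(x \<oplus>\<^bsub>B\<^esub> a \<odot>\<^bsub>B\<^esub> b, e \<oplus>\<^bsub>E\<^esub> a \<odot>\<^bsub>E\<^esub> e0) | x e a. (x, e) \<in> \<rho> \<and> a \<in> carrier R}"
    note \<rho>c = linrelD(1)[OF lin] linrelD(2)[OF lin]
    have "linrel R B E \<sigma>"
    proof (rule linrelI)
      show "x \<in> carrier B \<and> y \<in> carrier E" if "(x, y) \<in> \<sigma>" for x y
        using that \<rho>c b e0 by (auto simp: \<sigma>_def)
      show "(\<zero>\<^bsub>B\<^esub>, \<zero>\<^bsub>E\<^esub>) \<in> \<sigma>"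
        using linrelD(3)[OF lin] b e0 unfolding \<sigma>_def
        by (intro CollectI exI[of _ "\<zero>\<^bsub>B\<^esub>"] exI[of _ "\<zero>\<^bsub>E\<^esub>"] exI[of _ "\<zero>\<^bsub>R\<^esub>"]) simp
    next
      fix x y x' y' assume "(x, y) \<in> \<sigma>" "(x', y') \<in> \<sigma>"
      then obtain u e a u' e' a' where *: "(u, e) \<in> \<rho>" "(u', e') \<in> \<rho>" "a \<in> carrier R" "a' \<in> carrier R"
        "x = u \<oplus>\<^bsub>B\<^esub> a \<odot>\<^bsub>B\<^esub> b" "x' = u' \<oplus>\<^bsub>B\<^esub> a' \<odot>\<^bsub>B\<^esub> b" "y = e \<oplus>\<^bsub>E\<^esub> a \<odot>\<^bsub>E\<^esub> e0" "y' = e' \<oplus>\<^bsub>E\<^esub> a' \<odot>\<^bsub>E\<^esub> e0"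
        unfolding \<sigma>_def by blast
      have "x \<oplus>\<^bsub>B\<^esub> x' = (u \<oplus>\<^bsub>B\<^esub> u') \<oplus>\<^bsub>B\<^esub> (a \<oplus>\<^bsub>R\<^esub> a') \<odot>\<^bsub>B\<^esub> b" "y \<oplus>\<^bsub>E\<^esub> y' = (e \<oplus>\<^bsub>E\<^esub> e') \<oplus>\<^bsub>E\<^esub> (a \<oplus>\<^bsub>R\<^esub> a') \<odot>\<^bsub>E\<^esub> e0"
        using * \<rho>c b e0 by (simp_all add: B.smult_l_distr E.smult_l_distr B.a_ac E.a_ac)
      then show "(x \<oplus>\<^bsub>B\<^esub> x', y \<oplus>\<^bsub>E\<^esub> y') \<in> \<sigma>" unfolding \<sigma>_def using linrelD(4)[OF lin *(1,2)] * by blast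
    next
      fix c x y assume c: "c \<in> carrier R" and "(x, y) \<in> \<sigma>"
      then obtain u e a where *: "(u, e) \<in> \<rho>" "a \<in> carrier R" "x = u \<oplus>\<^bsub>B\<^esub> a \<odot>\<^bsub>B\<^esub> b" "y = e \<oplus>\<^bsub>E\<^esub> a \<odot>\<^bsub>E\<^esub> e0"
        unfolding \<sigma>_def by blast
      have "c \<odot>\<^bsub>B\<^esub> x = c \<odot>\<^bsub>B\<^esub> u \<oplus>\<^bsub>B\<^esub> (c \<otimes>\<^bsub>R\<^esub> a) \<odot>\<^bsub>B\<^esub> b" "c \<odot>\<^bsub>E\<^esub> y = c \<odot>\<^bsub>E\<^esub> e \<oplus>\<^bsub>E\<^esub> (c \<otimes>\<^bsub>R\<^esub> a) \<odot>\<^bsub>E\<^esub> e0"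
        using * c \<rho>c b e0 by (simp_all add: B.smult_r_distr E.smult_r_distr B.smult_assoc1 E.smult_assoc1)
      then show "(c \<odot>\<^bsub>B\<^esub> x, c \<odot>\<^bsub>E\<^esub> y) \<in> \<sigma>" unfolding \<sigma>_def using linrelD(5)[OF lin c *(1)] * c by blast
    qed
    moreover have "y = \<zero>\<^bsub>E\<^esub>" if y: "(\<zero>\<^bsub>B\<^esub>, y) \<in> \<sigma>" for y
    proof -
      obtain u e a where *: "(u, e) \<in> \<rho>" "a \<in> carrier R" "\<zero>\<^bsub>B\<^esub> = u \<oplus>\<^bsub>B\<^esub> a \<odot>\<^bsub>B\<^esub> b" "y = e \<oplus>\<^bsub>E\<^esub> a \<odot>\<^bsub>E\<^esub> e0"
        using y unfolding \<sigma>_def by blast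
      have "((\<ominus>\<^bsub>R\<^esub> \<one>\<^bsub>R\<^esub>) \<odot>\<^bsub>B\<^esub> u, (\<ominus>\<^bsub>R\<^esub> \<one>\<^bsub>R\<^esub>) \<odot>\<^bsub>E\<^esub> e) \<in> \<rho>" by (rule linrelD(5)[OF lin _ *(1)]) simp
      moreover have "(\<ominus>\<^bsub>R\<^esub> \<one>\<^bsub>R\<^esub>) \<odot>\<^bsub>B\<^esub> u = a \<odot>\<^bsub>B\<^esub> b"
        using * \<rho>c b by (simp add: B.smult_l_minus) (metis B.minus_equality B.a_comm B.smult_closed)
      ultimately have "(a, (\<ominus>\<^bsub>R\<^esub> \<one>\<^bsub>R\<^esub>) \<odot>\<^bsub>E\<^esub> e) \<in> \<tau>" "a \<in> J" using *(2) by (auto simp: \<tau>_def J_def)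
      then have "a \<odot>\<^bsub>E\<^esub> e0 = (\<ominus>\<^bsub>R\<^esub> \<one>\<^bsub>R\<^esub>) \<odot>\<^bsub>E\<^esub> e" using \<phi>(2) e0(2) by simp
      then show ?thesis using * \<rho>c(2)[OF *(1)] by (simp add: E.smult_l_minus E.r_neg)
    qed
    moreover have sub: "\<rho> \<subseteq> \<sigma>"
    proof (rule subrelI)
      fix x e assume "(x, e) \<in> \<rho>"
      then show "(x, e) \<in> \<sigma>" unfolding \<sigma>_def using \<rho>c b e0
        by (intro CollectI exI[of _ x] exI[of _ e] exI[of _ "\<zero>\<^bsub>R\<^esub>"]) simp
    qed
    ultimately have "\<sigma> \<in> \<A>" using ext by (auto simp: \<A>_def)
    then have "\<sigma> = \<rho>" using max sub by blast
    moreover have "(b, e0) \<in> \<sigma>" unfolding \<sigma>_def using linrelD(3)[OF lin] b e0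
      by (intro CollectI exI[of _ "\<zero>\<^bsub>B\<^esub>"] exI[of _ "\<zero>\<^bsub>E\<^esub>"] exI[of _ "\<one>\<^bsub>R\<^esub>"]) simp
    ultimately show ?thesis by blast
  qed
  have "B\<lparr>carrier := carrier B\<rparr> = B" by simp
  then obtain h where h: "h \<in> mod_hom R B E" "\<forall>x\<in>carrier B. \<forall>y. (x, y) \<in> \<rho> \<longleftrightarrow> y = h x"
    using linrel_function[OF lin B mE submodule_self[OF B] total sv] by auto
  have "h x = \<chi> x" if "x \<in> A" for x
    using that ext h(2) Ac by (auto simp: \<gamma>_def)
  then show ?thesis using h(1) by blast
qed

lemma image_relation_linrel:
  assumes "Module.module R P" "Module.module R Q" "Module.module R E" "f \<in> mod_hom R P Q" "x \<in> mod_hom R P E"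
  shows "linrel R Q E {(f p, x p) | p. p \<in> carrier P}"
proof -
  interpret P: Module.module R P by fact
  show ?thesis
  proof (rule linrelI)
    show "(\<zero>\<^bsub>Q\<^esub>, \<zero>\<^bsub>E\<^esub>) \<in> {(f p, x p) | p. p \<in> carrier P}"
      using mod_hom_zero[OF assms(4,1,2)] mod_hom_zero[OF assms(5,1,3)] P.zero_closed
      by (intro CollectI exI[of _ "\<zero>\<^bsub>P\<^esub>"]) simp
    show "(u \<oplus>\<^bsub>Q\<^esub> u', v \<oplus>\<^bsub>E\<^esub> v') \<in> {(f p, x p) | p. p \<in> carrier P}"
      if "(u, v) \<in> {(f p, x p) | p. p \<in> carrier P}" "(u', v') \<in> {(f p, x p) | p. p \<in> carrier P}" for u v u' v'
    proof -
      from that obtain p p' where "p \<in> carrier P" "p' \<in> carrier P" "u = f p" "v = x p" "u' = f p'" "v' = x p'" by blast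
      then show ?thesis using mod_hom_add[OF assms(4)] mod_hom_add[OF assms(5)]
        by (intro CollectI exI[of _ "p \<oplus>\<^bsub>P\<^esub> p'"]) simp
    qed
    show "(a \<odot>\<^bsub>Q\<^esub> u, a \<odot>\<^bsub>E\<^esub> v) \<in> {(f p, x p) | p. p \<in> carrier P}"
      if "a \<in> carrier R" "(u, v) \<in> {(f p, x p) | p. p \<in> carrier P}" for a u v
    proof -
      from that obtain p where "p \<in> carrier P" "u = f p" "v = x p" by blast
      then show ?thesis using that(1) mod_hom_smult[OF assms(4)] mod_hom_smult[OF assms(5)]
        by (intro CollectI exI[of _ "a \<odot>\<^bsub>P\<^esub> p"]) simp
    qed
  qed (use mod_hom_closed[OF assms(4)] mod_hom_closed[OF assms(5)] in auto)
qed

text \<open>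
  A homomorphism that vanishes on the kernel of \<open>f\<close> factors through the image of \<open>f\<close>; with an
  injective target the factor extends to the whole target of \<open>f\<close>.
\<close>

lemma hom_factor_image:
  assumes "Module.module R P" "Module.module R Q" "Module.module R E" "f \<in> mod_hom R P Q" "x \<in> mod_hom R P E"
    "\<And>p. p \<in> carrier P \<Longrightarrow> f p = \<zero>\<^bsub>Q\<^esub> \<Longrightarrow> x p = \<zero>\<^bsub>E\<^esub>"
  shows "\<exists>c\<in>mod_hom R (Q\<lparr>carrier := f ` carrier P\<rparr>) E. \<forall>p\<in>carrier P. c (f p) = x p"
proof -
  have S: "submodule (f ` carrier P) R Q"
    by (rule mod_hom_image_submodule[OF assms(4,1,2) submodule_self[OF assms(1)]])
  have "\<exists>c\<in>mod_hom R (Q\<lparr>carrier := f ` carrier P\<rparr>) E.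
      \<forall>q\<in>f ` carrier P. \<forall>y. (q, y) \<in> {(f p, x p) | p. p \<in> carrier P} \<longleftrightarrow> y = c q"
    by (rule linrel_function[OF image_relation_linrel[OF assms(1-5)] assms(2,3) S]) (use assms(6) in auto)
  then obtain c where c: "c \<in> mod_hom R (Q\<lparr>carrier := f ` carrier P\<rparr>) E"
    "\<forall>q\<in>f ` carrier P. \<forall>y. (q, y) \<in> {(f p, x p) | p. p \<in> carrier P} \<longleftrightarrow> y = c q" by blast
  have "c (f p) = x p" if "p \<in> carrier P" for p
    using c(2)[rule_format, of "f p" "x p"] that by auto
  then show ?thesis using c(1) by blast
qed

lemma hom_factor_surj:
  assumes "Module.module R P" "Module.module R Q" "Module.module R E" "f \<in> mod_hom R P Q" "x \<in> mod_hom R P E"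
    "\<And>p. p \<in> carrier P \<Longrightarrow> f p = \<zero>\<^bsub>Q\<^esub> \<Longrightarrow> x p = \<zero>\<^bsub>E\<^esub>" "f ` carrier P = carrier Q"
  shows "\<exists>c\<in>mod_hom R Q E. \<forall>p\<in>carrier P. c (f p) = x p"
  using hom_factor_image[OF assms(1-6)] assms(7) by simp

lemma baer_factor:
  assumes "Module.module R P" "Module.module R Q" "baer R E" "f \<in> mod_hom R P Q" "x \<in> mod_hom R P E"
    "\<And>p. p \<in> carrier P \<Longrightarrow> f p = \<zero>\<^bsub>Q\<^esub> \<Longrightarrow> x p = \<zero>\<^bsub>E\<^esub>"
  shows "\<exists>c\<in>mod_hom R Q E. \<forall>p\<in>carrier P. c (f p) = x p"
proof -
  obtain c where c: "c \<in> mod_hom R (Q\<lparr>carrier := f ` carrier P\<rparr>) E" "\<forall>p\<in>carrier P. c (f p) = x p"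
    using hom_factor_image[OF assms(1,2) baer_module[OF assms(3)] assms(4-6)] by blast
  have S: "submodule (f ` carrier P) R Q"
    by (rule mod_hom_image_submodule[OF assms(4,1,2) submodule_self[OF assms(1)]])
  show ?thesis using baer_extend[OF assms(3,2) S c(1)] c(2) by auto
qed

section \<open>Ext and its long exact sequence\<close>

lemma submodule_hom_vanish:
  assumes "Module.module R Q" "Module.module R Y" "S \<subseteq> carrier Q"
  shows "submodule {\<phi> \<in> mod_hom R Q Y. \<forall>c\<in>S. \<phi> c = \<zero>\<^bsub>Y\<^esub>} R (hom_module R Q Y)"
proof (rule submodule_intro[OF hom_module_module[OF assms(1,2)]])
  interpret Y: Module.module R Y by fact
  interpret H: Module.module R "hom_module R Q Y" by (rule hom_module_module[OF assms(1,2)])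
  let ?H = "hom_module R Q Y"
  show "\<zero>\<^bsub>?H\<^esub> \<in> {\<phi> \<in> mod_hom R Q Y. \<forall>c\<in>S. \<phi> c = \<zero>\<^bsub>Y\<^esub>}"
    using assms(3) H.zero_closed by (auto simp: subset_iff)
  show "f \<oplus>\<^bsub>?H\<^esub> g \<in> {\<phi> \<in> mod_hom R Q Y. \<forall>c\<in>S. \<phi> c = \<zero>\<^bsub>Y\<^esub>}"
    if "f \<in> {\<phi> \<in> mod_hom R Q Y. \<forall>c\<in>S. \<phi> c = \<zero>\<^bsub>Y\<^esub>}" "g \<in> {\<phi> \<in> mod_hom R Q Y. \<forall>c\<in>S. \<phi> c = \<zero>\<^bsub>Y\<^esub>}" for f g
    using that assms(3) H.add.m_closed[of f g] by (auto simp: subset_iff)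
  show "a \<odot>\<^bsub>?H\<^esub> f \<in> {\<phi> \<in> mod_hom R Q Y. \<forall>c\<in>S. \<phi> c = \<zero>\<^bsub>Y\<^esub>}"
    if "a \<in> carrier R" "f \<in> {\<phi> \<in> mod_hom R Q Y. \<forall>c\<in>S. \<phi> c = \<zero>\<^bsub>Y\<^esub>}" for a f
    using that assms(3) H.smult_closed[of a f] by (auto simp: subset_iff)
qed auto

text \<open>
  The cocycles and coboundaries of the complex that computes Ext, both as sets of homomorphisms on
  the terms of the standard resolution, so that Ext is the subquotient \<open>Zc / Bc\<close>.
\<close>

definition Zc :: "('a, 'r) ring_scheme \<Rightarrow> ('a, 'x) module \<Rightarrow> ('a, 'y) module \<Rightarrow> nat \<Rightarrow>
    ((('a, 'x) syz \<Rightarrow> 'a) \<Rightarrow> 'y) set" where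
  "Zc R X Y p = {\<phi> \<in> mod_hom R (res_module R X p) Y.
     \<forall>c\<in>carrier (res_module R X (Suc p)). \<phi> (res_diff R X p c) = \<zero>\<^bsub>Y\<^esub>}"

definition Bc :: "('a, 'r) ring_scheme \<Rightarrow> ('a, 'x) module \<Rightarrow> ('a, 'y) module \<Rightarrow> nat \<Rightarrow>
    ((('a, 'x) syz \<Rightarrow> 'a) \<Rightarrow> 'y) set" where
  "Bc R X Y p = (case p of 0 \<Rightarrow> {\<lambda>c\<in>carrier (res_module R X 0). \<zero>\<^bsub>Y\<^esub>}
     | Suc m \<Rightarrow> (\<lambda>\<psi>. compose (carrier (res_module R X (Suc m))) \<psi> (res_diff R X m)) ` mod_hom R (res_module R X m) Y)"

context
  fixes R :: "('a, 'r) ring_scheme" and X :: "('a, 'x) module"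
  assumes X: "Module.module R X"
begin

interpretation X: Module.module R X by (rule X)

private abbreviation "P \<equiv> res_module R X"
private abbreviation "dd \<equiv> res_diff R X"

lemma mP: "Module.module R (P n)" by (rule res_module_module[OF X.is_cring])

lemma diff_diff: "c \<in> carrier (P (Suc (Suc n))) \<Longrightarrow> dd n (dd (Suc n) c) = \<zero>\<^bsub>P n\<^esub>"
  using res_exact[OF X mod_hom_closed[OF res_diff_hom[OF X]]] by blast

lemma aug_diff: "c \<in> carrier (P 1) \<Longrightarrow> res_aug R X (dd 0 c) = \<zero>\<^bsub>X\<^esub>"
  using res_exact_aug[OF X mod_hom_closed[OF res_diff_hom[OF X]]] by fastforce

lemma Bc_0: "\<phi> \<in> Bc R X Y 0 \<longleftrightarrow> \<phi> = (\<lambda>c\<in>carrier (P 0). \<zero>\<^bsub>Y\<^esub>)"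
  by (simp add: Bc_def)

lemma Bc_Suc:
  "\<phi> \<in> Bc R X Y (Suc m) \<longleftrightarrow> \<phi> \<in> mod_hom R (P (Suc m)) Y \<and>
     (\<exists>\<psi>\<in>mod_hom R (P m) Y. \<forall>c\<in>carrier (P (Suc m)). \<phi> c = \<psi> (dd m c))"
proof
  assume "\<phi> \<in> Bc R X Y (Suc m)"
  then show "\<phi> \<in> mod_hom R (P (Suc m)) Y \<and> (\<exists>\<psi>\<in>mod_hom R (P m) Y. \<forall>c\<in>carrier (P (Suc m)). \<phi> c = \<psi> (dd m c))"
    using mod_hom_compose[OF res_diff_hom[OF X] _ mP] by (auto simp: Bc_def compose_eq)
next
  assume "\<phi> \<in> mod_hom R (P (Suc m)) Y \<and> (\<exists>\<psi>\<in>mod_hom R (P m) Y. \<forall>c\<in>carrier (P (Suc m)). \<phi> c = \<psi> (dd m c))"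
  then obtain \<psi> where \<psi>: "\<phi> \<in> mod_hom R (P (Suc m)) Y" "\<psi> \<in> mod_hom R (P m) Y"
    "\<forall>c\<in>carrier (P (Suc m)). \<phi> c = \<psi> (dd m c)" by blast
  then have "\<phi> = compose (carrier (P (Suc m))) \<psi> (dd m)"
    by (intro extensionalityI[OF mod_hom_ext[OF \<psi>(1)] compose_extensional]) (simp add: compose_eq)
  then show "\<phi> \<in> Bc R X Y (Suc m)" using \<psi>(2) by (auto simp: Bc_def)
qed

context
  fixes Y :: "('a, 'y) module"
  assumes Y: "Module.module R Y"
begin

interpretation Y: Module.module R Y by (rule Y)

lemma mHom: "Module.module R (hom_module R (P p) Y)"
  by (rule hom_module_module[OF mP Y])

lemma Zc_submodule: "submodule (Zc R X Y p) R (hom_module R (P p) Y)"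
proof -
  have e: "Zc R X Y p = {\<phi> \<in> mod_hom R (P p) Y. \<forall>c\<in>dd p ` carrier (P (Suc p)). \<phi> c = \<zero>\<^bsub>Y\<^esub>}"
    by (auto simp: Zc_def)
  show ?thesis
    unfolding e by (rule submodule_hom_vanish[OF mP Y]) (use mod_hom_closed[OF res_diff_hom[OF X]] in auto)
qed

lemma precompose_hom:
  assumes "Module.module R Q" "Module.module R Q'" "f \<in> mod_hom R Q Q'"
  shows "(\<lambda>\<psi>\<in>mod_hom R Q' Y. compose (carrier Q) \<psi> f) \<in> mod_hom R (hom_module R Q' Y) (hom_module R Q Y)"
  by (rule mod_homI)
    (use assms mod_hom_compose[OF assms(3) _ assms(1)] hom_module_module[OF assms(2) Y] in
      \<open>auto simp: compose_def mod_hom_closed dest: Module.module.smult_closed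
        abelian_monoid.a_closed[OF abelian_group.axioms(1)[OF Module.module.axioms(2)]] intro!: restrict_ext\<close>)

lemma Bc_submodule: "submodule (Bc R X Y p) R (hom_module R (P p) Y)"
proof (cases p)
  case 0
  then show ?thesis using submodule_zero_set[OF mHom[of 0]] by (simp add: Bc_def)
next
  case (Suc m)
  have "Bc R X Y p = (\<lambda>\<psi>\<in>mod_hom R (P m) Y. compose (carrier (P (Suc m))) \<psi> (dd m)) ` carrier (hom_module R (P m) Y)"
    unfolding Suc Bc_def by simp
  then show ?thesis
    using mod_hom_image_submodule[OF precompose_hom[OF mP mP res_diff_hom[OF X]] mHom mHom submodule_self[OF mHom]] Suc
    by simp
qed

lemma Bc_subset_Zc: "Bc R X Y p \<subseteq> Zc R X Y p"
proof
  fix \<phi> assume \<phi>: "\<phi> \<in> Bc R X Y p"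
  show "\<phi> \<in> Zc R X Y p"
  proof (cases p)
    case 0
    then show ?thesis
      using \<phi> mod_hom_zero_map[OF mP Y] mod_hom_closed[OF res_diff_hom[OF X]]
      by (auto simp: Bc_0 Zc_def)
  next
    case (Suc m)
    then obtain \<psi> where \<psi>: "\<phi> \<in> mod_hom R (P p) Y" "\<psi> \<in> mod_hom R (P m) Y" "\<forall>c\<in>carrier (P p). \<phi> c = \<psi> (dd m c)"
      using \<phi> Bc_Suc by blast
    have "\<phi> (dd p c) = \<zero>\<^bsub>Y\<^esub>" if c: "c \<in> carrier (P (Suc p))" for c
    proof -
      have "\<phi> (dd p c) = \<psi> (dd m (dd p c))"
        using \<psi>(3) mod_hom_closed[OF res_diff_hom[OF X] c] by blast
      also have "dd m (dd p c) = \<zero>\<^bsub>P m\<^esub>" using diff_diff c Suc by simp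
      finally show ?thesis using mod_hom_zero[OF \<psi>(2) mP Y] by simp
    qed
    then show ?thesis using \<psi>(1) by (simp add: Zc_def)
  qed
qed

lemma Ext_quot: "Ext R p X Y = quot_module ((hom_module R (P p) Y)\<lparr>carrier := Zc R X Y p\<rparr>) (Bc R X Y p)"
proof -
  have "{\<phi> \<in> mod_hom R (P p) Y. ext_diff R X p \<phi> = (\<lambda>c\<in>carrier (P (Suc p)). \<zero>\<^bsub>Y\<^esub>)} = Zc R X Y p"
    unfolding ext_diff_def Zc_def compose_def by (intro Collect_cong conj_cong refl) (auto simp: restrict_def fun_eq_iff)
  then have "cocycles (ext_complex R X Y) (ext_diff R X) p = (hom_module R (P p) Y)\<lparr>carrier := Zc R X Y p\<rparr>"
    by (simp add: cocycles_def ext_complex_def)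
  moreover have "coboundaries (ext_complex R X Y) (ext_diff R X) p = Bc R X Y p"
    by (cases p) (simp_all add: coboundaries_def ext_complex_def Bc_def ext_diff_def)
  ultimately show ?thesis by (simp add: Ext_def cohomology_def)
qed

lemma Ext_module: "Module.module R (Ext R p X Y)"
  unfolding Ext_quot
  by (intro quot_module submodule_module submodule_restrict Zc_submodule Bc_submodule Bc_subset_Zc mHom)

lemma weakly_Laskerian_Ext_iff:
  "weakly_Laskerian R (Ext R p X Y) \<longleftrightarrow> wl R (hom_module R (P p) Y) (Zc R X Y p) (Bc R X Y p)"
  unfolding Ext_quot by (rule weakly_Laskerian_quot_iff[OF mHom Zc_submodule Bc_submodule Bc_subset_Zc])

text \<open>
  For injective \<open>Y\<close> a cocycle of positive degree vanishes on the kernel of a differential, so it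
  factors through the image, and the factor extends to the whole term: it is a coboundary and Ext
  is zero.
\<close>

lemma Ext_baer:
  assumes "baer R Y"
  shows "weakly_Laskerian R (Ext R (Suc p) X Y)"
  unfolding weakly_Laskerian_Ext_iff
proof (rule wl_trivial, rule subsetI)
  fix \<phi> assume \<phi>: "\<phi> \<in> Zc R X Y (Suc p)"
  have "\<exists>\<psi>\<in>mod_hom R (P p) Y. \<forall>c\<in>carrier (P (Suc p)). \<psi> (dd p c) = \<phi> c"
  proof (rule baer_factor[OF mP mP assms res_diff_hom[OF X]])
    show "\<phi> \<in> mod_hom R (P (Suc p)) Y" using \<phi> by (simp add: Zc_def)
    show "\<phi> c = \<zero>\<^bsub>Y\<^esub>" if "c \<in> carrier (P (Suc p))" "dd p c = \<zero>\<^bsub>P p\<^esub>" for c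
      using that \<phi> res_exact[OF X] by (auto simp: Zc_def)
  qed
  then obtain \<psi> where "\<psi> \<in> mod_hom R (P p) Y" "\<forall>c\<in>carrier (P (Suc p)). \<psi> (dd p c) = \<phi> c" by blast
  then show "\<phi> \<in> Bc R X Y (Suc p)"
    using \<phi> unfolding Bc_Suc by (auto simp: Zc_def intro!: bexI[of _ \<psi>])
qed

end

lemma postcompose_linrel:
  assumes "Module.module R Q" "Module.module R V" "Module.module R W" "g \<in> mod_hom R V W"
  shows "linrel R (hom_module R Q V) (hom_module R Q W)
    {(v, w). v \<in> mod_hom R Q V \<and> w \<in> mod_hom R Q W \<and> (\<forall>c\<in>carrier Q. w c = g (v c))}"
proof -
  interpret HV: Module.module R "hom_module R Q V" by (rule hom_module_module[OF assms(1,2)])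
  interpret HW: Module.module R "hom_module R Q W" by (rule hom_module_module[OF assms(1,3)])
  interpret Q: Module.module R Q by fact
  let ?r = "{(v, w). v \<in> mod_hom R Q V \<and> w \<in> mod_hom R Q W \<and> (\<forall>c\<in>carrier Q. w c = g (v c))}"
  show ?thesis
  proof (rule linrelI)
    show "(\<zero>\<^bsub>hom_module R Q V\<^esub>, \<zero>\<^bsub>hom_module R Q W\<^esub>) \<in> ?r"
      using HV.zero_closed HW.zero_closed mod_hom_zero[OF assms(4,2,3)] by simp
    show "(v \<oplus>\<^bsub>hom_module R Q V\<^esub> v', w \<oplus>\<^bsub>hom_module R Q W\<^esub> w') \<in> ?r" if "(v, w) \<in> ?r" "(v', w') \<in> ?r" for v w v' w'
      using that HV.add.m_closed[of v v'] HW.add.m_closed[of w w'] mod_hom_add[OF assms(4)] by (auto simp: mod_hom_closed)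
    show "(a \<odot>\<^bsub>hom_module R Q V\<^esub> v, a \<odot>\<^bsub>hom_module R Q W\<^esub> w) \<in> ?r" if "a \<in> carrier R" "(v, w) \<in> ?r" for a v w
      using that HV.smult_closed[of a v] HW.smult_closed[of a w] mod_hom_smult[OF assms(4)] by (auto simp: mod_hom_closed)
  qed auto
qed

lemma hom_lift_inj:
  assumes "Module.module R Q" "Module.module R U" "Module.module R V" "f \<in> mod_hom R U V" "inj_on f (carrier U)"
    "x \<in> mod_hom R Q V" "\<And>c. c \<in> carrier Q \<Longrightarrow> x c \<in> f ` carrier U"
  shows "\<exists>u\<in>mod_hom R Q U. \<forall>c\<in>carrier Q. f (u c) = x c"
proof -
  interpret Q: Module.module R Q by fact
  interpret U: Module.module R U by fact
  let ?r = "{(c, u). c \<in> carrier Q \<and> u \<in> carrier U \<and> x c = f u}"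
  have f0: "f \<zero>\<^bsub>U\<^esub> = \<zero>\<^bsub>V\<^esub>" "x \<zero>\<^bsub>Q\<^esub> = \<zero>\<^bsub>V\<^esub>" using mod_hom_zero assms by blast+
  have "linrel R Q U ?r"
    by (rule linrelI) (use f0 in \<open>auto simp: mod_hom_add[OF assms(4)] mod_hom_add[OF assms(6)]
      mod_hom_smult[OF assms(4)] mod_hom_smult[OF assms(6)]\<close>)
  moreover have "u = \<zero>\<^bsub>U\<^esub>" if "(\<zero>\<^bsub>Q\<^esub>, u) \<in> ?r" for u
  proof -
    have "u \<in> carrier U" "f u = f \<zero>\<^bsub>U\<^esub>" using that f0 by simp_all
    then show ?thesis by (intro inj_onD[OF assms(5)]) simp_all
  qed
  moreover have "\<exists>u. (c, u) \<in> ?r" if "c \<in> carrier Q" for c using assms(7)[OF that] that by auto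
  ultimately have "\<exists>u\<in>mod_hom R (Q\<lparr>carrier := carrier Q\<rparr>) U. \<forall>c\<in>carrier Q. \<forall>y. (c, y) \<in> ?r \<longleftrightarrow> y = u c"
    using linrel_function[OF _ assms(1,2) submodule_self[OF assms(1)]] by blast
  then obtain u where u: "u \<in> mod_hom R Q U" "\<forall>c\<in>carrier Q. \<forall>y. (c, y) \<in> ?r \<longleftrightarrow> y = u c" by auto
  have "f (u c) = x c" if "c \<in> carrier Q" for c using u(2)[rule_format, of c "u c"] that by simp
  then show ?thesis using u(1) by blast
qed

subsection \<open>Short exact sequences\<close>

context
  fixes U :: "('a, 'u) module" and V :: "('a, 'v) module" and W :: "('a, 'w) module"
    and f :: "'u \<Rightarrow> 'v" and g :: "'v \<Rightarrow> 'w"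
  assumes U: "Module.module R U" and V: "Module.module R V" and W: "Module.module R W"
    and f: "f \<in> mod_hom R U V" and g: "g \<in> mod_hom R V W"
    and f_inj: "inj_on f (carrier U)" and g_surj: "g ` carrier V = carrier W"
    and fg: "f ` carrier U = {v \<in> carrier V. g v = \<zero>\<^bsub>W\<^esub>}"
begin

interpretation U: Module.module R U by (rule U)
interpretation V: Module.module R V by (rule V)
interpretation W: Module.module R W by (rule W)

lemma ses_composite_zero: "u \<in> carrier U \<Longrightarrow> g (f u) = \<zero>\<^bsub>W\<^esub>"
  using fg by blast

private lemma lift_f:
  assumes "Module.module R Q" "v \<in> mod_hom R Q V" "\<And>c. c \<in> carrier Q \<Longrightarrow> g (v c) = \<zero>\<^bsub>W\<^esub>"
  shows "\<exists>u\<in>mod_hom R Q U. \<forall>c\<in>carrier Q. f (u c) = v c"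
  by (rule hom_lift_inj[OF assms(1) U V f f_inj assms(2)]) (use assms mod_hom_closed[OF assms(2)] in \<open>simp add: fg\<close>)

private lemma lift_g:
  assumes "w \<in> mod_hom R (P p) W"
  shows "\<exists>v\<in>mod_hom R (P p) V. \<forall>c\<in>carrier (P p). g (v c) = w c"
  using free_lift[OF V W g, of w "res_basis R X p"] assms mod_hom_closed[OF assms] g_surj
  by (simp add: res_module_def)

text \<open>
  The connecting homomorphism as a relation between cochains: lift \<open>w\<close> to \<open>V\<close>, apply the
  differential, and take the preimage under \<open>f\<close>.
\<close>

definition "conn p = {(w, u). w \<in> mod_hom R (P p) W \<and> u \<in> mod_hom R (P (Suc p)) U \<and>
  (\<exists>v\<in>mod_hom R (P p) V. (\<forall>c\<in>carrier (P p). g (v c) = w c) \<and> (\<forall>c\<in>carrier (P (Suc p)). v (dd p c) = f (u c)))}"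

lemma conn_linrel: "linrel R (hom_module R (P p) W) (hom_module R (P (Suc p)) U) (conn p)"
proof -
  interpret HU: Module.module R "hom_module R (P (Suc p)) U" by (rule mHom[OF U])
  interpret HV: Module.module R "hom_module R (P p) V" by (rule mHom[OF V])
  interpret HW: Module.module R "hom_module R (P p) W" by (rule mHom[OF W])
  note d = mod_hom_closed[OF res_diff_hom[OF X]]
  show ?thesis
  proof (rule linrelI)
    have "(\<lambda>c\<in>carrier (P p). \<zero>\<^bsub>V\<^esub>) \<in> mod_hom R (P p) V" using HV.zero_closed by simp
    then show "(\<zero>\<^bsub>hom_module R (P p) W\<^esub>, \<zero>\<^bsub>hom_module R (P (Suc p)) U\<^esub>) \<in> conn p"
      using HU.zero_closed HW.zero_closed mod_hom_zero[OF f U V] mod_hom_zero[OF g V W] d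
      unfolding conn_def by (intro CollectI case_prodI conjI bexI[of _ "\<lambda>c\<in>carrier (P p). \<zero>\<^bsub>V\<^esub>"]) auto
  next
    fix w u w' u' assume "(w, u) \<in> conn p" "(w', u') \<in> conn p"
    then obtain v v' where *: "w \<in> mod_hom R (P p) W" "u \<in> mod_hom R (P (Suc p)) U" "v \<in> mod_hom R (P p) V"
      "w' \<in> mod_hom R (P p) W" "u' \<in> mod_hom R (P (Suc p)) U" "v' \<in> mod_hom R (P p) V"
      "\<forall>c\<in>carrier (P p). g (v c) = w c" "\<forall>c\<in>carrier (P (Suc p)). v (dd p c) = f (u c)"
      "\<forall>c\<in>carrier (P p). g (v' c) = w' c" "\<forall>c\<in>carrier (P (Suc p)). v' (dd p c) = f (u' c)" unfolding conn_def by blast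
    then show "(w \<oplus>\<^bsub>hom_module R (P p) W\<^esub> w', u \<oplus>\<^bsub>hom_module R (P (Suc p)) U\<^esub> u') \<in> conn p"
      using HU.add.m_closed[of u u'] HW.add.m_closed[of w w'] HV.add.m_closed[of v v']
        mod_hom_add[OF f] mod_hom_add[OF g] d unfolding conn_def
      by (intro CollectI case_prodI conjI bexI[of _ "v \<oplus>\<^bsub>hom_module R (P p) V\<^esub> v'"]) (auto simp: mod_hom_closed)
  next
    fix a w u assume a: "a \<in> carrier R" and "(w, u) \<in> conn p"
    then obtain v where *: "w \<in> mod_hom R (P p) W" "u \<in> mod_hom R (P (Suc p)) U" "v \<in> mod_hom R (P p) V"
      "\<forall>c\<in>carrier (P p). g (v c) = w c" "\<forall>c\<in>carrier (P (Suc p)). v (dd p c) = f (u c)" unfolding conn_def by blast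
    then show "(a \<odot>\<^bsub>hom_module R (P p) W\<^esub> w, a \<odot>\<^bsub>hom_module R (P (Suc p)) U\<^esub> u) \<in> conn p"
      using a HU.smult_closed[of a u] HW.smult_closed[of a w] HV.smult_closed[of a v]
        mod_hom_smult[OF f] mod_hom_smult[OF g] d unfolding conn_def
      by (intro CollectI case_prodI conjI bexI[of _ "a \<odot>\<^bsub>hom_module R (P p) V\<^esub> v"]) (auto simp: mod_hom_closed)
  qed (auto simp: conn_def)
qed

lemma conn_total:
  assumes "w \<in> Zc R X W p"
  shows "\<exists>u\<in>Zc R X U (Suc p). (w, u) \<in> conn p"
proof -
  have w: "w \<in> mod_hom R (P p) W" "\<And>c. c \<in> carrier (P (Suc p)) \<Longrightarrow> w (dd p c) = \<zero>\<^bsub>W\<^esub>"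
    using assms by (auto simp: Zc_def)
  note d = mod_hom_closed[OF res_diff_hom[OF X]]
  obtain v where v: "v \<in> mod_hom R (P p) V" "\<forall>c\<in>carrier (P p). g (v c) = w c" using lift_g[OF w(1)] by blast
  obtain u where u: "u \<in> mod_hom R (P (Suc p)) U" "\<forall>c\<in>carrier (P (Suc p)). f (u c) = v (dd p c)"
    using lift_f[OF mP mod_hom_compose[OF res_diff_hom[OF X] v(1) mP]] v(2) w(2) d by (auto simp: compose_eq)
  have "u (dd (Suc p) c) = \<zero>\<^bsub>U\<^esub>" if c: "c \<in> carrier (P (Suc (Suc p)))" for c
  proof (rule inj_onD[OF f_inj])
    show "f (u (dd (Suc p) c)) = f \<zero>\<^bsub>U\<^esub>"
      using u(2) d[OF c] diff_diff[OF c] mod_hom_zero[OF v(1) mP V] mod_hom_zero[OF f U V] by simp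
  qed (use mod_hom_closed[OF u(1)] d[OF c] in auto)
  then have "u \<in> Zc R X U (Suc p)" using u(1) by (simp add: Zc_def)
  moreover have "(w, u) \<in> conn p" using u v w(1) by (auto simp: conn_def intro!: bexI[of _ v])
  ultimately show ?thesis by blast
qed

text \<open>
  The difference of the two lifts \<open>v\<close> and \<open>v0\<close> of \<open>w\<close> takes its values in \<open>f ` U\<close>, and \<open>u\<close> is its
  coboundary.
\<close>

lemma conn_boundary:
  assumes "(w, u) \<in> conn p" "v0 \<in> Zc R X V p" "\<forall>c\<in>carrier (P p). w c = g (v0 c)"
  shows "u \<in> Bc R X U (Suc p)"
proof -
  obtain v where v: "u \<in> mod_hom R (P (Suc p)) U" "v \<in> mod_hom R (P p) V"
    "\<forall>c\<in>carrier (P p). g (v c) = w c" "\<forall>c\<in>carrier (P (Suc p)). v (dd p c) = f (u c)"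
    using assms(1) unfolding conn_def by blast
  note d = mod_hom_closed[OF res_diff_hom[OF X]]
  have v0: "v0 \<in> mod_hom R (P p) V" "\<And>c. c \<in> carrier (P (Suc p)) \<Longrightarrow> v0 (dd p c) = \<zero>\<^bsub>V\<^esub>"
    using assms(2) by (auto simp: Zc_def)
  let ?x = "mdiff R (hom_module R (P p) V) v v0"
  have x: "?x \<in> mod_hom R (P p) V" using mdiff_closed[OF mHom[OF V]] v(2) v0(1) by simp
  have xc: "?x c = mdiff R V (v c) (v0 c)" if "c \<in> carrier (P p)" for c
    using that by (simp add: hom_module_mdiff[OF mP])
  have "g (?x c) = \<zero>\<^bsub>W\<^esub>" if c: "c \<in> carrier (P p)" for c
    using xc[OF c] mod_hom_mdiff[OF g V mod_hom_closed[OF v(2) c] mod_hom_closed[OF v0(1) c]] v(3) assms(3) c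
      mdiff_self[OF W mod_hom_closed[OF g mod_hom_closed[OF v0(1) c]]] by simp
  then obtain u' where u': "u' \<in> mod_hom R (P p) U" "\<forall>c\<in>carrier (P p). f (u' c) = ?x c" using lift_f[OF mP x] by blast
  have "u c = u' (dd p c)" if c: "c \<in> carrier (P (Suc p))" for c
  proof (rule inj_onD[OF f_inj])
    show "f (u c) = f (u' (dd p c))"
      using u'(2) d[OF c] xc[OF d[OF c]] v0(2)[OF c] v(4) c mod_hom_closed[OF f mod_hom_closed[OF v(1) c]]
      by (simp add: mdiff_zero[OF V])
  qed (use mod_hom_closed[OF v(1) c] mod_hom_closed[OF u'(1) d[OF c]] in auto)
  then show ?thesis using u'(1) v(1) unfolding Bc_Suc by blast
qed

lemma Bc_lift:
  assumes "w \<in> Bc R X W p"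
  shows "\<exists>v0\<in>Bc R X V p. \<forall>c\<in>carrier (P p). w c = g (v0 c)"
proof (cases p)
  case 0
  then show ?thesis using assms mod_hom_zero[OF g V W] by (auto simp: Bc_0)
next
  case (Suc m)
  then obtain \<psi> where \<psi>: "\<psi> \<in> mod_hom R (P m) W" "\<forall>c\<in>carrier (P p). w c = \<psi> (dd m c)"
    using assms Bc_Suc by blast
  obtain v where v: "v \<in> mod_hom R (P m) V" "\<forall>c\<in>carrier (P m). g (v c) = \<psi> c" using lift_g[OF \<psi>(1)] by blast
  have "compose (carrier (P p)) v (dd m) \<in> Bc R X V p" using v(1) Suc by (auto simp: Bc_def)
  moreover have "\<forall>c\<in>carrier (P p). w c = g (compose (carrier (P p)) v (dd m) c)"
    using v(2) \<psi>(2) Suc mod_hom_closed[OF res_diff_hom[OF X]] by (simp add: compose_eq)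
  ultimately show ?thesis by blast
qed

lemma conn_Bc: "(w, u) \<in> conn p \<Longrightarrow> w \<in> Bc R X W p \<Longrightarrow> u \<in> Bc R X U (Suc p)"
  using Bc_lift conn_boundary Bc_subset_Zc[OF V] by blast

text \<open>
  If \<open>u\<close> is the coboundary of \<open>\<psi>\<close>, then \<open>v - f \<psi>\<close> is a cocycle that still lifts \<open>w\<close>.
\<close>

lemma conn_kernel:
  assumes "(w, u) \<in> conn p" "u \<in> Bc R X U (Suc p)"
  shows "\<exists>v\<in>Zc R X V p. \<forall>c\<in>carrier (P p). w c = g (v c)"
proof -
  obtain v where v: "u \<in> mod_hom R (P (Suc p)) U" "v \<in> mod_hom R (P p) V"
    "\<forall>c\<in>carrier (P p). g (v c) = w c" "\<forall>c\<in>carrier (P (Suc p)). v (dd p c) = f (u c)" "w \<in> mod_hom R (P p) W"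
    using assms(1) unfolding conn_def by blast
  obtain u' where u': "u' \<in> mod_hom R (P p) U" "\<forall>c\<in>carrier (P (Suc p)). u c = u' (dd p c)"
    using assms(2) unfolding Bc_Suc by blast
  note d = mod_hom_closed[OF res_diff_hom[OF X]]
  let ?fu = "compose (carrier (P p)) f u'"
  let ?x = "mdiff R (hom_module R (P p) V) v ?fu"
  have fu: "?fu \<in> mod_hom R (P p) V" by (rule mod_hom_compose[OF u'(1) f mP])
  have x: "?x \<in> mod_hom R (P p) V" using mdiff_closed[OF mHom[OF V]] v(2) fu by simp
  have xc: "?x c = mdiff R V (v c) (f (u' c))" if "c \<in> carrier (P p)" for c
    using that by (simp add: hom_module_mdiff[OF mP] compose_eq)
  note cl = mod_hom_closed[OF v(2)] mod_hom_closed[OF f mod_hom_closed[OF u'(1)]]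
  have "g (?x c) = w c" if c: "c \<in> carrier (P p)" for c
    using xc[OF c] mod_hom_mdiff[OF g V cl(1)[OF c] cl(2)[OF c]] v(3) c ses_composite_zero[OF mod_hom_closed[OF u'(1) c]]
      mdiff_zero[OF W mod_hom_closed[OF v(5) c]] by simp
  moreover have "?x (dd p c) = \<zero>\<^bsub>V\<^esub>" if c: "c \<in> carrier (P (Suc p))" for c
    using xc[OF d[OF c]] v(4) u'(2) c mdiff_self[OF V cl(2)[OF d[OF c]]] by simp
  ultimately show ?thesis using x by (force simp: Zc_def)
qed

text \<open>
  If \<open>f u\<close> is the coboundary of \<open>\<psi>\<close>, then \<open>g \<psi>\<close> is a cocycle, and \<open>\<psi>\<close> is a lift that shows its
  relation to \<open>u\<close>.
\<close>

lemma conn_surj: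
  assumes "u \<in> Zc R X U (Suc p)" "v' \<in> Bc R X V (Suc p)" "\<forall>c\<in>carrier (P (Suc p)). v' c = f (u c)"
  shows "\<exists>w\<in>Zc R X W p. (w, u) \<in> conn p"
proof -
  have u: "u \<in> mod_hom R (P (Suc p)) U" using assms(1) by (simp add: Zc_def)
  obtain v where v: "v \<in> mod_hom R (P p) V" "\<forall>c\<in>carrier (P (Suc p)). v' c = v (dd p c)"
    using assms(2) unfolding Bc_Suc by blast
  let ?w = "compose (carrier (P p)) g v"
  have w: "?w \<in> mod_hom R (P p) W" by (rule mod_hom_compose[OF v(1) g mP])
  note d = mod_hom_closed[OF res_diff_hom[OF X]]
  have "?w (dd p c) = \<zero>\<^bsub>W\<^esub>" if c: "c \<in> carrier (P (Suc p))" for c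
  proof -
    have "v (dd p c) = f (u c)" using v(2) assms(3) c by auto
    then show ?thesis using d[OF c] ses_composite_zero[OF mod_hom_closed[OF u c]] by (simp add: compose_eq)
  qed
  then have "?w \<in> Zc R X W p" using w by (auto simp: Zc_def)
  moreover have "(?w, u) \<in> conn p"
    unfolding conn_def using w u v assms(3) by (auto simp: compose_eq intro!: bexI[of _ v])
  ultimately show ?thesis by blast
qed

lemma pc_total:
  assumes "v \<in> Zc R X V p"
  shows "compose (carrier (P p)) g v \<in> Zc R X W p"
  using assms mod_hom_compose[OF _ g mP] mod_hom_zero[OF g V W] mod_hom_closed[OF res_diff_hom[OF X]]
  by (auto simp: Zc_def compose_eq)

lemma pc_total_f:
  assumes "u \<in> Zc R X U p"
  shows "compose (carrier (P p)) f u \<in> Zc R X V p"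
  using assms mod_hom_compose[OF _ f mP] mod_hom_zero[OF f U V] mod_hom_closed[OF res_diff_hom[OF X]]
  by (auto simp: Zc_def compose_eq)

lemma Bc_post:
  assumes "Module.module R Y" "Module.module R Y'" "h \<in> mod_hom R Y Y'" "v \<in> Bc R X Y p"
    "w \<in> mod_hom R (P p) Y'" "\<forall>c\<in>carrier (P p). w c = h (v c)"
  shows "w \<in> Bc R X Y' p"
proof (cases p)
  case 0
  then have "w = (\<lambda>c\<in>carrier (P 0). \<zero>\<^bsub>Y'\<^esub>)"
    using assms mod_hom_zero[OF assms(3,1,2)]
    by (intro extensionalityI[OF mod_hom_ext[OF assms(5)]]) (auto simp: Bc_0)
  then show ?thesis using 0 by (simp add: Bc_0)
next
  case (Suc m)
  then obtain \<psi> where \<psi>: "\<psi> \<in> mod_hom R (P m) Y" "\<forall>c\<in>carrier (P p). v c = \<psi> (dd m c)" using assms(4) Bc_Suc by blast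
  have "compose (carrier (P m)) h \<psi> \<in> mod_hom R (P m) Y'" by (rule mod_hom_compose[OF \<psi>(1) assms(3) mP])
  moreover have "\<forall>c\<in>carrier (P p). w c = compose (carrier (P m)) h \<psi> (dd m c)"
    using \<psi>(2) assms(6) Suc mod_hom_closed[OF res_diff_hom[OF X]] by (simp add: compose_eq)
  ultimately show ?thesis using assms(5) Suc Bc_Suc by blast
qed

text \<open>
  The long exact sequence of Ext, with its three positions, in the form in which it is used: a
  term is weakly Laskerian if its two neighbours are.
\<close>

lemma Ext_exact_sub:
  assumes "weakly_Laskerian R (Ext R p X W)" "weakly_Laskerian R (Ext R (Suc p) X V)"
  shows "weakly_Laskerian R (Ext R (Suc p) X U)"
  unfolding weakly_Laskerian_Ext_iff[OF U]
proof (rule wl_exact[OF mHom[OF W] mHom[OF U] mHom[OF V] Zc_submodule[OF W] Bc_subset_Zc[OF W]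
      Zc_submodule[OF U] Bc_submodule[OF U] Bc_subset_Zc[OF U] Zc_submodule[OF V] Bc_submodule[OF V] Bc_subset_Zc[OF V]
      conn_linrel _ _ Bc_submodule[OF W] postcompose_linrel[OF mP U V f]])
  fix y z assume y: "y \<in> Zc R X U (Suc p)"
    "(y, z) \<in> {(v, w). v \<in> mod_hom R (P (Suc p)) U \<and> w \<in> mod_hom R (P (Suc p)) V \<and> (\<forall>c\<in>carrier (P (Suc p)). w c = f (v c))}"
    "z \<in> Bc R X V (Suc p)"
  then obtain w where "w \<in> Zc R X W p" "(w, y) \<in> conn p" using conn_surj[OF y(1,3)] by auto
  moreover have "mdiff R (hom_module R (P (Suc p)) U) y y \<in> Bc R X U (Suc p)"
    using mdiff_self[OF mHom[OF U] submodule_mem[OF Zc_submodule[OF U] y(1)]] submodule_zero[OF Bc_submodule[OF U]] by simp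
  ultimately show "\<exists>x\<in>Zc R X W p. \<exists>y'. (x, y') \<in> conn p \<and> mdiff R (hom_module R (P (Suc p)) U) y y' \<in> Bc R X U (Suc p)" by blast
next
  show "\<exists>z\<in>Zc R X V (Suc p). (y, z) \<in> {(v, w). v \<in> mod_hom R (P (Suc p)) U \<and> w \<in> mod_hom R (P (Suc p)) V \<and>
      (\<forall>c\<in>carrier (P (Suc p)). w c = f (v c))}" if "y \<in> Zc R X U (Suc p)" for y
    using that pc_total_f[OF that] by (intro bexI[OF _ pc_total_f[OF that]]) (auto simp: Zc_def compose_eq)
qed (use assms conn_total conn_Bc Bc_post[OF U V f] in \<open>auto simp: weakly_Laskerian_Ext_iff[OF W] weakly_Laskerian_Ext_iff[OF V]\<close>)

lemma Ext_exact_quot: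
  assumes "weakly_Laskerian R (Ext R p X V)" "weakly_Laskerian R (Ext R (Suc p) X U)"
  shows "weakly_Laskerian R (Ext R p X W)"
  unfolding weakly_Laskerian_Ext_iff[OF W]
proof (rule wl_exact[OF mHom[OF V] mHom[OF W] mHom[OF U] Zc_submodule[OF V] Bc_subset_Zc[OF V]
      Zc_submodule[OF W] Bc_submodule[OF W] Bc_subset_Zc[OF W] Zc_submodule[OF U] Bc_submodule[OF U] Bc_subset_Zc[OF U]
      postcompose_linrel[OF mP V W g] _ _ Bc_submodule[OF V] conn_linrel])
  let ?r = "{(v, w). v \<in> mod_hom R (P p) V \<and> w \<in> mod_hom R (P p) W \<and> (\<forall>c\<in>carrier (P p). w c = g (v c))}"
  fix y z assume y: "y \<in> Zc R X W p" "(y, z) \<in> conn p" "z \<in> Bc R X U (Suc p)"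
  then obtain v where "v \<in> Zc R X V p" "\<forall>c\<in>carrier (P p). y c = g (v c)" using conn_kernel by blast
  then have "v \<in> Zc R X V p" "(v, y) \<in> ?r" using y by (auto simp: Zc_def)
  moreover have "mdiff R (hom_module R (P p) W) y y \<in> Bc R X W p"
    using mdiff_self[OF mHom[OF W] submodule_mem[OF Zc_submodule[OF W] y(1)]] submodule_zero[OF Bc_submodule[OF W]] by simp
  ultimately show "\<exists>x\<in>Zc R X V p. \<exists>y'. (x, y') \<in> ?r \<and> mdiff R (hom_module R (P p) W) y y' \<in> Bc R X W p" by blast
next
  show "\<exists>z\<in>Zc R X W p. (y, z) \<in> {(v, w). v \<in> mod_hom R (P p) V \<and> w \<in> mod_hom R (P p) W \<and> (\<forall>c\<in>carrier (P p). w c = g (v c))}"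
    if "y \<in> Zc R X V p" for y
    using that by (intro bexI[OF _ pc_total[OF that]]) (use pc_total[OF that] in \<open>auto simp: Zc_def compose_eq\<close>)
qed (use assms conn_total conn_Bc Bc_post[OF V W g] in \<open>auto simp: weakly_Laskerian_Ext_iff[OF U] weakly_Laskerian_Ext_iff[OF V]\<close>)

lemma Ext_exact_mid:
  assumes "weakly_Laskerian R (Ext R p X U)" "weakly_Laskerian R (Ext R p X W)"
  shows "weakly_Laskerian R (Ext R p X V)"
  unfolding weakly_Laskerian_Ext_iff[OF V]
proof (rule wl_exact[OF mHom[OF U] mHom[OF V] mHom[OF W] Zc_submodule[OF U] Bc_subset_Zc[OF U]
      Zc_submodule[OF V] Bc_submodule[OF V] Bc_subset_Zc[OF V] Zc_submodule[OF W] Bc_submodule[OF W] Bc_subset_Zc[OF W]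
      postcompose_linrel[OF mP U V f] _ _ Bc_submodule[OF U] postcompose_linrel[OF mP V W g]])
  let ?r = "{(v, w). v \<in> mod_hom R (P p) U \<and> w \<in> mod_hom R (P p) V \<and> (\<forall>c\<in>carrier (P p). w c = f (v c))}"
  fix v w assume v: "v \<in> Zc R X V p" and w: "w \<in> Bc R X W p"
    and vw: "(v, w) \<in> {(v, w). v \<in> mod_hom R (P p) V \<and> w \<in> mod_hom R (P p) W \<and> (\<forall>c\<in>carrier (P p). w c = g (v c))}"
  have vh: "v \<in> mod_hom R (P p) V" "\<And>c. c \<in> carrier (P p) \<Longrightarrow> w c = g (v c)" using vw by auto
  obtain v0 where v0: "v0 \<in> Bc R X V p" "\<forall>c\<in>carrier (P p). w c = g (v0 c)" using Bc_lift[OF w] by blast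
  have v0Z: "v0 \<in> Zc R X V p" using v0(1) Bc_subset_Zc[OF V] by blast
  then have v0h: "v0 \<in> mod_hom R (P p) V" by (simp add: Zc_def)
  let ?x = "mdiff R (hom_module R (P p) V) v v0"
  have xZ: "?x \<in> Zc R X V p" by (rule submodule_mdiff[OF Zc_submodule[OF V] mHom[OF V] v v0Z])
  then have x: "?x \<in> mod_hom R (P p) V" by (simp add: Zc_def)
  have xc: "?x c = mdiff R V (v c) (v0 c)" if "c \<in> carrier (P p)" for c
    using that by (simp add: hom_module_mdiff[OF mP])
  have "g (?x c) = \<zero>\<^bsub>W\<^esub>" if c: "c \<in> carrier (P p)" for c
    using xc[OF c] mod_hom_mdiff[OF g V mod_hom_closed[OF vh(1) c] mod_hom_closed[OF v0h c]] v0(2) vh(2)[OF c] c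
      mdiff_self[OF W mod_hom_closed[OF g mod_hom_closed[OF v0h c]]] by simp
  then obtain u where u: "u \<in> mod_hom R (P p) U" "\<forall>c\<in>carrier (P p). f (u c) = ?x c" using lift_f[OF mP x] by blast
  note d = mod_hom_closed[OF res_diff_hom[OF X]]
  have "u (dd p c) = \<zero>\<^bsub>U\<^esub>" if c: "c \<in> carrier (P (Suc p))" for c
  proof (rule inj_onD[OF f_inj])
    have "f (u (dd p c)) = ?x (dd p c)" using u(2) d[OF c] by blast
    also have "\<dots> = f \<zero>\<^bsub>U\<^esub>" using xZ c mod_hom_zero[OF f U V] by (simp add: Zc_def)
    finally show "f (u (dd p c)) = f \<zero>\<^bsub>U\<^esub>" .
  qed (use mod_hom_closed[OF u(1)] d[OF c] in auto)
  then have "u \<in> Zc R X U p" using u(1) by (simp add: Zc_def)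
  moreover have "(u, ?x) \<in> ?r" using u x by simp
  moreover have "mdiff R (hom_module R (P p) V) v ?x \<in> Bc R X V p"
    using mdiff_mdiff[OF mHom[OF V], of v p v0] vh(1) v0h v0(1) by simp
  ultimately show "\<exists>x\<in>Zc R X U p. \<exists>y'. (x, y') \<in> ?r \<and> mdiff R (hom_module R (P p) V) v y' \<in> Bc R X V p" by blast
next
  show "\<exists>z\<in>Zc R X W p. (y, z) \<in> {(v, w). v \<in> mod_hom R (P p) V \<and> w \<in> mod_hom R (P p) W \<and> (\<forall>c\<in>carrier (P p). w c = g (v c))}"
    if "y \<in> Zc R X V p" for y
    using that by (intro bexI[OF _ pc_total[OF that]]) (use pc_total[OF that] in \<open>auto simp: Zc_def compose_eq\<close>)
  show "\<exists>z\<in>Zc R X V p. (y, z) \<in> {(v, w). v \<in> mod_hom R (P p) U \<and> w \<in> mod_hom R (P p) V \<and> (\<forall>c\<in>carrier (P p). w c = f (v c))}"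
    if "y \<in> Zc R X U p" for y
    using that by (intro bexI[OF _ pc_total_f[OF that]]) (use pc_total_f[OF that] in \<open>auto simp: Zc_def compose_eq\<close>)
qed (use assms Bc_post[OF U V f] Bc_post[OF V W g] in \<open>auto simp: weakly_Laskerian_Ext_iff[OF U] weakly_Laskerian_Ext_iff[OF W]\<close>)

end

end

subsection \<open>Ext of a cyclic module in degree zero\<close>

definition torsion :: "('a, 'r) ring_scheme \<Rightarrow> 'a set \<Rightarrow> ('a, 'y) module \<Rightarrow> 'y set" where
  "torsion R J Y = {y \<in> carrier Y. \<forall>a\<in>J. a \<odot>\<^bsub>Y\<^esub> y = \<zero>\<^bsub>Y\<^esub>}"

lemma torsion_submodule:
  assumes "Module.module R Y" "J \<subseteq> carrier R"
  shows "submodule (torsion R J Y) R Y"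
proof -
  interpret Y: Module.module R Y by fact
  show ?thesis
  proof (rule submodule_intro[OF assms(1)])
    show "c \<odot>\<^bsub>Y\<^esub> x \<in> torsion R J Y" if c: "c \<in> carrier R" and x: "x \<in> torsion R J Y" for c x
    proof -
      have "a \<odot>\<^bsub>Y\<^esub> (c \<odot>\<^bsub>Y\<^esub> x) = \<zero>\<^bsub>Y\<^esub>" if a: "a \<in> J" for a
      proof -
        have "a \<odot>\<^bsub>Y\<^esub> (c \<odot>\<^bsub>Y\<^esub> x) = c \<odot>\<^bsub>Y\<^esub> (a \<odot>\<^bsub>Y\<^esub> x)"
        proof -
          have "a \<in> carrier R" "x \<in> carrier Y" using a x assms(2) by (auto simp: torsion_def)
          then show ?thesis using c by (simp add: Y.smult_assoc1[symmetric] Y.m_comm)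
        qed
        then show ?thesis using a c x by (simp add: torsion_def)
      qed
      then show ?thesis using c x by (simp add: torsion_def)
    qed
  qed (use assms(2) in \<open>auto simp: torsion_def Y.smult_r_distr subset_iff\<close>)
qed

context
  fixes R :: "('a, 'r) ring_scheme" and J :: "'a set"
  assumes R: "cring R" and J: "submodule J R (reg_module R)"
begin

interpretation R: cring R by (rule R)

private abbreviation "A \<equiv> quot_module (reg_module R) J"
private abbreviation "PA \<equiv> res_module R A"
private abbreviation "dA \<equiv> res_diff R A"

lemma cyclic_module: "Module.module R A"
  by (rule quot_module[OF reg_module_module[OF R] J])

lemma cyclic_one: "J +>\<^bsub>reg_module R\<^esub> \<one>\<^bsub>R\<^esub> \<in> carrier A"
  by (simp add: quot_carrier[OF reg_module_module[OF R] J])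

lemma cyclic_smult_one: "a \<in> carrier R \<Longrightarrow> a \<odot>\<^bsub>A\<^esub> (J +>\<^bsub>reg_module R\<^esub> \<one>\<^bsub>R\<^esub>) = J +>\<^bsub>reg_module R\<^esub> a"
  using quot_smult[OF reg_module_module[OF R] J, of a "\<one>\<^bsub>R\<^esub>"] by simp

lemma cyclic_elem:
  assumes "X \<in> carrier A"
  shows "\<exists>a\<in>carrier R. X = a \<odot>\<^bsub>A\<^esub> (J +>\<^bsub>reg_module R\<^esub> \<one>\<^bsub>R\<^esub>)"
  using assms cyclic_smult_one by (auto simp: quot_carrier[OF reg_module_module[OF R] J])

lemma cyclic_gen:
  assumes "submodule V R A" "J +>\<^bsub>reg_module R\<^esub> \<one>\<^bsub>R\<^esub> \<in> V"
  shows "carrier A \<subseteq> V"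
  using cyclic_elem submodule_smult[OF assms(1) _ assms(2)] by auto

text \<open>
  The basis element of the standard resolution of \<open>R/J\<close> above the generator of \<open>R/J\<close>. Evaluation
  at it identifies the cocycles of degree zero with the \<open>J\<close>-torsion of \<open>Y\<close>, which gives \<open>Hom (R/J,
  Y)\<close> its usual form.
\<close>

definition gen1 :: "('a, 'a set) syz \<Rightarrow> 'a" where
  "gen1 = free_unit R (Gen (J +>\<^bsub>reg_module R\<^esub> \<one>\<^bsub>R\<^esub>))"

lemma gen1_closed: "gen1 \<in> carrier (PA 0)"
  unfolding gen1_def by (rule gen_unit_closed[OF cyclic_module cyclic_one])

lemma aug_gen1: "res_aug R A gen1 = J +>\<^bsub>reg_module R\<^esub> \<one>\<^bsub>R\<^esub>"
  unfolding gen1_def by (rule res_aug_unit[OF cyclic_module cyclic_one])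

text \<open>
  A cocycle of degree zero vanishes on the kernel of the augmentation, so its values depend only
  on the image in \<open>R/J\<close>, a multiple of the generator.
\<close>

lemma cocycle_value:
  assumes "Module.module R Y" "\<phi> \<in> Zc R A Y 0" "c \<in> carrier (PA 0)"
  shows "\<exists>a\<in>carrier R. res_aug R A c = a \<odot>\<^bsub>A\<^esub> (J +>\<^bsub>reg_module R\<^esub> \<one>\<^bsub>R\<^esub>) \<and> \<phi> c = a \<odot>\<^bsub>Y\<^esub> \<phi> gen1"
proof -
  note mP = res_module_module[OF R, of A 0]
  interpret PA: Module.module R "PA 0" by (rule mP)
  have \<phi>: "\<phi> \<in> mod_hom R (PA 0) Y" "\<And>c. c \<in> carrier (PA (Suc 0)) \<Longrightarrow> \<phi> (dA 0 c) = \<zero>\<^bsub>Y\<^esub>"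
    using assms(2) by (auto simp: Zc_def)
  obtain a where a: "a \<in> carrier R" "res_aug R A c = a \<odot>\<^bsub>A\<^esub> (J +>\<^bsub>reg_module R\<^esub> \<one>\<^bsub>R\<^esub>)"
    using cyclic_elem[OF mod_hom_closed[OF res_aug_hom[OF cyclic_module] assms(3)]] by blast
  have ag: "a \<odot>\<^bsub>PA 0\<^esub> gen1 \<in> carrier (PA 0)" using a gen1_closed by simp
  let ?x = "mdiff R (PA 0) c (a \<odot>\<^bsub>PA 0\<^esub> gen1)"
  have x: "?x \<in> carrier (PA 0)" by (rule mdiff_closed[OF mP assms(3) ag])
  have "res_aug R A ?x = \<zero>\<^bsub>A\<^esub>"
    using mod_hom_mdiff[OF res_aug_hom[OF cyclic_module] mP assms(3) ag]
      mod_hom_smult[OF res_aug_hom[OF cyclic_module] a(1) gen1_closed] a(2)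
      mdiff_self[OF cyclic_module mod_hom_closed[OF res_aug_hom[OF cyclic_module] assms(3)]]
    by (simp add: aug_gen1)
  then obtain d where "d \<in> carrier (PA 1)" "dA 0 d = ?x" using res_exact_aug[OF cyclic_module x] by blast
  then have "\<phi> ?x = \<zero>\<^bsub>Y\<^esub>" using \<phi>(2)[of d] by simp
  then have "mdiff R Y (\<phi> c) (\<phi> (a \<odot>\<^bsub>PA 0\<^esub> gen1)) = \<zero>\<^bsub>Y\<^esub>" using mod_hom_mdiff[OF \<phi>(1) mP assms(3) ag] by simp
  then have "\<phi> c = \<phi> (a \<odot>\<^bsub>PA 0\<^esub> gen1)"
    using mdiff_eq_zero[OF assms(1)] mod_hom_closed[OF \<phi>(1)] assms(3) ag by blast
  then show ?thesis using mod_hom_smult[OF \<phi>(1) a(1) gen1_closed] a by auto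
qed

lemma cocycle_gen1_torsion:
  assumes "Module.module R Y" "\<phi> \<in> Zc R A Y 0"
  shows "\<phi> gen1 \<in> torsion R J Y"
proof -
  have \<phi>: "\<phi> \<in> mod_hom R (PA 0) Y" "\<And>c. c \<in> carrier (PA (Suc 0)) \<Longrightarrow> \<phi> (dA 0 c) = \<zero>\<^bsub>Y\<^esub>"
    using assms(2) by (auto simp: Zc_def)
  interpret PA: Module.module R "PA 0" by (rule res_module_module[OF R])
  have "a \<odot>\<^bsub>Y\<^esub> \<phi> gen1 = \<zero>\<^bsub>Y\<^esub>" if a: "a \<in> J" for a
  proof -
    have aR: "a \<in> carrier R" using submodule_mem[OF J a] by simp
    have ag: "a \<odot>\<^bsub>PA 0\<^esub> gen1 \<in> carrier (PA 0)" using aR gen1_closed by simp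
    have "res_aug R A (a \<odot>\<^bsub>PA 0\<^esub> gen1) = J +>\<^bsub>reg_module R\<^esub> a"
      using mod_hom_smult[OF res_aug_hom[OF cyclic_module] aR gen1_closed] aug_gen1 cyclic_smult_one[OF aR] by simp
    also have "\<dots> = \<zero>\<^bsub>A\<^esub>"
      using coset_eq_zero_iff[OF reg_module_module[OF R] J, of a] a aR
      by (simp add: quot_zero[OF reg_module_module[OF R] J])
    finally obtain d where "d \<in> carrier (PA 1)" "dA 0 d = a \<odot>\<^bsub>PA 0\<^esub> gen1"
      using res_exact_aug[OF cyclic_module ag] by blast
    then have "\<phi> (a \<odot>\<^bsub>PA 0\<^esub> gen1) = \<zero>\<^bsub>Y\<^esub>" using \<phi>(2)[of d] by simp
    then show ?thesis using mod_hom_smult[OF \<phi>(1) aR gen1_closed] by simp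
  qed
  then show ?thesis using mod_hom_closed[OF \<phi>(1) gen1_closed] by (simp add: torsion_def)
qed

lemma torsion_cocycle_exists:
  assumes "Module.module R Y" "y \<in> torsion R J Y"
  shows "\<exists>\<phi>\<in>Zc R A Y 0. \<phi> gen1 = y"
proof -
  interpret Y: Module.module R Y by fact
  note reg = reg_module_module[OF R]
  have y: "y \<in> carrier Y" "\<And>a. a \<in> J \<Longrightarrow> a \<odot>\<^bsub>Y\<^esub> y = \<zero>\<^bsub>Y\<^esub>" using assms(2) by (auto simp: torsion_def)
  let ?p = "\<lambda>a\<in>carrier (reg_module R). J +>\<^bsub>reg_module R\<^esub> a"
  have "\<exists>h\<in>mod_hom R A Y. \<forall>a\<in>carrier (reg_module R). h (?p a) = (\<lambda>a\<in>carrier R. a \<odot>\<^bsub>Y\<^esub> y) a"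
  proof (rule hom_factor_surj[OF reg cyclic_module assms(1) quot_proj_hom[OF reg J]])
    show "(\<lambda>a\<in>carrier R. a \<odot>\<^bsub>Y\<^esub> y) \<in> mod_hom R (reg_module R) Y"
      by (rule mod_homI) (use y(1) in \<open>auto simp: Y.smult_l_distr Y.smult_assoc1\<close>)
    show "(\<lambda>a\<in>carrier R. a \<odot>\<^bsub>Y\<^esub> y) a = \<zero>\<^bsub>Y\<^esub>" if "a \<in> carrier (reg_module R)" "?p a = \<zero>\<^bsub>A\<^esub>" for a
      using that y(2)[of a] coset_eq_zero_iff[OF reg J, of a] by (simp add: quot_zero[OF reg J])
    show "?p ` carrier (reg_module R) = carrier A" by (simp add: quot_carrier[OF reg J])
  qed
  then obtain h where h: "h \<in> mod_hom R A Y" "\<forall>a\<in>carrier R. h (J +>\<^bsub>reg_module R\<^esub> a) = a \<odot>\<^bsub>Y\<^esub> y" by auto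
  let ?\<phi> = "compose (carrier (PA 0)) h (res_aug R A)"
  have "?\<phi> \<in> mod_hom R (PA 0) Y"
    by (rule mod_hom_compose[OF res_aug_hom[OF cyclic_module] h(1) res_module_module[OF R]])
  moreover have "?\<phi> (dA 0 c) = \<zero>\<^bsub>Y\<^esub>" if "c \<in> carrier (PA (Suc 0))" for c
    using that aug_diff[OF cyclic_module, of c] mod_hom_closed[OF res_diff_hom[OF cyclic_module] that]
      mod_hom_zero[OF h(1) cyclic_module assms(1)] by (simp add: compose_eq)
  ultimately have "?\<phi> \<in> Zc R A Y 0" by (simp add: Zc_def)
  moreover have "?\<phi> gen1 = y" using gen1_closed aug_gen1 h(2) y(1) by (simp add: compose_eq)
  ultimately show ?thesis by blast
qed

lemma cocycle_gen1_zero: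
  assumes "Module.module R Y" "\<phi> \<in> Zc R A Y 0" "\<phi> gen1 = \<zero>\<^bsub>Y\<^esub>" "c \<in> carrier (PA 0)"
  shows "\<phi> c = \<zero>\<^bsub>Y\<^esub>"
proof -
  interpret Y: Module.module R Y by fact
  show ?thesis using cocycle_value[OF assms(1,2,4)] assms(3) by auto
qed

lemma cocycle_gen1_eq:
  assumes "Module.module R Y" "\<phi> \<in> Zc R A Y 0" "\<psi> \<in> Zc R A Y 0" "\<phi> gen1 = \<psi> gen1" "c \<in> carrier (PA 0)"
  shows "\<phi> c = \<psi> c"
proof -
  let ?H = "hom_module R (PA 0) Y"
  have "mdiff R ?H \<phi> \<psi> \<in> Zc R A Y 0"
    by (rule submodule_mdiff[OF Zc_submodule[OF cyclic_module assms(1)] mHom[OF cyclic_module assms(1)] assms(2,3)])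
  moreover have c: "mdiff R ?H \<phi> \<psi> c = mdiff R Y (\<phi> c) (\<psi> c)" if "c \<in> carrier (PA 0)" for c
    using that by (simp add: hom_module_mdiff[OF res_module_module[OF R]])
  moreover have cl: "\<phi> c \<in> carrier Y" "\<psi> c \<in> carrier Y" if "c \<in> carrier (PA 0)" for c
    using that assms(2,3) by (auto simp: Zc_def mod_hom_closed)
  ultimately have "mdiff R Y (\<phi> c) (\<psi> c) = \<zero>\<^bsub>Y\<^esub>"
    using cocycle_gen1_zero[OF assms(1) _ _ assms(5)] assms(4,5) gen1_closed mdiff_self[OF assms(1)] by metis
  then show ?thesis using mdiff_eq_zero[OF assms(1)] cl[OF assms(5)] by blast
qed

context
  fixes U :: "('a, 'u) module" and V :: "('a, 'v) module" and W :: "('a, 'w) module"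
    and f :: "'u \<Rightarrow> 'v" and g :: "'v \<Rightarrow> 'w"
  assumes U: "Module.module R U" and V: "Module.module R V" and W: "Module.module R W"
    and f: "f \<in> mod_hom R U V" and g: "g \<in> mod_hom R V W"
    and f_inj: "inj_on f (carrier U)" and g_surj: "g ` carrier V = carrier W"
    and fg: "f ` carrier U = {v \<in> carrier V. g v = \<zero>\<^bsub>W\<^esub>}"
begin

private lemmas ses = cyclic_module U V W f g f_inj g_surj fg
private abbreviation "cn \<equiv> conn R A U V W f g"

lemma torsion_image: "u \<in> torsion R J U \<Longrightarrow> f u \<in> torsion R J V" "v \<in> torsion R J V \<Longrightarrow> g v \<in> torsion R J W"
  using mod_hom_smult[OF f, symmetric] mod_hom_zero[OF f U V] mod_hom_closed[OF f] submodule_mem[OF J]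
    mod_hom_smult[OF g, symmetric] mod_hom_zero[OF g V W] mod_hom_closed[OF g]
  by (auto simp: torsion_def)

text \<open>
  The sequence \<open>Hom (R/J, V) \<rightarrow> Hom (R/J, W) \<rightarrow> Ext 1 (R/J, U) \<rightarrow> Ext 1 (R/J, V)\<close>, where \<open>Hom (R/J,
  _)\<close> is the \<open>J\<close>-torsion. Only the cokernel of the first map has to be weakly Laskerian, which is
  what makes the statement stronger than \<open>Ext_exact_sub\<close>.
\<close>

lemma Ext_one_sub:
  assumes "wl R W (torsion R J W) (g ` torsion R J V)" "weakly_Laskerian R (Ext R 1 A V)"
  shows "weakly_Laskerian R (Ext R 1 A U)"
proof -
  note mH = mHom[OF cyclic_module] and Zs = Zc_submodule[OF cyclic_module]
    and Bs = Bc_submodule[OF cyclic_module] and BZ = Bc_subset_Zc[OF cyclic_module]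
  have Jc: "J \<subseteq> carrier R" using submodule_subset[OF J] by simp
  let ?r = "{(v, w). v \<in> mod_hom R (PA (Suc 0)) U \<and> w \<in> mod_hom R (PA (Suc 0)) V \<and> (\<forall>c\<in>carrier (PA (Suc 0)). w c = f (v c))}"
  define \<rho> where "\<rho> = {(y, u). \<exists>w\<in>Zc R A W 0. w gen1 = y \<and> (w, u) \<in> cn 0}"
  interpret HW: Module.module R "hom_module R (PA 0) W" by (rule mH[OF W])
  have cl: "linrel R (hom_module R (PA 0) W) (hom_module R (PA (Suc 0)) U) (cn 0)"
    by (rule conn_linrel[OF ses])
  have rho: "linrel R W (hom_module R (PA (Suc 0)) U) \<rho>"
  proof (rule linrelI)
    show "y \<in> carrier W \<and> u \<in> carrier (hom_module R (PA (Suc 0)) U)" if "(y, u) \<in> \<rho>" for y u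
      using that linrelD(2)[OF cl] gen1_closed by (auto simp: \<rho>_def Zc_def mod_hom_closed)
    show "(\<zero>\<^bsub>W\<^esub>, \<zero>\<^bsub>hom_module R (PA (Suc 0)) U\<^esub>) \<in> \<rho>"
      unfolding \<rho>_def using submodule_zero[OF Zs[OF W, of 0]] linrelD(3)[OF cl] gen1_closed
      by (intro CollectI case_prodI bexI[of _ "\<zero>\<^bsub>hom_module R (PA 0) W\<^esub>"]) auto
    show "(y \<oplus>\<^bsub>W\<^esub> y', u \<oplus>\<^bsub>hom_module R (PA (Suc 0)) U\<^esub> u') \<in> \<rho>" if yu: "(y, u) \<in> \<rho>" "(y', u') \<in> \<rho>" for y u y' u'
    proof -
      obtain w w' where "w \<in> Zc R A W 0" "w' \<in> Zc R A W 0" "w gen1 = y" "w' gen1 = y'" "(w, u) \<in> cn 0" "(w', u') \<in> cn 0"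
        using yu unfolding \<rho>_def by blast
      then show ?thesis unfolding \<rho>_def using submodule_add[OF Zs[OF W]] linrelD(4)[OF cl] gen1_closed
        by (intro CollectI case_prodI bexI[of _ "w \<oplus>\<^bsub>hom_module R (PA 0) W\<^esub> w'"] conjI) auto
    qed
    show "(a \<odot>\<^bsub>W\<^esub> y, a \<odot>\<^bsub>hom_module R (PA (Suc 0)) U\<^esub> u) \<in> \<rho>" if a: "a \<in> carrier R" "(y, u) \<in> \<rho>" for a y u
    proof -
      obtain w where "w \<in> Zc R A W 0" "w gen1 = y" "(w, u) \<in> cn 0" using a unfolding \<rho>_def by blast
      then show ?thesis unfolding \<rho>_def using a(1) submodule_smult[OF Zs[OF W]] linrelD(5)[OF cl] gen1_closed
        by (intro CollectI case_prodI bexI[of _ "a \<odot>\<^bsub>hom_module R (PA 0) W\<^esub> w"] conjI) auto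
    qed
  qed
  have "wl R (hom_module R (PA (Suc 0)) U) (Zc R A U (Suc 0)) (Bc R A U (Suc 0))"
  proof (rule wl_exact[OF W mH[OF U] mH[OF V] torsion_submodule[OF W Jc] _
        Zs[OF U] Bs[OF U] BZ[OF U] Zs[OF V] Bs[OF V] BZ[OF V] rho _ _ _ postcompose_linrel[OF cyclic_module res_module_module[OF R] U V f]])
    show "g ` torsion R J V \<subseteq> torsion R J W" using torsion_image by blast
    show "submodule (g ` torsion R J V) R W"
      by (rule mod_hom_image_submodule[OF g V W torsion_submodule[OF V Jc]])
    show "\<exists>u\<in>Zc R A U (Suc 0). (y, u) \<in> \<rho>" if y: "y \<in> torsion R J W" for y
    proof -
      obtain w where "w \<in> Zc R A W 0" "w gen1 = y" using torsion_cocycle_exists[OF W y] by blast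
      then show ?thesis using conn_total[OF ses] unfolding \<rho>_def by blast
    qed
    show "u \<in> Bc R A U (Suc 0)" if yu: "(y, u) \<in> \<rho>" "y \<in> g ` torsion R J V" for y u
    proof -
      obtain w where w: "w \<in> Zc R A W 0" "w gen1 = y" "(w, u) \<in> cn 0" using yu unfolding \<rho>_def by blast
      obtain v where v: "v \<in> torsion R J V" "y = g v" using yu(2) by blast
      obtain \<phi> where \<phi>: "\<phi> \<in> Zc R A V 0" "\<phi> gen1 = v" using torsion_cocycle_exists[OF V v(1)] by blast
      have "w c = g (\<phi> c)" if c: "c \<in> carrier (PA 0)" for c
        using cocycle_gen1_eq[OF W w(1) pc_total[OF ses \<phi>(1)] _ c] \<phi>(2) w(2) v(2) gen1_closed c
        by (simp add: compose_eq)
      then show ?thesis using conn_boundary[OF ses w(3) \<phi>(1)] by blast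
    qed
    show "\<exists>z\<in>Zc R A V (Suc 0). (y, z) \<in> ?r" if "y \<in> Zc R A U (Suc 0)" for y
      using that by (intro bexI[OF _ pc_total_f[OF ses that]])
        (use pc_total_f[OF ses that] in \<open>auto simp: Zc_def compose_eq\<close>)
    show "z \<in> Bc R A V (Suc 0)" if "(y, z) \<in> ?r" "y \<in> Bc R A U (Suc 0)" for y z
      using that Bc_post[OF ses U V f, of y "Suc 0" z] by blast
    show "\<exists>x\<in>torsion R J W. \<exists>y'. (x, y') \<in> \<rho> \<and> mdiff R (hom_module R (PA (Suc 0)) U) y y' \<in> Bc R A U (Suc 0)"
      if y: "y \<in> Zc R A U (Suc 0)" "(y, z) \<in> ?r" "z \<in> Bc R A V (Suc 0)" for y z
    proof -
      obtain w where w: "w \<in> Zc R A W 0" "(w, y) \<in> cn 0" using conn_surj[OF ses y(1,3)] y(2) by auto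
      then have "(w gen1, y) \<in> \<rho>" unfolding \<rho>_def by blast
      moreover have "w gen1 \<in> torsion R J W" by (rule cocycle_gen1_torsion[OF W w(1)])
      moreover have "mdiff R (hom_module R (PA (Suc 0)) U) y y \<in> Bc R A U (Suc 0)"
        using mdiff_self[OF mH[OF U] submodule_mem[OF Zs[OF U] y(1)]] submodule_zero[OF Bs[OF U]] by simp
      ultimately show ?thesis by blast
    qed
  qed (use assms in \<open>simp_all add: weakly_Laskerian_Ext_iff[OF cyclic_module V]\<close>)
  then show ?thesis by (simp add: weakly_Laskerian_Ext_iff[OF cyclic_module U])
qed

text \<open>
  The sequence \<open>Hom (R/J, U) \<rightarrow> Hom (R/J, V) \<rightarrow> Hom (R/J, W) \<rightarrow> Ext 1 (R/J, U)\<close>, again with torsion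
  submodules and with a hypothesis on the cokernel of the first map.
\<close>

lemma Ext_zero_quot:
  assumes "wl R V (torsion R J V) (f ` torsion R J U)" "weakly_Laskerian R (Ext R 1 A U)"
  shows "weakly_Laskerian R (Ext R 0 A W)"
proof -
  note mH = mHom[OF cyclic_module] and Zs = Zc_submodule[OF cyclic_module]
    and Bs = Bc_submodule[OF cyclic_module] and BZ = Bc_subset_Zc[OF cyclic_module]
  have Jc: "J \<subseteq> carrier R" using submodule_subset[OF J] by simp
  define \<sigma> where "\<sigma> = {(v, w). v \<in> mod_hom R (PA 0) V \<and> w \<in> mod_hom R (PA 0) W \<and> (\<forall>c\<in>carrier (PA 0). w c = g (v c))}"
  define \<rho> where "\<rho> = {(y, w). \<exists>v\<in>Zc R A V 0. v gen1 = y \<and> (v, w) \<in> \<sigma>}"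
  have cl: "linrel R (hom_module R (PA 0) V) (hom_module R (PA 0) W) \<sigma>"
    unfolding \<sigma>_def by (rule postcompose_linrel[OF cyclic_module res_module_module[OF R] V W g])
  have rho: "linrel R V (hom_module R (PA 0) W) \<rho>"
  proof (rule linrelI)
    show "y \<in> carrier V \<and> u \<in> carrier (hom_module R (PA 0) W)" if "(y, u) \<in> \<rho>" for y u
      using that linrelD(2)[OF cl] gen1_closed by (auto simp: \<rho>_def Zc_def mod_hom_closed)
    show "(\<zero>\<^bsub>V\<^esub>, \<zero>\<^bsub>hom_module R (PA 0) W\<^esub>) \<in> \<rho>"
      unfolding \<rho>_def using submodule_zero[OF Zs[OF V, of 0]] linrelD(3)[OF cl] gen1_closed
      by (intro CollectI case_prodI bexI[of _ "\<zero>\<^bsub>hom_module R (PA 0) V\<^esub>"]) auto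
    show "(y \<oplus>\<^bsub>V\<^esub> y', u \<oplus>\<^bsub>hom_module R (PA 0) W\<^esub> u') \<in> \<rho>" if yu: "(y, u) \<in> \<rho>" "(y', u') \<in> \<rho>" for y u y' u'
    proof -
      obtain w w' where "w \<in> Zc R A V 0" "w' \<in> Zc R A V 0" "w gen1 = y" "w' gen1 = y'" "(w, u) \<in> \<sigma>" "(w', u') \<in> \<sigma>"
        using yu unfolding \<rho>_def by blast
      then show ?thesis unfolding \<rho>_def using submodule_add[OF Zs[OF V]] linrelD(4)[OF cl] gen1_closed
        by (intro CollectI case_prodI bexI[of _ "w \<oplus>\<^bsub>hom_module R (PA 0) V\<^esub> w'"] conjI) auto
    qed
    show "(a \<odot>\<^bsub>V\<^esub> y, a \<odot>\<^bsub>hom_module R (PA 0) W\<^esub> u) \<in> \<rho>" if a: "a \<in> carrier R" "(y, u) \<in> \<rho>" for a y u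
    proof -
      obtain w where "w \<in> Zc R A V 0" "w gen1 = y" "(w, u) \<in> \<sigma>" using a unfolding \<rho>_def by blast
      then show ?thesis unfolding \<rho>_def using a(1) submodule_smult[OF Zs[OF V]] linrelD(5)[OF cl] gen1_closed
        by (intro CollectI case_prodI bexI[of _ "a \<odot>\<^bsub>hom_module R (PA 0) V\<^esub> w"] conjI) auto
    qed
  qed
  have "wl R (hom_module R (PA 0) W) (Zc R A W 0) (Bc R A W 0)"
  proof (rule wl_exact[OF V mH[OF W] mH[OF U] torsion_submodule[OF V Jc] _
        Zs[OF W] Bs[OF W] BZ[OF W] Zs[OF U] Bs[OF U] BZ[OF U] rho _ _ _ conn_linrel[OF ses]])
    show "f ` torsion R J U \<subseteq> torsion R J V" using torsion_image by blast
    show "submodule (f ` torsion R J U) R V"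
      by (rule mod_hom_image_submodule[OF f U V torsion_submodule[OF U Jc]])
    show "\<exists>w\<in>Zc R A W 0. (y, w) \<in> \<rho>" if y: "y \<in> torsion R J V" for y
    proof -
      obtain v where v: "v \<in> Zc R A V 0" "v gen1 = y" using torsion_cocycle_exists[OF V y] by blast
      have "(v, compose (carrier (PA 0)) g v) \<in> \<sigma>"
        using v(1) pc_total[OF ses v(1)] by (auto simp: \<sigma>_def Zc_def compose_eq)
      then show ?thesis using pc_total[OF ses v(1)] v unfolding \<rho>_def by blast
    qed
    show "w \<in> Bc R A W 0" if yw: "(y, w) \<in> \<rho>" "y \<in> f ` torsion R J U" for y w
    proof -
      obtain v where v: "v \<in> Zc R A V 0" "v gen1 = y" "(v, w) \<in> \<sigma>" using yw unfolding \<rho>_def by blast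
      obtain u where u: "u \<in> torsion R J U" "y = f u" using yw(2) by blast
      obtain \<phi> where \<phi>: "\<phi> \<in> Zc R A U 0" "\<phi> gen1 = u" using torsion_cocycle_exists[OF U u(1)] by blast
      have "w c = \<zero>\<^bsub>W\<^esub>" if c: "c \<in> carrier (PA 0)" for c
      proof -
        have "v c = f (\<phi> c)"
          using cocycle_gen1_eq[OF V v(1) pc_total_f[OF ses \<phi>(1)] _ c] \<phi>(2) v(2) u(2) gen1_closed c
          by (simp add: compose_eq)
        moreover have "\<phi> c \<in> carrier U" using \<phi>(1) c by (auto simp: Zc_def mod_hom_closed)
        ultimately show ?thesis using v(3) c ses_composite_zero[OF ses] by (auto simp: \<sigma>_def)
      qed
      moreover have "w \<in> mod_hom R (PA 0) W" using v(3) by (simp add: \<sigma>_def)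
      ultimately have "w = (\<lambda>c\<in>carrier (PA 0). \<zero>\<^bsub>W\<^esub>)"
        by (intro extensionalityI[OF mod_hom_ext restrict_extensional]) auto
      then show ?thesis by (simp add: Bc_0[OF cyclic_module])
    qed
    show "\<exists>z\<in>Zc R A U (Suc 0). (w, z) \<in> cn 0" if "w \<in> Zc R A W 0" for w
      by (rule conn_total[OF ses that])
    show "z \<in> Bc R A U (Suc 0)" if "(w, z) \<in> cn 0" "w \<in> Bc R A W 0" for w z
      by (rule conn_Bc[OF ses that])
    show "\<exists>x\<in>torsion R J V. \<exists>w'. (x, w') \<in> \<rho> \<and> mdiff R (hom_module R (PA 0) W) w w' \<in> Bc R A W 0"
      if w: "w \<in> Zc R A W 0" "(w, z) \<in> cn 0" "z \<in> Bc R A U (Suc 0)" for w z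
    proof -
      obtain v where v: "v \<in> Zc R A V 0" "\<forall>c\<in>carrier (PA 0). w c = g (v c)" using conn_kernel[OF ses w(2,3)] by blast
      then have "(v gen1, w) \<in> \<rho>" using w(1) unfolding \<rho>_def \<sigma>_def by (auto simp: Zc_def intro!: bexI[of _ v])
      moreover have "v gen1 \<in> torsion R J V" by (rule cocycle_gen1_torsion[OF V v(1)])
      moreover have "mdiff R (hom_module R (PA 0) W) w w \<in> Bc R A W 0"
        using mdiff_self[OF mH[OF W] submodule_mem[OF Zs[OF W] w(1)]] submodule_zero[OF Bs[OF W]] by simp
      ultimately show ?thesis by blast
    qed
  qed (use assms in \<open>simp_all add: weakly_Laskerian_Ext_iff[OF cyclic_module U]\<close>)
  then show ?thesis by (simp add: weakly_Laskerian_Ext_iff[OF cyclic_module W])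
qed

end

end

section \<open>Ext of a finitely generated module into a weakly Laskerian module\<close>

text \<open>
  The quotient of \<open>Z\<close> by the common kernel embeds into a finite power of \<open>Wz\<close>. The induction adds
  one coordinate at a time: the kernel for \<open>S\<close> modulo the kernel for \<open>insert b S\<close> embeds into \<open>Wz\<close>
  by \<open>e b\<close>.
\<close>

lemma wl_finite_evaluation:
  assumes X: "Module.module R X" and Z: "submodule Z R X" and W: "Module.module R W"
    and Wz: "submodule Wz R W" "wl R W Wz {\<zero>\<^bsub>W\<^esub>}" and S: "finite S"
    and e: "\<And>b. b \<in> S \<Longrightarrow> e b \<in> mod_hom R X W" "\<And>b x. b \<in> S \<Longrightarrow> x \<in> Z \<Longrightarrow> e b x \<in> Wz"
  shows "wl R X Z {x \<in> Z. \<forall>b\<in>S. e b x = \<zero>\<^bsub>W\<^esub>}"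
  using S e
proof (induction S rule: finite_induct)
  case empty
  then show ?case by (simp add: wl_trivial)
next
  case (insert b S)
  let ?K = "\<lambda>S. {x \<in> Z. \<forall>b\<in>S. e b x = \<zero>\<^bsub>W\<^esub>}"
  have K: "submodule (?K S') R X" if e': "\<And>c. c \<in> S' \<Longrightarrow> e c \<in> mod_hom R X W" for S'
  proof (rule submodule_intro[OF X])
    interpret X: Module.module R X by (rule X)
    interpret W: Module.module R W by (rule W)
    have Zc: "\<And>x. x \<in> Z \<Longrightarrow> x \<in> carrier X" by (rule submodule_mem[OF Z])
    show "?K S' \<subseteq> carrier X" using Zc by auto
    show "\<zero>\<^bsub>X\<^esub> \<in> ?K S'" using submodule_zero[OF Z] mod_hom_zero[OF e' X W] by simp
    show "x \<oplus>\<^bsub>X\<^esub> y \<in> ?K S'" if "x \<in> ?K S'" "y \<in> ?K S'" for x y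
      using that submodule_add[OF Z] mod_hom_add[OF e'] Zc by simp
    show "a \<odot>\<^bsub>X\<^esub> x \<in> ?K S'" if "a \<in> carrier R" "x \<in> ?K S'" for a x
      using that submodule_smult[OF Z] mod_hom_smult[OF e'] Zc by simp
  qed
  have KS: "submodule (?K S) R X" and KbS: "submodule (?K (insert b S)) R X"
    by (rule K; use insert.prems(1) in blast)+
  have eb: "e b \<in> mod_hom R X W" using insert.prems(1) by simp
  have IH: "wl R X Z (?K S)" by (rule insert.IH) (use insert.prems in auto)
  have Zc: "\<And>x. x \<in> Z \<Longrightarrow> x \<in> carrier X" by (rule submodule_mem[OF Z])
  let ?r = "{(e b x, x) | x. x \<in> ?K S}"
  have graph: "linrel R X W {(x, e b x) | x. x \<in> ?K S}" by (rule linrel_graph[OF eb X W KS])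
  have r: "linrel R W X ?r"
  proof (rule linrelI)
    show "x \<in> carrier W \<and> y \<in> carrier X" if "(x, y) \<in> ?r" for x y
      using that linrelD(1,2)[OF graph, of y x] by auto
    show "(\<zero>\<^bsub>W\<^esub>, \<zero>\<^bsub>X\<^esub>) \<in> ?r" using linrelD(3)[OF graph] by auto
    show "(x \<oplus>\<^bsub>W\<^esub> x', y \<oplus>\<^bsub>X\<^esub> y') \<in> ?r" if "(x, y) \<in> ?r" "(x', y') \<in> ?r" for x y x' y'
      using that linrelD(4)[OF graph, of y x y' x'] by auto
    show "(a \<odot>\<^bsub>W\<^esub> x, a \<odot>\<^bsub>X\<^esub> y) \<in> ?r" if "a \<in> carrier R" "(x, y) \<in> ?r" for a x y
      using that linrelD(5)[OF graph, of a y x] by auto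
  qed
  have im: "submodule (e b ` ?K S) R W" by (rule mod_hom_image_submodule[OF eb X W KS])
  show ?case
  proof (rule wl_exact[OF W X X im _ Z KbS _ Z KS _ r _ _ submodule_zero_set[OF W] linrel_Id_on[OF X]])
    show "{\<zero>\<^bsub>W\<^esub>} \<subseteq> e b ` ?K S" using submodule_zero[OF im] by simp
    show "\<exists>y\<in>Z. (x, y) \<in> ?r" if "x \<in> e b ` ?K S" for x using that by auto
    show "y \<in> ?K (insert b S)" if "(x, y) \<in> ?r" "x \<in> {\<zero>\<^bsub>W\<^esub>}" for x y using that by auto
    show "\<exists>z\<in>Z. (y, z) \<in> Id_on (carrier X)" if "y \<in> Z" for y using that Zc by blast
    show "z \<in> ?K S" if "(y, z) \<in> Id_on (carrier X)" "y \<in> ?K (insert b S)" for y z using that by auto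
    show "\<exists>x\<in>e b ` ?K S. \<exists>y'. (x, y') \<in> ?r \<and> mdiff R X y y' \<in> ?K (insert b S)"
      if "y \<in> Z" "(y, z) \<in> Id_on (carrier X)" "z \<in> ?K S" for y z
    proof -
      have "y \<in> ?K S" using that by auto
      moreover have "mdiff R X y y \<in> ?K (insert b S)"
        using mdiff_self[OF X] Zc that submodule_zero[OF KbS] by simp
      ultimately show ?thesis by blast
    qed
    show "wl R W (e b ` ?K S) {\<zero>\<^bsub>W\<^esub>}" by (rule wl_mono[OF Wz(2)]) (use insert.prems(2) in auto)
    show "wl R X Z (?K S)" by (rule IH)
  qed auto
qed

definition free_part :: "('a, 'r) ring_scheme \<Rightarrow> 'b set \<Rightarrow> 'b set \<Rightarrow> ('b \<Rightarrow> 'a) set" where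
  "free_part R B S = {c \<in> carrier (free_module R B). \<forall>b. b \<notin> S \<longrightarrow> c b = \<zero>\<^bsub>R\<^esub>}"

lemma free_part_submodule:
  assumes "cring R"
  shows "submodule (free_part R B S) R (free_module R B)"
proof -
  interpret R: cring R by fact
  interpret F: Module.module R "free_module R B" by (rule free_module_module[OF assms])
  show ?thesis
    by (rule submodule_intro[OF free_module_module[OF assms]])
      (use F.add.m_closed F.smult_closed F.zero_closed in \<open>auto simp: free_part_def\<close>)
qed

lemma free_part_gen:
  assumes "cring R" "submodule V R (free_module R B)" "finite S" "S \<subseteq> B" "\<And>b. b \<in> S \<Longrightarrow> free_unit R b \<in> V"
  shows "free_part R B S \<subseteq> V"
  using free_gen_finite[OF assms(1,2,5,3,4)] by (auto simp: free_part_def)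

text \<open>
  Induction on the rank: the coordinates at \<open>b\<close> of the elements of \<open>V\<close> form an ideal. Elements of
  \<open>V\<close> whose coordinates generate this ideal, together with generators of the part of \<open>V\<close> on which
  the coordinate vanishes, generate \<open>V\<close>.
\<close>

lemma free_part_noetherian:
  assumes R: "cring R" and N: "noetherian_ring R" and "finite S" "S \<subseteq> B"
    and "submodule V R (free_module R B)" "V \<subseteq> free_part R B S"
  shows "\<exists>T. finite T \<and> T \<subseteq> V \<and> (\<forall>V2. submodule V2 R (free_module R B) \<longrightarrow> T \<subseteq> V2 \<longrightarrow> V \<subseteq> V2)"
  using assms(3-6)
proof (induction S arbitrary: V rule: finite_induct)
  case empty
  have "V \<subseteq> {\<zero>\<^bsub>free_module R B\<^esub>}" using empty.prems by (auto simp: free_part_def)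
  then have "V \<subseteq> V2" if "submodule V2 R (free_module R B)" for V2
    using submodule_zero[OF that] by blast
  then show ?case by (intro exI[of _ "{}"]) blast
next
  case (insert b S)
  let ?F = "free_module R B"
  interpret R: cring R by (rule R)
  note F = free_module_module[OF R, of B] and reg = reg_module_module[OF R]
  define e where "e = (\<lambda>c\<in>carrier ?F. c b)"
  have e: "e \<in> mod_hom R ?F (reg_module R)"
    unfolding e_def
  proof (rule mod_homI)
    interpret F: Module.module R ?F by (rule F)
    show "(\<lambda>c\<in>carrier ?F. c b) (x \<oplus>\<^bsub>?F\<^esub> y) = (\<lambda>c\<in>carrier ?F. c b) x \<oplus>\<^bsub>reg_module R\<^esub> (\<lambda>c\<in>carrier ?F. c b) y"
      if "x \<in> carrier ?F" "y \<in> carrier ?F" for x y using that F.add.m_closed[OF that] by simp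
    show "(\<lambda>c\<in>carrier ?F. c b) (a \<odot>\<^bsub>?F\<^esub> x) = a \<odot>\<^bsub>reg_module R\<^esub> (\<lambda>c\<in>carrier ?F. c b) x"
      if "a \<in> carrier R" "x \<in> carrier ?F" for a x using that F.smult_closed[OF that] by simp
  qed (auto simp: free_carrier)
  have Vc: "\<And>c. c \<in> V \<Longrightarrow> c \<in> carrier ?F" by (rule submodule_mem[OF insert.prems(2)])
  have "ideal (e ` V) R"
    using mod_hom_image_submodule[OF e F reg insert.prems(2)] submodule_reg_iff[OF R] by blast
  then obtain A where A: "A \<subseteq> carrier R" "finite A" "e ` V = genideal R A"
    using noetherian_ring.finetely_gen[OF N, of "e ` V"] by auto
  have "A \<subseteq> e ` V" using R.genideal_self[OF A(1)] A(3) by simp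
  then obtain k where k: "k \<subseteq> V" "finite k" "A = e ` k" using A(2) finite_subset_image by metis
  define V' where "V' = {c \<in> V. e c = \<zero>\<^bsub>R\<^esub>}"
  have sV': "submodule V' R ?F"
    using mod_hom_kernel_submodule[OF e F reg insert.prems(2)] by (simp add: V'_def)
  have "V' \<subseteq> free_part R B S"
  proof
    fix c assume "c \<in> V'"
    then have c: "c \<in> V" "e c = \<zero>\<^bsub>R\<^esub>" by (auto simp: V'_def)
    have "c b = \<zero>\<^bsub>R\<^esub>" using c Vc by (simp add: e_def)
    moreover have "c v = \<zero>\<^bsub>R\<^esub>" if "v \<notin> insert b S" for v
      using insert.prems(3) c(1) that unfolding free_part_def by blast
    ultimately have "c v = \<zero>\<^bsub>R\<^esub>" if "v \<notin> S" for v using that by (cases "v = b") auto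
    then show "c \<in> free_part R B S" using Vc[OF c(1)] by (simp add: free_part_def)
  qed
  then obtain T where T: "finite T" "T \<subseteq> V'" "\<And>V2. submodule V2 R ?F \<Longrightarrow> T \<subseteq> V2 \<Longrightarrow> V' \<subseteq> V2"
    using insert.IH[OF _ sV'] insert.prems(1) by blast
  have "V \<subseteq> V2" if V2: "submodule V2 R ?F" "T \<union> k \<subseteq> V2" for V2
  proof
    fix c assume c: "c \<in> V"
    have s: "submodule (V2 \<inter> V) R ?F"
      by (rule submodule_intro[OF F]) (use Vc submodule_zero[OF V2(1)] submodule_zero[OF insert.prems(2)]
          submodule_add[OF V2(1)] submodule_add[OF insert.prems(2)] submodule_smult[OF V2(1)]
          submodule_smult[OF insert.prems(2)] in \<open>auto simp del: free_simps\<close>)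
    have "ideal (e ` (V2 \<inter> V)) R"
      using mod_hom_image_submodule[OF e F reg s] submodule_reg_iff[OF R] by blast
    moreover have "A \<subseteq> e ` (V2 \<inter> V)" using k V2(2) by blast
    ultimately have "e ` V \<subseteq> e ` (V2 \<inter> V)" using R.genideal_minimal A(3) by simp
    then obtain c' where c': "c' \<in> V2" "c' \<in> V" "e c = e c'" using c by blast
    have "mdiff R ?F c c' \<in> V" by (rule submodule_mdiff[OF insert.prems(2) F c c'(2)])
    moreover have "e (mdiff R ?F c c') = \<zero>\<^bsub>R\<^esub>"
      using mod_hom_mdiff[OF e F Vc[OF c] Vc[OF c'(2)]] c'(3) mdiff_self[OF reg mod_hom_closed[OF e Vc[OF c'(2)]]] by simp
    ultimately have "mdiff R ?F c c' \<in> V2" using T(3)[OF V2(1)] V2(2) by (auto simp: V'_def)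
    then show "c \<in> V2" using submodule_add_cancel[OF V2(1) F Vc[OF c] _ c'(1)] by blast
  qed
  then show ?case using T k by (intro exI[of _ "T \<union> k"]) (auto simp: V'_def)
qed

text \<open>
  Over a Noetherian ring the standard resolution of a finitely generated module contains a
  subcomplex of free modules of finite rank that is itself a resolution, and the standard
  resolution can be contracted onto it: for suitable \<open>h n\<close> the maps \<open>1 - \<partial> h - h \<partial>\<close> take their
  values in the subcomplex. Hence a cocycle that vanishes on the subcomplex is a coboundary, and
  \<open>Ext R p X W\<close> embeds into a quotient of a finite power of \<open>W\<close>.
\<close>

context
  fixes R :: "('a, 'r) ring_scheme" and X :: "('a, 'x) module" and S0 :: "'x set"
  assumes N: "noetherian_ring R" and X: "Module.module R X" and S0: "finite S0" "S0 \<subseteq> carrier X"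
    and gen: "\<And>V. submodule V R X \<Longrightarrow> S0 \<subseteq> V \<Longrightarrow> carrier X \<subseteq> V"
begin

interpretation X: Module.module R X by (rule X)
private abbreviation "PX \<equiv> res_module R X"
private abbreviation "dX \<equiv> res_diff R X"
private abbreviation "F n S \<equiv> free_part R (res_basis R X n) S"

private lemmas dh = res_diff_hom[OF X] and dc = mod_hom_closed[OF res_diff_hom[OF X]] and mPX = mP[OF X]

definition "cycle n c \<longleftrightarrow> (case n of 0 \<Rightarrow> res_aug R X c = \<zero>\<^bsub>X\<^esub> | Suc m \<Rightarrow> dX m c = \<zero>\<^bsub>PX m\<^esub>)"

lemma cycle_iff:
  assumes "c \<in> carrier (PX n)"
  shows "cycle n c \<longleftrightarrow> (\<exists>d\<in>carrier (PX (Suc n)). dX n d = c)"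
  using res_exact_aug[OF X, of c] res_exact[OF X, of c] assms by (cases n) (simp_all add: cycle_def)

lemma cycle_submodule: "submodule {c \<in> carrier (PX n). cycle n c} R (PX n)"
proof (cases n)
  case 0
  then show ?thesis
    using mod_hom_kernel_submodule[OF res_aug_hom[OF X] mPX X submodule_self[OF mPX]] by (simp add: cycle_def)
next
  case (Suc m)
  then show ?thesis
    using mod_hom_kernel_submodule[OF dh mPX mPX submodule_self[OF mPX], of m] by (simp add: cycle_def)
qed

lemma free_part_P: "submodule (F n S) R (PX n)"
  using free_part_submodule[OF X.is_cring] by (simp add: res_module_def)

lemma P_gen:
  assumes "submodule V R (PX n)" "\<And>b. b \<in> res_basis R X n \<Longrightarrow> free_unit R b \<in> V" "c \<in> carrier (PX n)"
  shows "c \<in> V"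
  using free_gen[OF X.is_cring assms(1)[unfolded res_module_def] assms(2) assms(3)[unfolded res_module_def]] by blast

lemma preimage_submodule:
  assumes "f \<in> mod_hom R A B" "Module.module R A" "Module.module R B" "submodule T R B"
  shows "submodule {x \<in> carrier A. f x \<in> T} R A"
proof (rule submodule_intro[OF assms(2)])
  interpret A: Module.module R A by fact
  show "\<zero>\<^bsub>A\<^esub> \<in> {x \<in> carrier A. f x \<in> T}" using mod_hom_zero[OF assms(1-3)] submodule_zero[OF assms(4)] by simp
  show "a \<oplus>\<^bsub>A\<^esub> b \<in> {x \<in> carrier A. f x \<in> T}" if "a \<in> {x \<in> carrier A. f x \<in> T}" "b \<in> {x \<in> carrier A. f x \<in> T}" for a b
    using that submodule_add[OF assms(4)] mod_hom_add[OF assms(1)] by simp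
  show "a \<odot>\<^bsub>A\<^esub> b \<in> {x \<in> carrier A. f x \<in> T}" if "a \<in> carrier R" "b \<in> {x \<in> carrier A. f x \<in> T}" for a b
    using that submodule_smult[OF assms(4)] mod_hom_smult[OF assms(1)] by simp
qed auto

text \<open>
  The cycles in a free part of finite rank are finitely generated, and each generator is the image
  of a single basis element of the next degree; these basis elements are the next part.
\<close>

lemma finite_subresolution:
  "\<exists>S. (\<forall>n. finite (S n) \<and> S n \<subseteq> res_basis R X n) \<and> (\<forall>x\<in>carrier X. \<exists>c\<in>F 0 (S 0). res_aug R X c = x) \<and>
     (\<forall>n. (\<forall>c\<in>F (Suc n) (S (Suc n)). dX n c \<in> F n (S n)) \<and>
       (\<forall>c\<in>F n (S n). cycle n c \<longrightarrow> (\<exists>d\<in>F (Suc n) (S (Suc n)). dX n d = c)))"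
proof -
  define Good where "Good n S \<longleftrightarrow> finite S \<and> S \<subseteq> res_basis R X n \<and>
    (n = 0 \<longrightarrow> (\<forall>x\<in>carrier X. \<exists>c\<in>F 0 S. res_aug R X c = x))" for n S
  define Step where "Step n S S' \<longleftrightarrow> (\<forall>c\<in>F (Suc n) S'. dX n c \<in> F n S) \<and>
    (\<forall>c\<in>F n S. cycle n c \<longrightarrow> (\<exists>d\<in>F (Suc n) S'. dX n d = c))" for n S S'
  have unit_in: "free_unit R b \<in> F n S" if "b \<in> S" "S \<subseteq> res_basis R X n" for b n S
    using free_unit_closed[OF X.is_cring, of b "res_basis R X n"] that
    by (auto simp: free_part_def free_unit_def)
  have "\<exists>S. Good 0 S"
  proof -
    let ?S = "Gen ` S0"
    have S: "?S \<subseteq> res_basis R X 0" using S0 by auto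
    have "submodule (res_aug R X ` F 0 ?S) R X"
      by (rule mod_hom_image_submodule[OF res_aug_hom[OF X] mPX X free_part_P])
    moreover have "S0 \<subseteq> res_aug R X ` F 0 ?S"
    proof
      fix x assume x: "x \<in> S0"
      then have "res_aug R X (free_unit R (Gen x)) = x" using res_aug_unit[OF X] S0(2) by blast
      moreover have "free_unit R (Gen x) \<in> F 0 ?S" by (rule unit_in[OF _ S]) (use x in blast)
      ultimately show "x \<in> res_aug R X ` F 0 ?S" by force
    qed
    ultimately have "carrier X \<subseteq> res_aug R X ` F 0 ?S" by (rule gen)
    then show ?thesis using S S0(1) by (intro exI[of _ ?S]) (auto simp: Good_def)
  qed
  moreover have "\<exists>S'. Good (Suc n) S' \<and> Step n S S'" if "Good n S" for n S
  proof -
    have S: "finite S" "S \<subseteq> res_basis R X n" using that by (auto simp: Good_def)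
    define K where "K = {c \<in> F n S. cycle n c}"
    have Fc: "F n S \<subseteq> carrier (PX n)" using submodule_subset[OF free_part_P] .
    have K: "submodule K R (PX n)"
    proof (rule submodule_intro[OF mPX])
      show "a \<oplus>\<^bsub>PX n\<^esub> b \<in> K" if "a \<in> K" "b \<in> K" for a b
        using that Fc submodule_add[OF free_part_P, of a n S b] submodule_add[OF cycle_submodule, of a n b] by (auto simp: K_def)
      show "r \<odot>\<^bsub>PX n\<^esub> b \<in> K" if "r \<in> carrier R" "b \<in> K" for r b
        using that Fc submodule_smult[OF free_part_P, of r b n S] submodule_smult[OF cycle_submodule, of r b n] by (auto simp: K_def)
      show "\<zero>\<^bsub>PX n\<^esub> \<in> K"
        using submodule_zero[OF free_part_P, of n S] submodule_zero[OF cycle_submodule, of n] by (auto simp: K_def)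
    qed (use Fc in \<open>auto simp: K_def\<close>)
    obtain T where T: "finite T" "T \<subseteq> K" "\<And>V2. submodule V2 R (PX n) \<Longrightarrow> T \<subseteq> V2 \<Longrightarrow> K \<subseteq> V2"
      using free_part_noetherian[OF X.is_cring N S, of K] K by (auto simp: res_module_def K_def)
    have "\<exists>b\<in>res_basis R X (Suc n). dX n (free_unit R b) = t" if "t \<in> T" for t
      using rel_unit_exists[OF X, of t n] that T(2) Fc unfolding K_def cycle_def by blast
    then obtain k where k: "\<And>t. t \<in> T \<Longrightarrow> k t \<in> res_basis R X (Suc n)" "\<And>t. t \<in> T \<Longrightarrow> dX n (free_unit R (k t)) = t"
      by metis
    let ?S = "k ` T"
    have S': "?S \<subseteq> res_basis R X (Suc n)" using k(1) by blast
    have "F (Suc n) ?S \<subseteq> {x \<in> carrier (PX (Suc n)). dX n x \<in> F n S}"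
      unfolding res_module_def[of R X "Suc n"]
    proof (rule free_part_gen[OF X.is_cring _ _ S'])
      show "submodule {x \<in> carrier (free_module R (res_basis R X (Suc n))). dX n x \<in> F n S} R
          (free_module R (res_basis R X (Suc n)))"
        using preimage_submodule[OF dh mPX mPX free_part_P] by (simp add: res_module_def)
      show "free_unit R b \<in> {x \<in> carrier (free_module R (res_basis R X (Suc n))). dX n x \<in> F n S}" if "b \<in> ?S" for b
        using that k T(2) free_unit_closed[OF X.is_cring, of b "res_basis R X (Suc n)"] S' by (auto simp: K_def)
    qed (use T(1) in simp)
    moreover have "K \<subseteq> dX n ` F (Suc n) ?S"
    proof (rule T(3))
      show "submodule (dX n ` F (Suc n) ?S) R (PX n)" by (rule mod_hom_image_submodule[OF dh mPX mPX free_part_P])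
      show "T \<subseteq> dX n ` F (Suc n) ?S"
      proof
        fix t assume t: "t \<in> T"
        have "free_unit R (k t) \<in> F (Suc n) ?S" by (rule unit_in[OF _ S']) (use t in blast)
        then show "t \<in> dX n ` F (Suc n) ?S" using k(2)[OF t] by force
      qed
    qed
    ultimately have "Step n S ?S" by (auto simp: Step_def K_def)
    moreover have "Good (Suc n) ?S" using T(1) S' by (simp add: Good_def)
    ultimately show ?thesis by blast
  qed
  ultimately obtain S where "\<And>n. Good n (S n)" "\<And>n. Step n (S n) (S (Suc n))"
    using dependent_nat_choice[of Good Step] by auto
  then show ?thesis unfolding Good_def Step_def by blast
qed

text \<open>
  Constructed on basis elements, degree by degree. For \<open>y = c - h (\<partial> c)\<close> the boundary \<open>\<partial> y\<close> is a
  cycle in the subcomplex, hence \<open>\<partial> y = \<partial> f\<close> for some \<open>f\<close> in the subcomplex, and \<open>y - f\<close> is a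
  cycle, hence \<open>y - f = \<partial> z\<close>. Then \<open>z\<close> is the value of the next map at \<open>c\<close>.
\<close>

lemma contraction:
  assumes S: "\<And>n. S n \<subseteq> res_basis R X n" "\<And>x. x \<in> carrier X \<Longrightarrow> \<exists>c\<in>F 0 (S 0). res_aug R X c = x"
    "\<And>n c. c \<in> F n (S n) \<Longrightarrow> cycle n c \<Longrightarrow> \<exists>d\<in>F (Suc n) (S (Suc n)). dX n d = c"
  shows "\<exists>h. (\<forall>n. h n \<in> mod_hom R (PX n) (PX (Suc n))) \<and>
    (\<forall>c\<in>carrier (PX 0). mdiff R (PX 0) c (dX 0 (h 0 c)) \<in> F 0 (S 0)) \<and>
    (\<forall>n. \<forall>c\<in>carrier (PX (Suc n)).
       mdiff R (PX (Suc n)) (mdiff R (PX (Suc n)) c (h n (dX n c))) (dX (Suc n) (h (Suc n) c)) \<in> F (Suc n) (S (Suc n)))"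
proof -
  have Fc: "c \<in> carrier (PX n)" if "c \<in> F n T" for c n T using submodule_mem[OF free_part_P that] .
  define Good where "Good n h \<longleftrightarrow> h \<in> mod_hom R (PX n) (PX (Suc n)) \<and>
    (\<forall>c\<in>carrier (PX n). cycle n c \<longrightarrow> mdiff R (PX n) c (dX n (h c)) \<in> F n (S n)) \<and>
    (n = 0 \<longrightarrow> (\<forall>c\<in>carrier (PX 0). mdiff R (PX n) c (dX n (h c)) \<in> F n (S n)))" for n h
  define Step where "Step n h h' \<longleftrightarrow> (\<forall>c\<in>carrier (PX (Suc n)).
       mdiff R (PX (Suc n)) (mdiff R (PX (Suc n)) c (h (dX n c))) (dX (Suc n) (h' c)) \<in> F (Suc n) (S (Suc n)))" for n h h'
  have hom_of: "\<exists>k\<in>mod_hom R (PX n) (PX (Suc n)). \<forall>b\<in>res_basis R X n. k (free_unit R b) = z b"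
    if "\<And>b. b \<in> res_basis R X n \<Longrightarrow> z b \<in> carrier (PX (Suc n))" for n z
  proof (rule bexI[of _ "lin_ext R (res_basis R X n) (PX (Suc n)) z"])
    show "\<forall>b\<in>res_basis R X n. lin_ext R (res_basis R X n) (PX (Suc n)) z (free_unit R b) = z b"
      using lin_ext_unit[OF mPX, of "res_basis R X n" z] that by simp
    show "lin_ext R (res_basis R X n) (PX (Suc n)) z \<in> mod_hom R (PX n) (PX (Suc n))"
      using lin_ext_hom[OF mPX that] by (simp only: res_module_def[of R X n])
  qed
  have "\<exists>h. Good 0 h"
  proof -
    have "\<exists>z\<in>carrier (PX 1). mdiff R (PX 0) (free_unit R b) (dX 0 z) \<in> F 0 (S 0)" if b: "b \<in> res_basis R X 0" for b
    proof -
      have u: "free_unit R b \<in> carrier (PX 0)" unfolding res_module_def by (rule free_unit_closed[OF X.is_cring b])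
      obtain c where c: "c \<in> F 0 (S 0)" "res_aug R X c = res_aug R X (free_unit R b)"
        using S(2)[OF mod_hom_closed[OF res_aug_hom[OF X] u]] by blast
      let ?y = "mdiff R (PX 0) (free_unit R b) c"
      have y: "?y \<in> carrier (PX 0)" by (rule mdiff_closed[OF mPX u Fc[OF c(1)]])
      have "res_aug R X ?y = \<zero>\<^bsub>X\<^esub>"
        using mod_hom_mdiff[OF res_aug_hom[OF X] mPX u Fc[OF c(1)]] c(2)
          mdiff_self[OF X mod_hom_closed[OF res_aug_hom[OF X] u]] by simp
      then obtain z where "z \<in> carrier (PX 1)" "dX 0 z = ?y" using res_exact_aug[OF X y] by blast
      then show ?thesis using mdiff_mdiff[OF mPX u Fc[OF c(1)]] c(1) by (intro bexI[of _ z]) simp_all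
    qed
    then obtain z where z: "\<And>b. b \<in> res_basis R X 0 \<Longrightarrow> z b \<in> carrier (PX 1)"
      "\<And>b. b \<in> res_basis R X 0 \<Longrightarrow> mdiff R (PX 0) (free_unit R b) (dX 0 (z b)) \<in> F 0 (S 0)" by metis
    obtain h where h: "h \<in> mod_hom R (PX 0) (PX (Suc 0))" "\<forall>b\<in>res_basis R X 0. h (free_unit R b) = z b"
      using hom_of[of 0 z] z(1) by auto
    let ?k = "mdiff R (hom_module R (PX 0) (PX 0)) (restrict id (carrier (PX 0))) (compose (carrier (PX 0)) (dX 0) h)"
    have k: "?k \<in> mod_hom R (PX 0) (PX 0)"
      using mdiff_closed[OF hom_module_module[OF mPX mPX]] mod_hom_id[OF mPX] mod_hom_compose[OF h(1) dh mPX] by simp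
    have kc: "?k c = mdiff R (PX 0) c (dX 0 (h c))" if "c \<in> carrier (PX 0)" for c
      using that by (simp add: hom_module_mdiff[OF mPX] compose_eq)
    have "c \<in> {c \<in> carrier (PX 0). ?k c \<in> F 0 (S 0)}" if c: "c \<in> carrier (PX 0)" for c
    proof (rule P_gen[OF preimage_submodule[OF k mPX mPX free_part_P] _ c])
      fix b assume b: "b \<in> res_basis R X 0"
      have u: "free_unit R b \<in> carrier (PX 0)" unfolding res_module_def by (rule free_unit_closed[OF X.is_cring b])
      show "free_unit R b \<in> {c \<in> carrier (PX 0). ?k c \<in> F 0 (S 0)}"
        using kc[OF u] bspec[OF h(2) b] z(2)[OF b] u by simp
    qed
    then have "\<forall>c\<in>carrier (PX 0). mdiff R (PX 0) c (dX 0 (h c)) \<in> F 0 (S 0)" using kc by simp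
    then show ?thesis using h(1) by (auto simp: Good_def)
  qed
  moreover have "\<exists>h'. Good (Suc n) h' \<and> Step n h h'" if g: "Good n h" for n h
  proof -
    have h: "h \<in> mod_hom R (PX n) (PX (Suc n))"
      "\<And>c. c \<in> carrier (PX n) \<Longrightarrow> cycle n c \<Longrightarrow> mdiff R (PX n) c (dX n (h c)) \<in> F n (S n)"
      using g by (auto simp: Good_def)
    have cyc: "cycle n (dX n c)" if "c \<in> carrier (PX (Suc n))" for c
      using cycle_iff[OF dc[OF that]] that by blast
    have "\<exists>z\<in>carrier (PX (Suc (Suc n))). mdiff R (PX (Suc n)) (mdiff R (PX (Suc n)) c (h (dX n c))) (dX (Suc n) z) \<in> F (Suc n) (S (Suc n))"
      if c: "c \<in> carrier (PX (Suc n))" for c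
    proof -
      let ?y = "mdiff R (PX (Suc n)) c (h (dX n c))"
      have hd: "h (dX n c) \<in> carrier (PX (Suc n))" using mod_hom_closed[OF h(1)] dc[OF c] by blast
      have y: "?y \<in> carrier (PX (Suc n))" by (rule mdiff_closed[OF mPX c hd])
      have "dX n ?y = mdiff R (PX n) (dX n c) (dX n (h (dX n c)))" by (rule mod_hom_mdiff[OF dh mPX c hd])
      then have "dX n ?y \<in> F n (S n)" using h(2)[OF dc[OF c] cyc[OF c]] by simp
      then obtain f where f: "f \<in> F (Suc n) (S (Suc n))" "dX n f = dX n ?y" using S(3) cyc[OF y] by blast
      let ?w = "mdiff R (PX (Suc n)) ?y f"
      have w: "?w \<in> carrier (PX (Suc n))" by (rule mdiff_closed[OF mPX y Fc[OF f(1)]])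
      have "dX n ?w = \<zero>\<^bsub>PX n\<^esub>"
        using mod_hom_mdiff[OF dh mPX y Fc[OF f(1)]] f(2) mdiff_self[OF mPX dc[OF y]] by simp
      then obtain z where "z \<in> carrier (PX (Suc (Suc n)))" "dX (Suc n) z = ?w" using res_exact[OF X w] by blast
      then show ?thesis using mdiff_mdiff[OF mPX y Fc[OF f(1)]] f(1) by (intro bexI[of _ z]) simp_all
    qed
    then obtain z where z: "\<And>c. c \<in> carrier (PX (Suc n)) \<Longrightarrow> z c \<in> carrier (PX (Suc (Suc n)))"
      "\<And>c. c \<in> carrier (PX (Suc n)) \<Longrightarrow>
        mdiff R (PX (Suc n)) (mdiff R (PX (Suc n)) c (h (dX n c))) (dX (Suc n) (z c)) \<in> F (Suc n) (S (Suc n))" by metis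
    have u: "free_unit R b \<in> carrier (PX (Suc n))" if "b \<in> res_basis R X (Suc n)" for b
      unfolding res_module_def by (rule free_unit_closed[OF X.is_cring that])
    obtain h' where h': "h' \<in> mod_hom R (PX (Suc n)) (PX (Suc (Suc n)))"
      "\<forall>b\<in>res_basis R X (Suc n). h' (free_unit R b) = z (free_unit R b)"
      using hom_of[of "Suc n" "\<lambda>b. z (free_unit R b)"] z(1) u by auto
    let ?H = "hom_module R (PX (Suc n)) (PX (Suc n))"
    let ?C = "carrier (PX (Suc n))"
    let ?k = "mdiff R ?H (mdiff R ?H (restrict id ?C) (compose ?C h (dX n))) (compose ?C (dX (Suc n)) h')"
    have k: "?k \<in> mod_hom R (PX (Suc n)) (PX (Suc n))"
      using mdiff_closed[OF hom_module_module[OF mPX mPX]] mod_hom_id[OF mPX] mod_hom_compose[OF h'(1) dh mPX]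
        mod_hom_compose[OF dh h(1) mPX] by simp
    have kc: "?k c = mdiff R (PX (Suc n)) (mdiff R (PX (Suc n)) c (h (dX n c))) (dX (Suc n) (h' c))" if "c \<in> ?C" for c
      using that by (simp add: hom_module_mdiff[OF mPX] compose_eq)
    have "c \<in> {c \<in> ?C. ?k c \<in> F (Suc n) (S (Suc n))}" if c: "c \<in> ?C" for c
    proof (rule P_gen[OF preimage_submodule[OF k mPX mPX free_part_P] _ c])
      fix b assume b: "b \<in> res_basis R X (Suc n)"
      show "free_unit R b \<in> {c \<in> ?C. ?k c \<in> F (Suc n) (S (Suc n))}"
        using kc[OF u[OF b]] h'(2) z(2)[OF u[OF b]] b u[OF b] by simp
    qed
    then have st: "Step n h h'" using kc by (simp add: Step_def)
    have "mdiff R (PX (Suc n)) c (dX (Suc n) (h' c)) \<in> F (Suc n) (S (Suc n))" if c: "c \<in> ?C" "cycle (Suc n) c" for c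
    proof -
      have "dX n c = \<zero>\<^bsub>PX n\<^esub>" using c(2) by (simp add: cycle_def)
      then have "mdiff R (PX (Suc n)) c (h (dX n c)) = c"
        using mod_hom_zero[OF h(1) mPX mPX] mdiff_zero[OF mPX c(1)] by simp
      then show ?thesis using st c(1) unfolding Step_def by metis
    qed
    then have "Good (Suc n) h'" using h'(1) by (simp add: Good_def)
    then show ?thesis using st by blast
  qed
  ultimately obtain h where h: "\<And>n. Good n (h n)" "\<And>n. Step n (h n) (h (Suc n))"
    using dependent_nat_choice[of Good Step] by auto
  then show ?thesis unfolding Good_def Step_def by (intro exI[of _ h]) blast
qed

theorem Ext_weakly_Laskerian:
  assumes "weakly_Laskerian R W"
  shows "weakly_Laskerian R (Ext R p X W)"
proof -
  have W: "Module.module R W" and WL: "wl R W (carrier W) {\<zero>\<^bsub>W\<^esub>}" using assms weakly_Laskerian_iff by auto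
  obtain S where S: "\<And>n. finite (S n)" "\<And>n. S n \<subseteq> res_basis R X n"
    "\<And>x. x \<in> carrier X \<Longrightarrow> \<exists>c\<in>F 0 (S 0). res_aug R X c = x"
    "\<And>n c. c \<in> F n (S n) \<Longrightarrow> cycle n c \<Longrightarrow> \<exists>d\<in>F (Suc n) (S (Suc n)). dX n d = c"
  proof -
    from finite_subresolution obtain S where *: "(\<forall>n. finite (S n) \<and> S n \<subseteq> res_basis R X n) \<and>
      (\<forall>x\<in>carrier X. \<exists>c\<in>F 0 (S 0). res_aug R X c = x) \<and>
      (\<forall>n. (\<forall>c\<in>F (Suc n) (S (Suc n)). dX n c \<in> F n (S n)) \<and>
       (\<forall>c\<in>F n (S n). cycle n c \<longrightarrow> (\<exists>d\<in>F (Suc n) (S (Suc n)). dX n d = c)))" ..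
    show thesis by (rule that[of S]) (use * in auto)
  qed
  obtain h where h: "\<And>n. h n \<in> mod_hom R (PX n) (PX (Suc n))"
    "\<And>c. c \<in> carrier (PX 0) \<Longrightarrow> mdiff R (PX 0) c (dX 0 (h 0 c)) \<in> F 0 (S 0)"
    "\<And>n c. c \<in> carrier (PX (Suc n)) \<Longrightarrow>
       mdiff R (PX (Suc n)) (mdiff R (PX (Suc n)) c (h n (dX n c))) (dX (Suc n) (h (Suc n) c)) \<in> F (Suc n) (S (Suc n))"
    using contraction[OF S(2-4)] by blast
  have Fc: "c \<in> carrier (PX n)" if "c \<in> F n T" for c n T using submodule_mem[OF free_part_P that] .
  have u: "free_unit R b \<in> carrier (PX p)" if "b \<in> S p" for b
    unfolding res_module_def by (rule free_unit_closed[OF X.is_cring subsetD[OF S(2) that]])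
  define e where "e b = (\<lambda>\<phi>\<in>mod_hom R (PX p) W. \<phi> (free_unit R b))" for b
  let ?K = "{\<phi> \<in> Zc R X W p. \<forall>b\<in>S p. e b \<phi> = \<zero>\<^bsub>W\<^esub>}"
  have "wl R (hom_module R (PX p) W) (Zc R X W p) ?K"
  proof (rule wl_finite_evaluation[OF mHom[OF X W] Zc_submodule[OF X W] W submodule_self[OF W] WL S(1)])
    interpret H: Module.module R "hom_module R (PX p) W" by (rule mHom[OF X W])
    fix b assume b: "b \<in> S p"
    show "e b \<in> mod_hom R (hom_module R (PX p) W) W"
      unfolding e_def
      by (rule mod_homI) (use u[OF b] H.add.m_closed H.smult_closed in \<open>auto simp: mod_hom_closed\<close>)
    then show "e b \<phi> \<in> carrier W" if "\<phi> \<in> Zc R X W p" for \<phi>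
      using that mod_hom_closed by (force simp: Zc_def)
  qed
  moreover have "?K \<subseteq> Bc R X W p"
  proof
    fix \<phi> assume "\<phi> \<in> ?K"
    then have \<phi>: "\<phi> \<in> mod_hom R (PX p) W" "\<And>c. c \<in> carrier (PX (Suc p)) \<Longrightarrow> \<phi> (dX p c) = \<zero>\<^bsub>W\<^esub>"
      "\<And>b. b \<in> S p \<Longrightarrow> \<phi> (free_unit R b) = \<zero>\<^bsub>W\<^esub>" by (auto simp: Zc_def e_def)
    have "F p (S p) \<subseteq> {c \<in> carrier (PX p). \<phi> c = \<zero>\<^bsub>W\<^esub>}"
    proof (rule free_part_gen[OF X.is_cring _ S(1,2)])
      show "submodule {c \<in> carrier (PX p). \<phi> c = \<zero>\<^bsub>W\<^esub>} R (free_module R (res_basis R X p))"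
        using mod_hom_kernel_submodule[OF \<phi>(1) mPX W submodule_self[OF mPX]] by (simp add: res_module_def)
    qed (use \<phi>(3) u in auto)
    then have F0: "\<phi> c = \<zero>\<^bsub>W\<^esub>" if "c \<in> F p (S p)" for c using that by auto
    show "\<phi> \<in> Bc R X W p"
    proof (cases p)
      case 0
      have "\<phi> c = \<zero>\<^bsub>W\<^esub>" if c: "c \<in> carrier (PX 0)" for c
      proof -
        have d: "dX 0 (h 0 c) \<in> carrier (PX 0)" using dc mod_hom_closed[OF h(1) c] by blast
        have "mdiff R W (\<phi> c) (\<phi> (dX 0 (h 0 c))) = \<zero>\<^bsub>W\<^esub>"
          using mod_hom_mdiff[OF \<phi>(1)[unfolded 0] mPX c d] F0 h(2)[OF c] 0 by simp
        then show ?thesis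
          using \<phi>(2)[of "h 0 c"] mod_hom_closed[OF h(1) c] mdiff_zero[OF W mod_hom_closed[OF \<phi>(1)[unfolded 0] c]] 0 by simp
      qed
      then have "\<phi> = (\<lambda>c\<in>carrier (PX 0). \<zero>\<^bsub>W\<^esub>)"
        using \<phi>(1) 0 by (intro extensionalityI[OF mod_hom_ext restrict_extensional]) auto
      then show ?thesis using 0 by (simp add: Bc_0[OF X])
    next
      case (Suc n)
      \<comment> \<open>\<open>\<phi>\<close> kills \<open>c - h (\<partial> c) - \<partial> (h c)\<close>, an element of the subcomplex, and the boundary \<open>\<partial> (h c)\<close>.\<close>
      let ?\<psi> = "compose (carrier (PX n)) \<phi> (h n)"
      have "?\<psi> \<in> mod_hom R (PX n) W" using mod_hom_compose[OF h(1) \<phi>(1)[unfolded Suc] mPX] .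
      moreover have "\<phi> c = ?\<psi> (dX n c)" if c: "c \<in> carrier (PX (Suc n))" for c
      proof -
        note \<phi>S = \<phi>(1)[unfolded Suc]
        have d: "dX (Suc n) (h (Suc n) c) \<in> carrier (PX (Suc n))" using dc mod_hom_closed[OF h(1) c] by blast
        have hd: "h n (dX n c) \<in> carrier (PX (Suc n))" using mod_hom_closed[OF h(1)] dc[OF c] by blast
        let ?y = "mdiff R (PX (Suc n)) c (h n (dX n c))"
        have y: "?y \<in> carrier (PX (Suc n))" by (rule mdiff_closed[OF mPX c hd])
        have "mdiff R W (\<phi> ?y) (\<phi> (dX (Suc n) (h (Suc n) c))) = \<zero>\<^bsub>W\<^esub>"
          using mod_hom_mdiff[OF \<phi>S mPX y d] F0 h(3)[OF c] Suc by simp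
        moreover have "\<phi> (dX (Suc n) (h (Suc n) c)) = \<zero>\<^bsub>W\<^esub>"
          using \<phi>(2)[of "h (Suc n) c"] mod_hom_closed[OF h(1) c] Suc by simp
        ultimately have "\<phi> ?y = \<zero>\<^bsub>W\<^esub>" using mdiff_zero[OF W mod_hom_closed[OF \<phi>S y]] by simp
        then have "mdiff R W (\<phi> c) (\<phi> (h n (dX n c))) = \<zero>\<^bsub>W\<^esub>" using mod_hom_mdiff[OF \<phi>S mPX c hd] by simp
        then have "\<phi> c = \<phi> (h n (dX n c))"
          using mdiff_eq_zero[OF W mod_hom_closed[OF \<phi>S c] mod_hom_closed[OF \<phi>S hd]] by blast
        then show ?thesis using dc[OF c] by (simp add: compose_eq)
      qed
      ultimately show ?thesis using \<phi>(1) unfolding Suc Bc_Suc[OF X] by blast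
    qed
  qed
  ultimately show ?thesis
    unfolding weakly_Laskerian_Ext_iff[OF X W] by (meson wl_mono order_refl)
qed

end

section \<open>Homomorphisms into an injective resolution\<close>

lemma submodule_adjoin:
  assumes X: "Module.module R X" and X0: "submodule X0 R X" and x: "x \<in> carrier X"
  shows "submodule {y \<oplus>\<^bsub>X\<^esub> a \<odot>\<^bsub>X\<^esub> x | y a. y \<in> X0 \<and> a \<in> carrier R} R X" (is "submodule ?X1 R X")
    and "X0 \<subseteq> {y \<oplus>\<^bsub>X\<^esub> a \<odot>\<^bsub>X\<^esub> x | y a. y \<in> X0 \<and> a \<in> carrier R}"
    and "x \<in> {y \<oplus>\<^bsub>X\<^esub> a \<odot>\<^bsub>X\<^esub> x | y a. y \<in> X0 \<and> a \<in> carrier R}"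
proof -
  interpret X: Module.module R X by (rule X)
  have X0c: "\<And>y. y \<in> X0 \<Longrightarrow> y \<in> carrier X" by (rule submodule_mem[OF X0])
  show X0X1: "X0 \<subseteq> ?X1"
  proof
    fix y assume y: "y \<in> X0"
    have "y = y \<oplus>\<^bsub>X\<^esub> \<zero>\<^bsub>R\<^esub> \<odot>\<^bsub>X\<^esub> x" using X0c[OF y] x by simp
    then show "y \<in> ?X1" using y by blast
  qed
  show "x \<in> ?X1"
  proof -
    have "x = \<zero>\<^bsub>X\<^esub> \<oplus>\<^bsub>X\<^esub> \<one>\<^bsub>R\<^esub> \<odot>\<^bsub>X\<^esub> x" using x by simp
    then show ?thesis using submodule_zero[OF X0] by blast
  qed
  show "submodule ?X1 R X"
  proof (rule submodule_intro[OF X])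
    show "?X1 \<subseteq> carrier X" using X0c x by auto
    show "\<zero>\<^bsub>X\<^esub> \<in> ?X1" using X0X1 submodule_zero[OF X0] by blast
    show "u \<oplus>\<^bsub>X\<^esub> v \<in> ?X1" if uv: "u \<in> ?X1" "v \<in> ?X1" for u v
    proof -
      obtain y a y' a' where *: "y \<in> X0" "a \<in> carrier R" "y' \<in> X0" "a' \<in> carrier R" "u = y \<oplus>\<^bsub>X\<^esub> a \<odot>\<^bsub>X\<^esub> x"
        "v = y' \<oplus>\<^bsub>X\<^esub> a' \<odot>\<^bsub>X\<^esub> x" using uv by blast
      then have "u \<oplus>\<^bsub>X\<^esub> v = (y \<oplus>\<^bsub>X\<^esub> y') \<oplus>\<^bsub>X\<^esub> (a \<oplus>\<^bsub>R\<^esub> a') \<odot>\<^bsub>X\<^esub> x" using X0c x by (simp add: X.smult_l_distr X.a_ac)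
      then show ?thesis using *(2,4) submodule_add[OF X0 *(1,3)] by blast
    qed
    show "c \<odot>\<^bsub>X\<^esub> u \<in> ?X1" if c: "c \<in> carrier R" and u: "u \<in> ?X1" for c u
    proof -
      obtain y a where *: "y \<in> X0" "a \<in> carrier R" "u = y \<oplus>\<^bsub>X\<^esub> a \<odot>\<^bsub>X\<^esub> x" using u by blast
      then have "c \<odot>\<^bsub>X\<^esub> u = c \<odot>\<^bsub>X\<^esub> y \<oplus>\<^bsub>X\<^esub> (c \<otimes>\<^bsub>R\<^esub> a) \<odot>\<^bsub>X\<^esub> x" using X0c x c by (simp add: X.smult_r_distr X.smult_assoc1)
      moreover have "c \<otimes>\<^bsub>R\<^esub> a \<in> carrier R" using c *(2) by simp
      ultimately show ?thesis using submodule_smult[OF X0 c *(1)] by blast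
    qed
  qed
qed

text \<open>
  The terms of the resolution have the extension property for ideals. This form of injectivity
  mentions no type but those of \<open>R\<close> and \<open>E\<close>, and by \<open>baer_extend\<close> it serves for modules on every
  type.
\<close>

locale inj_res =
  fixes R :: "('a, 'r) ring_scheme" and N :: "('a, 'n) module" and E :: "nat \<Rightarrow> ('a, 'e) module"
    and d :: "nat \<Rightarrow> 'e \<Rightarrow> 'e" and \<epsilon> :: "'n \<Rightarrow> 'e"
  assumes N: "Module.module R N" and E: "baer R (E i)"
    and \<epsilon>: "\<epsilon> \<in> mod_hom R N (E 0)" and d: "d i \<in> mod_hom R (E i) (E (Suc i))"
    and \<epsilon>_inj: "inj_on \<epsilon> (carrier N)"
    and exact_N: "\<epsilon> ` carrier N = {x \<in> carrier (E 0). d 0 x = \<zero>\<^bsub>E 1\<^esub>}"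
    and exact: "d i ` carrier (E i) = {x \<in> carrier (E (Suc i)). d (Suc i) x = \<zero>\<^bsub>E (Suc (Suc i))\<^esub>}"
begin

lemma mE: "Module.module R (E i)"
  by (rule baer_module[OF E])

lemma R: "cring R"
  using N by (rule Module.module.axioms(1))

lemma dd: "e \<in> carrier (E i) \<Longrightarrow> d (Suc i) (d i e) = \<zero>\<^bsub>E (Suc (Suc i))\<^esub>"
  using exact[of i] by blast

lemma d_exact:
  assumes "e \<in> carrier (E (Suc i))" "d (Suc i) e = \<zero>\<^bsub>E (Suc (Suc i))\<^esub>"
  shows "\<exists>e'\<in>carrier (E i). d i e' = e"
proof -
  have "e \<in> d i ` carrier (E i)" using assms exact[of i] by simp
  then show ?thesis by blast
qed

lemma d_closed: "e \<in> carrier (E i) \<Longrightarrow> d i e \<in> carrier (E (Suc i))"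
  by (rule mod_hom_closed[OF d])

lemma d_zero: "d i \<zero>\<^bsub>E i\<^esub> = \<zero>\<^bsub>E (Suc i)\<^esub>"
  by (rule mod_hom_zero[OF d mE mE])

text \<open>
  Cocycles and coboundaries of the complex \<open>Hom (X/X0, E)\<close>, and of \<open>Hom (R/J, E)\<close>, the latter in
  the form of the \<open>J\<close>-torsion of \<open>E\<close>.
\<close>

definition HZ :: "('a, 'x) module \<Rightarrow> 'x set \<Rightarrow> nat \<Rightarrow> ('x \<Rightarrow> 'e) set" where
  "HZ X X0 i = {f \<in> mod_hom R X (E i). (\<forall>x\<in>X0. f x = \<zero>\<^bsub>E i\<^esub>) \<and> (\<forall>x\<in>carrier X. d i (f x) = \<zero>\<^bsub>E (Suc i)\<^esub>)}"

definition HB :: "('a, 'x) module \<Rightarrow> 'x set \<Rightarrow> nat \<Rightarrow> ('x \<Rightarrow> 'e) set" where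
  "HB X X0 i = (case i of 0 \<Rightarrow> {\<lambda>x\<in>carrier X. \<zero>\<^bsub>E 0\<^esub>}
     | Suc j \<Rightarrow> (\<lambda>f. compose (carrier X) (d j) f) ` {f \<in> mod_hom R X (E j). \<forall>x\<in>X0. f x = \<zero>\<^bsub>E j\<^esub>})"

definition EZ :: "'a set \<Rightarrow> nat \<Rightarrow> 'e set" where
  "EZ J i = {e \<in> torsion R J (E i). d i e = \<zero>\<^bsub>E (Suc i)\<^esub>}"

definition EB :: "'a set \<Rightarrow> nat \<Rightarrow> 'e set" where
  "EB J i = (case i of 0 \<Rightarrow> {\<zero>\<^bsub>E 0\<^esub>} | Suc j \<Rightarrow> d j ` torsion R J (E j))"

lemma torsion_d:
  assumes "J \<subseteq> carrier R" "e \<in> torsion R J (E i)"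
  shows "d i e \<in> torsion R J (E (Suc i))"
  using assms mod_hom_smult[OF d, symmetric] d_zero d_closed by (auto simp: torsion_def subset_iff)

lemma EZ_submodule: "J \<subseteq> carrier R \<Longrightarrow> submodule (EZ J i) R (E i)"
  unfolding EZ_def by (rule mod_hom_kernel_submodule[OF d mE mE torsion_submodule[OF mE]])

lemma EB_submodule: "J \<subseteq> carrier R \<Longrightarrow> submodule (EB J i) R (E i)"
  using submodule_zero_set[OF mE] mod_hom_image_submodule[OF d mE mE torsion_submodule[OF mE]]
  by (auto simp: EB_def split: nat.split)

lemma EB_subset_EZ: "J \<subseteq> carrier R \<Longrightarrow> EB J i \<subseteq> EZ J i"
  using submodule_zero[OF EZ_submodule] torsion_d dd
  by (auto simp: EB_def EZ_def torsion_def split: nat.split)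

context
  fixes X :: "('a, 'x) module"
  assumes X: "Module.module R X"
begin

interpretation X: Module.module R X by (rule X)

lemma mHX: "Module.module R (hom_module R X (E i))"
  by (rule hom_module_module[OF X mE])

lemma compose_d_hom: "(\<lambda>f\<in>mod_hom R X (E i). compose (carrier X) (d i) f) \<in> mod_hom R (hom_module R X (E i)) (hom_module R X (E (Suc i)))"
  by (rule mod_homI)
    (use mod_hom_compose[OF _ d X] Module.module.smult_closed[OF mHX]
        abelian_monoid.a_closed[OF abelian_group.axioms(1)[OF Module.module.axioms(2)[OF mHX]]] in
      \<open>auto simp: compose_def mod_hom_closed mod_hom_add[OF d] mod_hom_smult[OF d] intro!: restrict_ext\<close>)

lemma HZ_submodule: "X0 \<subseteq> carrier X \<Longrightarrow> submodule (HZ X X0 i) R (hom_module R X (E i))"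
proof -
  assume X0: "X0 \<subseteq> carrier X"
  have e: "HZ X X0 i = {f \<in> {f \<in> mod_hom R X (E i). \<forall>x\<in>X0. f x = \<zero>\<^bsub>E i\<^esub>}.
      (\<lambda>f\<in>mod_hom R X (E i). compose (carrier X) (d i) f) f = \<zero>\<^bsub>hom_module R X (E (Suc i))\<^esub>}"
    by (auto simp: HZ_def compose_def fun_eq_iff restrict_def)
  show ?thesis unfolding e
    by (rule mod_hom_kernel_submodule[OF compose_d_hom mHX mHX submodule_hom_vanish[OF X mE X0]])
qed

lemma HB_Suc: "f \<in> HB X X0 (Suc j) \<longleftrightarrow> f \<in> mod_hom R X (E (Suc j)) \<and>
    (\<exists>f'\<in>mod_hom R X (E j). (\<forall>x\<in>X0. f' x = \<zero>\<^bsub>E j\<^esub>) \<and> (\<forall>x\<in>carrier X. f x = d j (f' x)))"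
proof
  assume "f \<in> HB X X0 (Suc j)"
  then show "f \<in> mod_hom R X (E (Suc j)) \<and>
    (\<exists>f'\<in>mod_hom R X (E j). (\<forall>x\<in>X0. f' x = \<zero>\<^bsub>E j\<^esub>) \<and> (\<forall>x\<in>carrier X. f x = d j (f' x)))"
    using mod_hom_compose[OF _ d X] by (auto simp: HB_def compose_eq)
next
  assume "f \<in> mod_hom R X (E (Suc j)) \<and>
    (\<exists>f'\<in>mod_hom R X (E j). (\<forall>x\<in>X0. f' x = \<zero>\<^bsub>E j\<^esub>) \<and> (\<forall>x\<in>carrier X. f x = d j (f' x)))"
  then obtain f' where f': "f \<in> mod_hom R X (E (Suc j))" "f' \<in> mod_hom R X (E j)" "\<forall>x\<in>X0. f' x = \<zero>\<^bsub>E j\<^esub>"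
    "\<forall>x\<in>carrier X. f x = d j (f' x)" by blast
  then have "f = compose (carrier X) (d j) f'"
    by (intro extensionalityI[OF mod_hom_ext[OF f'(1)] compose_extensional]) (simp add: compose_eq)
  then show "f \<in> HB X X0 (Suc j)" using f' by (auto simp: HB_def)
qed

lemma HB_submodule: "X0 \<subseteq> carrier X \<Longrightarrow> submodule (HB X X0 i) R (hom_module R X (E i))"
proof (cases i)
  case 0
  then show ?thesis using submodule_zero_set[OF mHX[of 0]] by (simp add: HB_def)
next
  case (Suc j)
  assume X0: "X0 \<subseteq> carrier X"
  have "HB X X0 i = (\<lambda>f\<in>mod_hom R X (E j). compose (carrier X) (d j) f) ` {f \<in> mod_hom R X (E j). \<forall>x\<in>X0. f x = \<zero>\<^bsub>E j\<^esub>}"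
    unfolding HB_def Suc by (auto intro!: image_cong)
  then show ?thesis
    using mod_hom_image_submodule[OF compose_d_hom mHX mHX submodule_hom_vanish[OF X mE X0]] Suc by simp
qed

lemma HB_subset_HZ: "X0 \<subseteq> carrier X \<Longrightarrow> HB X X0 i \<subseteq> HZ X X0 i"
proof
  fix f assume X0: "X0 \<subseteq> carrier X" and f: "f \<in> HB X X0 i"
  show "f \<in> HZ X X0 i"
  proof (cases i)
    case 0
    then show ?thesis using f submodule_zero[OF HZ_submodule[OF X0], of 0] by (simp add: HB_def)
  next
    case (Suc j)
    then show ?thesis using f X0 d_zero dd by (auto simp: HB_Suc HZ_def mod_hom_closed subset_iff)
  qed
qed

text \<open>
  On \<open>X0 + R x\<close> the map \<open>y + a x \<mapsto> a e\<close> is well defined, because \<open>e\<close> is killed by every \<open>a\<close> with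
  \<open>a x \<in> X0\<close>. By injectivity it extends to \<open>X\<close>.
\<close>

lemma extend_by_one:
  assumes X0: "submodule X0 R X" and x: "x \<in> carrier X"
    and e: "e \<in> torsion R {a \<in> carrier R. a \<odot>\<^bsub>X\<^esub> x \<in> X0} (E j)"
  shows "\<exists>f\<in>mod_hom R X (E j). (\<forall>y\<in>X0. f y = \<zero>\<^bsub>E j\<^esub>) \<and> f x = e"
proof -
  interpret E: Module.module R "E j" by (rule mE)
  let ?X1 = "{y \<oplus>\<^bsub>X\<^esub> a \<odot>\<^bsub>X\<^esub> x | y a. y \<in> X0 \<and> a \<in> carrier R}"
  let ?r = "{(y \<oplus>\<^bsub>X\<^esub> a \<odot>\<^bsub>X\<^esub> x, a \<odot>\<^bsub>E j\<^esub> e) | y a. y \<in> X0 \<and> a \<in> carrier R}"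
  have X0c: "\<And>y. y \<in> X0 \<Longrightarrow> y \<in> carrier X" by (rule submodule_mem[OF X0])
  have ec: "e \<in> carrier (E j)" "\<And>a. a \<in> carrier R \<Longrightarrow> a \<odot>\<^bsub>X\<^esub> x \<in> X0 \<Longrightarrow> a \<odot>\<^bsub>E j\<^esub> e = \<zero>\<^bsub>E j\<^esub>"
    using e by (auto simp: torsion_def)
  have add: "(y \<oplus>\<^bsub>X\<^esub> a \<odot>\<^bsub>X\<^esub> x) \<oplus>\<^bsub>X\<^esub> (y' \<oplus>\<^bsub>X\<^esub> a' \<odot>\<^bsub>X\<^esub> x) = (y \<oplus>\<^bsub>X\<^esub> y') \<oplus>\<^bsub>X\<^esub> (a \<oplus>\<^bsub>R\<^esub> a') \<odot>\<^bsub>X\<^esub> x"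
    if "y \<in> X0" "y' \<in> X0" "a \<in> carrier R" "a' \<in> carrier R" for y y' a a'
    using that X0c x by (simp add: X.smult_l_distr X.a_ac)
  have sm: "c \<odot>\<^bsub>X\<^esub> (y \<oplus>\<^bsub>X\<^esub> a \<odot>\<^bsub>X\<^esub> x) = c \<odot>\<^bsub>X\<^esub> y \<oplus>\<^bsub>X\<^esub> (c \<otimes>\<^bsub>R\<^esub> a) \<odot>\<^bsub>X\<^esub> x"
    if "y \<in> X0" "c \<in> carrier R" "a \<in> carrier R" for c y a
    using that X0c x by (simp add: X.smult_r_distr X.smult_assoc1)
  have z: "\<zero>\<^bsub>X\<^esub> = \<zero>\<^bsub>X\<^esub> \<oplus>\<^bsub>X\<^esub> \<zero>\<^bsub>R\<^esub> \<odot>\<^bsub>X\<^esub> x" "\<zero>\<^bsub>E j\<^esub> = \<zero>\<^bsub>R\<^esub> \<odot>\<^bsub>E j\<^esub> e" using x ec by simp_all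
  have r: "linrel R X (E j) ?r"
  proof (rule linrelI)
    show "u \<in> carrier X \<and> v \<in> carrier (E j)" if "(u, v) \<in> ?r" for u v using that X0c x ec by auto
    show "(\<zero>\<^bsub>X\<^esub>, \<zero>\<^bsub>E j\<^esub>) \<in> ?r" using z submodule_zero[OF X0] by blast
    show "(u \<oplus>\<^bsub>X\<^esub> u', v \<oplus>\<^bsub>E j\<^esub> v') \<in> ?r" if uv: "(u, v) \<in> ?r" "(u', v') \<in> ?r" for u v u' v'
    proof -
      obtain y a y' a' where *: "y \<in> X0" "a \<in> carrier R" "y' \<in> X0" "a' \<in> carrier R" "u = y \<oplus>\<^bsub>X\<^esub> a \<odot>\<^bsub>X\<^esub> x"
        "u' = y' \<oplus>\<^bsub>X\<^esub> a' \<odot>\<^bsub>X\<^esub> x" "v = a \<odot>\<^bsub>E j\<^esub> e" "v' = a' \<odot>\<^bsub>E j\<^esub> e" using uv by blast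
      then have "v \<oplus>\<^bsub>E j\<^esub> v' = (a \<oplus>\<^bsub>R\<^esub> a') \<odot>\<^bsub>E j\<^esub> e" using ec by (simp add: E.smult_l_distr)
      moreover have "u \<oplus>\<^bsub>X\<^esub> u' = (y \<oplus>\<^bsub>X\<^esub> y') \<oplus>\<^bsub>X\<^esub> (a \<oplus>\<^bsub>R\<^esub> a') \<odot>\<^bsub>X\<^esub> x" using * add by simp
      moreover have "a \<oplus>\<^bsub>R\<^esub> a' \<in> carrier R" using * by simp
      ultimately show ?thesis using submodule_add[OF X0 *(1,3)] by blast
    qed
    show "(c \<odot>\<^bsub>X\<^esub> u, c \<odot>\<^bsub>E j\<^esub> v) \<in> ?r" if c: "c \<in> carrier R" and uv: "(u, v) \<in> ?r" for c u v
    proof -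
      obtain y a where *: "y \<in> X0" "a \<in> carrier R" "u = y \<oplus>\<^bsub>X\<^esub> a \<odot>\<^bsub>X\<^esub> x" "v = a \<odot>\<^bsub>E j\<^esub> e" using uv by blast
      then have "c \<odot>\<^bsub>E j\<^esub> v = (c \<otimes>\<^bsub>R\<^esub> a) \<odot>\<^bsub>E j\<^esub> e" using c ec by (simp add: E.smult_assoc1)
      moreover have "c \<odot>\<^bsub>X\<^esub> u = c \<odot>\<^bsub>X\<^esub> y \<oplus>\<^bsub>X\<^esub> (c \<otimes>\<^bsub>R\<^esub> a) \<odot>\<^bsub>X\<^esub> x" using * c sm by simp
      moreover have "c \<otimes>\<^bsub>R\<^esub> a \<in> carrier R" using * c by simp
      ultimately show ?thesis using submodule_smult[OF X0 c *(1)] by blast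
    qed
  qed
  note X1 = submodule_adjoin(1)[OF X X0 x]
  have "v = \<zero>\<^bsub>E j\<^esub>" if v: "(\<zero>\<^bsub>X\<^esub>, v) \<in> ?r" for v
  proof -
    obtain y a where *: "y \<in> X0" "a \<in> carrier R" "\<zero>\<^bsub>X\<^esub> = y \<oplus>\<^bsub>X\<^esub> a \<odot>\<^bsub>X\<^esub> x" "v = a \<odot>\<^bsub>E j\<^esub> e" using v by blast
    have "a \<odot>\<^bsub>X\<^esub> x = mdiff R X (y \<oplus>\<^bsub>X\<^esub> a \<odot>\<^bsub>X\<^esub> x) y"
      using mdiff_add(4)[OF X X0c[OF *(1)], of "a \<odot>\<^bsub>X\<^esub> x"] *(2) x by simp
    also have "\<dots> \<in> X0" using *(3) submodule_mdiff[OF X0 X submodule_zero[OF X0] *(1)] by simp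
    finally show ?thesis using ec(2) * by simp
  qed
  then obtain \<chi> where \<chi>: "\<chi> \<in> mod_hom R (X\<lparr>carrier := ?X1\<rparr>) (E j)" "\<forall>u\<in>?X1. \<forall>v. (u, v) \<in> ?r \<longleftrightarrow> v = \<chi> u"
    using linrel_function[OF r X mE X1] by blast
  obtain f where f: "f \<in> mod_hom R X (E j)" "\<forall>u\<in>?X1. f u = \<chi> u" using baer_extend[OF E X X1 \<chi>(1)] by blast
  have val: "f (y \<oplus>\<^bsub>X\<^esub> a \<odot>\<^bsub>X\<^esub> x) = a \<odot>\<^bsub>E j\<^esub> e" if "y \<in> X0" "a \<in> carrier R" for y a
  proof -
    have m: "y \<oplus>\<^bsub>X\<^esub> a \<odot>\<^bsub>X\<^esub> x \<in> ?X1" "(y \<oplus>\<^bsub>X\<^esub> a \<odot>\<^bsub>X\<^esub> x, a \<odot>\<^bsub>E j\<^esub> e) \<in> ?r" using that by blast+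
    then have "a \<odot>\<^bsub>E j\<^esub> e = \<chi> (y \<oplus>\<^bsub>X\<^esub> a \<odot>\<^bsub>X\<^esub> x)" using \<chi>(2) by blast
    then show ?thesis using bspec[OF f(2) m(1)] by simp
  qed
  have "f y = \<zero>\<^bsub>E j\<^esub>" if "y \<in> X0" for y using val[OF that X.R.zero_closed] X0c[OF that] x ec by simp
  moreover have "f x = e" using val[OF submodule_zero[OF X0] X.R.one_closed] x ec by simp
  ultimately show ?thesis using f(1) by blast
qed

text \<open>
  Induction on the number of generators of \<open>X\<close> over \<open>X0\<close>: for one generator \<open>x\<close> more, evaluation
  at \<open>x\<close> gives an exact sequence of complexes with the \<open>(X0 : x)\<close>-torsion of \<open>E\<close> on the right.
\<close>

lemma wl_HZ_HB:
  assumes cyclic: "\<And>J. submodule J R (reg_module R) \<Longrightarrow> wl R (E i) (EZ J i) (EB J i)"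
    and "finite S" "S \<subseteq> carrier X" "submodule X0 R X"
    and "\<And>V. submodule V R X \<Longrightarrow> X0 \<subseteq> V \<Longrightarrow> S \<subseteq> V \<Longrightarrow> carrier X \<subseteq> V"
  shows "wl R (hom_module R X (E i)) (HZ X X0 i) (HB X X0 i)"
  using assms(2-)
proof (induction S arbitrary: X0 rule: finite_induct)
  case empty
  have X0: "X0 \<subseteq> carrier X" by (rule submodule_subset[OF empty.prems(2)])
  have "f \<in> HB X X0 i" if "f \<in> HZ X X0 i" for f
  proof -
    have "carrier X \<subseteq> X0" using empty.prems by blast
    then have "f = (\<lambda>x\<in>carrier X. \<zero>\<^bsub>E i\<^esub>)"
      using that by (intro extensionalityI[OF mod_hom_ext restrict_extensional, of f R X "E i"]) (auto simp: HZ_def)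
    then show ?thesis using submodule_zero[OF HB_submodule[OF X0, of i]] by simp
  qed
  then show ?case by (intro wl_trivial) blast
next
  case (insert x S)
  have X0: "submodule X0 R X" and x: "x \<in> carrier X" using insert.prems by auto
  have X0s: "X0 \<subseteq> carrier X" by (rule submodule_subset[OF X0])
  let ?X1 = "{y \<oplus>\<^bsub>X\<^esub> a \<odot>\<^bsub>X\<^esub> x | y a. y \<in> X0 \<and> a \<in> carrier R}"
  let ?J = "{a \<in> carrier R. a \<odot>\<^bsub>X\<^esub> x \<in> X0}"
  note reg = reg_module_module[OF X.is_cring]
  have J: "submodule ?J R (reg_module R)"
    by (rule submodule_intro[OF reg])
      (use x submodule_zero[OF X0] submodule_add[OF X0] submodule_smult[OF X0] in
        \<open>auto simp: X.smult_l_distr X.smult_assoc1\<close>)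
  have Jc: "?J \<subseteq> carrier R" by auto
  have X0c: "\<And>y. y \<in> X0 \<Longrightarrow> y \<in> carrier X" using X0s by blast
  note X1 = submodule_adjoin(1)[OF X X0 x] and X0X1 = submodule_adjoin(2)[OF X X0 x]
    and xX1 = submodule_adjoin(3)[OF X X0 x]
  have X1s: "?X1 \<subseteq> carrier X" by (rule submodule_subset[OF X1])
  have IH: "wl R (hom_module R X (E i)) (HZ X ?X1 i) (HB X ?X1 i)"
  proof (rule insert.IH[OF _ X1])
    show "carrier X \<subseteq> V" if "submodule V R X" "?X1 \<subseteq> V" "S \<subseteq> V" for V
      using insert.prems(3)[OF that(1)] that X0X1 xX1 by blast
  qed (use insert.prems in auto)
  have HZ01: "HZ X ?X1 i \<subseteq> HZ X X0 i" using X0X1 by (auto simp: HZ_def)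
  have HB01: "HB X ?X1 i \<subseteq> HB X X0 i"
  proof (cases i)
    case (Suc j)
    have "{f \<in> mod_hom R X (E j). \<forall>x\<in>?X1. f x = \<zero>\<^bsub>E j\<^esub>} \<subseteq> {f \<in> mod_hom R X (E j). \<forall>x\<in>X0. f x = \<zero>\<^bsub>E j\<^esub>}"
      using X0X1 by blast
    then show ?thesis unfolding HB_def Suc nat.case by (rule image_mono)
  qed (simp add: HB_def)
  let ?s = "{(f, f x) | f. f \<in> mod_hom R X (E i)}"
  have s: "linrel R (hom_module R X (E i)) (E i) ?s"
  proof (rule linrelI)
    interpret H: Module.module R "hom_module R X (E i)" by (rule mHX)
    show "(\<zero>\<^bsub>hom_module R X (E i)\<^esub>, \<zero>\<^bsub>E i\<^esub>) \<in> ?s" using x H.zero_closed by auto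
    show "(f \<oplus>\<^bsub>hom_module R X (E i)\<^esub> g, u \<oplus>\<^bsub>E i\<^esub> v) \<in> ?s" if "(f, u) \<in> ?s" "(g, v) \<in> ?s" for f u g v
      using that x H.add.m_closed[of f g] by auto
    show "(a \<odot>\<^bsub>hom_module R X (E i)\<^esub> f, a \<odot>\<^bsub>E i\<^esub> u) \<in> ?s" if "a \<in> carrier R" "(f, u) \<in> ?s" for a f u
      using that x H.smult_closed[of a f] by auto
  qed (use x in \<open>auto simp: mod_hom_closed\<close>)
  show ?case
  proof (rule wl_exact[OF mHX mHX mE HZ_submodule[OF X1s] HB_subset_HZ[OF X1s]
        HZ_submodule[OF X0s] HB_submodule[OF X0s] HB_subset_HZ[OF X0s] EZ_submodule[OF Jc] EB_submodule[OF Jc] EB_subset_EZ[OF Jc]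
        linrel_Id_on[OF mHX] _ _ HB_submodule[OF X1s] s])
    show "\<exists>g\<in>HZ X X0 i. (f, g) \<in> Id_on (carrier (hom_module R X (E i)))" if f: "f \<in> HZ X ?X1 i" for f
      using f HZ01 submodule_mem[OF HZ_submodule[OF X1s] f] by blast
    show "g \<in> HB X X0 i" if "(f, g) \<in> Id_on (carrier (hom_module R X (E i)))" "f \<in> HB X ?X1 i" for f g
      using that HB01 by blast
    have tors: "f x \<in> torsion R ?J (E j)" if "f \<in> mod_hom R X (E j)" "\<forall>y\<in>X0. f y = \<zero>\<^bsub>E j\<^esub>" for f j
      using that x mod_hom_smult[OF that(1), symmetric] by (auto simp: torsion_def mod_hom_closed)
    show "\<exists>e\<in>EZ ?J i. (f, e) \<in> ?s" if "f \<in> HZ X X0 i" for f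
      using that tors[of f i] x by (auto simp: HZ_def EZ_def)
    show "e \<in> EB ?J i" if fe: "(f, e) \<in> ?s" "f \<in> HB X X0 i" for f e
    proof (cases i)
      case 0
      then show ?thesis using fe x by (auto simp: HB_def EB_def)
    next
      case (Suc j)
      then obtain f' where "f' \<in> mod_hom R X (E j)" "\<forall>y\<in>X0. f' y = \<zero>\<^bsub>E j\<^esub>" "\<forall>y\<in>carrier X. f y = d j (f' y)"
        using fe(2) HB_Suc by blast
      then show ?thesis using fe(1) x tors[of f' j] Suc by (auto simp: EB_def)
    qed
    show "\<exists>g\<in>HZ X ?X1 i. \<exists>g'. (g, g') \<in> Id_on (carrier (hom_module R X (E i))) \<and>
        mdiff R (hom_module R X (E i)) f g' \<in> HB X X0 i"
      if f: "f \<in> HZ X X0 i" and fe: "(f, e) \<in> ?s" "e \<in> EB ?J i" for f e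
    proof -
      have fh: "f \<in> mod_hom R X (E i)" "\<And>y. y \<in> X0 \<Longrightarrow> f y = \<zero>\<^bsub>E i\<^esub>" using f by (auto simp: HZ_def)
      have "\<exists>h\<in>HB X X0 i. h x = f x"
      proof (cases i)
        case 0
        then have "f x = \<zero>\<^bsub>E 0\<^esub>" using fe by (auto simp: EB_def)
        then show ?thesis using 0 x by (auto simp: HB_def)
      next
        case (Suc j)
        then obtain e' where e': "e' \<in> torsion R ?J (E j)" "f x = d j e'" using fe by (auto simp: EB_def)
        obtain f' where f': "f' \<in> mod_hom R X (E j)" "\<forall>y\<in>X0. f' y = \<zero>\<^bsub>E j\<^esub>" "f' x = e'"
          using extend_by_one[OF X0 x e'(1)] by blast
        have "compose (carrier X) (d j) f' \<in> HB X X0 i" using f' Suc by (auto simp: HB_def)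
        moreover have "compose (carrier X) (d j) f' x = f x" using f' e' x by (simp add: compose_eq)
        ultimately show ?thesis by blast
      qed
      then obtain h where h: "h \<in> HB X X0 i" "h x = f x" by blast
      have hZ: "h \<in> HZ X X0 i" using h(1) HB_subset_HZ[OF X0s] by blast
      then have hh: "h \<in> mod_hom R X (E i)" "\<And>y. y \<in> X0 \<Longrightarrow> h y = \<zero>\<^bsub>E i\<^esub>" by (auto simp: HZ_def)
      let ?g = "mdiff R (hom_module R X (E i)) f h"
      have gZ: "?g \<in> HZ X X0 i" by (rule submodule_mdiff[OF HZ_submodule[OF X0s] mHX f hZ])
      have gc: "?g y = mdiff R (E i) (f y) (h y)" if "y \<in> carrier X" for y
        using that by (simp add: hom_module_mdiff[OF X])
      have gh: "?g \<in> mod_hom R X (E i)" using gZ by (simp add: HZ_def)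
      interpret Ei: Module.module R "E i" by (rule mE)
      have "?g x = \<zero>\<^bsub>E i\<^esub>" using gc[OF x] h(2) mdiff_self[OF mE mod_hom_closed[OF fh(1) x]] by simp
      then have "?g u = \<zero>\<^bsub>E i\<^esub>" if "u \<in> ?X1" for u
        using that gZ x X0c mod_hom_add[OF gh] mod_hom_smult[OF gh] by (auto simp: HZ_def)
      then have "?g \<in> HZ X ?X1 i" using gZ by (simp add: HZ_def)
      moreover have "(?g, ?g) \<in> Id_on (carrier (hom_module R X (E i)))" using gh by auto
      moreover have "mdiff R (hom_module R X (E i)) f ?g \<in> HB X X0 i"
        using mdiff_mdiff[OF mHX, of f i h] fh(1) hh(1) h(1) by simp
      ultimately show ?thesis by blast
    qed
  qed (use IH cyclic[OF J] in auto)
qed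

end

text \<open>
  In degree zero the cocycles lie in \<open>\<epsilon> ` N\<close>, a copy of \<open>N\<close>.
\<close>

lemma torsion_cohomology_zero:
  assumes "weakly_Laskerian R N" "J \<subseteq> carrier R"
  shows "wl R (E 0) (EZ J 0) (EB J 0)"
proof -
  have WL: "wl R N (carrier N) {\<zero>\<^bsub>N\<^esub>}" using assms(1) weakly_Laskerian_iff by blast
  have \<epsilon>z: "\<epsilon> \<zero>\<^bsub>N\<^esub> = \<zero>\<^bsub>E 0\<^esub>" by (rule mod_hom_zero[OF \<epsilon> N mE])
  have im: "submodule (\<epsilon> ` carrier N) R (E 0)" by (rule mod_hom_image_submodule[OF \<epsilon> N mE submodule_self[OF N]])
  have "wl R (E 0) (\<epsilon> ` carrier N) {\<zero>\<^bsub>E 0\<^esub>}"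
  proof (rule wl_surj[OF N mE submodule_self[OF N] submodule_zero_set[OF N] _ im submodule_zero_set[OF mE] _
        linrel_graph[OF \<epsilon> N mE submodule_self[OF N]] _ _ _ WL])
    show "{\<zero>\<^bsub>N\<^esub>} \<subseteq> carrier N" using submodule_zero[OF submodule_self[OF N]] by simp
    show "{\<zero>\<^bsub>E 0\<^esub>} \<subseteq> \<epsilon> ` carrier N" using submodule_zero[OF im] by simp
    show "\<exists>x\<in>carrier N. \<exists>y'. (x, y') \<in> {(x, \<epsilon> x) | x. x \<in> carrier N} \<and> mdiff R (E 0) y y' \<in> {\<zero>\<^bsub>E 0\<^esub>}"
      if "y \<in> \<epsilon> ` carrier N" for y
      using that mdiff_self[OF mE submodule_mem[OF im that]] by auto
  qed (use \<epsilon>z in auto)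
  moreover have "EZ J 0 \<subseteq> \<epsilon> ` carrier N" using exact_N by (auto simp: EZ_def torsion_def)
  ultimately show ?thesis unfolding EB_def by (simp add: wl_mono)
qed

text \<open>
  Dimension shift: a cocycle \<open>d e\<close> of degree \<open>i + 1\<close> that is killed by \<open>J\<close> comes from the cocycle
  \<open>a \<mapsto> a e\<close> of \<open>Hom (J, E)\<close>.
\<close>

lemma torsion_cohomology_Suc:
  assumes J: "submodule J R (reg_module R)"
    and wl: "wl R (hom_module R ((reg_module R)\<lparr>carrier := J\<rparr>) (E i))
      (HZ ((reg_module R)\<lparr>carrier := J\<rparr>) {\<zero>\<^bsub>R\<^esub>} i) (HB ((reg_module R)\<lparr>carrier := J\<rparr>) {\<zero>\<^bsub>R\<^esub>} i)"
  shows "wl R (E (Suc i)) (EZ J (Suc i)) (EB J (Suc i))"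
proof -
  let ?X = "(reg_module R)\<lparr>carrier := J\<rparr>"
  interpret R: cring R by (rule R)
  interpret E: Module.module R "E i" by (rule mE)
  note reg = reg_module_module[OF R]
  have X: "Module.module R ?X" by (rule submodule_module[OF J reg])
  have Jc: "J \<subseteq> carrier R" using submodule_subset[OF J] by simp
  have JcD: "\<And>a. a \<in> J \<Longrightarrow> a \<in> carrier R" using Jc by blast
  have z: "{\<zero>\<^bsub>R\<^esub>} \<subseteq> carrier ?X" using submodule_zero[OF J] by simp
  have id: "ideal J R" using submodule_reg_iff[OF R] J by blast
  define \<rho> where "\<rho> = {(\<phi>, y). \<phi> \<in> mod_hom R ?X (E i) \<and> (\<exists>e\<in>carrier (E i). (\<forall>a\<in>J. \<phi> a = a \<odot>\<^bsub>E i\<^esub> e) \<and> y = d i e)}"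
  interpret H: Module.module R "hom_module R ?X (E i)" by (rule mHX[OF X])
  have rho: "linrel R (hom_module R ?X (E i)) (E (Suc i)) \<rho>"
  proof (rule linrelI)
    show "(\<zero>\<^bsub>hom_module R ?X (E i)\<^esub>, \<zero>\<^bsub>E (Suc i)\<^esub>) \<in> \<rho>"
      using H.zero_closed JcD d_zero[of i] unfolding \<rho>_def
      by (intro CollectI case_prodI conjI bexI[of _ "\<zero>\<^bsub>E i\<^esub>"]) auto
    show "(\<phi> \<oplus>\<^bsub>hom_module R ?X (E i)\<^esub> \<phi>', y \<oplus>\<^bsub>E (Suc i)\<^esub> y') \<in> \<rho>" if yy: "(\<phi>, y) \<in> \<rho>" "(\<phi>', y') \<in> \<rho>" for \<phi> y \<phi>' y'
    proof -
      obtain e e' where *: "\<phi> \<in> mod_hom R ?X (E i)" "\<phi>' \<in> mod_hom R ?X (E i)" "e \<in> carrier (E i)" "e' \<in> carrier (E i)"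
        "\<forall>a\<in>J. \<phi> a = a \<odot>\<^bsub>E i\<^esub> e" "\<forall>a\<in>J. \<phi>' a = a \<odot>\<^bsub>E i\<^esub> e'" "y = d i e" "y' = d i e'" using yy unfolding \<rho>_def by blast
      then show ?thesis using H.add.m_closed[of \<phi> \<phi>'] JcD unfolding \<rho>_def
        by (intro CollectI case_prodI conjI bexI[of _ "e \<oplus>\<^bsub>E i\<^esub> e'"]) (auto simp: E.smult_r_distr mod_hom_add[OF d])
    qed
    show "(c \<odot>\<^bsub>hom_module R ?X (E i)\<^esub> \<phi>, c \<odot>\<^bsub>E (Suc i)\<^esub> y) \<in> \<rho>" if c: "c \<in> carrier R" and y: "(\<phi>, y) \<in> \<rho>" for c \<phi> y
    proof -
      obtain e where *: "\<phi> \<in> mod_hom R ?X (E i)" "e \<in> carrier (E i)" "\<forall>a\<in>J. \<phi> a = a \<odot>\<^bsub>E i\<^esub> e" "y = d i e"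
        using y unfolding \<rho>_def by blast
      have "c \<odot>\<^bsub>E i\<^esub> (a \<odot>\<^bsub>E i\<^esub> e) = a \<odot>\<^bsub>E i\<^esub> (c \<odot>\<^bsub>E i\<^esub> e)" if "a \<in> J" for a
        using JcD[OF that] c *(2) by (simp add: E.smult_assoc1[symmetric] R.m_comm)
      then show ?thesis using * c H.smult_closed[of c \<phi>] unfolding \<rho>_def
        by (intro CollectI case_prodI conjI bexI[of _ "c \<odot>\<^bsub>E i\<^esub> e"]) (auto simp: mod_hom_smult[OF d])
    qed
  qed (auto simp: \<rho>_def d_closed)
  show ?thesis
  proof (rule wl_surj[OF mHX[OF X] mE HZ_submodule[OF X z] HB_submodule[OF X z] HB_subset_HZ[OF X z]
        EZ_submodule[OF Jc] EB_submodule[OF Jc] EB_subset_EZ[OF Jc] rho _ _ _ wl])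
    show "\<exists>y\<in>EZ J (Suc i). (\<phi>, y) \<in> \<rho>" if \<phi>: "\<phi> \<in> HZ ?X {\<zero>\<^bsub>R\<^esub>} i" for \<phi>
    proof -
      have \<phi>h: "\<phi> \<in> mod_hom R ?X (E i)" "\<And>a. a \<in> J \<Longrightarrow> d i (\<phi> a) = \<zero>\<^bsub>E (Suc i)\<^esub>" using \<phi> by (auto simp: HZ_def)
      obtain e where e: "e \<in> carrier (E i)" "\<forall>a\<in>J. \<phi> a = a \<odot>\<^bsub>E i\<^esub> e" using baerD[OF E id \<phi>h(1)] by blast
      have "a \<odot>\<^bsub>E (Suc i)\<^esub> d i e = \<zero>\<^bsub>E (Suc i)\<^esub>" if a: "a \<in> J" for a
        using mod_hom_smult[OF d JcD[OF a] e(1)] \<phi>h(2)[OF a] e(2) a by simp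
      then have "d i e \<in> EZ J (Suc i)" using d_closed[OF e(1)] dd[OF e(1)] by (simp add: EZ_def torsion_def)
      moreover have "(\<phi>, d i e) \<in> \<rho>" using \<phi>h(1) e unfolding \<rho>_def by blast
      ultimately show ?thesis by blast
    qed
    show "y \<in> EB J (Suc i)" if y: "(\<phi>, y) \<in> \<rho>" and \<phi>: "\<phi> \<in> HB ?X {\<zero>\<^bsub>R\<^esub>} i" for \<phi> y
    proof -
      obtain e where e: "e \<in> carrier (E i)" "\<forall>a\<in>J. \<phi> a = a \<odot>\<^bsub>E i\<^esub> e" "y = d i e" using y unfolding \<rho>_def by blast
      show ?thesis
      proof (cases i)
        case 0
        then have "a \<odot>\<^bsub>E i\<^esub> e = \<zero>\<^bsub>E i\<^esub>" if "a \<in> J" for a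
          using that \<phi> e(2) by (simp add: HB_def)
        then have "e \<in> torsion R J (E i)" using e(1) by (simp add: torsion_def)
        then show ?thesis using e(3) by (auto simp: EB_def)
      next
        case (Suc j)
        then obtain \<phi>' where \<phi>': "\<phi>' \<in> mod_hom R ?X (E j)" "\<forall>a\<in>carrier ?X. \<phi> a = d j (\<phi>' a)"
          using \<phi> HB_Suc[OF X] by blast
        obtain e' where e': "e' \<in> carrier (E j)" "\<forall>a\<in>J. \<phi>' a = a \<odot>\<^bsub>E j\<^esub> e'" using baerD[OF E id \<phi>'(1)] by blast
        have de: "d j e' \<in> carrier (E i)" using d_closed[OF e'(1)] Suc by simp
        let ?t = "mdiff R (E i) e (d j e')"
        have t: "?t \<in> carrier (E i)" by (rule mdiff_closed[OF mE e(1) de])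
        have "a \<odot>\<^bsub>E i\<^esub> ?t = \<zero>\<^bsub>E i\<^esub>" if a: "a \<in> J" for a
        proof -
          have "a \<odot>\<^bsub>E i\<^esub> ?t = mdiff R (E i) (a \<odot>\<^bsub>E i\<^esub> e) (a \<odot>\<^bsub>E i\<^esub> d j e')"
            using JcD[OF a] e(1) de by (simp add: mdiff_def E.smult_r_distr E.smult_assoc1[symmetric] R.m_comm)
          also have "a \<odot>\<^bsub>E i\<^esub> d j e' = a \<odot>\<^bsub>E i\<^esub> e"
            using mod_hom_smult[OF d JcD[OF a] e'(1)] e'(2) \<phi>'(2) e(2) a Suc by simp
          finally show ?thesis using mdiff_self[OF mE] JcD[OF a] e(1) by simp
        qed
        then have "?t \<in> torsion R J (E i)" using t by (simp add: torsion_def)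
        moreover have "d i ?t = y"
          using mod_hom_mdiff[OF d mE e(1) de] dd[OF e'(1)] e(3) mdiff_zero[OF mE d_closed[OF e(1)]] Suc by simp
        ultimately show ?thesis by (auto simp: EB_def)
      qed
    qed
    show "\<exists>\<phi>\<in>HZ ?X {\<zero>\<^bsub>R\<^esub>} i. \<exists>y'. (\<phi>, y') \<in> \<rho> \<and> mdiff R (E (Suc i)) y y' \<in> EB J (Suc i)" if y: "y \<in> EZ J (Suc i)" for y
    proof -
      have yc: "y \<in> carrier (E (Suc i))" "\<And>a. a \<in> J \<Longrightarrow> a \<odot>\<^bsub>E (Suc i)\<^esub> y = \<zero>\<^bsub>E (Suc i)\<^esub>" "d (Suc i) y = \<zero>\<^bsub>E (Suc (Suc i))\<^esub>"
        using y by (auto simp: EZ_def torsion_def)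
      obtain e where e: "e \<in> carrier (E i)" "d i e = y" using d_exact[OF yc(1,3)] by blast
      let ?\<phi> = "\<lambda>a\<in>J. a \<odot>\<^bsub>E i\<^esub> e"
      have \<phi>: "?\<phi> \<in> mod_hom R ?X (E i)"
        by (rule mod_homI) (use JcD e(1) submodule_add[OF J] submodule_smult[OF J] in
            \<open>auto simp: E.smult_l_distr E.smult_assoc1\<close>)
      have "?\<phi> \<in> HZ ?X {\<zero>\<^bsub>R\<^esub>} i"
        using \<phi> submodule_zero[OF J] e mod_hom_smult[OF d _ e(1)] JcD yc(2) by (auto simp: HZ_def)
      moreover have "(?\<phi>, y) \<in> \<rho>" unfolding \<rho>_def using \<phi> e by auto
      moreover have "mdiff R (E (Suc i)) y y \<in> EB J (Suc i)"
        using mdiff_self[OF mE yc(1)] submodule_zero[OF EB_submodule[OF Jc]] by simp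
      ultimately show ?thesis by blast
    qed
  qed
qed

lemma ideal_generators:
  assumes N: "noetherian_ring R" and J: "submodule J R (reg_module R)"
  shows "\<exists>A. finite A \<and> A \<subseteq> J \<and> (\<forall>V. submodule V R ((reg_module R)\<lparr>carrier := J\<rparr>) \<longrightarrow> A \<subseteq> V \<longrightarrow> J \<subseteq> V)"
proof -
  interpret R: cring R by (rule R)
  note reg = reg_module_module[OF R]
  have "ideal J R" using submodule_reg_iff[OF R] J by blast
  then obtain A where A: "A \<subseteq> carrier R" "finite A" "J = genideal R A"
    using noetherian_ring.finetely_gen[OF N, of J] by auto
  have "J \<subseteq> V" if V: "submodule V R ((reg_module R)\<lparr>carrier := J\<rparr>)" "A \<subseteq> V" for V
    using R.genideal_minimal[OF _ V(2)] submodule_unrestrict[OF V(1) J reg] submodule_reg_iff[OF R] A(3) by blast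
  then show ?thesis using A(2,3) R.genideal_self[OF A(1)] by (intro exI[of _ A]) blast
qed

text \<open>
  Induction on the degree. The dimension shift replaces \<open>R/J\<close> by the ideal \<open>J\<close> and lowers the
  degree; over a Noetherian ring \<open>J\<close> is finitely generated, so that \<open>wl_HZ_HB\<close> leads back to
  cyclic modules, for which the induction hypothesis holds.
\<close>

lemma wl_torsion_cohomology:
  assumes "noetherian_ring R" "weakly_Laskerian R N" "submodule J R (reg_module R)"
  shows "wl R (E i) (EZ J i) (EB J i)"
  using assms(3)
proof (induction i arbitrary: J)
  case 0
  then show ?case using torsion_cohomology_zero[OF assms(2)] submodule_subset[OF 0] by simp
next
  case (Suc i)
  let ?X = "(reg_module R)\<lparr>carrier := J\<rparr>"
  note reg = reg_module_module[OF R]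
  have X: "Module.module R ?X" by (rule submodule_module[OF Suc.prems reg])
  obtain A where A: "finite A" "A \<subseteq> J" "\<forall>V. submodule V R ?X \<longrightarrow> A \<subseteq> V \<longrightarrow> J \<subseteq> V"
    using ideal_generators[OF assms(1) Suc.prems] by blast
  have "submodule {\<zero>\<^bsub>R\<^esub>} R ?X" using submodule_zero_set[OF X] by simp
  then have "wl R (hom_module R ?X (E i)) (HZ ?X {\<zero>\<^bsub>R\<^esub>} i) (HB ?X {\<zero>\<^bsub>R\<^esub>} i)"
    using wl_HZ_HB[OF X Suc.IH A(1)] A(2,3) by simp
  then show ?case by (rule torsion_cohomology_Suc[OF Suc.prems])
qed

theorem wl_Hom_cohomology:
  assumes "noetherian_ring R" "weakly_Laskerian R N" "Module.module R X"
    "finite S" "S \<subseteq> carrier X" "\<And>V. submodule V R X \<Longrightarrow> S \<subseteq> V \<Longrightarrow> carrier X \<subseteq> V" "submodule X0 R X"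
  shows "wl R (hom_module R X (E i)) (HZ X X0 i) (HB X X0 i)"
  using wl_HZ_HB[OF assms(3) wl_torsion_cohomology[OF assms(1,2)] assms(4,5,7)] assms(6) by blast

end

section \<open>Balancing Ext by an injective resolution\<close>

text \<open>
  A zigzag through the double complex \<open>Hom (P p, E q)\<close> from a homomorphism on \<open>P p\<close> to one on
  \<open>P 0\<close>. Each step replaces \<open>c \<partial>\<close> by \<open>d c\<close>.
\<close>

primrec zig :: "('a, 'r) ring_scheme \<Rightarrow> (nat \<Rightarrow> ('a, 'e) module) \<Rightarrow> (nat \<Rightarrow> 'e \<Rightarrow> 'e) \<Rightarrow> ('a, 'x) module \<Rightarrow> nat \<Rightarrow> nat \<Rightarrow>
    ((('a, 'x) syz \<Rightarrow> 'a) \<Rightarrow> 'e) \<Rightarrow> ((('a, 'x) syz \<Rightarrow> 'a) \<Rightarrow> 'e) \<Rightarrow> bool" where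
  "zig R E d X 0 = (\<lambda>q x y. x = y)"
| "zig R E d X (Suc p) = (\<lambda>q x y. \<exists>c\<in>mod_hom R (res_module R X p) (E q).
     (\<forall>z\<in>carrier (res_module R X (Suc p)). c (res_diff R X p z) = x z) \<and>
     zig R E d X p (Suc q) (compose (carrier (res_module R X p)) (d q) c) y)"

lemma Zc_precompose:
  assumes X: "Module.module R X" "Module.module R X'" and f: "restrict f (carrier X) \<in> mod_hom R X X'"
    and Y: "Module.module R Y" and a: "a \<in> Zc R X' Y i"
  shows "compose (carrier (res_module R X i)) a (res_map R X X' f i) \<in> Zc R X Y i"
proof -
  have R: "cring R" using X(1) by (rule Module.module.axioms(1))
  note F = res_map_hom[OF X f]
  have "compose (carrier (res_module R X i)) a (res_map R X X' f i) \<in> mod_hom R (res_module R X i) Y"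
    by (rule mod_hom_compose[OF F _ res_module_module[OF R]]) (use a in \<open>simp add: Zc_def\<close>)
  moreover have "a (res_map R X X' f i (res_diff R X i c)) = \<zero>\<^bsub>Y\<^esub>" if c: "c \<in> carrier (res_module R X (Suc i))" for c
    using a mod_hom_closed[OF F c] unfolding res_map_diff[OF X f c, symmetric] by (simp add: Zc_def)
  ultimately show ?thesis
    using mod_hom_closed[OF res_diff_hom[OF X(1)]] by (simp add: Zc_def compose_eq)
qed

lemma Bc_precompose:
  assumes X: "Module.module R X" "Module.module R X'" and f: "restrict f (carrier X) \<in> mod_hom R X X'"
    and Y: "Module.module R Y" and a: "a \<in> Bc R X' Y i"
  shows "compose (carrier (res_module R X i)) a (res_map R X X' f i) \<in> Bc R X Y i"
proof (cases i)
  case 0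
  then show ?thesis using a mod_hom_closed[OF res_map_hom[OF X f]]
    by (auto simp: Bc_0[OF X(1)] Bc_0[OF X(2)] compose_def intro!: restrict_ext)
next
  case (Suc m)
  have R: "cring R" using X(1) by (rule Module.module.axioms(1))
  note F = res_map_hom[OF X f]
  obtain \<psi> where \<psi>: "a \<in> mod_hom R (res_module R X' i) Y" "\<psi> \<in> mod_hom R (res_module R X' m) Y"
    "\<forall>c\<in>carrier (res_module R X' i). a c = \<psi> (res_diff R X' m c)" using a Suc Bc_Suc[OF X(2)] by blast
  have "compose (carrier (res_module R X i)) a (res_map R X X' f i) \<in> mod_hom R (res_module R X i) Y"
    by (rule mod_hom_compose[OF F \<psi>(1) res_module_module[OF R]])
  moreover have "compose (carrier (res_module R X m)) \<psi> (res_map R X X' f m) \<in> mod_hom R (res_module R X m) Y"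
    by (rule mod_hom_compose[OF F \<psi>(2) res_module_module[OF R]])
  moreover have "compose (carrier (res_module R X i)) a (res_map R X X' f i) c =
      compose (carrier (res_module R X m)) \<psi> (res_map R X X' f m) (res_diff R X m c)"
    if "c \<in> carrier (res_module R X i)" for c
    using that Suc \<psi>(3) res_map_diff[OF X f, of c m] mod_hom_closed[OF F] mod_hom_closed[OF res_diff_hom[OF X(1)]]
    by (simp add: compose_eq)
  ultimately show ?thesis unfolding Suc Bc_Suc[OF X(1)] by blast
qed

lemma Ext_map_coset:
  assumes X: "Module.module R X" "Module.module R X'" and f: "restrict f (carrier X) \<in> mod_hom R X X'"
    and Y: "Module.module R Y" and a: "a \<in> Zc R X' Y i"
  shows "Ext_map R i X X' Y f (Bc R X' Y i +>\<^bsub>hom_module R (res_module R X' i) Y\<^esub> a) =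
    Bc R X Y i +>\<^bsub>hom_module R (res_module R X i) Y\<^esub> compose (carrier (res_module R X i)) a (res_map R X X' f i)"
proof -
  let ?C = "(hom_module R (res_module R X' i) Y)\<lparr>carrier := Zc R X' Y i\<rparr>"
  let ?D = "(hom_module R (res_module R X i) Y)\<lparr>carrier := Zc R X Y i\<rparr>"
  let ?h = "\<lambda>\<phi>. compose (carrier (res_module R X i)) \<phi> (res_map R X X' f i)"
  have cy: "cocycles (ext_complex R X Y) (ext_diff R X) i = ?D"
    "coboundaries (ext_complex R X Y) (ext_diff R X) i = Bc R X Y i"
  proof -
    have "{\<phi> \<in> mod_hom R (res_module R X i) Y. ext_diff R X i \<phi> = (\<lambda>c\<in>carrier (res_module R X (Suc i)). \<zero>\<^bsub>Y\<^esub>)} = Zc R X Y i"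
      unfolding ext_diff_def Zc_def compose_def by (intro Collect_cong conj_cong refl) (auto simp: restrict_def fun_eq_iff)
    then show "cocycles (ext_complex R X Y) (ext_diff R X) i = ?D"
      by (simp add: cocycles_def ext_complex_def)
    show "coboundaries (ext_complex R X Y) (ext_diff R X) i = Bc R X Y i"
      by (cases i) (simp_all add: coboundaries_def ext_complex_def Bc_def ext_diff_def)
  qed
  have "coset_map ?D (Bc R X Y i) ?h (Bc R X' Y i +>\<^bsub>?C\<^esub> a) = Bc R X Y i +>\<^bsub>?D\<^esub> ?h a"
  proof (rule coset_map_coset)
    show "Module.module R ?C" by (rule submodule_module[OF Zc_submodule[OF X(2) Y] mHom[OF X(2) Y]])
    show "Module.module R ?D" by (rule submodule_module[OF Zc_submodule[OF X(1) Y] mHom[OF X(1) Y]])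
    show "submodule (Bc R X' Y i) R ?C"
      by (rule submodule_restrict[OF Bc_submodule[OF X(2) Y] Zc_submodule[OF X(2) Y] Bc_subset_Zc[OF X(2) Y] mHom[OF X(2) Y]])
    show "submodule (Bc R X Y i) R ?D"
      by (rule submodule_restrict[OF Bc_submodule[OF X(1) Y] Zc_submodule[OF X(1) Y] Bc_subset_Zc[OF X(1) Y] mHom[OF X(1) Y]])
    show "a \<in> carrier ?C" using a by simp
    show "?h \<phi> \<in> carrier ?D" if "\<phi> \<in> carrier ?C" for \<phi>
      using Zc_precompose[OF X f Y, of \<phi> i] that by simp
    show "?h (\<phi> \<oplus>\<^bsub>?C\<^esub> \<psi>) = ?h \<phi> \<oplus>\<^bsub>?D\<^esub> ?h \<psi>" if "\<phi> \<in> carrier ?C" "\<psi> \<in> carrier ?C" for \<phi> \<psi>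
      using mod_hom_closed[OF res_map_hom[OF X f]] by (auto simp: compose_def intro!: restrict_ext)
    show "?h \<phi> \<in> Bc R X Y i" if "\<phi> \<in> Bc R X' Y i" for \<phi>
      by (rule Bc_precompose[OF X f Y that])
  qed
  then show ?thesis unfolding Ext_map_def cy by simp
qed

context inj_res
begin

text \<open>
  \<open>ZV\<close> consists of the elements of the double complex that are killed by both differentials. A
  zigzag preserves and reflects \<open>ZB\<close>, which is the condition to be \<open>d w\<close> for a \<open>w\<close> with \<open>w \<partial> = 0\<close>;
  in the row \<open>q = 0\<close>, where \<open>d\<close> has no predecessor, it is the condition to be \<open>w \<partial>\<close> for a \<open>w\<close> with
  \<open>d w = 0\<close>.
\<close>

definition ZV :: "('a, 'x) module \<Rightarrow> nat \<Rightarrow> nat \<Rightarrow> ((('a, 'x) syz \<Rightarrow> 'a) \<Rightarrow> 'e) set" where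
  "ZV X p q = {x \<in> Zc R X (E q) p. \<forall>z\<in>carrier (res_module R X p). d q (x z) = \<zero>\<^bsub>E (Suc q)\<^esub>}"

definition ZB :: "('a, 'x) module \<Rightarrow> nat \<Rightarrow> nat \<Rightarrow> ((('a, 'x) syz \<Rightarrow> 'a) \<Rightarrow> 'e) \<Rightarrow> bool" where
  "ZB X p q x \<longleftrightarrow> (case q of
      Suc q' \<Rightarrow> \<exists>w\<in>Zc R X (E q') p. \<forall>z\<in>carrier (res_module R X p). x z = d q' (w z)
    | 0 \<Rightarrow> (case p of 0 \<Rightarrow> \<forall>z\<in>carrier (res_module R X 0). x z = \<zero>\<^bsub>E 0\<^esub>
      | Suc p' \<Rightarrow> \<exists>w\<in>mod_hom R (res_module R X p') (E 0). (\<forall>z\<in>carrier (res_module R X p'). d 0 (w z) = \<zero>\<^bsub>E 1\<^esub>) \<and>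
          (\<forall>z\<in>carrier (res_module R X p). x z = w (res_diff R X p' z))))"

context
  fixes X :: "('a, 'x) module"
  assumes X: "Module.module R X"
begin

interpretation X: Module.module R X by (rule X)
private abbreviation "PZ \<equiv> res_module R X"
private abbreviation "dZ \<equiv> res_diff R X"
private lemmas mPZ = mP[OF X] and dZh = res_diff_hom[OF X] and dZc = mod_hom_closed[OF res_diff_hom[OF X]]
  and dZZ = diff_diff[OF X]

lemma lift_d:
  assumes "x \<in> mod_hom R (PZ p) (E (Suc q))" "\<And>z. z \<in> carrier (PZ p) \<Longrightarrow> d (Suc q) (x z) = \<zero>\<^bsub>E (Suc (Suc q))\<^esub>"
  shows "\<exists>c\<in>mod_hom R (PZ p) (E q). \<forall>z\<in>carrier (PZ p). d q (c z) = x z"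
proof -
  have "\<exists>c\<in>mod_hom R (free_module R (res_basis R X p)) (E q). \<forall>z\<in>carrier (free_module R (res_basis R X p)). d q (c z) = x z"
  proof (rule free_lift[OF mE mE d])
    show "x \<in> mod_hom R (free_module R (res_basis R X p)) (E (Suc q))" using assms(1) by (simp only: res_module_def)
    show "x z \<in> d q ` carrier (E q)" if "z \<in> carrier (free_module R (res_basis R X p))" for z
      using that assms(2)[of z] mod_hom_closed[OF assms(1), of z] by (simp add: exact res_module_def)
  qed
  then show ?thesis by (simp only: res_module_def)
qed

lemma extend_dZ:
  assumes "x \<in> Zc R X (E q) (Suc p)"
  shows "\<exists>c\<in>mod_hom R (PZ p) (E q). \<forall>z\<in>carrier (PZ (Suc p)). c (dZ p z) = x z"
proof (rule baer_factor[OF mPZ mPZ E dZh])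
  show "x \<in> mod_hom R (PZ (Suc p)) (E q)" using assms by (simp add: Zc_def)
  show "x z = \<zero>\<^bsub>E q\<^esub>" if "z \<in> carrier (PZ (Suc p))" "dZ p z = \<zero>\<^bsub>PZ p\<^esub>" for z
    using that assms res_exact[OF X] by (auto simp: Zc_def)
qed

lemma factor_aug:
  assumes "Module.module R Y" "x \<in> Zc R X Y 0"
  shows "\<exists>g\<in>mod_hom R X Y. \<forall>z\<in>carrier (PZ 0). g (res_aug R X z) = x z"
proof (rule hom_factor_surj[OF mPZ X assms(1) res_aug_hom[OF X]])
  show "x \<in> mod_hom R (PZ 0) Y" using assms by (simp add: Zc_def)
  show "x z = \<zero>\<^bsub>Y\<^esub>" if "z \<in> carrier (PZ 0)" "res_aug R X z = \<zero>\<^bsub>X\<^esub>" for z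
    using that assms res_exact_aug[OF X] by (auto simp: Zc_def)
  have "x \<in> res_aug R X ` carrier (PZ 0)" if "x \<in> carrier X" for x
    using res_aug_unit[OF X that] gen_unit_closed[OF X that] by force
  then show "res_aug R X ` carrier (PZ 0) = carrier X" using mod_hom_closed[OF res_aug_hom[OF X]] by blast
qed

lemma aug_surj:
  assumes "x \<in> carrier X"
  shows "\<exists>z\<in>carrier (PZ 0). res_aug R X z = x"
  using res_aug_unit[OF X assms] gen_unit_closed[OF X assms] by blast

lemma compose_d_hom':
  "c \<in> mod_hom R (PZ p) (E q) \<Longrightarrow> compose (carrier (PZ p)) (d q) c \<in> mod_hom R (PZ p) (E (Suc q))"
  by (rule mod_hom_compose[OF _ d mPZ])

lemma step_ZV:
  assumes "c \<in> mod_hom R (PZ p) (E q)" "x \<in> ZV X (Suc p) q" "\<forall>z\<in>carrier (PZ (Suc p)). c (dZ p z) = x z"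
  shows "compose (carrier (PZ p)) (d q) c \<in> ZV X p (Suc q)"
  using assms compose_d_hom'[OF assms(1)] dZc dd mod_hom_closed[OF assms(1)]
  by (auto simp: ZV_def Zc_def compose_eq)

lemma zig_total: "x \<in> ZV X p q \<Longrightarrow> \<exists>y\<in>ZV X 0 (p + q). zig R E d X p q x y"
proof (induction p arbitrary: q x)
  case 0
  then show ?case by auto
next
  case (Suc p)
  then have "x \<in> Zc R X (E q) (Suc p)" by (simp add: ZV_def)
  then obtain c where c: "c \<in> mod_hom R (PZ p) (E q)" "\<forall>z\<in>carrier (PZ (Suc p)). c (dZ p z) = x z"
    using extend_dZ by blast
  obtain y where "y \<in> ZV X 0 (p + Suc q)" "zig R E d X p (Suc q) (compose (carrier (PZ p)) (d q) c) y"
    using Suc.IH[OF step_ZV[OF c(1) Suc.prems c(2)]] by blast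
  then show ?case using c by auto
qed

lemma zig_surj: "y \<in> ZV X 0 (p + q) \<Longrightarrow> \<exists>x\<in>ZV X p q. zig R E d X p q x y"
proof (induction p arbitrary: q)
  case 0
  then show ?case by auto
next
  case (Suc p)
  obtain x' where x': "x' \<in> ZV X p (Suc q)" "zig R E d X p (Suc q) x' y"
    using Suc.IH[of "Suc q"] Suc.prems by auto
  have x'h: "x' \<in> mod_hom R (PZ p) (E (Suc q))" "\<And>z. z \<in> carrier (PZ p) \<Longrightarrow> d (Suc q) (x' z) = \<zero>\<^bsub>E (Suc (Suc q))\<^esub>"
    "\<And>z. z \<in> carrier (PZ (Suc p)) \<Longrightarrow> x' (dZ p z) = \<zero>\<^bsub>E (Suc q)\<^esub>"
    using x'(1) by (auto simp: ZV_def Zc_def)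
  obtain c where c: "c \<in> mod_hom R (PZ p) (E q)" "\<forall>z\<in>carrier (PZ p). d q (c z) = x' z"
    using lift_d[OF x'h(1,2)] by blast
  let ?x = "compose (carrier (PZ (Suc p))) c (dZ p)"
  have "?x \<in> mod_hom R (PZ (Suc p)) (E q)" by (rule mod_hom_compose[OF dZh c(1) mPZ])
  then have "?x \<in> ZV X (Suc p) q"
    using c(2) x'h(3) dZc dZZ mod_hom_zero[OF c(1) mPZ mE] by (auto simp: ZV_def Zc_def compose_eq)
  moreover have "compose (carrier (PZ p)) (d q) c = x'"
    by (rule extensionalityI[OF compose_extensional mod_hom_ext[OF x'h(1)]]) (use c(2) in \<open>simp add: compose_eq\<close>)
  then have "zig R E d X (Suc p) q ?x y"
    using c(1) x'(2) by (auto simp: compose_eq intro!: bexI[of _ c])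
  ultimately show ?case by blast
qed

lemma hom_diff:
  assumes "Module.module R Q" "Module.module R Y" "c \<in> mod_hom R Q Y" "w \<in> mod_hom R Q Y"
  shows "\<exists>u\<in>mod_hom R Q Y. \<forall>z\<in>carrier Q. u z = mdiff R Y (c z) (w z)"
  using mdiff_closed[OF hom_module_module[OF assms(1,2)], of c w] assms(3,4)
  by (intro bexI[of _ "mdiff R (hom_module R Q Y) c w"]) (simp_all add: hom_module_mdiff[OF assms(1)])

text \<open>
  One step of a zigzag preserves and reflects coboundaries: \<open>c \<partial> = w \<partial>\<close> with \<open>d w = 0\<close> means that
  \<open>d c = d (c - w)\<close> with \<open>(c - w) \<partial> = 0\<close>.
\<close>

lemma step_coboundary:
  assumes c: "c \<in> mod_hom R (PZ p) (E q)" and xc: "\<forall>z\<in>carrier (PZ (Suc p)). c (dZ p z) = x z"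
  shows "(\<exists>w\<in>mod_hom R (PZ p) (E q). (\<forall>z\<in>carrier (PZ p). d q (w z) = \<zero>\<^bsub>E (Suc q)\<^esub>) \<and>
      (\<forall>z\<in>carrier (PZ (Suc p)). x z = w (dZ p z))) \<longleftrightarrow>
    (\<exists>w\<in>Zc R X (E q) p. \<forall>z\<in>carrier (PZ p). d q (c z) = d q (w z))"
proof
  assume "\<exists>w\<in>mod_hom R (PZ p) (E q). (\<forall>z\<in>carrier (PZ p). d q (w z) = \<zero>\<^bsub>E (Suc q)\<^esub>) \<and>
      (\<forall>z\<in>carrier (PZ (Suc p)). x z = w (dZ p z))"
  then obtain w where w: "w \<in> mod_hom R (PZ p) (E q)" "\<forall>z\<in>carrier (PZ p). d q (w z) = \<zero>\<^bsub>E (Suc q)\<^esub>"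
    "\<forall>z\<in>carrier (PZ (Suc p)). x z = w (dZ p z)" by blast
  obtain u where u: "u \<in> mod_hom R (PZ p) (E q)" "\<forall>z\<in>carrier (PZ p). u z = mdiff R (E q) (c z) (w z)"
    using hom_diff[OF mPZ mE c w(1)] by blast
  have "u (dZ p z) = \<zero>\<^bsub>E q\<^esub>" if z: "z \<in> carrier (PZ (Suc p))" for z
    using u(2) dZc[OF z] w(3) xc z mdiff_self[OF mE mod_hom_closed[OF c dZc[OF z]]] by simp
  then have "u \<in> Zc R X (E q) p" using u(1) by (simp add: Zc_def)
  moreover have "d q (c z) = d q (u z)" if z: "z \<in> carrier (PZ p)" for z
    using u(2) z mod_hom_mdiff[OF d mE mod_hom_closed[OF c z] mod_hom_closed[OF w(1) z]] w(2)
      mdiff_zero[OF mE d_closed[OF mod_hom_closed[OF c z]]] by simp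
  ultimately show "\<exists>w\<in>Zc R X (E q) p. \<forall>z\<in>carrier (PZ p). d q (c z) = d q (w z)" by blast
next
  assume "\<exists>w\<in>Zc R X (E q) p. \<forall>z\<in>carrier (PZ p). d q (c z) = d q (w z)"
  then obtain w where w: "w \<in> mod_hom R (PZ p) (E q)" "\<forall>z\<in>carrier (PZ (Suc p)). w (dZ p z) = \<zero>\<^bsub>E q\<^esub>"
    "\<forall>z\<in>carrier (PZ p). d q (c z) = d q (w z)" by (auto simp: Zc_def)
  obtain u where u: "u \<in> mod_hom R (PZ p) (E q)" "\<forall>z\<in>carrier (PZ p). u z = mdiff R (E q) (c z) (w z)"
    using hom_diff[OF mPZ mE c w(1)] by blast
  have "d q (u z) = \<zero>\<^bsub>E (Suc q)\<^esub>" if z: "z \<in> carrier (PZ p)" for z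
    using u(2) z mod_hom_mdiff[OF d mE mod_hom_closed[OF c z] mod_hom_closed[OF w(1) z]] w(3)
      mdiff_self[OF mE d_closed[OF mod_hom_closed[OF w(1) z]]] by simp
  moreover have "x z = u (dZ p z)" if z: "z \<in> carrier (PZ (Suc p))" for z
    using u(2) dZc[OF z] w(2) xc z mdiff_zero[OF mE mod_hom_closed[OF c dZc[OF z]]] by simp
  ultimately show "\<exists>w\<in>mod_hom R (PZ p) (E q). (\<forall>z\<in>carrier (PZ p). d q (w z) = \<zero>\<^bsub>E (Suc q)\<^esub>) \<and>
      (\<forall>z\<in>carrier (PZ (Suc p)). x z = w (dZ p z))" using u(1) by blast
qed

text \<open>
  Away from the edges of the double complex the two kinds of coboundaries, \<open>w \<partial>\<close> with \<open>d w = 0\<close> and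
  \<open>d w\<close> with \<open>w \<partial> = 0\<close>, are the same elements \<open>d (u \<partial>)\<close>.
\<close>

lemma coboundary_kinds:
  "(\<exists>w\<in>mod_hom R (PZ p) (E (Suc q)). (\<forall>z\<in>carrier (PZ p). d (Suc q) (w z) = \<zero>\<^bsub>E (Suc (Suc q))\<^esub>) \<and>
      (\<forall>z\<in>carrier (PZ (Suc p)). x z = w (dZ p z))) \<longleftrightarrow>
   (\<exists>w\<in>Zc R X (E q) (Suc p). \<forall>z\<in>carrier (PZ (Suc p)). x z = d q (w z))"
proof
  assume "\<exists>w\<in>mod_hom R (PZ p) (E (Suc q)). (\<forall>z\<in>carrier (PZ p). d (Suc q) (w z) = \<zero>\<^bsub>E (Suc (Suc q))\<^esub>) \<and>
      (\<forall>z\<in>carrier (PZ (Suc p)). x z = w (dZ p z))"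
  then obtain w where w: "w \<in> mod_hom R (PZ p) (E (Suc q))" "\<forall>z\<in>carrier (PZ p). d (Suc q) (w z) = \<zero>\<^bsub>E (Suc (Suc q))\<^esub>"
    "\<forall>z\<in>carrier (PZ (Suc p)). x z = w (dZ p z)" by blast
  obtain u where u: "u \<in> mod_hom R (PZ p) (E q)" "\<forall>z\<in>carrier (PZ p). d q (u z) = w z" using lift_d[OF w(1)] w(2) by blast
  have "compose (carrier (PZ (Suc p))) u (dZ p) \<in> Zc R X (E q) (Suc p)"
    using mod_hom_compose[OF dZh u(1) mPZ] dZc dZZ mod_hom_zero[OF u(1) mPZ mE] by (auto simp: Zc_def compose_eq)
  moreover have "x z = d q (compose (carrier (PZ (Suc p))) u (dZ p) z)" if "z \<in> carrier (PZ (Suc p))" for z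
    using that w(3) u(2) dZc by (simp add: compose_eq)
  ultimately show "\<exists>w\<in>Zc R X (E q) (Suc p). \<forall>z\<in>carrier (PZ (Suc p)). x z = d q (w z)" by blast
next
  assume "\<exists>w\<in>Zc R X (E q) (Suc p). \<forall>z\<in>carrier (PZ (Suc p)). x z = d q (w z)"
  then obtain w where w: "w \<in> Zc R X (E q) (Suc p)" "\<forall>z\<in>carrier (PZ (Suc p)). x z = d q (w z)" by blast
  obtain u where u: "u \<in> mod_hom R (PZ p) (E q)" "\<forall>z\<in>carrier (PZ (Suc p)). u (dZ p z) = w z" using extend_dZ[OF w(1)] by blast
  have "compose (carrier (PZ p)) (d q) u \<in> mod_hom R (PZ p) (E (Suc q))" by (rule compose_d_hom'[OF u(1)])
  moreover have "\<forall>z\<in>carrier (PZ p). d (Suc q) (compose (carrier (PZ p)) (d q) u z) = \<zero>\<^bsub>E (Suc (Suc q))\<^esub>"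
    using dd mod_hom_closed[OF u(1)] by (simp add: compose_eq)
  moreover have "\<forall>z\<in>carrier (PZ (Suc p)). x z = compose (carrier (PZ p)) (d q) u (dZ p z)"
    using w(2) u(2) dZc by (simp add: compose_eq)
  ultimately show "\<exists>w\<in>mod_hom R (PZ p) (E (Suc q)). (\<forall>z\<in>carrier (PZ p). d (Suc q) (w z) = \<zero>\<^bsub>E (Suc (Suc q))\<^esub>) \<and>
      (\<forall>z\<in>carrier (PZ (Suc p)). x z = w (dZ p z))" by blast
qed

lemma zig_coboundary: "zig R E d X p q x y \<Longrightarrow> ZB X p q x \<longleftrightarrow> ZB X 0 (p + q) y"
proof (induction p arbitrary: q x)
  case 0
  then show ?case by simp
next
  case (Suc p)
  then obtain c where c: "c \<in> mod_hom R (PZ p) (E q)" "\<forall>z\<in>carrier (PZ (Suc p)). c (dZ p z) = x z"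
    "zig R E d X p (Suc q) (compose (carrier (PZ p)) (d q) c) y" by auto
  have "ZB X (Suc p) q x \<longleftrightarrow> (\<exists>w\<in>mod_hom R (PZ p) (E q). (\<forall>z\<in>carrier (PZ p). d q (w z) = \<zero>\<^bsub>E (Suc q)\<^esub>) \<and>
      (\<forall>z\<in>carrier (PZ (Suc p)). x z = w (dZ p z)))"
    by (cases q) (simp_all add: ZB_def coboundary_kinds)
  also have "\<dots> \<longleftrightarrow> ZB X p (Suc q) (compose (carrier (PZ p)) (d q) c)"
    using step_coboundary[OF c(1,2)] by (simp add: ZB_def compose_eq)
  also have "\<dots> \<longleftrightarrow> ZB X 0 (Suc p + q) y" using Suc.IH[OF c(3)] by simp
  finally show ?case .
qed

lemma zig_zero: "zig R E d X p q (\<lambda>z\<in>carrier (PZ p). \<zero>\<^bsub>E q\<^esub>) (\<lambda>z\<in>carrier (PZ 0). \<zero>\<^bsub>E (p + q)\<^esub>)"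
proof (induction p arbitrary: q)
  case (Suc p)
  have "compose (carrier (PZ p)) (d q) (\<lambda>z\<in>carrier (PZ p). \<zero>\<^bsub>E q\<^esub>) = (\<lambda>z\<in>carrier (PZ p). \<zero>\<^bsub>E (Suc q)\<^esub>)"
    by (auto simp: compose_def d_zero)
  moreover have "zig R E d X p (Suc q) (\<lambda>z\<in>carrier (PZ p). \<zero>\<^bsub>E (Suc q)\<^esub>) (\<lambda>z\<in>carrier (PZ 0). \<zero>\<^bsub>E (Suc p + q)\<^esub>)"
    using Suc[of "Suc q"] by (simp only: add_Suc_right add_Suc)
  ultimately have z: "zig R E d X p (Suc q) (compose (carrier (PZ p)) (d q) (\<lambda>z\<in>carrier (PZ p). \<zero>\<^bsub>E q\<^esub>))
      (\<lambda>z\<in>carrier (PZ 0). \<zero>\<^bsub>E (Suc p + q)\<^esub>)" by (simp only:)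
  show ?case unfolding zig.simps
    by (rule bexI[of _ "\<lambda>z\<in>carrier (PZ p). \<zero>\<^bsub>E q\<^esub>"], rule conjI[OF _ z])
      (use mod_hom_zero_map[OF mPZ mE] dZc in auto)
qed simp

lemma zig_add:
  "zig R E d X p q x y \<Longrightarrow> zig R E d X p q x' y' \<Longrightarrow>
    zig R E d X p q (x \<oplus>\<^bsub>hom_module R (PZ p) (E q)\<^esub> x') (y \<oplus>\<^bsub>hom_module R (PZ 0) (E (p + q))\<^esub> y')"
proof (induction p arbitrary: q x x')
  case 0
  then show ?case by simp
next
  case (Suc p)
  obtain c where c: "c \<in> mod_hom R (PZ p) (E q)" "\<forall>z\<in>carrier (PZ (Suc p)). c (dZ p z) = x z"
    "zig R E d X p (Suc q) (compose (carrier (PZ p)) (d q) c) y" using Suc.prems(1) by auto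
  obtain c' where c': "c' \<in> mod_hom R (PZ p) (E q)" "\<forall>z\<in>carrier (PZ (Suc p)). c' (dZ p z) = x' z"
    "zig R E d X p (Suc q) (compose (carrier (PZ p)) (d q) c') y'" using Suc.prems(2) by auto
  interpret H: Module.module R "hom_module R (PZ p) (E q)" by (rule mHom[OF X mE])
  let ?c = "c \<oplus>\<^bsub>hom_module R (PZ p) (E q)\<^esub> c'"
  have "?c \<in> mod_hom R (PZ p) (E q)" using H.add.m_closed[of c c'] c(1) c'(1) by simp
  moreover have "compose (carrier (PZ p)) (d q) ?c = compose (carrier (PZ p)) (d q) c
      \<oplus>\<^bsub>hom_module R (PZ p) (E (Suc q))\<^esub> compose (carrier (PZ p)) (d q) c'"
    using c(1) c'(1) by (auto simp: compose_def mod_hom_add[OF d] mod_hom_closed intro!: restrict_ext)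
  then have z: "zig R E d X p (Suc q) (compose (carrier (PZ p)) (d q) ?c) (y \<oplus>\<^bsub>hom_module R (PZ 0) (E (Suc p + q))\<^esub> y')"
    using Suc.IH[OF c(3) c'(3)] by (simp only: add_Suc_right add_Suc)
  moreover have "\<forall>z\<in>carrier (PZ (Suc p)). ?c (dZ p z) = (x \<oplus>\<^bsub>hom_module R (PZ (Suc p)) (E q)\<^esub> x') z"
    using c(2) c'(2) dZc by simp
  ultimately show ?case unfolding zig.simps by blast
qed

lemma zig_smult:
  "zig R E d X p q x y \<Longrightarrow> a \<in> carrier R \<Longrightarrow>
    zig R E d X p q (a \<odot>\<^bsub>hom_module R (PZ p) (E q)\<^esub> x) (a \<odot>\<^bsub>hom_module R (PZ 0) (E (p + q))\<^esub> y)"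
proof (induction p arbitrary: q x)
  case 0
  then show ?case by simp
next
  case (Suc p)
  obtain c where c: "c \<in> mod_hom R (PZ p) (E q)" "\<forall>z\<in>carrier (PZ (Suc p)). c (dZ p z) = x z"
    "zig R E d X p (Suc q) (compose (carrier (PZ p)) (d q) c) y" using Suc.prems(1) by auto
  interpret H: Module.module R "hom_module R (PZ p) (E q)" by (rule mHom[OF X mE])
  let ?c = "a \<odot>\<^bsub>hom_module R (PZ p) (E q)\<^esub> c"
  have "?c \<in> mod_hom R (PZ p) (E q)" using H.smult_closed[of a c] c(1) Suc.prems(2) by simp
  moreover have "compose (carrier (PZ p)) (d q) ?c = a \<odot>\<^bsub>hom_module R (PZ p) (E (Suc q))\<^esub> compose (carrier (PZ p)) (d q) c"
    using c(1) Suc.prems(2) by (auto simp: compose_def mod_hom_smult[OF d] mod_hom_closed intro!: restrict_ext)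
  then have z: "zig R E d X p (Suc q) (compose (carrier (PZ p)) (d q) ?c) (a \<odot>\<^bsub>hom_module R (PZ 0) (E (Suc p + q))\<^esub> y)"
    using Suc.IH[OF c(3) Suc.prems(2)] by (simp only: add_Suc_right add_Suc)
  moreover have "\<forall>z\<in>carrier (PZ (Suc p)). ?c (dZ p z) = (a \<odot>\<^bsub>hom_module R (PZ (Suc p)) (E q)\<^esub> x) z"
    using c(2) dZc by simp
  ultimately show ?case unfolding zig.simps by blast
qed

text \<open>The isomorphism between \<open>Ext R i X N\<close> and the cohomology of \<open>Hom (X, E)\<close>, as a relation between cocycles.\<close>

definition balance :: "nat \<Rightarrow> (((('a, 'x) syz \<Rightarrow> 'a) \<Rightarrow> 'n) \<times> ('x \<Rightarrow> 'e)) set" where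
  "balance i = {(a, g). a \<in> Zc R X N i \<and> g \<in> HZ X {} i \<and>
     zig R E d X i 0 (compose (carrier (PZ i)) \<epsilon> a) (compose (carrier (PZ 0)) g (res_aug R X))}"

lemma balance_add:
  assumes "(a, g) \<in> balance i" "(a', g') \<in> balance i"
  shows "(a \<oplus>\<^bsub>hom_module R (PZ i) N\<^esub> a', g \<oplus>\<^bsub>hom_module R X (E i)\<^esub> g') \<in> balance i"
proof -
  have h: "a \<in> mod_hom R (PZ i) N" "a' \<in> mod_hom R (PZ i) N" using assms by (auto simp: balance_def Zc_def)
  have "compose (carrier (PZ i)) \<epsilon> (a \<oplus>\<^bsub>hom_module R (PZ i) N\<^esub> a') =
      compose (carrier (PZ i)) \<epsilon> a \<oplus>\<^bsub>hom_module R (PZ i) (E 0)\<^esub> compose (carrier (PZ i)) \<epsilon> a'"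
    using h by (auto simp: compose_def mod_hom_add[OF \<epsilon>] mod_hom_closed intro!: restrict_ext)
  moreover have "compose (carrier (PZ 0)) (g \<oplus>\<^bsub>hom_module R X (E i)\<^esub> g') (res_aug R X) =
      compose (carrier (PZ 0)) g (res_aug R X) \<oplus>\<^bsub>hom_module R (PZ 0) (E i)\<^esub> compose (carrier (PZ 0)) g' (res_aug R X)"
    using mod_hom_closed[OF res_aug_hom[OF X]] by (auto simp: compose_def intro!: restrict_ext)
  ultimately show ?thesis
    using assms zig_add[of i 0 "compose (carrier (PZ i)) \<epsilon> a" "compose (carrier (PZ 0)) g (res_aug R X)"
        "compose (carrier (PZ i)) \<epsilon> a'" "compose (carrier (PZ 0)) g' (res_aug R X)"]
      submodule_add[OF Zc_submodule[OF X N], of a i a'] submodule_add[OF HZ_submodule[OF X, of "{}"], of g i g']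
    by (auto simp: balance_def)
qed

lemma balance_smult:
  assumes "(a, g) \<in> balance i" "c \<in> carrier R"
  shows "(c \<odot>\<^bsub>hom_module R (PZ i) N\<^esub> a, c \<odot>\<^bsub>hom_module R X (E i)\<^esub> g) \<in> balance i"
proof -
  have h: "a \<in> mod_hom R (PZ i) N" using assms by (auto simp: balance_def Zc_def)
  have "compose (carrier (PZ i)) \<epsilon> (c \<odot>\<^bsub>hom_module R (PZ i) N\<^esub> a) =
      c \<odot>\<^bsub>hom_module R (PZ i) (E 0)\<^esub> compose (carrier (PZ i)) \<epsilon> a"
    using h assms(2) by (auto simp: compose_def mod_hom_smult[OF \<epsilon>] mod_hom_closed intro!: restrict_ext)
  moreover have "compose (carrier (PZ 0)) (c \<odot>\<^bsub>hom_module R X (E i)\<^esub> g) (res_aug R X) =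
      c \<odot>\<^bsub>hom_module R (PZ 0) (E i)\<^esub> compose (carrier (PZ 0)) g (res_aug R X)"
    using mod_hom_closed[OF res_aug_hom[OF X]] by (auto simp: compose_def intro!: restrict_ext)
  ultimately show ?thesis
    using assms zig_smult[of i 0 "compose (carrier (PZ i)) \<epsilon> a" "compose (carrier (PZ 0)) g (res_aug R X)" c]
      submodule_smult[OF Zc_submodule[OF X N], of c a i] submodule_smult[OF HZ_submodule[OF X, of "{}"], of c g i]
    by (auto simp: balance_def)
qed

lemma balance_linrel: "linrel R (hom_module R (PZ i) N) (hom_module R X (E i)) (balance i)"
proof (rule linrelI)
  show "x \<in> carrier (hom_module R (PZ i) N) \<and> y \<in> carrier (hom_module R X (E i))" if "(x, y) \<in> balance i" for x y
    using that by (auto simp: balance_def Zc_def HZ_def)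
  have "compose (carrier (PZ i)) \<epsilon> (\<lambda>z\<in>carrier (PZ i). \<zero>\<^bsub>N\<^esub>) = (\<lambda>z\<in>carrier (PZ i). \<zero>\<^bsub>E 0\<^esub>)"
    by (auto simp: compose_def mod_hom_zero[OF \<epsilon> N mE])
  moreover have "compose (carrier (PZ 0)) (\<lambda>x\<in>carrier X. \<zero>\<^bsub>E i\<^esub>) (res_aug R X) = (\<lambda>z\<in>carrier (PZ 0). \<zero>\<^bsub>E i\<^esub>)"
    using mod_hom_closed[OF res_aug_hom[OF X]] by (auto simp: compose_def)
  ultimately show "(\<zero>\<^bsub>hom_module R (PZ i) N\<^esub>, \<zero>\<^bsub>hom_module R X (E i)\<^esub>) \<in> balance i"
    using zig_zero[of i 0] submodule_zero[OF Zc_submodule[OF X N], of i] submodule_zero[OF HZ_submodule[OF X, of "{}"], of i]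
    by (simp add: balance_def)
qed (rule balance_add balance_smult; assumption)+

lemma aug_HZ:
  assumes "g \<in> mod_hom R X (E i)"
  shows "g \<in> HZ X {} i \<longleftrightarrow> compose (carrier (PZ 0)) g (res_aug R X) \<in> ZV X 0 i"
proof -
  have ga: "compose (carrier (PZ 0)) g (res_aug R X) \<in> mod_hom R (PZ 0) (E i)"
    by (rule mod_hom_compose[OF res_aug_hom[OF X] assms mPZ])
  have "compose (carrier (PZ 0)) g (res_aug R X) (dZ 0 z) = \<zero>\<^bsub>E i\<^esub>" if "z \<in> carrier (PZ (Suc 0))" for z
    using that dZc[OF that] aug_diff[OF X, of z] mod_hom_zero[OF assms X mE] by (simp add: compose_eq)
  then have "compose (carrier (PZ 0)) g (res_aug R X) \<in> ZV X 0 i \<longleftrightarrow>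
      (\<forall>z\<in>carrier (PZ 0). d i (g (res_aug R X z)) = \<zero>\<^bsub>E (Suc i)\<^esub>)"
    using ga by (auto simp: ZV_def Zc_def compose_eq)
  also have "\<dots> \<longleftrightarrow> (\<forall>x\<in>carrier X. d i (g x) = \<zero>\<^bsub>E (Suc i)\<^esub>)"
    using aug_surj mod_hom_closed[OF res_aug_hom[OF X]] by metis
  finally show ?thesis using assms by (simp add: HZ_def)
qed

lemma \<epsilon>_kernel: "n \<in> carrier N \<Longrightarrow> d 0 (\<epsilon> n) = \<zero>\<^bsub>E 1\<^esub>"
  using exact_N by blast

lemma \<epsilon>_Zc:
  assumes "a \<in> Zc R X N i"
  shows "compose (carrier (PZ i)) \<epsilon> a \<in> ZV X i 0"
  using assms mod_hom_compose[OF _ \<epsilon> mPZ] mod_hom_zero[OF \<epsilon> N mE] dZc \<epsilon>_kernel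
  by (auto simp: ZV_def Zc_def compose_eq mod_hom_closed)

lemma balance_total:
  assumes a: "a \<in> Zc R X N i"
  shows "\<exists>g\<in>HZ X {} i. (a, g) \<in> balance i"
proof -
  obtain y where y: "y \<in> ZV X 0 i" "zig R E d X i 0 (compose (carrier (PZ i)) \<epsilon> a) y"
    using zig_total[OF \<epsilon>_Zc[OF a]] by auto
  have yZ: "y \<in> Zc R X (E i) 0" using y(1) by (simp add: ZV_def)
  obtain g where g: "g \<in> mod_hom R X (E i)" "\<forall>z\<in>carrier (PZ 0). g (res_aug R X z) = y z"
    using factor_aug[OF mE yZ] by blast
  have e: "compose (carrier (PZ 0)) g (res_aug R X) = y"
    by (rule extensionalityI[OF compose_extensional mod_hom_ext[of y R "PZ 0" "E i"]])
      (use g(2) yZ in \<open>auto simp: compose_eq Zc_def\<close>)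
  then have "g \<in> HZ X {} i" using aug_HZ[OF g(1)] y(1) by simp
  then show ?thesis using a y(2) e by (auto simp: balance_def)
qed

lemma lift_\<epsilon>:
  assumes "x \<in> mod_hom R (PZ p) (E 0)" "\<forall>z\<in>carrier (PZ p). d 0 (x z) = \<zero>\<^bsub>E 1\<^esub>"
  shows "\<exists>a\<in>mod_hom R (PZ p) N. \<forall>z\<in>carrier (PZ p). \<epsilon> (a z) = x z"
  by (rule hom_lift_inj[OF X mPZ N mE \<epsilon> \<epsilon>_inj assms(1)]) (use assms mod_hom_closed[OF assms(1)] exact_N in auto)

lemma balance_surj:
  assumes g: "g \<in> HZ X {} i"
  shows "\<exists>a\<in>Zc R X N i. (a, g) \<in> balance i"
proof -
  have gh: "g \<in> mod_hom R X (E i)" using g by (simp add: HZ_def)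
  have "compose (carrier (PZ 0)) g (res_aug R X) \<in> ZV X 0 (i + 0)" using aug_HZ[OF gh] g by simp
  then obtain x where x: "x \<in> ZV X i 0" "zig R E d X i 0 x (compose (carrier (PZ 0)) g (res_aug R X))"
    using zig_surj by blast
  then have xh: "x \<in> mod_hom R (PZ i) (E 0)" "\<forall>z\<in>carrier (PZ i). d 0 (x z) = \<zero>\<^bsub>E 1\<^esub>"
    "\<forall>z\<in>carrier (PZ (Suc i)). x (dZ i z) = \<zero>\<^bsub>E 0\<^esub>" by (auto simp: ZV_def Zc_def)
  obtain a where a: "a \<in> mod_hom R (PZ i) N" "\<forall>z\<in>carrier (PZ i). \<epsilon> (a z) = x z" using lift_\<epsilon>[OF xh(1,2)] by blast
  have "a (dZ i z) = \<zero>\<^bsub>N\<^esub>" if z: "z \<in> carrier (PZ (Suc i))" for z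
  proof (rule inj_onD[OF \<epsilon>_inj])
    show "\<epsilon> (a (dZ i z)) = \<epsilon> \<zero>\<^bsub>N\<^esub>" using a(2) dZc[OF z] xh(3) z mod_hom_zero[OF \<epsilon> N mE] by simp
    show "a (dZ i z) \<in> carrier N" by (rule mod_hom_closed[OF a(1) dZc[OF z]])
    show "\<zero>\<^bsub>N\<^esub> \<in> carrier N" using submodule_zero[OF submodule_self[OF N]] .
  qed
  then have aZ: "a \<in> Zc R X N i" using a(1) by (simp add: Zc_def)
  have "compose (carrier (PZ i)) \<epsilon> a = x"
    by (rule extensionalityI[OF compose_extensional mod_hom_ext[OF xh(1)]]) (use a(2) in \<open>simp add: compose_eq\<close>)
  then show ?thesis using aZ g x(2) by (auto simp: balance_def)
qed

lemma \<epsilon>_eq: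
  "n \<in> carrier N \<Longrightarrow> n' \<in> carrier N \<Longrightarrow> \<epsilon> n = \<epsilon> n' \<Longrightarrow> n = n'"
  using \<epsilon>_inj by (auto dest: inj_onD)

lemma Bc_ZB:
  assumes a: "a \<in> Zc R X N i"
  shows "a \<in> Bc R X N i \<longleftrightarrow> ZB X i 0 (compose (carrier (PZ i)) \<epsilon> a)"
proof (cases i)
  case 0
  have ah: "a \<in> mod_hom R (PZ 0) N" using a 0 by (simp add: Zc_def)
  have z: "\<zero>\<^bsub>N\<^esub> \<in> carrier N" using submodule_zero[OF submodule_self[OF N]] .
  have "ZB X 0 0 (compose (carrier (PZ 0)) \<epsilon> a) \<longleftrightarrow> (\<forall>z\<in>carrier (PZ 0). a z = \<zero>\<^bsub>N\<^esub>)"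
  proof -
    have "\<epsilon> (a z) = \<zero>\<^bsub>E 0\<^esub> \<longleftrightarrow> a z = \<zero>\<^bsub>N\<^esub>" if "z \<in> carrier (PZ 0)" for z
      using \<epsilon>_eq[OF mod_hom_closed[OF ah that] z] mod_hom_zero[OF \<epsilon> N mE] by metis
    then show ?thesis by (simp add: ZB_def compose_eq)
  qed
  also have "\<dots> \<longleftrightarrow> a = (\<lambda>z\<in>carrier (PZ 0). \<zero>\<^bsub>N\<^esub>)"
    using extensionalityI[OF mod_hom_ext[OF ah] restrict_extensional, of "\<lambda>z. \<zero>\<^bsub>N\<^esub>"] by auto
  finally show ?thesis using 0 by (simp add: Bc_0[OF X])
next
  case (Suc m)
  have ah: "a \<in> mod_hom R (PZ (Suc m)) N" using a Suc by (simp add: Zc_def)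
  show ?thesis unfolding Suc
  proof
    assume "a \<in> Bc R X N (Suc m)"
    then obtain \<psi> where \<psi>: "\<psi> \<in> mod_hom R (PZ m) N" "\<forall>c\<in>carrier (PZ (Suc m)). a c = \<psi> (dZ m c)" using Bc_Suc[OF X] by blast
    have "compose (carrier (PZ m)) \<epsilon> \<psi> \<in> mod_hom R (PZ m) (E 0)" by (rule mod_hom_compose[OF \<psi>(1) \<epsilon> mPZ])
    then show "ZB X (Suc m) 0 (compose (carrier (PZ (Suc m))) \<epsilon> a)"
      using \<psi> dZc \<epsilon>_kernel by (auto simp: ZB_def compose_eq mod_hom_closed intro!: bexI[of _ "compose (carrier (PZ m)) \<epsilon> \<psi>"])
  next
    assume "ZB X (Suc m) 0 (compose (carrier (PZ (Suc m))) \<epsilon> a)"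
    then obtain w where w: "w \<in> mod_hom R (PZ m) (E 0)" "\<forall>z\<in>carrier (PZ m). d 0 (w z) = \<zero>\<^bsub>E 1\<^esub>"
      "\<forall>z\<in>carrier (PZ (Suc m)). \<epsilon> (a z) = w (dZ m z)" by (auto simp: ZB_def compose_eq)
    obtain \<psi> where \<psi>: "\<psi> \<in> mod_hom R (PZ m) N" "\<forall>z\<in>carrier (PZ m). \<epsilon> (\<psi> z) = w z" using lift_\<epsilon>[OF w(1,2)] by blast
    have "a z = \<psi> (dZ m z)" if z: "z \<in> carrier (PZ (Suc m))" for z
      by (rule \<epsilon>_eq) (use w(3) \<psi>(2) z dZc[OF z] mod_hom_closed[OF ah z] mod_hom_closed[OF \<psi>(1) dZc[OF z]] in auto)
    then show "a \<in> Bc R X N (Suc m)" using \<psi>(1) ah Bc_Suc[OF X] by blast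
  qed
qed

lemma HB_ZB:
  assumes g: "g \<in> HZ X {} i"
  shows "g \<in> HB X {} i \<longleftrightarrow> ZB X 0 i (compose (carrier (PZ 0)) g (res_aug R X))"
proof (cases i)
  case 0
  have gh: "g \<in> mod_hom R X (E 0)" using g 0 by (simp add: HZ_def)
  have "ZB X 0 0 (compose (carrier (PZ 0)) g (res_aug R X)) \<longleftrightarrow> (\<forall>x\<in>carrier X. g x = \<zero>\<^bsub>E 0\<^esub>)"
  proof
    assume z: "ZB X 0 0 (compose (carrier (PZ 0)) g (res_aug R X))"
    show "\<forall>x\<in>carrier X. g x = \<zero>\<^bsub>E 0\<^esub>"
    proof
      fix x assume "x \<in> carrier X"
      then obtain z where "z \<in> carrier (PZ 0)" "res_aug R X z = x" using aug_surj by blast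
      then show "g x = \<zero>\<^bsub>E 0\<^esub>" using z by (auto simp: ZB_def compose_eq)
    qed
  qed (use mod_hom_closed[OF res_aug_hom[OF X]] in \<open>auto simp: ZB_def compose_eq\<close>)
  also have "\<dots> \<longleftrightarrow> g = (\<lambda>x\<in>carrier X. \<zero>\<^bsub>E 0\<^esub>)"
    using extensionalityI[OF mod_hom_ext[OF gh] restrict_extensional, of "\<lambda>x. \<zero>\<^bsub>E 0\<^esub>"] by auto
  finally show ?thesis using 0 by (simp add: HB_def)
next
  case (Suc j)
  have gh: "g \<in> mod_hom R X (E (Suc j))" using g Suc by (simp add: HZ_def)
  show ?thesis unfolding Suc
  proof
    assume "g \<in> HB X {} (Suc j)"
    then obtain f where f: "f \<in> mod_hom R X (E j)" "\<forall>x\<in>carrier X. g x = d j (f x)" using HB_Suc[OF X] by blast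
    let ?w = "compose (carrier (PZ 0)) f (res_aug R X)"
    have "?w (dZ 0 z) = \<zero>\<^bsub>E j\<^esub>" if "z \<in> carrier (PZ (Suc 0))" for z
      using that dZc[OF that] aug_diff[OF X, of z] mod_hom_zero[OF f(1) X mE] by (simp add: compose_eq)
    then have "?w \<in> Zc R X (E j) 0" using mod_hom_compose[OF res_aug_hom[OF X] f(1) mPZ] by (simp add: Zc_def)
    then show "ZB X 0 (Suc j) (compose (carrier (PZ 0)) g (res_aug R X))"
      using f(2) mod_hom_closed[OF res_aug_hom[OF X]] by (auto simp: ZB_def compose_eq intro!: bexI[of _ ?w])
  next
    assume "ZB X 0 (Suc j) (compose (carrier (PZ 0)) g (res_aug R X))"
    then obtain w where w: "w \<in> Zc R X (E j) 0" "\<forall>z\<in>carrier (PZ 0). g (res_aug R X z) = d j (w z)"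
      by (auto simp: ZB_def compose_eq)
    obtain f where f: "f \<in> mod_hom R X (E j)" "\<forall>z\<in>carrier (PZ 0). f (res_aug R X z) = w z"
      using factor_aug[OF mE w(1)] by blast
    have "g x = d j (f x)" if "x \<in> carrier X" for x using aug_surj[OF that] w(2) f(2) by auto
    then show "g \<in> HB X {} (Suc j)" using gh f(1) HB_Suc[OF X] by auto
  qed
qed

lemma balance_zero: "(a, g) \<in> balance i \<Longrightarrow> a \<in> Bc R X N i \<longleftrightarrow> g \<in> HB X {} i"
  using zig_coboundary[of i 0] Bc_ZB HB_ZB by (auto simp: balance_def)

end

text \<open>
  Strict functoriality of the standard resolution makes naturality hold for the cochains
  themselves, without a homotopy.
\<close>

lemma zig_natural:
  assumes X: "Module.module R X" "Module.module R X'" and f: "restrict f (carrier X) \<in> mod_hom R X X'"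
  shows "zig R E d X' p q x y \<Longrightarrow> zig R E d X p q (compose (carrier (res_module R X p)) x (res_map R X X' f p))
    (compose (carrier (res_module R X 0)) y (res_map R X X' f 0))"
proof (induction p arbitrary: q x)
  case 0
  then show ?case by simp
next
  case (Suc p)
  note F = res_map_hom[OF X f]
  obtain c where c: "c \<in> mod_hom R (res_module R X' p) (E q)"
    "\<forall>z\<in>carrier (res_module R X' (Suc p)). c (res_diff R X' p z) = x z"
    "zig R E d X' p (Suc q) (compose (carrier (res_module R X' p)) (d q) c) y" using Suc.prems by auto
  let ?c = "compose (carrier (res_module R X p)) c (res_map R X X' f p)"
  have "?c \<in> mod_hom R (res_module R X p) (E q)" by (rule mod_hom_compose[OF F c(1) res_module_module[OF R]])
  moreover have "?c (res_diff R X p z) = compose (carrier (res_module R X (Suc p))) x (res_map R X X' f (Suc p)) z"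
    if z: "z \<in> carrier (res_module R X (Suc p))" for z
    using z c(2) res_map_diff[OF X f z] mod_hom_closed[OF F z] mod_hom_closed[OF res_diff_hom[OF X(1)] z]
    by (simp add: compose_eq) (metis)
  moreover have "compose (carrier (res_module R X p)) (d q) ?c =
      compose (carrier (res_module R X p)) (compose (carrier (res_module R X' p)) (d q) c) (res_map R X X' f p)"
    using mod_hom_closed[OF F] by (auto simp: compose_def intro!: restrict_ext)
  ultimately show ?case using Suc.IH[OF c(3)] by (auto intro!: bexI[of _ ?c])
qed

lemma balance_natural:
  assumes X: "Module.module R X" "Module.module R X'" and f: "restrict f (carrier X) \<in> mod_hom R X X'"
    and ag: "(a, g) \<in> balance X' i"
  shows "(compose (carrier (res_module R X i)) a (res_map R X X' f i), compose (carrier X) g f) \<in> balance X i"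
proof -
  note F = res_map_hom[OF X f]
  have a: "a \<in> Zc R X' N i" and g: "g \<in> HZ X' {} i"
    and z: "zig R E d X' i 0 (compose (carrier (res_module R X' i)) \<epsilon> a) (compose (carrier (res_module R X' 0)) g (res_aug R X'))"
    using ag by (auto simp: balance_def[OF X(2)])
  have gh: "g \<in> mod_hom R X' (E i)" using g by (simp add: HZ_def)
  have fc: "\<And>x. x \<in> carrier X \<Longrightarrow> f x \<in> carrier X'" using mod_hom_closed[OF f] by simp
  have "compose (carrier X) g (restrict f (carrier X)) \<in> mod_hom R X (E i)" by (rule mod_hom_compose[OF f gh X(1)])
  moreover have "compose (carrier X) g (restrict f (carrier X)) = compose (carrier X) g f"
    by (auto simp: compose_def)
  ultimately have "compose (carrier X) g f \<in> HZ X {} i"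
    using g fc by (auto simp: HZ_def compose_eq)
  moreover have "compose (carrier (res_module R X i)) (compose (carrier (res_module R X' i)) \<epsilon> a) (res_map R X X' f i) =
      compose (carrier (res_module R X i)) \<epsilon> (compose (carrier (res_module R X i)) a (res_map R X X' f i))"
    using mod_hom_closed[OF F] by (auto simp: compose_def intro!: restrict_ext)
  moreover have "compose (carrier (res_module R X 0)) (compose (carrier (res_module R X' 0)) g (res_aug R X')) (res_map R X X' f 0) =
      compose (carrier (res_module R X 0)) (compose (carrier X) g f) (res_aug R X)"
    using mod_hom_closed[OF F] mod_hom_closed[OF res_aug_hom[OF X(1)]] res_map_aug[OF X f]
    by (auto simp: compose_def intro!: restrict_ext)
  ultimately show ?thesis
    using zig_natural[OF X f z] Zc_precompose[OF X f N a] by (auto simp: balance_def[OF X(1)])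
qed

end

section \<open>Direct limits and generalized local cohomology\<close>

lemma mod_hom_inverse:
  assumes A: "Module.module R A" and f: "f \<in> mod_hom R A B" and inj: "inj_on f (carrier A)"
    and surj: "f ` carrier A = carrier B"
  shows "\<exists>h\<in>mod_hom R B A. inj_on h (carrier B) \<and> h ` carrier B = carrier A \<and> (\<forall>x\<in>carrier A. h (f x) = x)"
proof -
  interpret A: Module.module R A by fact
  define h where "h = (\<lambda>y\<in>carrier B. inv_into (carrier A) f y)"
  have hf: "h (f x) = x" if "x \<in> carrier A" for x
    using that inv_into_f_f[OF inj that] mod_hom_closed[OF f that] by (simp add: h_def)
  have fh: "h y \<in> carrier A" "f (h y) = y" if "y \<in> carrier B" for y
    using that f_inv_into_f[of y f "carrier A"] inv_into_into[of y f "carrier A"] surj by (auto simp: h_def)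
  have "h \<in> mod_hom R B A"
  proof (rule mod_homI)
    show "h (x \<oplus>\<^bsub>B\<^esub> y) = h x \<oplus>\<^bsub>A\<^esub> h y" if "x \<in> carrier B" "y \<in> carrier B" for x y
    proof -
      have "f (h x \<oplus>\<^bsub>A\<^esub> h y) = x \<oplus>\<^bsub>B\<^esub> y" using that fh mod_hom_add[OF f] by simp
      then show ?thesis using hf[of "h x \<oplus>\<^bsub>A\<^esub> h y"] that fh by simp
    qed
    show "h (a \<odot>\<^bsub>B\<^esub> x) = a \<odot>\<^bsub>A\<^esub> h x" if "a \<in> carrier R" "x \<in> carrier B" for a x
    proof -
      have "f (a \<odot>\<^bsub>A\<^esub> h x) = a \<odot>\<^bsub>B\<^esub> x" using that fh mod_hom_smult[OF f] by simp
      then show ?thesis using hf[of "a \<odot>\<^bsub>A\<^esub> h x"] that fh by simp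
    qed
  qed (use fh in \<open>auto simp: h_def\<close>)
  moreover have "inj_on h (carrier B)" by (rule inj_onI) (metis fh(2))
  moreover have "h ` carrier B = carrier A" using hf fh(1) mod_hom_closed[OF f] by force
  ultimately show ?thesis using hf by blast
qed

text \<open>
  A compatible family of maps \<open>\<zeta> n\<close> out of a direct system identifies its limit with \<open>K\<close>, once the
  family is jointly surjective and every element of the kernel of \<open>\<zeta> n\<close> dies at a later stage: the
  elements of the limit are then the fibres of \<open>\<zeta>\<close>.
\<close>

lemma dir_lim_iso:
  fixes G :: "nat \<Rightarrow> ('a, 'b) module"
  assumes K: "Module.module R K" and G: "\<And>n. Module.module R (G n)"
    and \<phi>: "\<And>n. restrict (\<phi> n) (carrier (G n)) \<in> mod_hom R (G n) (G (Suc n))"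
    and \<zeta>: "\<And>n. restrict (\<zeta> n) (carrier (G n)) \<in> mod_hom R (G n) K"
    and compat: "\<And>n x. x \<in> carrier (G n) \<Longrightarrow> \<zeta> (Suc n) (\<phi> n x) = \<zeta> n x"
    and surj: "\<And>k. k \<in> carrier K \<Longrightarrow> \<exists>n. \<exists>x\<in>carrier (G n). \<zeta> n x = k"
    and ker: "\<And>n x. x \<in> carrier (G n) \<Longrightarrow> \<zeta> n x = \<zero>\<^bsub>K\<^esub> \<Longrightarrow> \<exists>j. dl_trans \<phi> n j x = \<zero>\<^bsub>G (n + j)\<^esub>"
  shows "Module.module R (dir_lim G \<phi>) \<and> (\<exists>\<Theta>\<in>mod_hom R (dir_lim G \<phi>) K.
    inj_on \<Theta> (carrier (dir_lim G \<phi>)) \<and> \<Theta> ` carrier (dir_lim G \<phi>) = carrier K)"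
proof -
  interpret K: Module.module R K by (rule K)
  have \<phi>c: "\<phi> n x \<in> carrier (G (Suc n))" if "x \<in> carrier (G n)" for n x
    using mod_hom_closed[OF \<phi> that] that by simp
  have \<phi>d: "\<phi> n (mdiff R (G n) x y) = mdiff R (G (Suc n)) (\<phi> n x) (\<phi> n y)" if "x \<in> carrier (G n)" "y \<in> carrier (G n)" for n x y
    using mod_hom_mdiff[OF \<phi> G that] mdiff_closed[OF G that] that by simp
  have \<zeta>c: "\<zeta> n x \<in> carrier K" if "x \<in> carrier (G n)" for n x
    using mod_hom_closed[OF \<zeta> that] that by simp
  have \<zeta>d: "\<zeta> n (mdiff R (G n) x y) = mdiff R K (\<zeta> n x) (\<zeta> n y)" if "x \<in> carrier (G n)" "y \<in> carrier (G n)" for n x y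
    using mod_hom_mdiff[OF \<zeta> G that] mdiff_closed[OF G that] that by simp
  have Gadd: "x \<oplus>\<^bsub>G n\<^esub> y \<in> carrier (G n)" and \<zeta>a: "\<zeta> n (x \<oplus>\<^bsub>G n\<^esub> y) = \<zeta> n x \<oplus>\<^bsub>K\<^esub> \<zeta> n y"
    if "x \<in> carrier (G n)" "y \<in> carrier (G n)" for n x y
  proof -
    interpret Gn: Module.module R "G n" by (rule G)
    show "x \<oplus>\<^bsub>G n\<^esub> y \<in> carrier (G n)" using that by simp
    then show "\<zeta> n (x \<oplus>\<^bsub>G n\<^esub> y) = \<zeta> n x \<oplus>\<^bsub>K\<^esub> \<zeta> n y" using mod_hom_add[OF \<zeta> that] that by simp
  qed
  have Gsm: "a \<odot>\<^bsub>G n\<^esub> x \<in> carrier (G n)" and \<zeta>s: "\<zeta> n (a \<odot>\<^bsub>G n\<^esub> x) = a \<odot>\<^bsub>K\<^esub> \<zeta> n x"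
    if "a \<in> carrier R" "x \<in> carrier (G n)" for n x a
  proof -
    interpret Gn: Module.module R "G n" by (rule G)
    show "a \<odot>\<^bsub>G n\<^esub> x \<in> carrier (G n)" using that by simp
    then show "\<zeta> n (a \<odot>\<^bsub>G n\<^esub> x) = a \<odot>\<^bsub>K\<^esub> \<zeta> n x" using mod_hom_smult[OF \<zeta> that] that by simp
  qed
  have Gz: "\<zero>\<^bsub>G n\<^esub> \<in> carrier (G n)" for n using submodule_zero[OF submodule_self[OF G]] .
  have \<zeta>z: "\<zeta> n \<zero>\<^bsub>G n\<^esub> = \<zero>\<^bsub>K\<^esub>" for n using mod_hom_zero[OF \<zeta> G K] Gz by simp
  have tc: "dl_trans \<phi> n j x \<in> carrier (G (n + j))" if "x \<in> carrier (G n)" for n j x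
    using that by (induction j) (auto intro: \<phi>c)
  have t\<zeta>: "\<zeta> (n + j) (dl_trans \<phi> n j x) = \<zeta> n x" if "x \<in> carrier (G n)" for n j x
    using that by (induction j) (auto simp: compat tc)
  have td: "dl_trans \<phi> n j (mdiff R (G n) x y) = mdiff R (G (n + j)) (dl_trans \<phi> n j x) (dl_trans \<phi> n j y)"
    if "x \<in> carrier (G n)" "y \<in> carrier (G n)" for n j x y
    using that by (induction j) (auto simp: \<phi>d tc)
  have tt: "dl_trans \<phi> (n + i) j (dl_trans \<phi> n i x) = dl_trans \<phi> n (i + j) x" for n i j x
    by (induction j) (auto simp: add.assoc)
  have rel: "((n, x), (m, y)) \<in> dl_rel G \<phi> \<longleftrightarrow> x \<in> carrier (G n) \<and> y \<in> carrier (G m) \<and> \<zeta> n x = \<zeta> m y" for n x m y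
  proof
    assume "((n, x), (m, y)) \<in> dl_rel G \<phi>"
    then obtain i j where *: "x \<in> carrier (G n)" "y \<in> carrier (G m)" "n + i = m + j"
      "dl_trans \<phi> n i x = dl_trans \<phi> m j y" by (auto simp: dl_rel_def)
    then show "x \<in> carrier (G n) \<and> y \<in> carrier (G m) \<and> \<zeta> n x = \<zeta> m y" using t\<zeta>[of x n i] t\<zeta>[of y m j] by simp
  next
    assume *: "x \<in> carrier (G n) \<and> y \<in> carrier (G m) \<and> \<zeta> n x = \<zeta> m y"
    let ?u = "dl_trans \<phi> n m x" and ?v = "dl_trans \<phi> m n y"
    have u: "?u \<in> carrier (G (n + m))" "?v \<in> carrier (G (n + m))"
      using tc[of x n m] tc[of y m n] * by (simp_all add: add.commute)
    have "\<zeta> (n + m) (mdiff R (G (n + m)) ?u ?v) = \<zero>\<^bsub>K\<^esub>"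
      using \<zeta>d[OF u] t\<zeta>[of x n m] t\<zeta>[of y m n] * mdiff_self[OF K \<zeta>c] by (simp add: add.commute)
    then obtain j where "dl_trans \<phi> (n + m) j (mdiff R (G (n + m)) ?u ?v) = \<zero>\<^bsub>G (n + m + j)\<^esub>"
      using ker mdiff_closed[OF G u] by blast
    then have "dl_trans \<phi> (n + m) j ?u = dl_trans \<phi> (n + m) j ?v"
      using td[OF u] mdiff_eq_zero[OF G tc[OF u(1)] tc[OF u(2)]] by simp
    then have "dl_trans \<phi> n (m + j) x = dl_trans \<phi> m (n + j) y"
      using tt[of n m j x] tt[of m n j y] by (simp add: add.commute)
    moreover have "n + (m + j) = m + (n + j)" by simp
    ultimately have "\<exists>i j. n + i = m + j \<and> dl_trans \<phi> n i x = dl_trans \<phi> m j y" by blast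
    then show "((n, x), (m, y)) \<in> dl_rel G \<phi>" using * by (simp add: dl_rel_def)
  qed
  define fib where "fib k = {(m, y). y \<in> carrier (G m) \<and> \<zeta> m y = k}" for k
  have cls: "dl_rel G \<phi> `` {(n, x)} = fib (\<zeta> n x)" if "x \<in> carrier (G n)" for n x
    using that rel[of n x] by (auto simp: fib_def)
  have fib_eq: "fib k = fib l \<longleftrightarrow> k = l" if "k \<in> carrier K" "l \<in> carrier K" for k l
    using surj[OF that(1)] by (auto simp: fib_def)
  have carr: "carrier (dir_lim G \<phi>) = fib ` carrier K"
  proof
    show "carrier (dir_lim G \<phi>) \<subseteq> fib ` carrier K"
      using cls \<zeta>c by (auto simp: dir_lim_def quotient_def)
    show "fib ` carrier K \<subseteq> carrier (dir_lim G \<phi>)"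
    proof (rule image_subsetI)
      fix k assume "k \<in> carrier K"
      then obtain n x where nx: "x \<in> carrier (G n)" "\<zeta> n x = k" using surj by blast
      then have "fib k = dl_rel G \<phi> `` {(n, x)}" using cls by simp
      then show "fib k \<in> carrier (dir_lim G \<phi>)" using nx(1) by (auto simp: dir_lim_def quotient_def)
    qed
  qed
  have zero: "\<zero>\<^bsub>dir_lim G \<phi>\<^esub> = fib \<zero>\<^bsub>K\<^esub>" using cls[OF Gz] \<zeta>z by (simp add: dir_lim_def)
  have add: "fib k \<oplus>\<^bsub>dir_lim G \<phi>\<^esub> fib l = fib (k \<oplus>\<^bsub>K\<^esub> l)" if k: "k \<in> carrier K" and l: "l \<in> carrier K" for k l
  proof -
    have 1: "dl_rel G \<phi> `` {(n, x \<oplus>\<^bsub>G n\<^esub> y)} = fib (k \<oplus>\<^bsub>K\<^esub> l)" if "(n, x) \<in> fib k" "(n, y) \<in> fib l" for n x y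
      using that cls[OF Gadd] \<zeta>a by (auto simp: fib_def)
    obtain n x m y where *: "x \<in> carrier (G n)" "\<zeta> n x = k" "y \<in> carrier (G m)" "\<zeta> m y = l"
      using surj k l by metis
    have 2: "(n + m, dl_trans \<phi> n m x) \<in> fib k" "(n + m, dl_trans \<phi> m n y) \<in> fib l"
      using tc[OF *(1), of m] t\<zeta>[OF *(1), of m] tc[OF *(3), of n] t\<zeta>[OF *(3), of n] * by (auto simp: fib_def add.commute)
    have "{dl_rel G \<phi> `` {(n, x \<oplus>\<^bsub>G n\<^esub> y)} | n x y. (n, x) \<in> fib k \<and> (n, y) \<in> fib l} = {fib (k \<oplus>\<^bsub>K\<^esub> l)}"
    proof
      show "{dl_rel G \<phi> `` {(n, x \<oplus>\<^bsub>G n\<^esub> y)} | n x y. (n, x) \<in> fib k \<and> (n, y) \<in> fib l} \<subseteq> {fib (k \<oplus>\<^bsub>K\<^esub> l)}"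
        using 1 by blast
      show "{fib (k \<oplus>\<^bsub>K\<^esub> l)} \<subseteq> {dl_rel G \<phi> `` {(n, x \<oplus>\<^bsub>G n\<^esub> y)} | n x y. (n, x) \<in> fib k \<and> (n, y) \<in> fib l}"
        using 1[OF 2, symmetric] 2 by blast
    qed
    then show ?thesis by (simp add: dir_lim_def)
  qed
  have smult: "a \<odot>\<^bsub>dir_lim G \<phi>\<^esub> fib k = fib (a \<odot>\<^bsub>K\<^esub> k)" if a: "a \<in> carrier R" and k: "k \<in> carrier K" for a k
  proof -
    have 1: "dl_rel G \<phi> `` {(n, a \<odot>\<^bsub>G n\<^esub> x)} = fib (a \<odot>\<^bsub>K\<^esub> k)" if "(n, x) \<in> fib k" for n x
      using that cls[OF Gsm[OF a]] \<zeta>s[OF a] by (auto simp: fib_def)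
    obtain n x where nx: "(n, x) \<in> fib k" using surj[OF k] by (auto simp: fib_def)
    have "(\<Union>p\<in>fib k. case p of (n, x) \<Rightarrow> dl_rel G \<phi> `` {(n, a \<odot>\<^bsub>G n\<^esub> x)}) = fib (a \<odot>\<^bsub>K\<^esub> k)"
      by (rule UN_constant_eq[OF nx]) (use 1 in auto)
    then show ?thesis by (simp add: dir_lim_def)
  qed
  define \<Theta> where "\<Theta> = (\<lambda>X\<in>carrier (dir_lim G \<phi>). inv_into (carrier K) fib X)"
  have \<Theta>: "\<Theta> (fib k) = k" if "k \<in> carrier K" for k
  proof -
    have "inj_on fib (carrier K)" using fib_eq by (auto intro: inj_onI)
    then show ?thesis using that carr by (simp add: \<Theta>_def)
  qed
  have hom: "\<Theta> \<in> mod_hom R (dir_lim G \<phi>) K"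
    by (rule mod_homI) (auto simp: carr add smult \<Theta>, auto simp: \<Theta>_def carr)
  moreover have inj: "inj_on \<Theta> (carrier (dir_lim G \<phi>))" by (auto simp: inj_on_def carr \<Theta>)
  moreover have "\<Theta> ` carrier (dir_lim G \<phi>) = carrier K" by (auto simp: carr \<Theta> image_iff)
  moreover have "Module.module R (dir_lim G \<phi>)"
    by (rule module_transport[OF K inj]) (auto simp: carr add smult zero \<Theta>)
  ultimately show ?thesis by blast
qed

subsection \<open>Classes of cocycles\<close>

definition ext_class :: "('a, 'r) ring_scheme \<Rightarrow> nat \<Rightarrow> ('a, 'x) module \<Rightarrow> ('a, 'y) module \<Rightarrow>
    ((('a, 'x) syz \<Rightarrow> 'a) \<Rightarrow> 'y) \<Rightarrow> ((('a, 'x) syz \<Rightarrow> 'a) \<Rightarrow> 'y) set" where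
  "ext_class R p X Y a = Bc R X Y p +>\<^bsub>hom_module R (res_module R X p) Y\<^esub> a"

context
  fixes R :: "('a, 'r) ring_scheme" and X :: "('a, 'x) module" and Y :: "('a, 'y) module" and p :: nat
  assumes X: "Module.module R X" and Y: "Module.module R Y"
begin

private lemmas em = submodule_module[OF Zc_submodule[OF X Y] mHom[OF X Y], of p]
  and es = submodule_restrict[OF Bc_submodule[OF X Y] Zc_submodule[OF X Y] Bc_subset_Zc[OF X Y] mHom[OF X Y], of p]

lemma Ext_carrier: "carrier (Ext R p X Y) = ext_class R p X Y ` Zc R X Y p"
  unfolding Ext_quot[OF X Y] quot_carrier[OF em es] by (simp add: ext_class_def)

lemma Ext_add:
  "a \<in> Zc R X Y p \<Longrightarrow> b \<in> Zc R X Y p \<Longrightarrow> ext_class R p X Y a \<oplus>\<^bsub>Ext R p X Y\<^esub> ext_class R p X Y b =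
    ext_class R p X Y (a \<oplus>\<^bsub>hom_module R (res_module R X p) Y\<^esub> b)"
  unfolding Ext_quot[OF X Y] ext_class_def using quot_add[OF em es, of a b] by simp

lemma Ext_smult:
  "r \<in> carrier R \<Longrightarrow> a \<in> Zc R X Y p \<Longrightarrow> r \<odot>\<^bsub>Ext R p X Y\<^esub> ext_class R p X Y a =
    ext_class R p X Y (r \<odot>\<^bsub>hom_module R (res_module R X p) Y\<^esub> a)"
  unfolding Ext_quot[OF X Y] ext_class_def using quot_smult[OF em es, of r a] by simp

lemma ext_class_eq_iff:
  assumes "a \<in> Zc R X Y p" "b \<in> Zc R X Y p"
  shows "ext_class R p X Y a = ext_class R p X Y b \<longleftrightarrow>
    mdiff R (hom_module R (res_module R X p) Y) a b \<in> Bc R X Y p"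
  unfolding ext_class_def using assms submodule_mem[OF Zc_submodule[OF X Y]]
  by (intro coset_eq_iff[OF mHom[OF X Y] Bc_submodule[OF X Y]]) blast+

lemma ext_class_zero_iff:
  assumes "a \<in> Zc R X Y p"
  shows "ext_class R p X Y a = \<zero>\<^bsub>Ext R p X Y\<^esub> \<longleftrightarrow> a \<in> Bc R X Y p"
  unfolding Ext_quot[OF X Y] quot_zero[OF em es] ext_class_def
  using assms submodule_mem[OF Zc_submodule[OF X Y]]
  by (intro coset_eq_zero_iff[OF mHom[OF X Y] Bc_submodule[OF X Y]]) blast

end

lemma Ext_map_hom:
  assumes X: "Module.module R X" "Module.module R X'" and f: "restrict f (carrier X) \<in> mod_hom R X X'"
    and Y: "Module.module R Y"
  shows "restrict (Ext_map R i X X' Y f) (carrier (Ext R i X' Y)) \<in> mod_hom R (Ext R i X' Y) (Ext R i X Y)"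
    (is "restrict ?\<phi> ?C \<in> _")
proof (rule mod_homI)
  let ?pull = "\<lambda>a. compose (carrier (res_module R X i)) a (res_map R X X' f i)"
  interpret E: Module.module R "Ext R i X' Y" by (rule Ext_module[OF X(2) Y])
  note F = mod_hom_closed[OF res_map_hom[OF X f]]
  have \<phi>: "?\<phi> (ext_class R i X' Y a) = ext_class R i X Y (?pull a)" if "a \<in> Zc R X' Y i" for a
    unfolding ext_class_def by (rule Ext_map_coset[OF X f Y that])
  have pZ: "?pull a \<in> Zc R X Y i" if "a \<in> Zc R X' Y i" for a by (rule Zc_precompose[OF X f Y that])
  note Za = submodule_add[OF Zc_submodule[OF X(2) Y]] and Zs = submodule_smult[OF Zc_submodule[OF X(2) Y]]
  show "restrict ?\<phi> ?C x \<in> carrier (Ext R i X Y)" if "x \<in> ?C" for x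
    using that \<phi> pZ by (auto simp: Ext_carrier[OF X(1) Y] Ext_carrier[OF X(2) Y])
  show "restrict ?\<phi> ?C (x \<oplus>\<^bsub>Ext R i X' Y\<^esub> y) = restrict ?\<phi> ?C x \<oplus>\<^bsub>Ext R i X Y\<^esub> restrict ?\<phi> ?C y"
    if xy: "x \<in> ?C" "y \<in> ?C" for x y
  proof -
    obtain a b where ab: "a \<in> Zc R X' Y i" "b \<in> Zc R X' Y i" "x = ext_class R i X' Y a" "y = ext_class R i X' Y b"
      using xy Ext_carrier[OF X(2) Y] by auto
    have "?pull (a \<oplus>\<^bsub>hom_module R (res_module R X' i) Y\<^esub> b) = ?pull a \<oplus>\<^bsub>hom_module R (res_module R X i) Y\<^esub> ?pull b"
      using F by (auto simp: compose_def intro!: restrict_ext)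
    then have "?\<phi> (x \<oplus>\<^bsub>Ext R i X' Y\<^esub> y) = ?\<phi> x \<oplus>\<^bsub>Ext R i X Y\<^esub> ?\<phi> y"
      unfolding ab(3,4) Ext_add[OF X(2) Y ab(1,2)] \<phi>[OF Za[OF ab(1,2)]] \<phi>[OF ab(1)] \<phi>[OF ab(2)]
        Ext_add[OF X(1) Y pZ[OF ab(1)] pZ[OF ab(2)]] by (rule arg_cong)
    then show ?thesis using xy E.add.m_closed[OF xy] by simp
  qed
  show "restrict ?\<phi> ?C (r \<odot>\<^bsub>Ext R i X' Y\<^esub> x) = r \<odot>\<^bsub>Ext R i X Y\<^esub> restrict ?\<phi> ?C x"
    if xy: "r \<in> carrier R" "x \<in> ?C" for r x
  proof -
    obtain a where ab: "a \<in> Zc R X' Y i" "x = ext_class R i X' Y a" using xy Ext_carrier[OF X(2) Y] by auto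
    have "?pull (r \<odot>\<^bsub>hom_module R (res_module R X' i) Y\<^esub> a) = r \<odot>\<^bsub>hom_module R (res_module R X i) Y\<^esub> ?pull a"
      using F by (auto simp: compose_def intro!: restrict_ext)
    then have "?\<phi> (r \<odot>\<^bsub>Ext R i X' Y\<^esub> x) = r \<odot>\<^bsub>Ext R i X Y\<^esub> ?\<phi> x"
      unfolding ab(2) Ext_smult[OF X(2) Y xy(1) ab(1)] \<phi>[OF Zs[OF xy(1) ab(1)]] \<phi>[OF ab(1)]
        Ext_smult[OF X(1) Y xy(1) pZ[OF ab(1)]] by (rule arg_cong)
    then show ?thesis using xy E.smult_closed[OF xy] by simp
  qed
qed simp

text \<open>A map on classes given by a map \<open>v\<close> on cocycles, which need not be given by a formula.\<close>

lemma Ext_hom_of_cocycles: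
  assumes X: "Module.module R X" and Y: "Module.module R Y"
    and cl: "\<And>a. a \<in> Zc R X Y i \<Longrightarrow> \<zeta> (ext_class R i X Y a) = v a" "\<And>a. a \<in> Zc R X Y i \<Longrightarrow> v a \<in> carrier K"
    and add: "\<And>a b. a \<in> Zc R X Y i \<Longrightarrow> b \<in> Zc R X Y i \<Longrightarrow>
      v (a \<oplus>\<^bsub>hom_module R (res_module R X i) Y\<^esub> b) = v a \<oplus>\<^bsub>K\<^esub> v b"
    and smult: "\<And>r a. r \<in> carrier R \<Longrightarrow> a \<in> Zc R X Y i \<Longrightarrow> v (r \<odot>\<^bsub>hom_module R (res_module R X i) Y\<^esub> a) = r \<odot>\<^bsub>K\<^esub> v a"
  shows "restrict \<zeta> (carrier (Ext R i X Y)) \<in> mod_hom R (Ext R i X Y) K"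
proof (rule mod_homI)
  interpret E: Module.module R "Ext R i X Y" by (rule Ext_module[OF X Y])
  note Za = submodule_add[OF Zc_submodule[OF X Y]] and Zs = submodule_smult[OF Zc_submodule[OF X Y]]
  let ?C = "carrier (Ext R i X Y)"
  show "restrict \<zeta> ?C x \<in> carrier K" if "x \<in> ?C" for x
    using that cl by (auto simp: Ext_carrier[OF X Y])
  show "restrict \<zeta> ?C (x \<oplus>\<^bsub>Ext R i X Y\<^esub> y) = restrict \<zeta> ?C x \<oplus>\<^bsub>K\<^esub> restrict \<zeta> ?C y" if xy: "x \<in> ?C" "y \<in> ?C" for x y
  proof -
    obtain a b where ab: "a \<in> Zc R X Y i" "b \<in> Zc R X Y i" "x = ext_class R i X Y a" "y = ext_class R i X Y b"
      using xy Ext_carrier[OF X Y] by auto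
    have "\<zeta> (x \<oplus>\<^bsub>Ext R i X Y\<^esub> y) = \<zeta> x \<oplus>\<^bsub>K\<^esub> \<zeta> y"
      unfolding ab(3,4) Ext_add[OF X Y ab(1,2)] cl(1)[OF Za[OF ab(1,2)]] cl(1)[OF ab(1)] cl(1)[OF ab(2)]
      by (rule add[OF ab(1,2)])
    then show ?thesis using xy E.add.m_closed[OF xy] by simp
  qed
  show "restrict \<zeta> ?C (r \<odot>\<^bsub>Ext R i X Y\<^esub> x) = r \<odot>\<^bsub>K\<^esub> restrict \<zeta> ?C x" if xy: "r \<in> carrier R" "x \<in> ?C" for r x
  proof -
    obtain a where ab: "a \<in> Zc R X Y i" "x = ext_class R i X Y a" using xy Ext_carrier[OF X Y] by auto
    have "\<zeta> (r \<odot>\<^bsub>Ext R i X Y\<^esub> x) = r \<odot>\<^bsub>K\<^esub> \<zeta> x"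
      unfolding ab(2) Ext_smult[OF X Y xy(1) ab(1)] cl(1)[OF Zs[OF xy(1) ab(1)]] cl(1)[OF ab(1)]
      by (rule smult[OF xy(1) ab(1)])
    then show ?thesis using xy E.smult_closed[OF xy] by simp
  qed
qed simp

subsection \<open>Adic quotients\<close>

lemma mod_span_submodule:
  assumes "Module.module R M" "S \<subseteq> carrier M"
  shows "submodule (mod_span R M S) R M"
proof (rule submodule_intro[OF assms(1)])
  show "mod_span R M S \<subseteq> carrier M" unfolding mod_span_def using submodule_self[OF assms(1)] assms(2) by blast
qed (auto simp: mod_span_def submodule_zero submodule_add submodule_smult)

lemma mod_span_mem: "x \<in> S \<Longrightarrow> x \<in> mod_span R M S"
  by (auto simp: mod_span_def)

lemma mod_span_least: "submodule V R M \<Longrightarrow> S \<subseteq> V \<Longrightarrow> mod_span R M S \<subseteq> V"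
  by (auto simp: mod_span_def)

context
  fixes R :: "('a, 'r) ring_scheme" and I :: "'a set"
  assumes R: "cring R" and I: "ideal I R"
begin

interpretation R: cring R by (rule R)

lemma ideal_pow_ideal: "ideal (ideal_pow R I n) R"
  by (induction n) (auto intro: R.oneideal R.ideal_prod_is_ideal I)

lemma ideal_pow_subset: "ideal_pow R I n \<subseteq> carrier R"
  using ideal.Icarr[OF ideal_pow_ideal] by blast

lemma ideal_pow_Suc_subset: "ideal_pow R I (Suc n) \<subseteq> ideal_pow R I n"
  using R.ideal_prod_inter[OF ideal_pow_ideal I, of n] by simp

lemma ideal_pow_antimono: "m \<le> n \<Longrightarrow> ideal_pow R I n \<subseteq> ideal_pow R I m"
  by (rule lift_Suc_antimono_le[of "ideal_pow R I"]) (rule ideal_pow_Suc_subset)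

context
  fixes M :: "('a, 'm) module"
  assumes M: "Module.module R M"
begin

interpretation M: Module.module R M by (rule M)

private abbreviation "UM n \<equiv> ideal_smult R (ideal_pow R I n) M"

lemma adic_gens: "{a \<odot>\<^bsub>M\<^esub> x | a x. a \<in> ideal_pow R I n \<and> x \<in> carrier M} \<subseteq> carrier M"
  using ideal_pow_subset by auto

lemma adic_submodule: "submodule (UM n) R M"
  unfolding ideal_smult_def by (rule mod_span_submodule[OF M adic_gens])

lemma adic_antimono:
  assumes "m \<le> n"
  shows "UM n \<subseteq> UM m"
  unfolding ideal_smult_def
proof (rule mod_span_least[OF mod_span_submodule[OF M adic_gens]], rule subsetI, rule mod_span_mem)
  show "x \<in> {a \<odot>\<^bsub>M\<^esub> x | a x. a \<in> ideal_pow R I m \<and> x \<in> carrier M}"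
    if "x \<in> {a \<odot>\<^bsub>M\<^esub> x | a x. a \<in> ideal_pow R I n \<and> x \<in> carrier M}" for x
    using that ideal_pow_antimono[OF assms] by blast
qed

lemma adic_vanish_iff:
  assumes "Module.module R Y" "f \<in> mod_hom R M Y"
  shows "(\<forall>x\<in>UM n. f x = \<zero>\<^bsub>Y\<^esub>) \<longleftrightarrow> (\<forall>a\<in>ideal_pow R I n. \<forall>x\<in>carrier M. f (a \<odot>\<^bsub>M\<^esub> x) = \<zero>\<^bsub>Y\<^esub>)"
proof
  assume *: "\<forall>x\<in>UM n. f x = \<zero>\<^bsub>Y\<^esub>"
  have "a \<odot>\<^bsub>M\<^esub> x \<in> UM n" if "a \<in> ideal_pow R I n" "x \<in> carrier M" for a x
    unfolding ideal_smult_def by (rule mod_span_mem) (use that in blast)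
  then show "\<forall>a\<in>ideal_pow R I n. \<forall>x\<in>carrier M. f (a \<odot>\<^bsub>M\<^esub> x) = \<zero>\<^bsub>Y\<^esub>" using * by blast
next
  assume *: "\<forall>a\<in>ideal_pow R I n. \<forall>x\<in>carrier M. f (a \<odot>\<^bsub>M\<^esub> x) = \<zero>\<^bsub>Y\<^esub>"
  have "UM n \<subseteq> {x \<in> carrier M. f x = \<zero>\<^bsub>Y\<^esub>}"
    unfolding ideal_smult_def
  proof (rule mod_span_least[OF mod_hom_kernel_submodule[OF assms(2) M assms(1) submodule_self[OF M]]])
    show "{a \<odot>\<^bsub>M\<^esub> x | a x. a \<in> ideal_pow R I n \<and> x \<in> carrier M} \<subseteq> {x \<in> carrier M. f x = \<zero>\<^bsub>Y\<^esub>}"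
      using * adic_gens[of n] by blast
  qed
  then show "\<forall>x\<in>UM n. f x = \<zero>\<^bsub>Y\<^esub>" by blast
qed

lemma adic_module: "Module.module R (adic_quot R I M n)"
  unfolding adic_quot_def by (rule quot_module[OF M adic_submodule])

definition "acoset n x = UM n +>\<^bsub>M\<^esub> x"

lemma acoset_hom: "restrict (acoset n) (carrier M) \<in> mod_hom R M (adic_quot R I M n)"
  unfolding adic_quot_def acoset_def by (rule quot_proj_hom[OF M adic_submodule])

lemma acoset_closed: "x \<in> carrier M \<Longrightarrow> acoset n x \<in> carrier (adic_quot R I M n)"
  using mod_hom_closed[OF acoset_hom] by simp

lemma acoset_surj: "X \<in> carrier (adic_quot R I M n) \<Longrightarrow> \<exists>x\<in>carrier M. X = acoset n x"
  by (auto simp: adic_quot_def quot_carrier[OF M adic_submodule] acoset_def)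

lemma acoset_zero_iff: "x \<in> carrier M \<Longrightarrow> acoset n x = \<zero>\<^bsub>adic_quot R I M n\<^esub> \<longleftrightarrow> x \<in> UM n"
  unfolding acoset_def adic_quot_def quot_zero[OF M adic_submodule] by (rule coset_eq_zero_iff[OF M adic_submodule])

lemma adic_proj_acoset: "x \<in> carrier M \<Longrightarrow> adic_proj R I M n (acoset (Suc n) x) = acoset n x"
  unfolding adic_proj_def acoset_def
  using coset_map_coset[OF M M adic_submodule[of "Suc n"] adic_submodule[of n], of x id] adic_antimono[of n "Suc n"]
  by (simp add: subset_iff)

lemma adic_proj_hom:
  "restrict (adic_proj R I M n) (carrier (adic_quot R I M (Suc n))) \<in> mod_hom R (adic_quot R I M (Suc n)) (adic_quot R I M n)"
proof (rule mod_homI)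
  interpret Q: Module.module R "adic_quot R I M (Suc n)" by (rule adic_module)
  have ah: "acoset m (x \<oplus>\<^bsub>M\<^esub> y) = acoset m x \<oplus>\<^bsub>adic_quot R I M m\<^esub> acoset m y"
    "a \<in> carrier R \<Longrightarrow> acoset m (a \<odot>\<^bsub>M\<^esub> x) = a \<odot>\<^bsub>adic_quot R I M m\<^esub> acoset m x"
    if "x \<in> carrier M" "y \<in> carrier M" for m x y a
    using mod_hom_add[OF acoset_hom that] mod_hom_smult[OF acoset_hom _ that(1)] that by simp_all
  show "restrict (adic_proj R I M n) (carrier (adic_quot R I M (Suc n))) x \<in> carrier (adic_quot R I M n)"
    if "x \<in> carrier (adic_quot R I M (Suc n))" for x
    using acoset_surj[OF that] adic_proj_acoset acoset_closed that by auto
  show "restrict (adic_proj R I M n) (carrier (adic_quot R I M (Suc n))) (x \<oplus>\<^bsub>adic_quot R I M (Suc n)\<^esub> y) =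
      restrict (adic_proj R I M n) (carrier (adic_quot R I M (Suc n))) x \<oplus>\<^bsub>adic_quot R I M n\<^esub>
      restrict (adic_proj R I M n) (carrier (adic_quot R I M (Suc n))) y"
    if xy: "x \<in> carrier (adic_quot R I M (Suc n))" "y \<in> carrier (adic_quot R I M (Suc n))" for x y
  proof -
    obtain u v where "u \<in> carrier M" "v \<in> carrier M" "x = acoset (Suc n) u" "y = acoset (Suc n) v"
      using acoset_surj xy by metis
    then show ?thesis using xy ah(1)[of u v, symmetric] acoset_closed by (simp add: adic_proj_acoset)
  qed
  show "restrict (adic_proj R I M n) (carrier (adic_quot R I M (Suc n))) (a \<odot>\<^bsub>adic_quot R I M (Suc n)\<^esub> x) =
      a \<odot>\<^bsub>adic_quot R I M n\<^esub> restrict (adic_proj R I M n) (carrier (adic_quot R I M (Suc n))) x"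
    if x: "a \<in> carrier R" "x \<in> carrier (adic_quot R I M (Suc n))" for a x
  proof -
    obtain u where "u \<in> carrier M" "x = acoset (Suc n) u" using acoset_surj x by metis
    then show ?thesis using x ah(2)[of u u a, symmetric] acoset_closed by (simp add: adic_proj_acoset)
  qed
qed simp

lemma adic_factor:
  assumes Y: "Module.module R Y" and f: "f \<in> mod_hom R M Y" "\<forall>x\<in>UM n. f x = \<zero>\<^bsub>Y\<^esub>"
  shows "\<exists>g\<in>mod_hom R (adic_quot R I M n) Y. \<forall>x\<in>carrier M. g (acoset n x) = f x"
proof -
  have "\<exists>g\<in>mod_hom R (adic_quot R I M n) Y. \<forall>x\<in>carrier M. g (restrict (acoset n) (carrier M) x) = f x"
    by (rule hom_factor_surj[OF M adic_module Y acoset_hom f(1)])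
      (use f(2) acoset_zero_iff acoset_surj acoset_closed in \<open>auto simp: image_iff\<close>)
  then show ?thesis by simp
qed

lemma adic_compose:
  assumes "g \<in> mod_hom R (adic_quot R I M n) Y"
  shows "compose (carrier M) g (acoset n) \<in> mod_hom R M Y"
proof -
  have "compose (carrier M) g (acoset n) = compose (carrier M) g (restrict (acoset n) (carrier M))"
    by (auto simp: compose_def)
  then show ?thesis using mod_hom_compose[OF acoset_hom assms M] by simp
qed

end

subsection \<open>Local cohomology in degree zero\<close>

lemma adic_reg_eq: "ideal_smult R (ideal_pow R I n) (reg_module R) = ideal_pow R I n"
proof
  note reg = reg_module_module[OF R]
  show "ideal_smult R (ideal_pow R I n) (reg_module R) \<subseteq> ideal_pow R I n"
    unfolding ideal_smult_def
    by (rule mod_span_least) (use submodule_reg_iff[OF R] ideal_pow_ideal ideal.I_r_closed[OF ideal_pow_ideal] in auto)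
  show "ideal_pow R I n \<subseteq> ideal_smult R (ideal_pow R I n) (reg_module R)"
  proof
    fix a assume a: "a \<in> ideal_pow R I n"
    then have "a \<in> carrier R" using ideal_pow_subset[of n] by blast
    then have "a = a \<odot>\<^bsub>reg_module R\<^esub> \<one>\<^bsub>R\<^esub>" by simp
    then have "a \<in> {a \<odot>\<^bsub>reg_module R\<^esub> x | a x. a \<in> ideal_pow R I n \<and> x \<in> carrier (reg_module R)}" using a by force
    then show "a \<in> ideal_smult R (ideal_pow R I n) (reg_module R)"
      unfolding ideal_smult_def by (rule mod_span_mem)
  qed
qed

definition pow_torsion :: "('a, 'y) module \<Rightarrow> 'y set" where
  "pow_torsion Y = (\<Union>n. torsion R (ideal_pow R I n) Y)"

lemma pow_torsion_submodule:
  assumes "Module.module R Y"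
  shows "submodule (pow_torsion Y) R Y"
proof (rule submodule_intro[OF assms])
  note s = torsion_submodule[OF assms ideal_pow_subset]
  have mono: "torsion R (ideal_pow R I m) Y \<subseteq> torsion R (ideal_pow R I n) Y" if "m \<le> n" for m n
    using ideal_pow_antimono[OF that] by (auto simp: torsion_def)
  show "x \<oplus>\<^bsub>Y\<^esub> y \<in> pow_torsion Y" if xy: "x \<in> pow_torsion Y" "y \<in> pow_torsion Y" for x y
  proof -
    obtain m n where "x \<in> torsion R (ideal_pow R I m) Y" "y \<in> torsion R (ideal_pow R I n) Y"
      using xy by (auto simp: pow_torsion_def)
    then have "x \<in> torsion R (ideal_pow R I (max m n)) Y" "y \<in> torsion R (ideal_pow R I (max m n)) Y"
      using mono[of m "max m n"] mono[of n "max m n"] by auto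
    then show ?thesis using submodule_add[OF s] by (auto simp: pow_torsion_def)
  qed
  show "a \<odot>\<^bsub>Y\<^esub> x \<in> pow_torsion Y" if a: "a \<in> carrier R" and x: "x \<in> pow_torsion Y" for a x
    using x submodule_smult[OF s a] unfolding pow_torsion_def by blast
  show "\<zero>\<^bsub>Y\<^esub> \<in> pow_torsion Y" using submodule_zero[OF s] unfolding pow_torsion_def by blast
qed (auto simp: pow_torsion_def torsion_def)

text \<open>
  Evaluation at the generator identifies \<open>Ext 0 (R/J, Y)\<close> with the \<open>J\<close>-torsion of \<open>Y\<close> for each
  power \<open>J\<close> of \<open>I\<close>, and the transition maps become inclusions.
\<close>

lemma loc_coh_zero_iso:
  fixes Y :: "('a, 'y) module"
  assumes Y: "Module.module R Y"
  shows "\<exists>\<Theta>\<in>mod_hom R (loc_coh R I 0 Y) (Y\<lparr>carrier := pow_torsion Y\<rparr>).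
    inj_on \<Theta> (carrier (loc_coh R I 0 Y)) \<and> \<Theta> ` carrier (loc_coh R I 0 Y) = pow_torsion Y"
proof -
  note reg = reg_module_module[OF R]
  let ?J = "\<lambda>n. ideal_pow R I n"
  let ?A = "\<lambda>n. quot_module (reg_module R) (?J n)"
  have aq: "adic_quot R I (reg_module R) n = ?A n" for n by (simp add: adic_quot_def adic_reg_eq)
  have J: "submodule (?J n) R (reg_module R)" for n using submodule_reg_iff[OF R] ideal_pow_ideal by blast
  note cm = cyclic_module[OF R J]
  let ?H = "\<lambda>n. hom_module R (res_module R (?A n) 0) Y"
  let ?p = "adic_proj R I (reg_module R)"
  have ph: "restrict (?p n) (carrier (?A (Suc n))) \<in> mod_hom R (?A (Suc n)) (?A n)" for n
    using adic_proj_hom[OF reg, of n] by (simp add: aq)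
  let ?G = "\<lambda>n. Ext R 0 (?A n) Y"
  let ?\<phi> = "\<lambda>n. Ext_map R 0 (?A (Suc n)) (?A n) Y (?p n)"
  define g1 where "g1 n = gen1 R (?J n)" for n
  define \<zeta> where "\<zeta> n q = (SOME a. a \<in> Zc R (?A n) Y 0 \<and> ext_class R 0 (?A n) Y a = q) (g1 n)" for n q
  have ceq: "a = b" if ab: "a \<in> Zc R (?A n) Y 0" "b \<in> Zc R (?A n) Y 0"
    "ext_class R 0 (?A n) Y a = ext_class R 0 (?A n) Y b" for n a b
  proof -
    have c: "a \<in> carrier (?H n)" "b \<in> carrier (?H n)" using submodule_mem[OF Zc_submodule[OF cm Y]] ab by blast+
    have "mdiff R (?H n) a b \<in> Bc R (?A n) Y 0" using ext_class_eq_iff[OF cm Y ab(1,2)] ab(3) by simp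
    then have "mdiff R (?H n) a b = \<zero>\<^bsub>?H n\<^esub>" by (simp add: Bc_0[OF cm])
    then show ?thesis using mdiff_eq_zero[OF mHom[OF cm Y] c] by blast
  qed
  have \<zeta>_eq: "\<zeta> n (ext_class R 0 (?A n) Y a) = a (g1 n)" if "a \<in> Zc R (?A n) Y 0" for n a
  proof -
    have "(SOME b. b \<in> Zc R (?A n) Y 0 \<and> ext_class R 0 (?A n) Y b = ext_class R 0 (?A n) Y a) = a"
      by (rule some_equality) (use that ceq in auto)
    then show ?thesis by (simp add: \<zeta>_def)
  qed
  have g1c: "g1 n \<in> carrier (res_module R (?A n) 0)" for n unfolding g1_def by (rule gen1_closed[OF R J])
  have val: "a (g1 n) \<in> torsion R (?J n) Y" if "a \<in> Zc R (?A n) Y 0" for n a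
    unfolding g1_def by (rule cocycle_gen1_torsion[OF R J Y that])
  have \<phi>_eq: "?\<phi> n (ext_class R 0 (?A n) Y a) =
      ext_class R 0 (?A (Suc n)) Y (compose (carrier (res_module R (?A (Suc n)) 0)) a (res_map R (?A (Suc n)) (?A n) (?p n) 0))"
    if "a \<in> Zc R (?A n) Y 0" for n a
    unfolding ext_class_def by (rule Ext_map_coset[OF cm cm ph Y that])
  have \<phi>_Z: "compose (carrier (res_module R (?A (Suc n)) 0)) a (res_map R (?A (Suc n)) (?A n) (?p n) 0) \<in> Zc R (?A (Suc n)) Y 0"
    if "a \<in> Zc R (?A n) Y 0" for n a
    by (rule Zc_precompose[OF cm cm ph Y that])
  have p1: "?p n (?J (Suc n) +>\<^bsub>reg_module R\<^esub> \<one>\<^bsub>R\<^esub>) = ?J n +>\<^bsub>reg_module R\<^esub> \<one>\<^bsub>R\<^esub>" for n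
    using adic_proj_acoset[OF reg, of "\<one>\<^bsub>R\<^esub>" n] by (simp add: acoset_def[OF reg] adic_reg_eq del: ideal_pow.simps)
  have F1: "res_map R (?A (Suc n)) (?A n) (?p n) 0 (g1 (Suc n)) = g1 n" for n
  proof -
    have "Gen (?J (Suc n) +>\<^bsub>reg_module R\<^esub> \<one>\<^bsub>R\<^esub>) \<in> res_basis R (?A (Suc n)) 0"
      using cyclic_one[OF R J, of "Suc n"] by simp
    from res_map_unit[OF cm cm ph this] show ?thesis
      using p1 by (simp add: g1_def gen1_def[OF R J] del: ideal_pow.simps)
  qed
  have tK: "submodule (pow_torsion Y) R Y" by (rule pow_torsion_submodule[OF Y])
  have "Module.module R (dir_lim ?G ?\<phi>) \<and> (\<exists>\<Theta>\<in>mod_hom R (dir_lim ?G ?\<phi>) (Y\<lparr>carrier := pow_torsion Y\<rparr>).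
    inj_on \<Theta> (carrier (dir_lim ?G ?\<phi>)) \<and> \<Theta> ` carrier (dir_lim ?G ?\<phi>) = carrier (Y\<lparr>carrier := pow_torsion Y\<rparr>))"
  proof (rule dir_lim_iso[where \<zeta> = \<zeta>])
    show "Module.module R (Y\<lparr>carrier := pow_torsion Y\<rparr>)" by (rule submodule_module[OF tK Y])
    show "Module.module R (?G n)" for n by (rule Ext_module[OF cm Y])
    show "restrict (?\<phi> n) (carrier (?G n)) \<in> mod_hom R (?G n) (?G (Suc n))" for n
      by (rule Ext_map_hom[OF cm cm ph Y])
    show "restrict (\<zeta> n) (carrier (?G n)) \<in> mod_hom R (?G n) (Y\<lparr>carrier := pow_torsion Y\<rparr>)" for n
      by (rule Ext_hom_of_cocycles[where v = "\<lambda>a. a (g1 n)", OF cm Y \<zeta>_eq]) (use val g1c in \<open>auto simp: pow_torsion_def\<close>)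
    show "\<zeta> (Suc n) (?\<phi> n x) = \<zeta> n x" if x: "x \<in> carrier (?G n)" for n x
    proof -
      obtain a where a: "a \<in> Zc R (?A n) Y 0" "x = ext_class R 0 (?A n) Y a" using x Ext_carrier[OF cm Y] by auto
      show ?thesis
        unfolding a(2) \<phi>_eq[OF a(1)] \<zeta>_eq[OF a(1)] \<zeta>_eq[OF \<phi>_Z[OF a(1)]] compose_eq[OF g1c] F1 ..
    qed
    show "\<exists>n. \<exists>x\<in>carrier (?G n). \<zeta> n x = k" if k: "k \<in> carrier (Y\<lparr>carrier := pow_torsion Y\<rparr>)" for k
    proof -
      obtain n where "k \<in> torsion R (?J n) Y" using k by (auto simp: pow_torsion_def)
      then obtain a where a: "a \<in> Zc R (?A n) Y 0" "a (g1 n) = k"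
        using torsion_cocycle_exists[OF R J Y, of k n] unfolding g1_def by blast
      then show ?thesis using \<zeta>_eq[OF a(1)] Ext_carrier[OF cm Y] by blast
    qed
    show "\<exists>j. dl_trans ?\<phi> n j x = \<zero>\<^bsub>?G (n + j)\<^esub>" if x: "x \<in> carrier (?G n)" "\<zeta> n x = \<zero>\<^bsub>Y\<lparr>carrier := pow_torsion Y\<rparr>\<^esub>" for n x
    proof -
      obtain a where a: "a \<in> Zc R (?A n) Y 0" "x = ext_class R 0 (?A n) Y a"
        using x Ext_carrier[OF cm Y] by auto
      then have "a (gen1 R (?J n)) = \<zero>\<^bsub>Y\<^esub>" using \<zeta>_eq[OF a(1)] x(2) by (simp add: g1_def)
      then have "a c = \<zero>\<^bsub>Y\<^esub>" if "c \<in> carrier (res_module R (?A n) 0)" for c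
        using cocycle_gen1_zero[OF R J Y a(1) _ that] by simp
      then have "a = (\<lambda>c\<in>carrier (res_module R (?A n) 0). \<zero>\<^bsub>Y\<^esub>)"
        using a(1) by (intro extensionalityI[OF mod_hom_ext[of a R "res_module R (?A n) 0" Y] restrict_extensional]) (auto simp: Zc_def)
      then have "a \<in> Bc R (?A n) Y 0" by (simp add: Bc_0[OF cm])
      then have "x = \<zero>\<^bsub>?G n\<^esub>" using a ext_class_zero_iff[OF cm Y a(1)] by simp
      then show ?thesis by (intro exI[of _ 0]) simp
    qed
  qed
  then show ?thesis by (simp add: gen_loc_coh_def aq)
qed

end

subsection \<open>Complexes of torsion homomorphisms\<close>

context inj_res
begin

context
  fixes I :: "'a set" and M :: "('a, 'm) module"
  assumes I: "ideal I R" and M: "Module.module R M"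
begin

private abbreviation "XM n \<equiv> adic_quot R I M n"
private abbreviation "HM i \<equiv> hom_module R M (E i)"
private abbreviation "GT i \<equiv> pow_torsion R I (hom_module R M (E i))"
private lemmas mXM = adic_module[OF R I M] and mHM = mHX[OF M]
  and Gsub = pow_torsion_submodule[OF R I mHX[OF M]] and ac = acoset_closed[OF R I M]

lemma torsion_hom_iff:
  "f \<in> torsion R (ideal_pow R I n) (HM i) \<longleftrightarrow>
    f \<in> mod_hom R M (E i) \<and> (\<forall>x\<in>ideal_smult R (ideal_pow R I n) M. f x = \<zero>\<^bsub>E i\<^esub>)"
proof -
  have "(\<forall>a\<in>ideal_pow R I n. (\<lambda>x\<in>carrier M. a \<odot>\<^bsub>E i\<^esub> f x) = (\<lambda>x\<in>carrier M. \<zero>\<^bsub>E i\<^esub>)) \<longleftrightarrow>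
      (\<forall>x\<in>ideal_smult R (ideal_pow R I n) M. f x = \<zero>\<^bsub>E i\<^esub>)" if f: "f \<in> mod_hom R M (E i)"
  proof -
    have "(\<lambda>x\<in>carrier M. a \<odot>\<^bsub>E i\<^esub> f x) = (\<lambda>x\<in>carrier M. \<zero>\<^bsub>E i\<^esub>) \<longleftrightarrow> (\<forall>x\<in>carrier M. f (a \<odot>\<^bsub>M\<^esub> x) = \<zero>\<^bsub>E i\<^esub>)"
      if "a \<in> ideal_pow R I n" for a
      using mod_hom_smult[OF f subsetD[OF ideal_pow_subset[OF R I] that]] by (auto simp: fun_eq_iff restrict_def)
    then show ?thesis using adic_vanish_iff[OF R I M mE f, of n] by simp
  qed
  then show ?thesis by (auto simp: torsion_def)
qed

lemma GT_iff:
  "f \<in> GT i \<longleftrightarrow> f \<in> mod_hom R M (E i) \<and> (\<exists>n. \<forall>x\<in>ideal_smult R (ideal_pow R I n) M. f x = \<zero>\<^bsub>E i\<^esub>)"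
  by (auto simp: pow_torsion_def[OF R I] torsion_hom_iff)

text \<open>
  The homomorphisms from \<open>M\<close> to \<open>E i\<close> that vanish on some power \<open>I^n M\<close> form the \<open>I\<close>-power torsion
  of \<open>Hom (M, E i)\<close>. They form a complex, with cocycles \<open>GZ\<close>, coboundaries \<open>GB\<close> and cohomology
  \<open>GH\<close>.
\<close>

definition GZ :: "nat \<Rightarrow> ('m \<Rightarrow> 'e) set" where
  "GZ i = {f \<in> GT i. \<forall>x\<in>carrier M. d i (f x) = \<zero>\<^bsub>E (Suc i)\<^esub>}"

definition GB :: "nat \<Rightarrow> ('m \<Rightarrow> 'e) set" where
  "GB i = (case i of 0 \<Rightarrow> {\<lambda>x\<in>carrier M. \<zero>\<^bsub>E 0\<^esub>} | Suc j \<Rightarrow> (\<lambda>f. compose (carrier M) (d j) f) ` GT j)"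

definition Dm :: "nat \<Rightarrow> ('m \<Rightarrow> 'e) \<Rightarrow> 'm \<Rightarrow> 'e" where
  "Dm i = (\<lambda>f\<in>mod_hom R M (E i). compose (carrier M) (d i) f)"

lemma Dm_hom: "Dm i \<in> mod_hom R (HM i) (HM (Suc i))"
  unfolding Dm_def by (rule compose_d_hom[OF M])

lemma GT_mod_hom: "f \<in> GT i \<Longrightarrow> f \<in> mod_hom R M (E i)"
  by (simp add: GT_iff)

lemma Dm_GT: "f \<in> GT i \<Longrightarrow> Dm i f \<in> GT (Suc i)"
proof -
  assume f: "f \<in> GT i"
  then obtain n where n: "f \<in> mod_hom R M (E i)" "\<forall>x\<in>ideal_smult R (ideal_pow R I n) M. f x = \<zero>\<^bsub>E i\<^esub>"
    using GT_iff by blast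
  have "Dm i f x = \<zero>\<^bsub>E (Suc i)\<^esub>" if "x \<in> ideal_smult R (ideal_pow R I n) M" for x
    using that n submodule_mem[OF adic_submodule[OF R I M] that] d_zero by (simp add: Dm_def compose_eq)
  then show ?thesis using mod_hom_closed[OF Dm_hom, of f i] n(1) by (auto simp: GT_iff)
qed

lemma GZ_eq: "GZ i = {f \<in> GT i. Dm i f = \<zero>\<^bsub>HM (Suc i)\<^esub>}"
  using GT_mod_hom by (auto simp: GZ_def Dm_def compose_def fun_eq_iff restrict_def)

lemma GB_eq: "GB i = (case i of 0 \<Rightarrow> {\<zero>\<^bsub>HM 0\<^esub>} | Suc j \<Rightarrow> Dm j ` GT j)"
  using GT_mod_hom by (auto simp: GB_def Dm_def image_iff split: nat.split)

lemma GZ_submodule: "submodule (GZ i) R (HM i)"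
  unfolding GZ_eq by (rule mod_hom_kernel_submodule[OF Dm_hom mHM mHM Gsub])

lemma GB_submodule: "submodule (GB i) R (HM i)"
  unfolding GB_eq using submodule_zero_set[OF mHM] mod_hom_image_submodule[OF Dm_hom mHM mHM Gsub]
  by (auto split: nat.split)

lemma GB_subset_GZ: "GB i \<subseteq> GZ i"
proof (cases i)
  case 0
  then show ?thesis using submodule_zero[OF GZ_submodule, of 0] by (simp add: GB_def)
next
  case (Suc j)
  have "Dm j f \<in> GZ (Suc j)" if f: "f \<in> GT j" for f
    using Dm_GT[OF f] GT_mod_hom[OF f] dd mod_hom_closed[OF GT_mod_hom[OF f]]
    by (simp add: GZ_def Dm_def compose_eq)
  then show ?thesis using Suc by (auto simp: GB_eq)
qed

definition GH :: "nat \<Rightarrow> ('a, ('m \<Rightarrow> 'e) set) module" where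
  "GH i = quot_module ((HM i)\<lparr>carrier := GZ i\<rparr>) (GB i)"

private lemmas em = submodule_module[OF GZ_submodule mHM] and es = submodule_restrict[OF GB_submodule GZ_submodule GB_subset_GZ mHM]

definition "gcls i f = GB i +>\<^bsub>HM i\<^esub> f"

lemma GH_module: "Module.module R (GH i)"
  unfolding GH_def by (rule quot_module[OF em es])

lemma GH_carrier: "carrier (GH i) = gcls i ` GZ i"
  unfolding GH_def quot_carrier[OF em es] by (simp add: gcls_def)

lemma GH_add: "f \<in> GZ i \<Longrightarrow> g \<in> GZ i \<Longrightarrow> gcls i f \<oplus>\<^bsub>GH i\<^esub> gcls i g = gcls i (f \<oplus>\<^bsub>HM i\<^esub> g)"
  unfolding GH_def gcls_def using quot_add[OF em es, of f i g] by simp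

lemma GH_smult: "r \<in> carrier R \<Longrightarrow> f \<in> GZ i \<Longrightarrow> r \<odot>\<^bsub>GH i\<^esub> gcls i f = gcls i (r \<odot>\<^bsub>HM i\<^esub> f)"
  unfolding GH_def gcls_def using quot_smult[OF em es, of r f i] by simp

lemma gcls_eq_iff: "f \<in> GZ i \<Longrightarrow> g \<in> GZ i \<Longrightarrow> gcls i f = gcls i g \<longleftrightarrow> mdiff R (HM i) f g \<in> GB i"
  unfolding gcls_def using coset_eq_iff[OF mHM GB_submodule] submodule_mem[OF GZ_submodule] by blast

lemma gcls_zero_iff: "f \<in> GZ i \<Longrightarrow> gcls i f = \<zero>\<^bsub>GH i\<^esub> \<longleftrightarrow> f \<in> GB i"
  unfolding gcls_def GH_def quot_zero[OF em es]
  using coset_eq_zero_iff[OF mHM GB_submodule] submodule_mem[OF GZ_submodule] by blast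

definition pull :: "nat \<Rightarrow> ('m set \<Rightarrow> 'e) \<Rightarrow> 'm \<Rightarrow> 'e" where
  "pull n g = compose (carrier M) g (acoset R I M n)"

lemma pull_eq: "x \<in> carrier M \<Longrightarrow> pull n g x = g (acoset R I M n x)"
  by (simp add: pull_def compose_eq)

lemma pull_hom: "g \<in> mod_hom R (XM n) (E i) \<Longrightarrow> pull n g \<in> mod_hom R M (E i)"
  unfolding pull_def by (rule adic_compose[OF R I M])

lemma pull_GT: "g \<in> mod_hom R (XM n) (E i) \<Longrightarrow> pull n g \<in> GT i"
proof -
  assume g: "g \<in> mod_hom R (XM n) (E i)"
  have "pull n g x = \<zero>\<^bsub>E i\<^esub>" if x: "x \<in> ideal_smult R (ideal_pow R I n) M" for x
  proof -
    have xc: "x \<in> carrier M" by (rule submodule_mem[OF adic_submodule[OF R I M] x])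
    then have "acoset R I M n x = \<zero>\<^bsub>XM n\<^esub>" using acoset_zero_iff[OF R I M] x by blast
    then show ?thesis using pull_eq[OF xc] mod_hom_zero[OF g mXM mE] by simp
  qed
  then show ?thesis using pull_hom[OF g] GT_iff by blast
qed

lemma pull_GZ: "g \<in> HZ (XM n) {} i \<Longrightarrow> pull n g \<in> GZ i"
  using pull_GT ac pull_eq by (auto simp: HZ_def GZ_def)

lemma pull_GB: "g \<in> HB (XM n) {} i \<Longrightarrow> pull n g \<in> GB i"
proof (cases i)
  case 0
  assume "g \<in> HB (XM n) {} i"
  then have "pull n g = (\<lambda>x\<in>carrier M. \<zero>\<^bsub>E 0\<^esub>)" using ac 0 by (auto simp: HB_def pull_def compose_def)
  then show ?thesis using 0 by (simp add: GB_def)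
next
  case (Suc j)
  assume "g \<in> HB (XM n) {} i"
  then obtain f where f: "f \<in> mod_hom R (XM n) (E j)" "\<forall>x\<in>carrier (XM n). g x = d j (f x)"
    using HB_Suc[OF mXM] Suc by blast
  have "pull n g = compose (carrier M) (d j) (pull n f)"
    using f(2) ac by (auto simp: pull_def compose_def intro!: restrict_ext)
  then show ?thesis using pull_GT[OF f(1)] Suc by (auto simp: GB_def)
qed

lemma pull_add: "pull n (g \<oplus>\<^bsub>hom_module R (XM n) (E i)\<^esub> h) = pull n g \<oplus>\<^bsub>HM i\<^esub> pull n h"
  using ac by (auto simp: pull_def compose_def intro!: restrict_ext)

lemma pull_smult: "pull n (r \<odot>\<^bsub>hom_module R (XM n) (E i)\<^esub> g) = r \<odot>\<^bsub>HM i\<^esub> pull n g"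
  using ac by (auto simp: pull_def compose_def intro!: restrict_ext)

lemma pull_surj:
  assumes "f \<in> mod_hom R M (E i)" "\<forall>x\<in>ideal_smult R (ideal_pow R I n) M. f x = \<zero>\<^bsub>E i\<^esub>"
  shows "\<exists>g\<in>mod_hom R (XM n) (E i). pull n g = f"
proof -
  obtain g where g: "g \<in> mod_hom R (XM n) (E i)" "\<forall>x\<in>carrier M. g (acoset R I M n x) = f x"
    using adic_factor[OF R I M mE assms] by blast
  have "pull n g = f"
    by (rule extensionalityI[OF _ mod_hom_ext[OF assms(1)]]) (use g(2) in \<open>auto simp: pull_def compose_eq\<close>)
  then show ?thesis using g(1) by blast
qed

lemma pull_surj_GZ:
  assumes "f \<in> GZ i"
  shows "\<exists>n. \<exists>g\<in>HZ (XM n) {} i. pull n g = f"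
proof -
  obtain n where "f \<in> mod_hom R M (E i)" "\<forall>x\<in>ideal_smult R (ideal_pow R I n) M. f x = \<zero>\<^bsub>E i\<^esub>"
    using assms by (auto simp: GZ_def GT_iff)
  then obtain g where g: "g \<in> mod_hom R (XM n) (E i)" "pull n g = f" using pull_surj by blast
  have "d i (g y) = \<zero>\<^bsub>E (Suc i)\<^esub>" if y: "y \<in> carrier (XM n)" for y
    using acoset_surj[OF R I M y] assms g(2) pull_eq by (auto simp: GZ_def)
  then have "g \<in> HZ (XM n) {} i" using g(1) by (simp add: HZ_def)
  then show ?thesis using g(2) by blast
qed

text \<open>
  If \<open>pull n g = d f\<close>, then \<open>f\<close> vanishes on some \<open>I^m M\<close>, so \<open>f\<close> exists on \<open>M/I^(n+m) M\<close> and shows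
  there that \<open>g\<close> is a coboundary.
\<close>

lemma pull_GB_later:
  assumes g: "g \<in> mod_hom R (XM n) (E i)" and B: "pull n g \<in> GB i"
  shows "\<exists>m. \<forall>h. h \<in> mod_hom R (XM (n + m)) (E i) \<longrightarrow> pull (n + m) h = pull n g \<longrightarrow> h \<in> HB (XM (n + m)) {} i"
proof (cases i)
  case 0
  have "h \<in> HB (XM (n + m)) {} i" if h: "h \<in> mod_hom R (XM (n + m)) (E i)" "pull (n + m) h = pull n g" for h m
  proof -
    have "h y = \<zero>\<^bsub>E 0\<^esub>" if y: "y \<in> carrier (XM (n + m))" for y
    proof -
      obtain x where x: "x \<in> carrier M" "y = acoset R I M (n + m) x" using acoset_surj[OF R I M y] by blast
      have "h y = pull (n + m) h x" using pull_eq[OF x(1)] x(2) by simp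
      also have "\<dots> = \<zero>\<^bsub>E 0\<^esub>" using B h(2) x(1) 0 by (simp add: GB_def)
      finally show ?thesis .
    qed
    then have "h = (\<lambda>y\<in>carrier (XM (n + m)). \<zero>\<^bsub>E 0\<^esub>)"
      using h(1) 0 by (intro extensionalityI[OF mod_hom_ext restrict_extensional]) auto
    then show ?thesis using 0 by (simp add: HB_def)
  qed
  then show ?thesis by blast
next
  case (Suc j)
  then obtain f where f: "f \<in> GT j" "pull n g = compose (carrier M) (d j) f" using B by (auto simp: GB_def)
  obtain m where m: "f \<in> mod_hom R M (E j)" "\<forall>x\<in>ideal_smult R (ideal_pow R I m) M. f x = \<zero>\<^bsub>E j\<^esub>"
    using f(1) GT_iff by blast
  have "\<forall>x\<in>ideal_smult R (ideal_pow R I (n + m)) M. f x = \<zero>\<^bsub>E j\<^esub>"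
    using m(2) adic_antimono[OF R I M, of m "n + m"] by auto
  then obtain f' where f': "f' \<in> mod_hom R (XM (n + m)) (E j)" "pull (n + m) f' = f" using pull_surj[OF m(1)] by blast
  have "h \<in> HB (XM (n + m)) {} i" if h: "h \<in> mod_hom R (XM (n + m)) (E i)" "pull (n + m) h = pull n g" for h
  proof -
    have "h y = d j (f' y)" if y: "y \<in> carrier (XM (n + m))" for y
    proof -
      obtain x where x: "x \<in> carrier M" "y = acoset R I M (n + m) x" using acoset_surj[OF R I M y] by blast
      have "h y = pull (n + m) h x" using pull_eq[OF x(1)] x(2) by simp
      also have "\<dots> = d j (pull (n + m) f' x)" using h(2) f(2) f'(2) x(1) by (simp add: compose_eq)
      also have "pull (n + m) f' x = f' y" using pull_eq[OF x(1)] x(2) by simp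
      finally show ?thesis .
    qed
    then show ?thesis using h(1) f'(1) HB_Suc[OF mXM] Suc by auto
  qed
  then show ?thesis by blast
qed

text \<open>
  The direct limit of the complexes \<open>Hom (M/I^n M, E)\<close> is the complex of torsion homomorphisms.
  The map out of \<open>Ext i (M/I^n M, N)\<close> sends a cocycle \<open>a\<close> to the class of \<open>pull n g\<close> for any \<open>g\<close>
  related to \<open>a\<close> by \<open>balance\<close>; classes of \<open>g\<close> are independent of this choice.
\<close>

theorem gen_loc_coh_iso:
  "Module.module R (gen_loc_coh R I i M N) \<and> (\<exists>\<Theta>\<in>mod_hom R (gen_loc_coh R I i M N) (GH i).
    inj_on \<Theta> (carrier (gen_loc_coh R I i M N)) \<and> \<Theta> ` carrier (gen_loc_coh R I i M N) = carrier (GH i))"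
proof -
  let ?Z = "\<lambda>n. Zc R (XM n) N i"
  let ?H = "\<lambda>n. hom_module R (res_module R (XM n) i) N"
  let ?G = "\<lambda>n. Ext R i (XM n) N"
  let ?p = "adic_proj R I M"
  let ?\<phi> = "\<lambda>n. Ext_map R i (XM (Suc n)) (XM n) N (?p n)"
  let ?F = "\<lambda>n a. compose (carrier (res_module R (XM (Suc n)) i)) a (res_map R (XM (Suc n)) (XM n) (?p n) i)"
  let ?bal = "\<lambda>n. balance (XM n) i"
  have ph: "restrict (?p n) (carrier (XM (Suc n))) \<in> mod_hom R (XM (Suc n)) (XM n)" for n
    by (rule adic_proj_hom[OF R I M])
  have balZ: "a \<in> ?Z n" "g \<in> HZ (XM n) {} i" if "(a, g) \<in> ?bal n" for a g n
    using that by (auto simp: balance_def[OF mXM])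
  have HZh: "g \<in> mod_hom R (XM n) (E i)" if "g \<in> HZ (XM n) {} i" for g n using that by (simp add: HZ_def)
  have same: "gcls i (pull n g) = gcls i (pull n h)"
    if ag: "(a, g) \<in> ?bal n" and bh: "(b, h) \<in> ?bal n" and ab: "mdiff R (?H n) a b \<in> Bc R (XM n) N i" for a g b h n
  proof -
    have "(mdiff R (?H n) a b, mdiff R (hom_module R (XM n) (E i)) g h) \<in> ?bal n"
      by (rule linrel_mdiff[OF balance_linrel[OF mXM] R ag bh])
    then have "mdiff R (hom_module R (XM n) (E i)) g h \<in> HB (XM n) {} i"
      using ab balance_zero[OF mXM] by blast
    then have "pull n (mdiff R (hom_module R (XM n) (E i)) g h) \<in> GB i" by (rule pull_GB)
    then have "mdiff R (HM i) (pull n g) (pull n h) \<in> GB i"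
      unfolding mdiff_def pull_add pull_smult .
    then show ?thesis using gcls_eq_iff[OF pull_GZ pull_GZ] balZ ag bh by blast
  qed
  \<comment> \<open>By the fact \<open>same\<close> neither the choice of \<open>g\<close> nor that of the representative \<open>a\<close> matters.\<close>
  define v where "v n a = gcls i (pull n (SOME g. (a, g) \<in> ?bal n))" for n a
  define \<zeta> where "\<zeta> n q = v n (SOME a. a \<in> ?Z n \<and> ext_class R i (XM n) N a = q)" for n q
  have v_eq: "v n a = gcls i (pull n g)" if "(a, g) \<in> ?bal n" for n a g
  proof -
    have "(a, SOME g. (a, g) \<in> ?bal n) \<in> ?bal n" by (rule someI[of "\<lambda>g. (a, g) \<in> ?bal n", OF that])
    moreover have "mdiff R (?H n) a a \<in> Bc R (XM n) N i"
      using mdiff_self[OF mHom[OF mXM N] submodule_mem[OF Zc_submodule[OF mXM N] balZ(1)[OF that]]]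
        submodule_zero[OF Bc_submodule[OF mXM N]] by simp
    ultimately show ?thesis unfolding v_def using same that by blast
  qed
  have bal_ex: "\<exists>g. (a, g) \<in> ?bal n" if "a \<in> ?Z n" for a n
    using balance_total[OF mXM that] by blast
  have \<zeta>_eq: "\<zeta> n (ext_class R i (XM n) N a) = v n a" if a: "a \<in> ?Z n" for n a
  proof -
    let ?b = "SOME b. b \<in> ?Z n \<and> ext_class R i (XM n) N b = ext_class R i (XM n) N a"
    have b: "?b \<in> ?Z n" "ext_class R i (XM n) N ?b = ext_class R i (XM n) N a"
      using someI[of "\<lambda>b. b \<in> ?Z n \<and> ext_class R i (XM n) N b = ext_class R i (XM n) N a" a] a by auto
    obtain g h where gh: "(a, g) \<in> ?bal n" "(?b, h) \<in> ?bal n" using bal_ex[OF a] bal_ex[OF b(1)] by blast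
    have "mdiff R (?H n) ?b a \<in> Bc R (XM n) N i" using ext_class_eq_iff[OF mXM N b(1) a] b(2) by simp
    then show ?thesis unfolding \<zeta>_def using same[OF gh(2,1)] v_eq[OF gh(1)] v_eq[OF gh(2)] by simp
  qed
  have \<phi>_eq: "?\<phi> n (ext_class R i (XM n) N a) = ext_class R i (XM (Suc n)) N (?F n a)" if "a \<in> ?Z n" for n a
    unfolding ext_class_def by (rule Ext_map_coset[OF mXM mXM ph N that])
  have F_bal: "(?F n a, compose (carrier (XM (Suc n))) g (?p n)) \<in> ?bal (Suc n)"
    "pull (Suc n) (compose (carrier (XM (Suc n))) g (?p n)) = pull n g" if "(a, g) \<in> ?bal n" for n a g
  proof -
    show "(?F n a, compose (carrier (XM (Suc n))) g (?p n)) \<in> ?bal (Suc n)" by (rule balance_natural[OF mXM mXM ph that])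
    show "pull (Suc n) (compose (carrier (XM (Suc n))) g (?p n)) = pull n g"
      using adic_proj_acoset[OF R I M] ac by (auto simp: pull_def compose_def intro!: restrict_ext)
  qed
  have trans: "\<exists>b h. (b, h) \<in> ?bal (n + j) \<and> dl_trans ?\<phi> n j (ext_class R i (XM n) N a) = ext_class R i (XM (n + j)) N b \<and>
      pull (n + j) h = pull n g" if ag: "(a, g) \<in> ?bal n" for n a g j
  proof (induction j)
    case 0
    then show ?case using ag by auto
  next
    case (Suc j)
    then obtain b h where b: "(b, h) \<in> ?bal (n + j)"
      "dl_trans ?\<phi> n j (ext_class R i (XM n) N a) = ext_class R i (XM (n + j)) N b" "pull (n + j) h = pull n g" by blast
    have "dl_trans ?\<phi> n (Suc j) (ext_class R i (XM n) N a) = ext_class R i (XM (n + Suc j)) N (?F (n + j) b)"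
      using b(2) \<phi>_eq[OF balZ(1)[OF b(1)]] by simp
    then show ?case using F_bal[OF b(1)] b(3) by auto
  qed
  have "Module.module R (dir_lim ?G ?\<phi>) \<and> (\<exists>\<Theta>\<in>mod_hom R (dir_lim ?G ?\<phi>) (GH i).
    inj_on \<Theta> (carrier (dir_lim ?G ?\<phi>)) \<and> \<Theta> ` carrier (dir_lim ?G ?\<phi>) = carrier (GH i))"
  proof (rule dir_lim_iso[where \<zeta> = \<zeta>])
    show "Module.module R (GH i)" by (rule GH_module)
    show "Module.module R (?G n)" for n by (rule Ext_module[OF mXM N])
    show "restrict (?\<phi> n) (carrier (?G n)) \<in> mod_hom R (?G n) (?G (Suc n))" for n
      by (rule Ext_map_hom[OF mXM mXM ph N])
    show "restrict (\<zeta> n) (carrier (?G n)) \<in> mod_hom R (?G n) (GH i)" for n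
    proof (rule Ext_hom_of_cocycles[where v = "v n", OF mXM N \<zeta>_eq])
      show "v n a \<in> carrier (GH i)" if a: "a \<in> ?Z n" for a
      proof -
        obtain g where g: "(a, g) \<in> ?bal n" using bal_ex[OF a] by blast
        show ?thesis unfolding v_eq[OF g] GH_carrier using pull_GZ[OF balZ(2)[OF g]] by blast
      qed
      show "v n (a \<oplus>\<^bsub>?H n\<^esub> b) = v n a \<oplus>\<^bsub>GH i\<^esub> v n b" if ab: "a \<in> ?Z n" "b \<in> ?Z n" for a b
      proof -
        obtain g h where gh: "(a, g) \<in> ?bal n" "(b, h) \<in> ?bal n" using bal_ex ab by blast
        show ?thesis
          unfolding v_eq[OF gh(1)] v_eq[OF gh(2)] v_eq[OF linrelD(4)[OF balance_linrel[OF mXM] gh]] pull_add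
          by (rule GH_add[OF pull_GZ pull_GZ, symmetric]) (use balZ(2) gh in blast)+
      qed
      show "v n (r \<odot>\<^bsub>?H n\<^esub> a) = r \<odot>\<^bsub>GH i\<^esub> v n a" if r: "r \<in> carrier R" and a: "a \<in> ?Z n" for r a
      proof -
        obtain g where g: "(a, g) \<in> ?bal n" using bal_ex a by blast
        show ?thesis
          unfolding v_eq[OF g] v_eq[OF linrelD(5)[OF balance_linrel[OF mXM] r g]] pull_smult
          by (rule GH_smult[OF r pull_GZ, symmetric]) (use balZ(2) g in blast)
      qed
    qed
    show "\<zeta> (Suc n) (?\<phi> n x) = \<zeta> n x" if x: "x \<in> carrier (?G n)" for n x
    proof -
      obtain a where a: "a \<in> ?Z n" "x = ext_class R i (XM n) N a" using x Ext_carrier[OF mXM N] by auto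
      obtain g where g: "(a, g) \<in> ?bal n" using bal_ex a by blast
      show ?thesis
        unfolding a(2) \<phi>_eq[OF a(1)] \<zeta>_eq[OF a(1)] \<zeta>_eq[OF balZ(1)[OF F_bal(1)[OF g]]] v_eq[OF g]
          v_eq[OF F_bal(1)[OF g]] F_bal(2)[OF g] ..
    qed
    show "\<exists>n. \<exists>x\<in>carrier (?G n). \<zeta> n x = k" if k: "k \<in> carrier (GH i)" for k
    proof -
      obtain f where f: "f \<in> GZ i" "k = gcls i f" using k GH_carrier by blast
      obtain n g where g: "g \<in> HZ (XM n) {} i" "pull n g = f" using pull_surj_GZ[OF f(1)] by blast
      obtain a where a: "a \<in> ?Z n" "(a, g) \<in> ?bal n" using balance_surj[OF mXM g(1)] by blast
      have "\<zeta> n (ext_class R i (XM n) N a) = k" using \<zeta>_eq[OF a(1)] v_eq[OF a(2)] g(2) f(2) by simp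
      then show ?thesis using a(1) Ext_carrier[OF mXM N] by blast
    qed
    show "\<exists>j. dl_trans ?\<phi> n j x = \<zero>\<^bsub>?G (n + j)\<^esub>" if x: "x \<in> carrier (?G n)" "\<zeta> n x = \<zero>\<^bsub>GH i\<^esub>" for n x
    proof -
      obtain a where a: "a \<in> ?Z n" "x = ext_class R i (XM n) N a" using x Ext_carrier[OF mXM N] by auto
      obtain g where g: "(a, g) \<in> ?bal n" using bal_ex a by blast
      have "gcls i (pull n g) = \<zero>\<^bsub>GH i\<^esub>" using x(2) \<zeta>_eq[OF a(1)] v_eq[OF g] a(2) by simp
      then have "pull n g \<in> GB i" using gcls_zero_iff[OF pull_GZ[OF balZ(2)[OF g]]] by blast
      then obtain m where m: "\<And>h. h \<in> mod_hom R (XM (n + m)) (E i) \<Longrightarrow> pull (n + m) h = pull n g \<Longrightarrow> h \<in> HB (XM (n + m)) {} i"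
        using pull_GB_later[OF HZh[OF balZ(2)[OF g]]] by blast
      obtain b h where b: "(b, h) \<in> ?bal (n + m)" "dl_trans ?\<phi> n m x = ext_class R i (XM (n + m)) N b"
        "pull (n + m) h = pull n g" using trans[OF g, of m] a(2) by blast
      have "h \<in> HB (XM (n + m)) {} i" by (rule m[OF HZh[OF balZ(2)[OF b(1)]] b(3)])
      then have "b \<in> Bc R (XM (n + m)) N i" using balance_zero[OF mXM b(1)] by blast
      then have "dl_trans ?\<phi> n m x = \<zero>\<^bsub>?G (n + m)\<^esub>" using b(2) ext_class_zero_iff[OF mXM N balZ(1)[OF b(1)]] by simp
      then show ?thesis by blast
    qed
  qed
  then show ?thesis by (simp add: gen_loc_coh_def)
qed

end

end

section \<open>Weakly cofinite cohomology\<close>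

lemma wl_restrict:
  assumes "wl R X Z B" "submodule S R X" "Module.module R X"
  shows "wl R (X\<lparr>carrier := S\<rparr>) Z B"
  unfolding wl_def
proof (intro allI impI, elim conjE)
  fix U assume U: "submodule U R (X\<lparr>carrier := S\<rparr>)" "B \<subseteq> U" "U \<subseteq> Z"
  have "submodule U R X" by (rule submodule_unrestrict[OF U(1) assms(2,3)])
  then show "finite {P. primeideal P R \<and> (\<exists>x\<in>Z. P = {a \<in> carrier R. a \<odot>\<^bsub>X\<lparr>carrier := S\<rparr>\<^esub> x \<in> U})}"
    using assms(1) U unfolding wl_def by simp
qed

lemma Ext_zero_module:
  assumes X: "Module.module R X" and Y: "Module.module R Y" and z: "carrier Y = {\<zero>\<^bsub>Y\<^esub>}"
  shows "weakly_Laskerian R (Ext R p X Y)"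
  unfolding weakly_Laskerian_Ext_iff[OF X Y]
proof (rule wl_trivial, rule subsetI)
  fix \<phi> assume "\<phi> \<in> Zc R X Y p"
  then have \<phi>: "\<phi> \<in> mod_hom R (res_module R X p) Y" by (simp add: Zc_def)
  have "\<phi> = \<zero>\<^bsub>hom_module R (res_module R X p) Y\<^esub>"
    using mod_hom_closed[OF \<phi>] z by (intro extensionalityI[OF mod_hom_ext[OF \<phi>]]) auto
  then show "\<phi> \<in> Bc R X Y p" using submodule_zero[OF Bc_submodule[OF X Y]] by simp
qed

text \<open>
  An isomorphism is a short exact sequence with zero third term.
\<close>

lemma Ext_iso:
  assumes X: "Module.module R X" and U: "Module.module R U" and V: "Module.module R V"
    and f: "f \<in> mod_hom R U V" "inj_on f (carrier U)" "f ` carrier U = carrier V"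
    and WL: "weakly_Laskerian R (Ext R p X U)"
  shows "weakly_Laskerian R (Ext R p X V)"
proof -
  let ?W = "V\<lparr>carrier := {\<zero>\<^bsub>V\<^esub>}\<rparr>"
  interpret V: Module.module R V by (rule V)
  have W: "Module.module R ?W" by (rule submodule_module[OF submodule_zero_set[OF V] V])
  have g: "(\<lambda>x\<in>carrier V. \<zero>\<^bsub>V\<^esub>) \<in> mod_hom R V ?W" by (rule mod_homI) auto
  have "weakly_Laskerian R (Ext R p X ?W)" by (rule Ext_zero_module[OF X W]) simp
  then show ?thesis
    by (rule Ext_exact_mid[OF X U V W f(1) g f(2) _ _ WL, rotated -1]) (use f(3) in auto)
qed

text \<open>
  For \<open>s \<in> I - P\<close> no power of \<open>s\<close> lies in \<open>P\<close>, and every element of \<open>W\<close> is killed by some power of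
  \<open>s\<close>; hence the localization at \<open>P\<close> is zero.
\<close>

lemma Supp_pow_torsion:
  assumes W: "Module.module R W" and I: "ideal I R"
    and t: "\<And>x. x \<in> carrier W \<Longrightarrow> \<exists>n. \<forall>a\<in>ideal_pow R I n. a \<odot>\<^bsub>W\<^esub> x = \<zero>\<^bsub>W\<^esub>"
  shows "Supp R W \<subseteq> Vset R I"
proof
  interpret W: Module.module R W by (rule W)
  fix P assume P: "P \<in> Supp R W"
  then have prime: "primeideal P R" by (simp add: Supp_def)
  interpret P: primeideal P R by (rule prime)
  have "I \<subseteq> P"
  proof (rule ccontr)
    assume "\<not> I \<subseteq> P"
    then obtain s where s: "s \<in> I" "s \<notin> P" by blast
    have sR: "s \<in> carrier R" using ideal.Icarr[OF I s(1)] .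
    have pow: "s [^]\<^bsub>R\<^esub> n \<in> ideal_pow R I n" for n :: nat
      using s(1) sR by (induction n) (auto intro: ideal_prod.prod)
    have powP: "s [^]\<^bsub>R\<^esub> n \<notin> P" for n :: nat
    proof (induction n)
      case 0
      then show ?case using P.one_imp_carrier P.I_notcarr by auto
    next
      case (Suc n)
      then show ?case using P.I_prime[of "s [^]\<^bsub>R\<^esub> n" s] sR s(2) by auto
    qed
    have kill: "\<exists>u\<in>carrier R - P. u \<odot>\<^bsub>W\<^esub> x = \<zero>\<^bsub>W\<^esub>" if "x \<in> carrier W" for x
      using t[OF that] pow powP sR W.R.nat_pow_closed by blast
    have all: "loc_rel R W P `` {(x, r)} = carrier W \<times> (carrier R - P)"
      if x: "x \<in> carrier W" and r: "r \<in> carrier R - P" for x r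
    proof -
      have "((x, r), (y, q)) \<in> loc_rel R W P" if y: "y \<in> carrier W" and q: "q \<in> carrier R - P" for y q
      proof -
        obtain u v where u: "u \<in> carrier R - P" "u \<odot>\<^bsub>W\<^esub> x = \<zero>\<^bsub>W\<^esub>" and v: "v \<in> carrier R - P" "v \<odot>\<^bsub>W\<^esub> y = \<zero>\<^bsub>W\<^esub>"
          using kill x y by metis
        have uv: "u \<otimes>\<^bsub>R\<^esub> v \<in> carrier R - P" using u v P.I_prime by auto
        have c: "u \<in> carrier R" "v \<in> carrier R" "q \<in> carrier R" "r \<in> carrier R" using u v q r by auto
        have "(u \<otimes>\<^bsub>R\<^esub> v) \<odot>\<^bsub>W\<^esub> (q \<odot>\<^bsub>W\<^esub> x) = (v \<otimes>\<^bsub>R\<^esub> q) \<odot>\<^bsub>W\<^esub> (u \<odot>\<^bsub>W\<^esub> x)"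
          using c x by (simp add: W.smult_assoc1[symmetric] W.m_ac)
        moreover have "(u \<otimes>\<^bsub>R\<^esub> v) \<odot>\<^bsub>W\<^esub> (r \<odot>\<^bsub>W\<^esub> y) = (u \<otimes>\<^bsub>R\<^esub> r) \<odot>\<^bsub>W\<^esub> (v \<odot>\<^bsub>W\<^esub> y)"
          using c y by (simp add: W.smult_assoc1[symmetric] W.m_ac)
        ultimately have "(u \<otimes>\<^bsub>R\<^esub> v) \<odot>\<^bsub>W\<^esub> (q \<odot>\<^bsub>W\<^esub> x) = (u \<otimes>\<^bsub>R\<^esub> v) \<odot>\<^bsub>W\<^esub> (r \<odot>\<^bsub>W\<^esub> y)"
          using u(2) v(2) c by simp
        then show ?thesis using x y q r uv unfolding loc_rel_def by blast
      qed
      then show ?thesis using x r by (auto simp: loc_rel_def)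
    qed
    have one: "\<one>\<^bsub>R\<^esub> \<in> carrier R - P" using P.one_imp_carrier P.I_notcarr by auto
    have "carrier (loc_module R W P) = {carrier W \<times> (carrier R - P)}"
      using all one W.zero_closed by (auto simp: loc_module_def quotient_def)
    moreover have "\<zero>\<^bsub>loc_module R W P\<^esub> = carrier W \<times> (carrier R - P)"
      using all[OF W.zero_closed one] by (simp add: loc_module_def)
    ultimately show False using P by (simp add: Supp_def)
  qed
  then show "P \<in> Vset R I" using prime by (simp add: Vset_def)
qed

context inj_res
begin

context
  fixes I :: "'a set" and M :: "('a, 'm) module" and S :: "'m set"
  assumes I: "ideal I R" and M: "Module.module R M"
    and noeth: "noetherian_ring R" and WL_N: "weakly_Laskerian R N"
    and S: "finite S" "S \<subseteq> carrier M" "\<And>V. submodule V R M \<Longrightarrow> S \<subseteq> V \<Longrightarrow> carrier M \<subseteq> V"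
    and torsion_baer: "\<And>i. baer R ((hom_module R M (E i))\<lparr>carrier := pow_torsion R I (hom_module R M (E i))\<rparr>)"
begin

private abbreviation "HN i \<equiv> hom_module R M (E i)"
private abbreviation "TT i \<equiv> pow_torsion R I (HN i)"
private abbreviation "ZZ i \<equiv> GZ I M i"
private abbreviation "BB i \<equiv> GB I M i"
private abbreviation "HH i \<equiv> GH I M i"
private abbreviation "mT i \<equiv> (HN i)\<lparr>carrier := TT i\<rparr>"
private abbreviation "mZ i \<equiv> (HN i)\<lparr>carrier := ZZ i\<rparr>"
private abbreviation "mB i \<equiv> (HN i)\<lparr>carrier := BB i\<rparr>"
private abbreviation "AA \<equiv> quot_module (reg_module R) I"

private definition "good p Y \<longleftrightarrow> weakly_Laskerian R (Ext R p AA Y)"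

private lemmas mHN = mHX[OF M] and Tsub = pow_torsion_submodule[OF R I mHX[OF M]]
  and Zsub = GZ_submodule[OF I M] and Bsub = GB_submodule[OF I M] and BZ = GB_subset_GZ[OF I M]

private lemma I_sub: "submodule I R (reg_module R)"
  using submodule_reg_iff[OF R] I by blast

private lemmas mAA = cyclic_module[OF R I_sub]

private lemma modules: "Module.module R (mT i)" "Module.module R (mZ i)" "Module.module R (mB i)"
  by (rule submodule_module[OF Tsub mHN] submodule_module[OF Zsub mHN] submodule_module[OF Bsub mHN])+

private lemma ZT: "ZZ i \<subseteq> TT i"
  by (auto simp: GZ_def[OF I M])

private lemma sub_incl:
  assumes "submodule A R (HN i)" "A \<subseteq> B" "submodule B R (HN i)"
  shows "(\<lambda>x\<in>A. x) \<in> mod_hom R ((HN i)\<lparr>carrier := A\<rparr>) ((HN i)\<lparr>carrier := B\<rparr>)"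
  by (rule mod_homI) (use assms submodule_add[OF assms(1)] submodule_smult[OF assms(1)] in \<open>auto simp del: hom_module_simps\<close>)

private lemma ses_d:
  "restrict (Dm M i) (TT i) \<in> mod_hom R (mT i) (mB (Suc i))"
  "(\<lambda>x\<in>ZZ i. x) \<in> mod_hom R (mZ i) (mT i)" "inj_on (\<lambda>x\<in>ZZ i. x) (carrier (mZ i))"
  "restrict (Dm M i) (TT i) ` carrier (mT i) = carrier (mB (Suc i))"
  "(\<lambda>x\<in>ZZ i. x) ` carrier (mZ i) = {v \<in> carrier (mT i). restrict (Dm M i) (TT i) v = \<zero>\<^bsub>mB (Suc i)\<^esub>}"
proof -
  have D: "restrict (Dm M i) (TT i) \<in> mod_hom R (mT i) (HN (Suc i))"
    by (rule mod_hom_restrict[OF Dm_hom[OF I M] submodule_subset[OF Tsub] Tsub])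
  have im: "Dm M i ` TT i = BB (Suc i)" by (simp add: GB_eq[OF I M])
  show "restrict (Dm M i) (TT i) \<in> mod_hom R (mT i) (mB (Suc i))"
    using D im submodule_subset[OF Bsub, of "Suc i"] by (subst mod_hom_corestrict) auto
  show "(\<lambda>x\<in>ZZ i. x) \<in> mod_hom R (mZ i) (mT i)" by (rule sub_incl[OF Zsub ZT Tsub])
  show "inj_on (\<lambda>x\<in>ZZ i. x) (carrier (mZ i))" by (auto simp: inj_on_def)
  show "restrict (Dm M i) (TT i) ` carrier (mT i) = carrier (mB (Suc i))" using im by (simp add: image_restrict_eq)
  show "(\<lambda>x\<in>ZZ i. x) ` carrier (mZ i) = {v \<in> carrier (mT i). restrict (Dm M i) (TT i) v = \<zero>\<^bsub>mB (Suc i)\<^esub>}"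
    by (auto simp: GZ_eq[OF I M] simp del: hom_module_simps)
qed

private lemma ses_h:
  "(\<lambda>x\<in>BB i. x) \<in> mod_hom R (mB i) (mZ i)" "restrict (gcls I M i) (ZZ i) \<in> mod_hom R (mZ i) (HH i)"
  "inj_on (\<lambda>x\<in>BB i. x) (carrier (mB i))" "restrict (gcls I M i) (ZZ i) ` carrier (mZ i) = carrier (HH i)"
  "(\<lambda>x\<in>BB i. x) ` carrier (mB i) = {v \<in> carrier (mZ i). restrict (gcls I M i) (ZZ i) v = \<zero>\<^bsub>HH i\<^esub>}"
proof -
  show "(\<lambda>x\<in>BB i. x) \<in> mod_hom R (mB i) (mZ i)" by (rule sub_incl[OF Bsub BZ Zsub])
  show "restrict (gcls I M i) (ZZ i) \<in> mod_hom R (mZ i) (HH i)"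
    by (rule mod_homI)
      (use submodule_add[OF Zsub] submodule_smult[OF Zsub] in
        \<open>auto simp: GH_carrier[OF I M] GH_add[OF I M] GH_smult[OF I M] simp del: hom_module_simps\<close>)
  show "inj_on (\<lambda>x\<in>BB i. x) (carrier (mB i))" by (auto simp: inj_on_def)
  show "restrict (gcls I M i) (ZZ i) ` carrier (mZ i) = carrier (HH i)"
    by (simp add: GH_carrier[OF I M] image_restrict_eq)
  show "(\<lambda>x\<in>BB i. x) ` carrier (mB i) = {v \<in> carrier (mZ i). restrict (gcls I M i) (ZZ i) v = \<zero>\<^bsub>HH i\<^esub>}"
    using BZ by (auto simp: gcls_zero_iff[OF I M])
qed

private lemmas sesd = mAA modules(2) modules(1) modules(3) ses_d(2) ses_d(1) ses_d(3) ses_d(4) ses_d(5)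
private lemmas sesh = mAA modules(3) modules(2) GH_module[OF I M] ses_h

private lemma torsion_restrict: "torsion R I ((HN i)\<lparr>carrier := A\<rparr>) = torsion R I (HN i) \<inter> A" if "A \<subseteq> mod_hom R M (E i)"
  using that by (auto simp: torsion_def)

private lemma I_pow_one: "ideal_pow R I 1 = I"
proof -
  interpret R: cring R by (rule R)
  show ?thesis using R.ideal_prod_one[OF I] R.ideal_prod_commute[OF R.oneideal I] by simp
qed

private lemma torsion_pow_torsion: "torsion R I (HN i) \<subseteq> TT i"
proof
  fix f assume "f \<in> torsion R I (HN i)"
  then have "f \<in> torsion R (ideal_pow R I 1) (HN i)" by (simp only: I_pow_one)
  then show "f \<in> TT i" unfolding pow_torsion_def[OF R I] by blast
qed

text \<open>
  The \<open>I\<close>-torsion of the complex of torsion homomorphisms is the complex \<open>Hom (M/IM, E)\<close>, whose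
  cohomology \<open>Ext (M/IM, N)\<close> is weakly Laskerian.
\<close>

private lemma wl_torsion_complex:
  "wl R (HN i) (torsion R I (mZ i)) (case i of 0 \<Rightarrow> {\<zero>\<^bsub>HN 0\<^esub>} | Suc j \<Rightarrow> Dm M j ` torsion R I (mT j))"
proof -
  let ?X0 = "ideal_smult R (ideal_pow R I 1) M"
  have t: "f \<in> torsion R I (HN j) \<longleftrightarrow> f \<in> mod_hom R M (E j) \<and> (\<forall>x\<in>?X0. f x = \<zero>\<^bsub>E j\<^esub>)" for f j
    using torsion_hom_iff[OF I M, of f 1 j] unfolding I_pow_one .
  have tT: "torsion R I (mT j) = torsion R I (HN j)" for j
    using torsion_restrict[OF submodule_subset[OF Tsub, of j, unfolded hom_module_simps]] torsion_pow_torsion by blast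
  have "torsion R I (mZ i) = torsion R I (HN i) \<inter> ZZ i"
    using torsion_restrict[OF submodule_subset[OF Zsub, of i, unfolded hom_module_simps]] .
  also have "\<dots> = HZ M ?X0 i"
    using torsion_pow_torsion by (auto simp: t HZ_def GZ_def[OF I M] subset_iff simp del: ideal_pow.simps)
  finally have z: "torsion R I (mZ i) = HZ M ?X0 i" .
  have b: "(case i of 0 \<Rightarrow> {\<zero>\<^bsub>HN 0\<^esub>} | Suc j \<Rightarrow> Dm M j ` torsion R I (mT j)) = HB M ?X0 i"
  proof (cases i)
    case (Suc j)
    have "Dm M j ` torsion R I (HN j) = (\<lambda>f. compose (carrier M) (d j) f) ` {f \<in> mod_hom R M (E j). \<forall>x\<in>?X0. f x = \<zero>\<^bsub>E j\<^esub>}"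
      by (rule image_cong) (auto simp: t Dm_def[OF I M])
    then show ?thesis by (simp add: Suc HB_def tT)
  qed (simp add: HB_def)
  show ?thesis
    unfolding z b by (rule wl_Hom_cohomology[OF noeth WL_N M S adic_submodule[OF R I M]])
qed

text \<open>
  Since \<open>Ext 1 (R/I, _)\<close> vanishes on the injective module \<open>mT i\<close>, the module \<open>Ext 1 (R/I, Z i)\<close> is
  the cokernel of the map from the torsion of \<open>mT i\<close> to the torsion of \<open>B (i + 1)\<close>. This cokernel
  is a part of the cohomology of the torsion complex in degree \<open>i + 1\<close>.
\<close>

private lemma good_Ext_one_Z: "good 1 (mZ i)"
  unfolding good_def
proof (rule Ext_one_sub[OF R I_sub modules(2) modules(1) modules(3) ses_d(2) ses_d(1) ses_d(3) ses_d(4) ses_d(5)])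
  have "wl R (HN (Suc i)) (torsion R I (mB (Suc i))) (Dm M i ` torsion R I (mT i))"
  proof (rule wl_mono)
    show "wl R (HN (Suc i)) (torsion R I (mZ (Suc i))) (Dm M i ` torsion R I (mT i))"
      using wl_torsion_complex[of "Suc i"] by simp
    show "torsion R I (mB (Suc i)) \<subseteq> torsion R I (mZ (Suc i))" using BZ[of "Suc i"] by (auto simp: torsion_def)
  qed simp
  moreover have "restrict (Dm M i) (TT i) ` torsion R I (mT i) = Dm M i ` torsion R I (mT i)"
    by (rule image_cong) (auto simp: torsion_def)
  ultimately show "wl R (mB (Suc i)) (torsion R I (mB (Suc i))) (restrict (Dm M i) (TT i) ` torsion R I (mT i))"
    using wl_restrict[OF _ Bsub mHN] by simp
  show "weakly_Laskerian R (Ext R 1 AA (mT i))"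
    using Ext_baer[OF mAA modules(1) torsion_baer, of 0] by simp
qed

private lemma good_T: "good (Suc p) (mT i)"
  unfolding good_def by (rule Ext_baer[OF mAA modules(1) torsion_baer])

text \<open>
  The two directions of the dimension shift along \<open>0 \<rightarrow> Z i \<rightarrow> T i \<rightarrow> B (i + 1) \<rightarrow> 0\<close> with injective
  \<open>T i\<close>.
\<close>

private lemma good_shift_up: "good p (mB (Suc i)) \<Longrightarrow> good (Suc p) (mZ i)"
  unfolding good_def by (rule Ext_exact_sub[OF sesd]) (use good_T in \<open>simp_all add: good_def\<close>)

private lemma good_shift_down: "good (Suc (Suc p)) (mZ i) \<Longrightarrow> good (Suc p) (mB (Suc i))"
  unfolding good_def by (rule Ext_exact_quot[OF sesd]) (use good_T in \<open>simp_all add: good_def\<close>)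

text \<open>
  All but one cohomology module good implies the last one good. To the right of \<open>k\<close> the cocycles
  are treated by induction on the degree \<open>p\<close> of Ext, starting from \<open>good_Ext_one_Z\<close>; to the left
  the coboundaries are treated by induction on \<open>i\<close>, starting from \<open>B 0 = 0\<close>.
\<close>

private lemma good_Z_right:
  assumes "\<And>i p. k < i \<Longrightarrow> good p (HH i)" "k \<le> i"
  shows "good (Suc p) (mZ i)"
  using assms(2)
proof (induction p arbitrary: i)
  case 0
  then show ?case using good_Ext_one_Z by simp
next
  case (Suc p)
  have "good p (HH (Suc i))" "good (Suc p) (mZ (Suc i))" using assms(1) Suc by auto
  then have "good (Suc p) (mB (Suc i))" unfolding good_def by (rule Ext_exact_sub[OF sesh])
  then show ?case by (rule good_shift_up)
qed

private lemma good_B_left: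
  assumes "\<And>i p. i < k \<Longrightarrow> good p (HH i)" "i \<le> k"
  shows "good (Suc p) (mB i)"
  using assms(2)
proof (induction i arbitrary: p)
  case 0
  have "carrier (mB 0) = {\<zero>\<^bsub>mB 0\<^esub>}" by (simp add: GB_def[OF I M])
  then show ?case unfolding good_def by (rule Ext_zero_module[OF mAA modules(3)])
next
  case (Suc i)
  have "good (Suc (Suc p)) (mB i)" "good (Suc (Suc p)) (HH i)" using Suc assms(1) by auto
  then have "good (Suc (Suc p)) (mZ i)" unfolding good_def by (rule Ext_exact_mid[OF sesh])
  then show ?case by (rule good_shift_down)
qed

private lemma good_H_last:
  assumes "\<And>i p. i \<noteq> k \<Longrightarrow> good p (HH i)"
  shows "good p (HH k)"
proof (cases p)
  case (Suc q)
  have "good p (mZ k)" "good (Suc p) (mB k)"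
    using good_Z_right[of k k q] good_B_left[of k k p] assms Suc by auto
  then show ?thesis unfolding good_def by (rule Ext_exact_quot[OF sesh])
next
  case 0
  \<comment> \<open>The map from the torsion of \<open>Z\<close> to that of \<open>H\<close> has the torsion of \<open>B\<close> as its kernel, and the
    cokernel embeds into \<open>Ext 1 (R/I, B)\<close>.\<close>
  have B1: "good 1 (mB k)" using good_B_left[of k k 0] assms by simp
  have "wl R (HN k) (torsion R I (mZ k)) (torsion R I (mB k))"
  proof (rule wl_mono[OF wl_torsion_complex order_refl])
    show "(case k of 0 \<Rightarrow> {\<zero>\<^bsub>HN 0\<^esub>} | Suc j \<Rightarrow> Dm M j ` torsion R I (mT j)) \<subseteq> torsion R I (mB k)"
    proof (cases k)
      case 0
      then show ?thesis
        using submodule_zero[OF torsion_submodule[OF modules(3)[of 0] submodule_subset[OF I_sub, simplified]]] by simp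
    next
      case (Suc j)
      have "Dm M j ` torsion R I (mT j) = restrict (Dm M j) (TT j) ` torsion R I (mT j)"
        by (rule image_cong) (auto simp: torsion_def)
      also have "\<dots> \<subseteq> torsion R I (mB k)"
        using torsion_image(2)[OF R I_sub modules(2) modules(1) modules(3) ses_d(2) ses_d(1) ses_d(3) ses_d(4) ses_d(5)] Suc
        by blast
      finally show ?thesis using Suc by simp
    qed
  qed
  then have w: "wl R (mZ k) (torsion R I (mZ k)) (torsion R I (mB k))" by (rule wl_restrict[OF _ Zsub mHN])
  have "(\<lambda>x\<in>BB k. x) ` torsion R I (mB k) = torsion R I (mB k)"
    by (auto simp: torsion_def image_iff)
  then have "wl R (mZ k) (torsion R I (mZ k)) ((\<lambda>x\<in>BB k. x) ` torsion R I (mB k))" using w by simp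
  then show ?thesis
    unfolding 0 good_def
    by (rule Ext_zero_quot[OF R I_sub modules(3) modules(2) GH_module[OF I M] ses_h])
      (use B1 in \<open>simp add: good_def\<close>)
qed

text \<open>
  \<open>HH 0\<close> is the \<open>I\<close>-power torsion of \<open>Hom (M, N)\<close>, a submodule of a finite power of \<open>N\<close>.
\<close>

private lemma good_H_zero: "good p (HH 0)"
proof -
  have "wl R (HN 0) (ZZ 0) {x \<in> ZZ 0. \<forall>s\<in>S. (\<lambda>f\<in>mod_hom R M (E 0). f s) x = \<zero>\<^bsub>E 0\<^esub>}"
  proof (rule wl_finite_evaluation[OF mHN Zsub mE EZ_submodule[of "{}" 0]])
    show "wl R (E 0) (EZ {} 0) {\<zero>\<^bsub>E 0\<^esub>}" using torsion_cohomology_zero[OF WL_N, of "{}"] by (simp add: EB_def)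
    show "finite S" by (rule S(1))
    interpret H: Module.module R "HN 0" by (rule mHN)
    fix s assume s: "s \<in> S"
    then have sM: "s \<in> carrier M" using S(2) by blast
    show "(\<lambda>f\<in>mod_hom R M (E 0). f s) \<in> mod_hom R (HN 0) (E 0)"
      by (rule mod_homI) (use sM H.add.m_closed H.smult_closed in \<open>auto simp: mod_hom_closed\<close>)
    show "(\<lambda>f\<in>mod_hom R M (E 0). f s) f \<in> EZ {} 0" if "f \<in> ZZ 0" for f
      using that sM by (auto simp: GZ_def[OF I M] GT_iff[OF I M] EZ_def torsion_def mod_hom_closed)
  qed simp
  moreover have "{x \<in> ZZ 0. \<forall>s\<in>S. (\<lambda>f\<in>mod_hom R M (E 0). f s) x = \<zero>\<^bsub>E 0\<^esub>} \<subseteq> BB 0"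
  proof
    fix f assume "f \<in> {x \<in> ZZ 0. \<forall>s\<in>S. (\<lambda>f\<in>mod_hom R M (E 0). f s) x = \<zero>\<^bsub>E 0\<^esub>}"
    then have f: "f \<in> mod_hom R M (E 0)" "\<And>s. s \<in> S \<Longrightarrow> f s = \<zero>\<^bsub>E 0\<^esub>"
      by (auto simp: GZ_def[OF I M] GT_iff[OF I M])
    have "carrier M \<subseteq> {x \<in> carrier M. f x = \<zero>\<^bsub>E 0\<^esub>}"
      by (rule S(3)[OF mod_hom_kernel_submodule[OF f(1) M mE submodule_self[OF M]]]) (use f(2) S(2) in auto)
    then have "f = (\<lambda>x\<in>carrier M. \<zero>\<^bsub>E 0\<^esub>)"
      by (intro extensionalityI[OF mod_hom_ext[OF f(1)] restrict_extensional]) auto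
    then show "f \<in> BB 0" by (simp add: GB_def[OF I M])
  qed
  ultimately have "wl R (HN 0) (ZZ 0) (BB 0)" by (meson wl_mono order_refl)
  then have WL_H: "weakly_Laskerian R (HH 0)"
    unfolding GH_def[OF I M] using weakly_Laskerian_quot_iff[OF mHN Zsub Bsub BZ] by blast
  show ?thesis
    unfolding good_def
  proof (rule Ext_weakly_Laskerian[OF noeth mAA _ _ _ WL_H])
    show "finite {I +>\<^bsub>reg_module R\<^esub> \<one>\<^bsub>R\<^esub>}" by simp
    show "{I +>\<^bsub>reg_module R\<^esub> \<one>\<^bsub>R\<^esub>} \<subseteq> carrier AA" using cyclic_one[OF R I_sub] by simp
    show "carrier AA \<subseteq> V" if "submodule V R AA" "{I +>\<^bsub>reg_module R\<^esub> \<one>\<^bsub>R\<^esub>} \<subseteq> V" for V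
      using cyclic_gen[OF R I_sub that(1)] that(2) by blast
  qed
qed

text \<open>
  Each class is represented by a homomorphism that is killed by a power of \<open>I\<close>, so the condition
  on the support holds automatically.
\<close>

lemma weakly_cofinite_iff: "weakly_cofinite R I (gen_loc_coh R I i M N) \<longleftrightarrow> (\<forall>p. good p (HH i))"
proof -
  let ?W = "gen_loc_coh R I i M N"
  have W: "Module.module R ?W" using gen_loc_coh_iso[OF I M] by blast
  obtain \<Theta> where \<Theta>: "\<Theta> \<in> mod_hom R ?W (HH i)" "inj_on \<Theta> (carrier ?W)" "\<Theta> ` carrier ?W = carrier (HH i)"
    using gen_loc_coh_iso[OF I M] by blast
  obtain \<Psi> where \<Psi>: "\<Psi> \<in> mod_hom R (HH i) ?W" "inj_on \<Psi> (carrier (HH i))" "\<Psi> ` carrier (HH i) = carrier ?W"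
    using mod_hom_inverse[OF W \<Theta>] by blast
  note mH = GH_module[OF I M, of i]
  interpret W: Module.module R ?W by (rule W)
  have "\<exists>n. \<forall>a\<in>ideal_pow R I n. a \<odot>\<^bsub>?W\<^esub> x = \<zero>\<^bsub>?W\<^esub>" if x: "x \<in> carrier ?W" for x
  proof -
    obtain f where f: "f \<in> ZZ i" "\<Theta> x = gcls I M i f" using mod_hom_closed[OF \<Theta>(1) x] GH_carrier[OF I M] by auto
    obtain n where n: "f \<in> torsion R (ideal_pow R I n) (HN i)"
      using f(1) ZT by (auto simp: pow_torsion_def[OF R I])
    have "a \<odot>\<^bsub>?W\<^esub> x = \<zero>\<^bsub>?W\<^esub>" if a: "a \<in> ideal_pow R I n" for a
    proof (rule inj_onD[OF \<Theta>(2)])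
      have aR: "a \<in> carrier R" using ideal_pow_subset[OF R I] a by blast
      have "\<Theta> (a \<odot>\<^bsub>?W\<^esub> x) = gcls I M i (a \<odot>\<^bsub>HN i\<^esub> f)"
        using mod_hom_smult[OF \<Theta>(1) aR x] f GH_smult[OF I M aR f(1)] by simp
      also have "a \<odot>\<^bsub>HN i\<^esub> f = \<zero>\<^bsub>HN i\<^esub>" using n a by (simp add: torsion_def)
      also have "gcls I M i (\<zero>\<^bsub>HN i\<^esub>) = \<zero>\<^bsub>HH i\<^esub>"
        using gcls_zero_iff[OF I M submodule_zero[OF Zsub]] submodule_zero[OF Bsub] by blast
      finally show "\<Theta> (a \<odot>\<^bsub>?W\<^esub> x) = \<Theta> \<zero>\<^bsub>?W\<^esub>" using mod_hom_zero[OF \<Theta>(1) W mH] by simp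
      show "a \<odot>\<^bsub>?W\<^esub> x \<in> carrier ?W" using aR x by simp
    qed simp
    then show ?thesis by blast
  qed
  then have "Supp R ?W \<subseteq> Vset R I" by (rule Supp_pow_torsion[OF W I])
  then have "weakly_cofinite R I ?W \<longleftrightarrow> (\<forall>p. good p ?W)"
    using W by (simp add: weakly_cofinite_def good_def)
  also have "\<dots> \<longleftrightarrow> (\<forall>p. good p (HH i))"
    using Ext_iso[OF mAA W mH \<Theta>] Ext_iso[OF mAA mH W \<Psi>] unfolding good_def by blast
  finally show ?thesis .
qed

lemma weakly_cofinite_vanishing:
  assumes "carrier (gen_loc_coh R I i M N) = {\<zero>\<^bsub>gen_loc_coh R I i M N\<^esub>}"
  shows "weakly_cofinite R I (gen_loc_coh R I i M N)"
proof -
  let ?W = "gen_loc_coh R I i M N"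
  have W: "Module.module R ?W" using gen_loc_coh_iso[OF I M] by blast
  obtain \<Theta> where \<Theta>: "\<Theta> \<in> mod_hom R ?W (HH i)" "inj_on \<Theta> (carrier ?W)" "\<Theta> ` carrier ?W = carrier (HH i)"
    using gen_loc_coh_iso[OF I M] by blast
  have "good p (HH i)" for p
    using Ext_iso[OF mAA W GH_module[OF I M] \<Theta> Ext_zero_module[OF mAA W assms]] by (simp add: good_def)
  then show ?thesis using weakly_cofinite_iff by blast
qed

text \<open>The module in degree zero is always weakly cofinite by \<open>good_H_zero\<close>, so \<open>good_H_last\<close> applies.\<close>

theorem weakly_cofinite_last:
  assumes "\<And>i. i \<noteq> 0 \<Longrightarrow> i \<noteq> k \<Longrightarrow> weakly_cofinite R I (gen_loc_coh R I i M N)"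
  shows "weakly_cofinite R I (gen_loc_coh R I k M N)"
proof -
  have "good p (HH i)" if "i \<noteq> k" for i p
    using assms[of i] that good_H_zero weakly_cofinite_iff by (cases "i = 0") auto
  then show ?thesis using good_H_last weakly_cofinite_iff by blast
qed

end

end

lemma gen_cd_vanishing:
  assumes "gen_cd R I M N = ereal (real n)" "n < i"
  shows "carrier (gen_loc_coh R I i M N) = {\<zero>\<^bsub>gen_loc_coh R I i M N\<^esub>}"
proof (rule ccontr)
  assume "carrier (gen_loc_coh R I i M N) \<noteq> {\<zero>\<^bsub>gen_loc_coh R I i M N\<^esub>}"
  then have "ereal (real i) \<le> gen_cd R I M N" unfolding gen_cd_def by (intro SUP_upper) simp
  then show False using assms by simp
qed

theorem theorem3p12:
  fixes R :: "('a, 'r) ring_scheme"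
    and I :: "'a set"
    and M :: "('a, 'm) module"
    and N :: "('a, 'n) module"
  assumes "cring R" and "noetherian_ring R"
    and "ideal I R" and "I \<noteq> carrier R"
    and "Module.module R M" and "fin_gen R M"
    and "Module.module R N" and "weakly_Laskerian R N"
    and "coh_injective_pair TYPE('e) R I M N"
  shows "(gen_cd R I M N = 1 \<longrightarrow> weakly_cofinite R I (gen_loc_coh R I 1 M N)) \<and>
    (gen_cd R I M N = 2 \<longrightarrow>
      (weakly_cofinite R I (gen_loc_coh R I 1 M N) \<longleftrightarrow>
       weakly_cofinite R I (gen_loc_coh R I 2 M N))) \<and>
    (gen_cd R I M N = 3 \<longrightarrow>
      (\<forall>i\<in>{1, 2, 3}. \<forall>j\<in>{1, 2, 3}. \<forall>k\<in>{1, 2, 3}.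
        i \<noteq> j \<and> i \<noteq> k \<and> j \<noteq> k \<longrightarrow>
        weakly_cofinite R I (gen_loc_coh R I i M N) \<longrightarrow>
        (weakly_cofinite R I (gen_loc_coh R I j M N) \<longleftrightarrow>
         weakly_cofinite R I (gen_loc_coh R I k M N))))"
proof -
  obtain E :: "nat \<Rightarrow> ('a, 'e) module" and d \<epsilon> where res: "injective_resolution R N E d \<epsilon>"
    and inj: "\<And>i. injective_module R (loc_coh R I 0 (hom_module R M (E i)))"
    using assms(9) unfolding coh_injective_pair_def by blast
  interpret inj_res R N E d \<epsilon>
    by (rule inj_res.intro[OF assms(7)])
      (use res in \<open>auto simp: injective_resolution_def intro: injective_imp_baer\<close>)
  obtain S where S: "finite S" "S \<subseteq> carrier M" "mod_span R M S = carrier M"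
    using assms(6) unfolding fin_gen_def by blast
  have gen: "carrier M \<subseteq> V" if "submodule V R M" "S \<subseteq> V" for V
    using mod_span_least[OF that] S(3) by simp
  have tb: "baer R ((hom_module R M (E i))\<lparr>carrier := pow_torsion R I (hom_module R M (E i))\<rparr>)" (is "baer R ?G") for i
  proof -
    let ?L = "loc_coh R I 0 (hom_module R M (E i))"
    note mH = mHX[OF assms(5), of i]
    have L: "baer R ?L" by (rule injective_imp_baer[OF inj])
    obtain \<Theta> where \<Theta>: "\<Theta> \<in> mod_hom R ?L ?G" "inj_on \<Theta> (carrier ?L)" "\<Theta> ` carrier ?L = carrier ?G"
      using loc_coh_zero_iso[OF assms(1,3) mH] by auto
    obtain \<Psi> where "\<Psi> \<in> mod_hom R ?G ?L" "inj_on \<Psi> (carrier ?G)" "\<Psi> ` carrier ?G = carrier ?L"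
      using mod_hom_inverse[OF baer_module[OF L] \<Theta>] by blast
    then show ?thesis
      by (rule baer_transport[OF L submodule_module[OF pow_torsion_submodule[OF assms(1,3) mH] mH]])
  qed
  define wc where "wc i \<longleftrightarrow> weakly_cofinite R I (gen_loc_coh R I i M N)" for i
  have last: "wc k" if "\<And>i. i \<noteq> 0 \<Longrightarrow> i \<noteq> k \<Longrightarrow> wc i" for k
    using weakly_cofinite_last[OF assms(3,5,2,8) S(1,2) gen tb] that unfolding wc_def by blast
  have van: "wc i" if "gen_cd R I M N = ereal (real n)" "n < i" for n i
    unfolding wc_def
    by (rule weakly_cofinite_vanishing[OF assms(3,5,2,8) S(1,2) gen tb gen_cd_vanishing[OF that]])
  have one: "wc 1" if cd: "gen_cd R I M N = 1"
    by (rule last) (use van[of 1] cd in auto)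
  have two: "wc k" if cd: "gen_cd R I M N = 2" and "wc j" "{j, k} = {1, 2}" for j k
  proof (rule last)
    fix i :: nat assume "i \<noteq> 0" "i \<noteq> k"
    moreover have "j = 1 \<and> k = 2 \<or> j = 2 \<and> k = 1" using that(3) by (simp only: doubleton_eq_iff)
    ultimately have "i = j \<or> 2 < i" by arith
    then show "wc i" using van[of 2] cd that(2) by auto
  qed
  have three: "wc k" if cd: "gen_cd R I M N = 3" and "wc i" "wc j" "{i, j, k} = {1, 2, 3}" for i j k
  proof (rule last)
    fix l :: nat assume "l \<noteq> 0" "l \<noteq> k"
    then have "l \<in> {1, 2, 3} \<or> 3 < l" by auto
    then have "l = i \<or> l = j \<or> 3 < l" using that(4) \<open>l \<noteq> k\<close> by blast
    then show "wc l" using van[of 3] cd that(2,3) by auto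
  qed
  have perm: "{i, j, k} = {1, 2, 3}" "{i, k, j} = {1, 2, 3}"
    if "i \<in> {1, 2, 3}" "j \<in> {1, 2, 3}" "k \<in> {1, 2, 3}" "i \<noteq> j \<and> i \<noteq> k \<and> j \<noteq> k" for i j k :: nat
    using that by auto
  show ?thesis
    unfolding wc_def[symmetric]
  proof (intro conjI impI ballI)
    show "wc 1" if "gen_cd R I M N = 1" by (rule one[OF that])
    show "wc 1 \<longleftrightarrow> wc 2" if "gen_cd R I M N = 2"
      using two[OF that, of 1 2] two[OF that, of 2 1] by auto
    show "wc j \<longleftrightarrow> wc k" if "gen_cd R I M N = 3" "i \<in> {1, 2, 3}" "j \<in> {1, 2, 3}" "k \<in> {1, 2, 3}"
      "i \<noteq> j \<and> i \<noteq> k \<and> j \<noteq> k" "wc i" for i j k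
      using three[OF that(1) that(6) _ perm(1)[OF that(2-5)]] three[OF that(1) that(6) _ perm(2)[OF that(2-5)]] by blast
  qed
qed

end
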